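(* Let $\widetilde{M}$ be a Hadamard manifold and $\pi:\widetilde{M}\to M$ a Riemannian covering. Suppose $f:M\to M$ is a homeomorphism isotopic to the identity and $x\in M$ is a periodic point for $f$ of minimal period $p$. Let $g:[0,1]\times M\to M$ be an isotopy between the identity and $f$ (so $g_0$ is the identity and $g_1=f$), and let $F=G_1$ where $G:[0,1]\times\widetilde{M}\to\widetilde{M}$ is the unique lift of $g$ to $\widetilde{M}$ starting at the identity. Then $$\|v_F(x)\|=\frac{l(C(x))}{p},$$ where $v_F(x)$ is the rotation vector of $x$ and $C(x)$ is the free homotopy class of the periodic point $x$ associated to the isotopy $g$.
   Context: A Hadamard manifold is a complete, connected and simply connected Riemannian manifold with non-positive sectional curvature. A Riemannian covering is a covering map between Riemannian manifolds that is a local isometry at all points. $d$ denotes the Riemannian distance. Rotation vector: a rotation vector $v_F(x)$ of a point $x\in M$ is a vector in $T_xM$ such that for any lift $\tilde{x}\in\widetilde{M}$ of $x$ one has $d(\tilde{\alpha}(n),F^n\tilde{x})=o(n)$ when $n\to+\infty$, where $\tilde{\alpha}$ is the lift starting at $\tilde{x}$ of the geodesic $\alpha:[0,+\infty)\to M$, $\alpha(t)=\exp_x(t\,v_F(x))$. (The lift $F$ above commutes with all covering transformations, and periodic points have a unique rotation vector.) Free homotopy: two continuous closed curves $\alpha,\beta:[0,1]\to M$ are freely homotopic if there is a continuous $\gamma:[0,1]\times[0,1]\to M$ with $\gamma(0,t)=\alpha(t)$ and $\gamma(1,t)=\beta(t)$ for all $t$, and $\gamma(s,0)=\gamma(s,1)$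 for all $s$; closed curves parametrized on other intervals are freely homotopic if they become so after continuous increasing reparametrization. The equivalence classes are the free homotopy classes. The length of a free homotopy class $C$ is $l(C)=\inf\{|\alpha|:\alpha\in C\}$, the infimum being over smooth curves $\alpha$ in $C$, with $|\alpha|$ the Riemannian length. Free homotopy class of a periodic point: with $x$ periodic for $g_1=f$ of minimal period $p$, $C(x)$ is the free homotopy class of the closed curve $\alpha:[0,p]\to M$ given by $\alpha(t)=g_{t-k}(g_1^k(x))$ if $k\le t\le k+1$, $k\in\mathbb{Z}$. *)

theory Defs
  imports "HOL-Analysis.Analysis" "HOL-Library.Landau_Symbols"
begin

section \<open>Smooth functions between Euclidean spaces\<close>

text \<open>Used for open \<open>S\<close> only.\<close>

primrec Ck_on :: "nat \<Rightarrow> 'a::euclidean_space set \<Rightarrow> ('a \<Rightarrow> 'b::euclidean_space) \<Rightarrow> bool" where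
  "Ck_on 0 S f \<longleftrightarrow> continuous_on S f"
| "Ck_on (Suc k) S f \<longleftrightarrow>
     (\<forall>x\<in>S. f differentiable (at x)) \<and>
     (\<forall>v. Ck_on k S (\<lambda>x. frechet_derivative f (at x) v))"

definition smooth_on :: "'a::euclidean_space set \<Rightarrow> ('a \<Rightarrow> 'b::euclidean_space) \<Rightarrow> bool" where
  "smooth_on S f \<longleftrightarrow> (\<forall>k. Ck_on k S f)"


section \<open>Smooth manifolds\<close>

text \<open>
  The underlying topological space of a manifold is a whole type \<open>'a\<close>, and the manifold is
  modelled on the Euclidean space \<open>'e\<close>, so its dimension is \<open>DIM('e)\<close>. An atlas need not be
  maximal.
\<close>

type_synonym ('a, 'e) chart = "'a set \<times> ('a \<Rightarrow> 'e)"

abbreviation chart_dom :: "('a, 'e) chart \<Rightarrow> 'a set" where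
  "chart_dom c \<equiv> fst c"

abbreviation chart_map :: "('a, 'e) chart \<Rightarrow> 'a \<Rightarrow> 'e" where
  "chart_map c \<equiv> snd c"

abbreviation chart_img :: "('a, 'e) chart \<Rightarrow> 'e set" where
  "chart_img c \<equiv> snd c ` fst c"

abbreviation chart_inv :: "('a, 'e) chart \<Rightarrow> 'e \<Rightarrow> 'a" where
  "chart_inv c \<equiv> inv_into (fst c) (snd c)"

definition is_chart :: "('a::topological_space, 'e::euclidean_space) chart \<Rightarrow> bool" where
  "is_chart c \<longleftrightarrow> open (chart_dom c) \<and> open (chart_img c) \<and>
     homeomorphism (chart_dom c) (chart_img c) (chart_map c) (chart_inv c)"

definition transition :: "('a, 'e) chart \<Rightarrow> ('a, 'e) chart \<Rightarrow> 'e \<Rightarrow> 'e" where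
  "transition c d = chart_map d \<circ> chart_inv c"

definition smooth_atlas :: "('a::topological_space, 'e::euclidean_space) chart set \<Rightarrow> bool" where
  "smooth_atlas A \<longleftrightarrow>
     (\<forall>c\<in>A. is_chart c) \<and> (\<Union>c\<in>A. chart_dom c) = UNIV \<and>
     (\<forall>c\<in>A. \<forall>d\<in>A. smooth_on (chart_map c ` (chart_dom c \<inter> chart_dom d)) (transition c d))"

definition smooth_map ::
    "('a::topological_space, 'e::euclidean_space) chart set \<Rightarrow>
     ('b::topological_space, 'f::euclidean_space) chart set \<Rightarrow> 'a set \<Rightarrow> ('a \<Rightarrow> 'b) \<Rightarrow> bool" where
  "smooth_map A B S f \<longleftrightarrow> open S \<and> continuous_on S f \<and>
     (\<forall>c\<in>A. \<forall>d\<in>B. smooth_on (chart_map c ` {x \<in> chart_dom c \<inter> S. f x \<in> chart_dom d})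
                             (chart_map d \<circ> f \<circ> chart_inv c))"

text \<open>
  Smoothness on an arbitrary interval \<open>I\<close> means that there is a smooth extension to an open
  neighbourhood of \<open>I\<close>.
\<close>

definition smooth_curve ::
    "('a::topological_space, 'e::euclidean_space) chart set \<Rightarrow> real set \<Rightarrow> (real \<Rightarrow> 'a) \<Rightarrow> bool" where
  "smooth_curve A I \<gamma> \<longleftrightarrow>
     (\<exists>J \<beta>. I \<subseteq> J \<and> smooth_map {(UNIV, id)} A J \<beta> \<and> (\<forall>t\<in>I. \<beta> t = \<gamma> t))"

definition piecewise_smooth_curve ::
    "('a::topological_space, 'e::euclidean_space) chart set \<Rightarrow> real \<Rightarrow> real \<Rightarrow> (real \<Rightarrow> 'a) \<Rightarrow> bool" where
  "piecewise_smooth_curve A a b \<gamma> \<longleftrightarrow> continuous_on {a..b} \<gamma> \<and>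
     (\<exists>T. finite T \<and>
        (\<forall>s t. a \<le> s \<and> s < t \<and> t \<le> b \<and> {s<..<t} \<inter> T = {} \<longrightarrow> smooth_curve A {s..t} \<gamma>))"

text \<open>
  A tangent vector at \<open>x\<close> is the family of its coordinate vectors in all charts around \<open>x\<close>,
  related by the derivatives of the transition maps; the family is \<open>0\<close> at the charts not
  containing \<open>x\<close>, so that it is determined by the tangent vector.
\<close>

type_synonym ('a, 'e) tvec = "('a, 'e) chart \<Rightarrow> 'e"

definition tangent_space ::
    "('a, 'e::euclidean_space) chart set \<Rightarrow> 'a \<Rightarrow> ('a, 'e) tvec set" where
  "tangent_space A x = {\<xi>.
     (\<forall>c. c \<notin> A \<or> x \<notin> chart_dom c \<longrightarrow> \<xi> c = 0) \<and>
     (\<forall>c\<in>A. \<forall>d\<in>A. x \<in> chart_dom c \<and> x \<in> chart_dom d \<longrightarrow>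
        \<xi> d = frechet_derivative (transition c d) (at (chart_map c x)) (\<xi> c))}"

text \<open>The tangent vector at \<open>x\<close> whose coordinate vector in the chart \<open>c\<close> is \<open>u\<close>.\<close>

definition tangent_vec ::
    "('a, 'e::euclidean_space) chart set \<Rightarrow> ('a, 'e) chart \<Rightarrow> 'a \<Rightarrow> 'e \<Rightarrow> ('a, 'e) tvec" where
  "tangent_vec A c x u = (\<lambda>d. if d \<in> A \<and> x \<in> chart_dom d
     then frechet_derivative (transition c d) (at (chart_map c x)) u else 0)"

definition differential ::
    "('a, 'e::euclidean_space) chart set \<Rightarrow> ('b, 'f::euclidean_space) chart set \<Rightarrow>
     ('a \<Rightarrow> 'b) \<Rightarrow> 'a \<Rightarrow> ('a, 'e) tvec \<Rightarrow> ('b, 'f) tvec" where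
  "differential A B f x \<xi> = (let c = (SOME c. c \<in> A \<and> x \<in> chart_dom c) in
     (\<lambda>d. if d \<in> B \<and> f x \<in> chart_dom d
          then frechet_derivative (chart_map d \<circ> f \<circ> chart_inv c) (at (chart_map c x)) (\<xi> c)
          else 0))"

text \<open>The velocity is one-sided at end points of the interval \<open>I\<close> that belong to \<open>I\<close>.\<close>

definition velocity ::
    "('a, 'e::euclidean_space) chart set \<Rightarrow> real set \<Rightarrow> (real \<Rightarrow> 'a) \<Rightarrow> real \<Rightarrow> ('a, 'e) tvec" where
  "velocity A I \<gamma> t = (\<lambda>c. if c \<in> A \<and> \<gamma> t \<in> chart_dom c
     then vector_derivative (chart_map c \<circ> \<gamma>) (at t within I) else 0)"


section \<open>Riemannian manifolds\<close>

record ('a, 'e) riemannian =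
  atlas :: "('a, 'e) chart set"
  inner_at :: "'a \<Rightarrow> ('a, 'e) tvec \<Rightarrow> ('a, 'e) tvec \<Rightarrow> real"

text \<open>The metric in the coordinates of the chart \<open>c\<close>, at \<open>y \<in> chart_img c\<close>.\<close>

definition coord_metric ::
    "('a, 'e::euclidean_space) riemannian \<Rightarrow> ('a, 'e) chart \<Rightarrow> 'e \<Rightarrow> 'e \<Rightarrow> 'e \<Rightarrow> real" where
  "coord_metric X c y u v = inner_at X (chart_inv c y)
     (tangent_vec (atlas X) c (chart_inv c y) u) (tangent_vec (atlas X) c (chart_inv c y) v)"

text \<open>
  Every tangent vector at a point of \<open>chart_dom c\<close> is of the form \<open>tangent_vec (atlas X) c x u\<close>,
  so the conditions below say that \<open>inner_at X x\<close> is an inner product on the tangent space at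
  each \<open>x\<close>, depending smoothly on \<open>x\<close>.
\<close>

definition riemannian_manifold ::
    "('a::{t2_space, second_countable_topology}, 'e::euclidean_space) riemannian \<Rightarrow> bool" where
  "riemannian_manifold X \<longleftrightarrow> smooth_atlas (atlas X) \<and>
     (\<forall>c\<in>atlas X.
        (\<forall>y\<in>chart_img c. bilinear (coord_metric X c y) \<and>
           (\<forall>u v. coord_metric X c y u v = coord_metric X c y v u) \<and>
           (\<forall>u. u \<noteq> 0 \<longrightarrow> coord_metric X c y u u > 0)) \<and>
        (\<forall>u v. smooth_on (chart_img c) (\<lambda>y. coord_metric X c y u v)))"

definition tnorm :: "('a, 'e) riemannian \<Rightarrow> 'a \<Rightarrow> ('a, 'e) tvec \<Rightarrow> real" where
  "tnorm X x \<xi> = sqrt (inner_at X x \<xi> \<xi>)"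

definition curve_length ::
    "('a, 'e::euclidean_space) riemannian \<Rightarrow> real \<Rightarrow> real \<Rightarrow> (real \<Rightarrow> 'a) \<Rightarrow> real" where
  "curve_length X a b \<gamma> = integral {a..b} (\<lambda>t. tnorm X (\<gamma> t) (velocity (atlas X) {a..b} \<gamma> t))"

definition riemannian_dist ::
    "('a::topological_space, 'e::euclidean_space) riemannian \<Rightarrow> 'a \<Rightarrow> 'a \<Rightarrow> real" where
  "riemannian_dist X x y = Inf {curve_length X 0 1 \<gamma> |\<gamma>.
     piecewise_smooth_curve (atlas X) 0 1 \<gamma> \<and> \<gamma> 0 = x \<and> \<gamma> 1 = y}"

text \<open>
  The Levi-Civita connection in the chart \<open>c\<close>: \<open>christoffel X c y u v\<close> is the covariant derivative
  at \<open>y\<close> of the constant field \<open>v\<close> in direction \<open>u\<close>, characterized by the Koszul formula.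
\<close>

definition christoffel ::
    "('a, 'e::euclidean_space) riemannian \<Rightarrow> ('a, 'e) chart \<Rightarrow> 'e \<Rightarrow> 'e \<Rightarrow> 'e \<Rightarrow> 'e" where
  "christoffel X c y u v =
     (let D = (\<lambda>a b w. frechet_derivative (\<lambda>z. coord_metric X c z a b) (at y) w) in
      THE z. \<forall>w. coord_metric X c y z w = (D v w u + D u w v - D u v w) / 2)"

text \<open>The curvature tensor \<open>R(u, v) w\<close> evaluated on the constant fields \<open>u\<close>, \<open>v\<close>, \<open>w\<close>.\<close>

definition curvature ::
    "('a, 'e::euclidean_space) riemannian \<Rightarrow> ('a, 'e) chart \<Rightarrow> 'e \<Rightarrow> 'e \<Rightarrow> 'e \<Rightarrow> 'e \<Rightarrow> 'e" where
  "curvature X c y u v w =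
     frechet_derivative (\<lambda>z. christoffel X c z v w) (at y) u
     - frechet_derivative (\<lambda>z. christoffel X c z u w) (at y) v
     + christoffel X c y u (christoffel X c y v w)
     - christoffel X c y v (christoffel X c y u w)"

definition sectional_curvature ::
    "('a, 'e::euclidean_space) riemannian \<Rightarrow> ('a, 'e) chart \<Rightarrow> 'e \<Rightarrow> 'e \<Rightarrow> 'e \<Rightarrow> real" where
  "sectional_curvature X c y u v =
     coord_metric X c y (curvature X c y u v v) u /
     (coord_metric X c y u u * coord_metric X c y v v - (coord_metric X c y u v)\<^sup>2)"

definition nonpositive_curvature :: "('a, 'e::euclidean_space) riemannian \<Rightarrow> bool" where
  "nonpositive_curvature X \<longleftrightarrow>
     (\<forall>c\<in>atlas X. \<forall>y\<in>chart_img c. \<forall>u v. u \<noteq> v \<and> independent {u, v} \<longrightarrow>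
        sectional_curvature X c y u v \<le> 0)"

definition geodesic ::
    "('a::topological_space, 'e::euclidean_space) riemannian \<Rightarrow> real set \<Rightarrow> (real \<Rightarrow> 'a) \<Rightarrow> bool" where
  "geodesic X I \<gamma> \<longleftrightarrow> smooth_curve (atlas X) I \<gamma> \<and>
     (\<forall>t\<in>I. \<forall>c\<in>atlas X. \<gamma> t \<in> chart_dom c \<longrightarrow>
        (let \<sigma> = chart_map c \<circ> \<gamma>; \<sigma>' = (\<lambda>s. vector_derivative \<sigma> (at s within I)) in
         vector_derivative \<sigma>' (at t within I) + christoffel X c (\<sigma> t) (\<sigma>' t) (\<sigma>' t) = 0))"

definition riemannian_exp ::
    "('a::topological_space, 'e::euclidean_space) riemannian \<Rightarrow> 'a \<Rightarrow> ('a, 'e) tvec \<Rightarrow> 'a" where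
  "riemannian_exp X x \<xi> = (THE y. \<exists>\<gamma>. geodesic X {0..1} \<gamma> \<and> \<gamma> 0 = x \<and>
     velocity (atlas X) {0..1} \<gamma> 0 = \<xi> \<and> \<gamma> 1 = y)"

definition geodesically_complete ::
    "('a::topological_space, 'e::euclidean_space) riemannian \<Rightarrow> bool" where
  "geodesically_complete X \<longleftrightarrow> (\<forall>x. \<forall>\<xi>\<in>tangent_space (atlas X) x.
     \<exists>\<gamma>. geodesic X UNIV \<gamma> \<and> \<gamma> 0 = x \<and> velocity (atlas X) UNIV \<gamma> 0 = \<xi>)"

definition hadamard_manifold ::
    "('a::{t2_space, second_countable_topology}, 'e::euclidean_space) riemannian \<Rightarrow> bool" where
  "hadamard_manifold X \<longleftrightarrow> riemannian_manifold X \<and> geodesically_complete X \<and>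
     connected (UNIV :: 'a set) \<and> simply_connected (UNIV :: 'a set) \<and> nonpositive_curvature X"

definition local_isometry ::
    "('a::topological_space, 'e::euclidean_space) riemannian \<Rightarrow>
     ('b::topological_space, 'e) riemannian \<Rightarrow> ('a \<Rightarrow> 'b) \<Rightarrow> bool" where
  "local_isometry X Y f \<longleftrightarrow> (\<forall>x. \<exists>U. x \<in> U \<and> inj_on f U \<and>
     smooth_map (atlas X) (atlas Y) U f \<and>
     smooth_map (atlas Y) (atlas X) (f ` U) (inv_into U f) \<and>
     (\<forall>y\<in>U. \<forall>\<xi>\<in>tangent_space (atlas X) y. \<forall>\<eta>\<in>tangent_space (atlas X) y.
        inner_at Y (f y) (differential (atlas X) (atlas Y) f y \<xi>)
                         (differential (atlas X) (atlas Y) f y \<eta>) = inner_at X y \<xi> \<eta>))"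

definition riemannian_covering ::
    "('a::{t2_space, second_countable_topology}, 'e::euclidean_space) riemannian \<Rightarrow>
     ('b::{t2_space, second_countable_topology}, 'e) riemannian \<Rightarrow> ('a \<Rightarrow> 'b) \<Rightarrow> bool" where
  "riemannian_covering X Y \<pi> \<longleftrightarrow> riemannian_manifold X \<and> riemannian_manifold Y \<and>
     covering_space UNIV \<pi> UNIV \<and> local_isometry X Y \<pi>"


section \<open>Isotopies, rotation vectors and free homotopy classes\<close>

definition isotopy ::
    "(real \<Rightarrow> 'b::topological_space \<Rightarrow> 'b) \<Rightarrow> ('b \<Rightarrow> 'b) \<Rightarrow> ('b \<Rightarrow> 'b) \<Rightarrow> bool" where
  "isotopy g f0 f1 \<longleftrightarrow> continuous_on ({0..1} \<times> UNIV) (\<lambda>(t, x). g t x) \<and>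
     (\<forall>t\<in>{0..1}. \<exists>h. homeomorphism UNIV UNIV (g t) h) \<and> g 0 = f0 \<and> g 1 = f1"

definition isotopy_lift ::
    "('a::topological_space \<Rightarrow> 'b) \<Rightarrow> (real \<Rightarrow> 'b \<Rightarrow> 'b) \<Rightarrow> (real \<Rightarrow> 'a \<Rightarrow> 'a) \<Rightarrow> bool" where
  "isotopy_lift \<pi> g G \<longleftrightarrow> continuous_on ({0..1} \<times> UNIV) (\<lambda>(t, y). G t y) \<and>
     (\<forall>t\<in>{0..1}. \<forall>y. \<pi> (G t y) = g t (\<pi> y)) \<and> G 0 = id"

definition minimal_period :: "('b \<Rightarrow> 'b) \<Rightarrow> 'b \<Rightarrow> nat \<Rightarrow> bool" where
  "minimal_period f x p \<longleftrightarrow> 0 < p \<and> (f ^^ p) x = x \<and> (\<forall>q. 0 < q \<and> q < p \<longrightarrow> (f ^^ q) x \<noteq> x)"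

definition is_rotation_vector ::
    "('a::topological_space, 'e::euclidean_space) riemannian \<Rightarrow>
     ('b::topological_space, 'e) riemannian \<Rightarrow> ('a \<Rightarrow> 'b) \<Rightarrow> ('a \<Rightarrow> 'a) \<Rightarrow> 'b \<Rightarrow> ('b, 'e) tvec \<Rightarrow> bool"
where
  "is_rotation_vector X Y \<pi> F x v \<longleftrightarrow> v \<in> tangent_space (atlas Y) x \<and>
     (\<forall>x'. \<pi> x' = x \<longrightarrow>
        (\<exists>\<alpha>'. continuous_on {0..} \<alpha>' \<and> \<alpha>' 0 = x' \<and>
           (\<forall>t\<ge>0. \<pi> (\<alpha>' t) = riemannian_exp Y x (\<lambda>c. t *\<^sub>R v c)) \<and>
           (\<lambda>n. riemannian_dist X (\<alpha>' (real n)) ((F ^^ n) x')) \<in> o(\<lambda>n. real n)))"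

text \<open>
  A free homotopy class is represented by its members parametrized on \<open>{0..1}\<close>; a closed curve on
  \<open>{a..b}\<close> is reparametrized affinely, which changes neither the class nor lengths.
\<close>

definition free_homotopy_class ::
    "real \<Rightarrow> real \<Rightarrow> (real \<Rightarrow> 'b::topological_space) \<Rightarrow> (real \<Rightarrow> 'b) set" where
  "free_homotopy_class a b \<alpha> = {\<beta>. homotopic_loops UNIV (\<lambda>s. \<alpha> (a + s * (b - a))) \<beta>}"

definition class_length ::
    "('b::topological_space, 'e::euclidean_space) riemannian \<Rightarrow> (real \<Rightarrow> 'b) set \<Rightarrow> real" where
  "class_length X C = Inf {curve_length X 0 1 \<beta> |\<beta>. \<beta> \<in> C \<and> smooth_curve (atlas X) {0..1} \<beta>}"

text \<open>
  On \<open>{k..k+1}\<close> this curve is \<open>g (t - k) ((g 1 ^^ k) x)\<close>: at the right end point both formulas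
  agree because \<open>g 0 = id\<close>.
\<close>

definition periodic_curve :: "(real \<Rightarrow> 'b \<Rightarrow> 'b) \<Rightarrow> 'b \<Rightarrow> real \<Rightarrow> 'b" where
  "periodic_curve g x t = g (frac t) ((g 1 ^^ nat \<lfloor>t\<rfloor>) x)"

definition periodic_point_class ::
    "(real \<Rightarrow> 'b::topological_space \<Rightarrow> 'b) \<Rightarrow> 'b \<Rightarrow> nat \<Rightarrow> (real \<Rightarrow> 'b) set" where
  "periodic_point_class g x p = free_homotopy_class 0 (real p) (periodic_curve g x)"

end

theory Submission
  imports Defs
begin

text \<open>
  Let \<open>x'\<close> be a lift of \<open>x\<close>. As \<open>F\<^sup>p x'\<close> also lies over \<open>x\<close>, it equals \<open>T x'\<close> for a deck
  transformation \<open>T\<close>, and \<open>F\<close> commutes with \<open>T\<close>, so \<open>F\<^sup>k\<^sup>p x' = T\<^sup>k x'\<close> and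
  \<open>p \<parallel>v\<parallel> = lim d(x', T\<^sup>k x') / k\<close>. Lifting free homotopies identifies the closed curves of the
  class \<open>C(x)\<close> with the projections of curves from \<open>y\<close> to \<open>T y\<close>, so \<open>l(C(x)) = inf\<^sub>y d(y, T y)\<close>.
  The triangle inequality gives \<open>lim d(x', T\<^sup>k x') / k \<le> d(y, T y)\<close>. Conversely, if \<open>m\<close> is the
  midpoint of \<open>y\<close> and \<open>T y\<close>, non-positive curvature gives \<open>d(m, T m) \<le> d(y, T\<^sup>2 y) / 2\<close>; iterating
  this over \<open>T, T\<^sup>2, T\<^sup>4, \<dots>\<close> bounds the infimum by the limit.

  The geometric input is the theorem of Cartan and Hadamard: Jacobi fields vanishing at \<open>0\<close> have
  convex length, so the exponential map expands, is a covering, hence a homeomorphism, and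
  contracts towards its base point at least as fast as in flat space.
\<close>

section \<open>Strict differentiability\<close>

text \<open>The limit of \<open>d(x', T^k x') / k\<close> exists because a rotation vector is given:
  geodesics of the cover minimise, so the lifted ray is at distance \<open>n * |v|\<close> from
  \<open>x'\<close>, and it stays within \<open>o(n)\<close> of the orbit. The halving step is
  therefore applied only along powers of two. It works because the segments from \<open>T y\<close>
  to \<open>y\<close> and to \<open>T (T y)\<close> issue from one point, towards which everything
  contracts. The differentiability of the exponential map has to be drawn from the geodesic
  equation. Strict differentiability suffices and propagates easily: it passes to compositions,
  inverses and flows, gives local injectivity, and makes derivatives continuous. That the
  exponential map is a covering is proved by growing local sections radially over coordinate balls;
  the expansion estimate gives them a Lipschitz constant that carries them through limits. Lengths
  and distances are compared by one-sided difference quotients along curves, so that curves obtained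
  by lifting need coordinate derivatives but no smoothness.\<close>

definition strict_deriv ::
    "('a::real_normed_vector \<Rightarrow> 'b::real_normed_vector) \<Rightarrow> ('a \<Rightarrow> 'b) \<Rightarrow> 'a \<Rightarrow> bool" where
  "strict_deriv f D x \<longleftrightarrow> bounded_linear D \<and>
     (\<forall>e>0. \<exists>d>0. \<forall>y\<in>ball x d. \<forall>z\<in>ball x d. norm (f y - f z - D (y - z)) \<le> e * norm (y - z))"

lemma strict_derivD:
  assumes "strict_deriv f D x" "e > 0"
  obtains d where "d > 0"
    "\<And>y z. y \<in> ball x d \<Longrightarrow> z \<in> ball x d \<Longrightarrow> norm (f y - f z - D (y - z)) \<le> e * norm (y - z)"
  using assms unfolding strict_deriv_def by meson

lemma strict_derivI:
  assumes "bounded_linear D"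
    "\<And>e. e > 0 \<Longrightarrow> \<exists>d>0. \<forall>y\<in>ball x d. \<forall>z\<in>ball x d. norm (f y - f z - D (y - z)) \<le> e * norm (y - z)"
  shows "strict_deriv f D x"
  using assms unfolding strict_deriv_def by blast

lemma strict_deriv_bounded_linear: "strict_deriv f D x \<Longrightarrow> bounded_linear D"
  unfolding strict_deriv_def by blast

lemma strict_deriv_imp_has_derivative:
  assumes "strict_deriv f D x"
  shows "(f has_derivative D) (at x)"
  unfolding has_derivative_at_alt
proof (intro conjI allI impI)
  show "bounded_linear D" using assms by (rule strict_deriv_bounded_linear)
  fix e :: real assume "e > 0"
  with assms obtain d where d: "d > 0"
    "\<And>y z. y \<in> ball x d \<Longrightarrow> z \<in> ball x d \<Longrightarrow> norm (f y - f z - D (y - z)) \<le> e * norm (y - z)"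
    by (rule strict_derivD) blast
  then show "\<exists>d>0. \<forall>y. norm (y - x) < d \<longrightarrow> norm (f y - f x - D (y - x)) \<le> e * norm (y - x)"
    by (intro exI[of _ d]) (auto simp: dist_norm norm_minus_commute)
qed

lemma strict_deriv_isCont: "strict_deriv f D x \<Longrightarrow> isCont f x"
  using has_derivative_continuous strict_deriv_imp_has_derivative by blast

lemma strict_deriv_lipschitz:
  assumes "strict_deriv f D x"
  obtains L d where "L > 0" "d > 0"
    "\<And>y z. y \<in> ball x d \<Longrightarrow> z \<in> ball x d \<Longrightarrow> norm (f y - f z) \<le> L * norm (y - z)"
proof -
  interpret D: bounded_linear D using assms by (rule strict_deriv_bounded_linear)
  obtain K where K: "K > 0" "\<And>h. norm (D h) \<le> norm h * K"
    using D.pos_bounded by blast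
  obtain d where d: "d > 0"
    "\<And>y z. y \<in> ball x d \<Longrightarrow> z \<in> ball x d \<Longrightarrow> norm (f y - f z - D (y - z)) \<le> 1 * norm (y - z)"
    using strict_derivD[OF assms, of 1] by auto
  have "norm (f y - f z) \<le> (1 + K) * norm (y - z)" if "y \<in> ball x d" "z \<in> ball x d" for y z
  proof -
    have "norm (f y - f z) \<le> norm (f y - f z - D (y - z)) + norm (D (y - z))"
      by norm
    also have "\<dots> \<le> norm (y - z) + norm (y - z) * K"
      using d(2)[OF that] K(2)[of "y - z"] by simp
    finally show ?thesis by (simp add: algebra_simps)
  qed
  then show thesis using that[of "1 + K" d] K(1) d(1) by auto
qed

lemma strict_deriv_cong:
  assumes "strict_deriv f D x" "eventually (\<lambda>y. f y = g y) (nhds x)"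
  shows "strict_deriv g D x"
proof (rule strict_derivI)
  show "bounded_linear D" using assms(1) by (rule strict_deriv_bounded_linear)
  fix e :: real assume "e > 0"
  with assms(1) obtain d where d: "d > 0"
    "\<And>y z. y \<in> ball x d \<Longrightarrow> z \<in> ball x d \<Longrightarrow> norm (f y - f z - D (y - z)) \<le> e * norm (y - z)"
    by (rule strict_derivD) blast
  obtain d' where d': "d' > 0" "\<And>y. dist y x < d' \<Longrightarrow> f y = g y"
    using assms(2) unfolding eventually_nhds_metric by blast
  show "\<exists>d>0. \<forall>y\<in>ball x d. \<forall>z\<in>ball x d. norm (g y - g z - D (y - z)) \<le> e * norm (y - z)"
  proof (intro exI[of _ "min d d'"] conjI ballI)
    show "min d d' > 0" using d d' by simp
    fix y z assume "y \<in> ball x (min d d')" "z \<in> ball x (min d d')"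
    then show "norm (g y - g z - D (y - z)) \<le> e * norm (y - z)"
      using d(2)[of y z] d'(2)[of y] d'(2)[of z] by (simp add: dist_commute)
  qed
qed

lemma strict_deriv_of_bounded_linear: "bounded_linear D \<Longrightarrow> strict_deriv D D x"
  by (rule strict_derivI) (auto simp: bounded_linear.linear linear_diff intro!: exI[of _ 1])

lemma strict_deriv_const: "strict_deriv (\<lambda>_. c) (\<lambda>_. 0) x"
  by (rule strict_derivI) (auto intro!: exI[of _ 1])

lemma strict_deriv_compose:
  assumes f: "strict_deriv f F x" and g: "strict_deriv g G (f x)"
  shows "strict_deriv (\<lambda>y. g (f y)) (\<lambda>h. G (F h)) x"
proof (rule strict_derivI)
  interpret F: bounded_linear F using f by (rule strict_deriv_bounded_linear)
  interpret G: bounded_linear G using g by (rule strict_deriv_bounded_linear)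
  show "bounded_linear (\<lambda>h. G (F h))"
    using F.bounded_linear_axioms G.bounded_linear_axioms bounded_linear_compose by blast
  fix e :: real assume e: "e > 0"
  obtain K where K: "K > 0" "\<And>h. norm (G h) \<le> norm h * K" using G.pos_bounded by blast
  obtain L d1 where L: "L > 0" "d1 > 0"
    "\<And>y z. y \<in> ball x d1 \<Longrightarrow> z \<in> ball x d1 \<Longrightarrow> norm (f y - f z) \<le> L * norm (y - z)"
    using strict_deriv_lipschitz[OF f] by blast
  obtain d2 where d2: "d2 > 0" "\<And>y z. y \<in> ball (f x) d2 \<Longrightarrow> z \<in> ball (f x) d2 \<Longrightarrow>
      norm (g y - g z - G (y - z)) \<le> (e / (2 * L)) * norm (y - z)"
    using strict_derivD[OF g, of "e / (2 * L)"] e L(1) by auto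
  obtain d3 where d3: "d3 > 0" "\<And>y z. y \<in> ball x d3 \<Longrightarrow> z \<in> ball x d3 \<Longrightarrow>
      norm (f y - f z - F (y - z)) \<le> (e / (2 * K)) * norm (y - z)"
    using strict_derivD[OF f, of "e / (2 * K)"] e K(1) by auto
  \<comment> \<open>The entry \<open>d2 / L\<close> makes \<open>f\<close> map the ball into
    \<open>ball (f x) d2\<close>, where the estimate for \<open>g\<close> holds.\<close>
  define d where "d = min d1 (min d3 (d2 / L))"
  have "d > 0" using L d2(1) d3(1) unfolding d_def by auto
  moreover have "norm (g (f y) - g (f z) - G (F (y - z))) \<le> e * norm (y - z)"
    if yz: "y \<in> ball x d" "z \<in> ball x d" for y z
  proof -
    have fb: "f u \<in> ball (f x) d2" if "u \<in> ball x d" for u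
    proof -
      have "norm (f u - f x) \<le> L * norm (u - x)"
        using L(3)[of u x] L(2) that unfolding d_def by auto
      also have "\<dots> < L * (d2 / L)"
        using that L(1) unfolding d_def by (intro mult_strict_left_mono) (auto simp: dist_norm norm_minus_commute)
      finally show ?thesis using L(1) by (simp add: dist_norm norm_minus_commute)
    qed
    have "g (f y) - g (f z) - G (F (y - z)) =
        (g (f y) - g (f z) - G (f y - f z)) + G (f y - f z - F (y - z))"
      by (simp add: G.diff)
    also have "norm \<dots> \<le> (e / (2 * L)) * norm (f y - f z) + norm (f y - f z - F (y - z)) * K"
      using d2(2)[OF fb[OF yz(1)] fb[OF yz(2)]] K(2) by (intro norm_triangle_le add_mono) auto
    also have "\<dots> \<le> (e / (2 * L)) * (L * norm (y - z)) + (e / (2 * K)) * norm (y - z) * K"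
      using L(3)[of y z] d3(2)[of y z] yz e L(1) K(1) unfolding d_def
      by (intro add_mono mult_left_mono mult_right_mono) auto
    also have "\<dots> = e * norm (y - z)" using L(1) K(1) by (simp add: field_simps)
    finally show ?thesis .
  qed
  ultimately show "\<exists>d>0. \<forall>y\<in>ball x d. \<forall>z\<in>ball x d.
      norm (g (f y) - g (f z) - G (F (y - z))) \<le> e * norm (y - z)" by blast
qed

lemma strict_deriv_linear_compose:
  "bounded_linear T \<Longrightarrow> strict_deriv f F x \<Longrightarrow> strict_deriv (\<lambda>y. T (f y)) (\<lambda>h. T (F h)) x"
  by (rule strict_deriv_compose[OF _ strict_deriv_of_bounded_linear])

lemma strict_deriv_Pair:
  assumes f: "strict_deriv f F x" and g: "strict_deriv g G x"
  shows "strict_deriv (\<lambda>y. (f y, g y)) (\<lambda>h. (F h, G h)) x"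
proof (rule strict_derivI)
  show "bounded_linear (\<lambda>h. (F h, G h))"
    using f g by (simp add: bounded_linear_Pair strict_deriv_bounded_linear)
  fix e :: real assume e: "e > 0"
  obtain d1 where d1: "d1 > 0" "\<And>y z. y \<in> ball x d1 \<Longrightarrow> z \<in> ball x d1 \<Longrightarrow>
      norm (f y - f z - F (y - z)) \<le> e / 2 * norm (y - z)"
    using strict_derivD[OF f, of "e / 2"] e by auto
  obtain d2 where d2: "d2 > 0" "\<And>y z. y \<in> ball x d2 \<Longrightarrow> z \<in> ball x d2 \<Longrightarrow>
      norm (g y - g z - G (y - z)) \<le> e / 2 * norm (y - z)"
    using strict_derivD[OF g, of "e / 2"] e by auto
  have "norm ((f y, g y) - (f z, g z) - (F (y - z), G (y - z))) \<le> e * norm (y - z)"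
    if "y \<in> ball x (min d1 d2)" "z \<in> ball x (min d1 d2)" for y z
  proof -
    have "norm ((f y, g y) - (f z, g z) - (F (y - z), G (y - z)))
        \<le> norm (f y - f z - F (y - z)) + norm (g y - g z - G (y - z))"
      using norm_Pair_le by simp
    also have "\<dots> \<le> e / 2 * norm (y - z) + e / 2 * norm (y - z)"
      using that by (intro add_mono d1(2) d2(2)) auto
    finally show ?thesis by (simp add: field_simps)
  qed
  then show "\<exists>d>0. \<forall>y\<in>ball x d. \<forall>z\<in>ball x d.
      norm ((f y, g y) - (f z, g z) - (F (y - z), G (y - z))) \<le> e * norm (y - z)"
    using d1(1) d2(1) by (intro exI[of _ "min d1 d2"]) auto
qed

lemma strict_deriv_fst: "strict_deriv f F x \<Longrightarrow> strict_deriv (\<lambda>y. fst (f y)) (\<lambda>h. fst (F h)) x"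
  by (rule strict_deriv_linear_compose[OF bounded_linear_fst])

lemma strict_deriv_snd: "strict_deriv f F x \<Longrightarrow> strict_deriv (\<lambda>y. snd (f y)) (\<lambda>h. snd (F h)) x"
  by (rule strict_deriv_linear_compose[OF bounded_linear_snd])

lemma strict_deriv_add:
  assumes "strict_deriv f F x" "strict_deriv g G x"
  shows "strict_deriv (\<lambda>y. f y + g y) (\<lambda>h. F h + G h) x"
  using strict_deriv_linear_compose[OF bounded_linear_add[OF bounded_linear_fst bounded_linear_snd]
      strict_deriv_Pair[OF assms]] by simp

lemma strict_deriv_minus:
  "strict_deriv f F x \<Longrightarrow> strict_deriv (\<lambda>y. - f y) (\<lambda>h. - F h) x"
  by (rule strict_deriv_linear_compose[OF bounded_linear_minus[OF bounded_linear_ident]])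

lemma strict_deriv_sum:
  assumes "finite I" "\<And>i. i \<in> I \<Longrightarrow> strict_deriv (f i) (F i) x"
  shows "strict_deriv (\<lambda>y. \<Sum>i\<in>I. f i y) (\<lambda>h. \<Sum>i\<in>I. F i h) x"
  using assms by (induction I) (auto intro: strict_deriv_const strict_deriv_add)

lemma strict_deriv_of_bilinear:
  assumes "bounded_bilinear pr"
  shows "strict_deriv (\<lambda>q. pr (fst q) (snd q))
    (\<lambda>h. pr (fst p) (snd h) + pr (fst h) (snd p)) p"
proof (rule strict_derivI)
  interpret bounded_bilinear pr by fact
  show "bounded_linear (\<lambda>h. pr (fst p) (snd h) + pr (fst h) (snd p))"
    by (intro bounded_linear_add
        bounded_linear_compose[OF bounded_linear_right bounded_linear_snd]
        bounded_linear_compose[OF bounded_linear_left bounded_linear_fst])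
  obtain K where K: "K > 0" "\<And>a b. norm (pr a b) \<le> norm a * norm b * K" using pos_bounded by blast
  fix e :: real assume e: "e > 0"
  \<comment> \<open>The remainder is a sum of two values of \<open>pr\<close>, each pairing the
    increment \<open>y - z\<close> with the deviation of \<open>y\<close> or \<open>z\<close> from
    \<open>p\<close>; each is at most \<open>d * K\<close> times the increment.\<close>
  define d where "d = e / (2 * K)"
  have d: "d > 0" using e K(1) unfolding d_def by simp
  have "norm (pr (fst y) (snd y) - pr (fst z) (snd z) -
      (pr (fst p) (snd (y - z)) + pr (fst (y - z)) (snd p))) \<le> e * norm (y - z)"
    if yz: "y \<in> ball p d" "z \<in> ball p d" for y z
  proof -
    have "pr (fst y) (snd y) - pr (fst z) (snd z) -
      (pr (fst p) (snd (y - z)) + pr (fst (y - z)) (snd p))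
      = pr (fst (y - z)) (snd (y - p)) + pr (fst (z - p)) (snd (y - z))"
      by (simp add: diff_left diff_right)
    also have "norm \<dots> \<le> norm (fst (y - z)) * norm (snd (y - p)) * K + norm (fst (z - p)) * norm (snd (y - z)) * K"
      by (intro norm_triangle_le add_mono K(2))
    also have "\<dots> \<le> norm (y - z) * d * K + d * norm (y - z) * K"
    proof -
      have fs: "norm (fst q) \<le> norm q" "norm (snd q) \<le> norm q" for q :: "'a \<times> 'b"
        using norm_fst_le[of "fst q" "snd q"] norm_snd_le[of "snd q" "fst q"] by auto
      have "norm (snd (y - p)) \<le> d" "norm (fst (z - p)) \<le> d"
        using fs(2)[of "y - p"] fs(1)[of "z - p"] yz by (auto simp: dist_norm norm_minus_commute)
      then show ?thesis
        using d K(1) fs[of "y - z"] by (intro add_mono mult_mono mult_right_mono) (auto simp del: fst_diff snd_diff)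
    qed
    also have "\<dots> = e * norm (y - z)" using K(1) unfolding d_def by (simp add: field_simps)
    finally show ?thesis .
  qed
  then show "\<exists>d>0. \<forall>y\<in>ball p d. \<forall>z\<in>ball p d. norm (pr (fst y) (snd y) - pr (fst z) (snd z) -
      (pr (fst p) (snd (y - z)) + pr (fst (y - z)) (snd p))) \<le> e * norm (y - z)"
    using d by blast
qed

lemma strict_deriv_bilinear:
  assumes "bounded_bilinear pr" "strict_deriv f F x" "strict_deriv g G x"
  shows "strict_deriv (\<lambda>y. pr (f y) (g y)) (\<lambda>h. pr (f x) (G h) + pr (F h) (g x)) x"
  using strict_deriv_compose[OF strict_deriv_Pair[OF assms(2,3)] strict_deriv_of_bilinear[OF assms(1)]]
  by simp

lemmas strict_deriv_scaleR = strict_deriv_bilinear[OF bounded_bilinear_scaleR]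
lemmas strict_deriv_mult = strict_deriv_bilinear[OF bounded_bilinear_mult]

text \<open>Mean value inequality on a ball around \<open>x\<close> on which \<open>f'\<close> stays
  within \<open>e\<close> of \<open>f' x\<close>; balls are convex, so the segment from
  \<open>z\<close> to \<open>y\<close> stays inside.\<close>

lemma strict_deriv_of_continuous_derivative:
  fixes f :: "'a::real_normed_vector \<Rightarrow> 'b::real_normed_vector" and f' :: "'a \<Rightarrow> 'a \<Rightarrow>\<^sub>L 'b"
  assumes "open S" "x \<in> S" "\<And>y. y \<in> S \<Longrightarrow> (f has_derivative f' y) (at y)" "isCont f' x"
  shows "strict_deriv f (f' x) x"
proof (rule strict_derivI)
  fix e :: real assume "e > 0"
  obtain d1 where d1: "d1 > 0" "ball x d1 \<subseteq> S" using assms(1,2) openE by blast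
  obtain d2 where d2: "d2 > 0" "\<And>y. dist y x < d2 \<Longrightarrow> dist (f' y) (f' x) < e"
    using assms(4) \<open>e > 0\<close> unfolding continuous_at_eps_delta by (auto simp: dist_commute)
  define d where "d = min d1 d2"
  have "norm (f y - f z - f' x (y - z)) \<le> e * norm (y - z)" if "y \<in> ball x d" "z \<in> ball x d" for y z
  proof -
    have "norm (f y - f z - f' x (y - z)) \<le> norm (y - z) * e"
    proof (rule differentiable_bound_linearization[where S = "ball x d" and f' = "\<lambda>x. f' x"])
      show "z + t *\<^sub>R (y - z) \<in> ball x d" if t: "t \<in> {0..1}" for t
      proof -
        have "(1 - t) *\<^sub>R z + t *\<^sub>R y \<in> ball x d"
          using t \<open>y \<in> ball x d\<close> \<open>z \<in> ball x d\<close> by (intro convexD[OF convex_ball]) auto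
        then show ?thesis by (simp add: algebra_simps)
      qed
      show "(f has_derivative f' u) (at u within ball x d)" if "u \<in> ball x d" for u
      proof (rule has_derivative_at_withinI[OF assms(3)])
        show "u \<in> S" using that d1(2) unfolding d_def by auto
      qed
      show "onorm (blinfun_apply (f' u) - blinfun_apply (f' x)) \<le> e" if "u \<in> ball x d" for u
      proof -
        have "blinfun_apply (f' u) - blinfun_apply (f' x) = blinfun_apply (f' u - f' x)"
          by (auto simp: blinfun.diff_left)
        then show ?thesis
          using d2(2)[of u] that unfolding d_def by (simp add: dist_norm norm_blinfun.rep_eq[symmetric] norm_minus_commute)
      qed
      show "x \<in> ball x d" using d1 d2 unfolding d_def by auto
    qed
    then show ?thesis by (simp add: mult.commute)
  qed
  then show "\<exists>d>0. \<forall>y\<in>ball x d. \<forall>z\<in>ball x d. norm (f y - f z - f' x (y - z)) \<le> e * norm (y - z)"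
    using d1 d2 by (intro exI[of _ d]) (auto simp: d_def)
qed (rule blinfun.bounded_linear_right)

text \<open>For nearby \<open>y\<close> the maps \<open>f' x\<close> and \<open>f' y\<close> both
  approximate the same increments of \<open>f\<close> on a small ball around \<open>y\<close>, hence
  differ little on short vectors, and by homogeneity on all. This feeds the continuity hypothesis of
  \<open>strict_deriv_flow\<close>.\<close>

lemma strict_deriv_continuous_derivative:
  fixes f' :: "'a::real_normed_vector \<Rightarrow> 'a \<Rightarrow>\<^sub>L 'b::real_normed_vector"
  assumes "open S" "\<And>y. y \<in> S \<Longrightarrow> strict_deriv f (f' y) y"
  shows "continuous_on S f'"
  unfolding continuous_on_iff
proof (intro ballI allI impI)
  fix x and e :: real assume x: "x \<in> S" and e: "e > 0"
  obtain d where d: "d > 0" "\<And>y z. y \<in> ball x d \<Longrightarrow> z \<in> ball x d \<Longrightarrow>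
      norm (f y - f z - f' x (y - z)) \<le> (e/4) * norm (y - z)"
    using strict_derivD[OF assms(2)[OF x], of "e/4"] e by auto
  have "dist (f' y) (f' x) < e" if y: "y \<in> S" "dist y x < d" for y
  proof -
    obtain d2 where d2: "d2 > 0" "\<And>u z. u \<in> ball y d2 \<Longrightarrow> z \<in> ball y d2 \<Longrightarrow>
      norm (f u - f z - f' y (u - z)) \<le> (e/4) * norm (u - z)"
      using strict_derivD[OF assms(2)[OF y(1)], of "e/4"] e by auto
    obtain r where r: "r > 0" "ball y r \<subseteq> ball x d \<inter> ball y d2"
      using y d2(1) openE[of "ball x d \<inter> ball y d2" y] by (auto simp: dist_commute)
    have small: "norm (f' y h - f' x h) \<le> (e/2) * norm h" if h: "norm h < r" for h
    proof -
      have yh: "y + h \<in> ball y r" "y \<in> ball y r" using h r(1) by (auto simp: dist_norm)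
      have 1: "norm (f (y + h) - f y - f' x h) \<le> (e/4) * norm h"
      proof -
        have "y + h \<in> ball x d" "y \<in> ball x d" using yh r(2) by blast+
        from d(2)[OF this] show ?thesis by simp
      qed
      have 2: "norm (f (y + h) - f y - f' y h) \<le> (e/4) * norm h"
      proof -
        have "y + h \<in> ball y d2" "y \<in> ball y d2" using yh r(2) by blast+
        from d2(2)[OF this] show ?thesis by simp
      qed
      have "f' y h - f' x h = (f (y + h) - f y - f' x h) - (f (y + h) - f y - f' y h)" by simp
      then have "norm (f' y h - f' x h) \<le> norm (f (y + h) - f y - f' x h) + norm (f (y + h) - f y - f' y h)"
        by (metis norm_triangle_ineq4)
      then show ?thesis using 1 2 by simp
    qed
    have "norm (f' y - f' x) \<le> e/2"
    proof (rule norm_blinfun_bound)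
      fix h
      show "norm ((f' y - f' x) h) \<le> (e/2) * norm h"
      proof (cases "h = 0")
        case False
        define c where "c = r / (2 * norm h)"
        have c: "c > 0" using r(1) False unfolding c_def by simp
        have "norm (c *\<^sub>R h) < r" using r(1) False unfolding c_def by simp
        from small[OF this] c have "c * norm (f' y h - f' x h) \<le> c * ((e/2) * norm h)"
          by (simp add: blinfun.scaleR_right scaleR_diff_right[symmetric])
        then show ?thesis using c by (simp add: blinfun.diff_left)
      qed simp
    qed (use e in simp)
    then show ?thesis using e by (simp add: dist_norm)
  qed
  then show "\<exists>d>0. \<forall>y\<in>S. dist y x < d \<longrightarrow> dist (f' y) (f' x) < e" using d(1) by blast
qed

text \<open>The inverse \<open>k\<close> is given and continuous. Because the estimate for
  \<open>f\<close> concerns two arbitrary points near \<open>k y\<close>, it can be applied to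
  \<open>k u\<close> and \<open>k z\<close> and solved for \<open>k u - k z\<close> with
  \<open>E\<close>.\<close>

lemma strict_deriv_inverse:
  fixes f :: "'a::real_normed_vector \<Rightarrow> 'b::real_normed_vector"
  assumes f: "strict_deriv f D (k y)" and Dinv: "bounded_linear E" "\<And>h. E (D h) = h" "\<And>h. D (E h) = h"
    and k: "isCont k y" and fk: "eventually (\<lambda>z. f (k z) = z) (nhds y)"
  shows "strict_deriv k E y"
proof (rule strict_derivI)
  interpret D: bounded_linear D using f by (rule strict_deriv_bounded_linear)
  interpret E: bounded_linear E by fact
  obtain K where K: "K > 0" "\<And>h. norm (E h) \<le> norm h * K" using E.pos_bounded by blast
  fix e :: real assume e: "e > 0"
  \<comment> \<open>The first bound makes \<open>k\<close> Lipschitz with constant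
    \<open>2 * K\<close> near \<open>y\<close>; the second turns the error
    \<open>K * \<eta> * (2 * K)\<close> into at most \<open>e\<close>.\<close>
  define \<eta> where "\<eta> = min (1 / (2 * K)) (e / (2 * K * K))"
  have \<eta>: "\<eta> > 0" using e K(1) unfolding \<eta>_def by simp
  obtain d1 where d1: "d1 > 0" "\<And>u z. u \<in> ball (k y) d1 \<Longrightarrow> z \<in> ball (k y) d1 \<Longrightarrow>
      norm (f u - f z - D (u - z)) \<le> \<eta> * norm (u - z)"
    using strict_derivD[OF f \<eta>] by blast
  obtain d2 where d2: "d2 > 0" "\<And>z. dist z y < d2 \<Longrightarrow> dist (k z) (k y) < d1"
    using k d1(1) unfolding continuous_at_eps_delta by (auto simp: dist_commute)
  obtain d3 where d3: "d3 > 0" "\<And>z. dist z y < d3 \<Longrightarrow> f (k z) = z"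
    using fk unfolding eventually_nhds_metric by blast
  define d where "d = min d2 d3"
  have "norm (k u - k z - E (u - z)) \<le> e * norm (u - z)" if uz: "u \<in> ball y d" "z \<in> ball y d" for u z
  proof -
    have *: "norm ((u - z) - D (k u - k z)) \<le> \<eta> * norm (k u - k z)"
      using d1(2)[of "k u" "k z"] d2(2)[of u] d2(2)[of z] d3(2)[of u] d3(2)[of z] uz
      unfolding d_def by (auto simp: dist_commute)
    have eq: "k u - k z - E (u - z) = - E ((u - z) - D (k u - k z))"
      by (simp add: E.diff Dinv)
    have 1: "norm (k u - k z - E (u - z)) \<le> K * \<eta> * norm (k u - k z)"
    proof -
      have "norm (k u - k z - E (u - z)) \<le> norm ((u - z) - D (k u - k z)) * K"
        unfolding eq using K(2) by simp
      also have "\<dots> \<le> \<eta> * norm (k u - k z) * K" using * K(1) by (intro mult_right_mono) auto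
      finally show ?thesis by (simp add: ac_simps)
    qed
    have "K * \<eta> \<le> 1/2" using K(1) mult_left_mono[of \<eta> "1 / (2 * K)" K] unfolding \<eta>_def by simp
    then have "norm (k u - k z) \<le> norm (E (u - z)) + (1/2) * norm (k u - k z)"
      using 1 norm_triangle_sub[of "k u - k z" "E (u - z)"]
        mult_right_mono[of "K * \<eta>" "1/2" "norm (k u - k z)", OF _ norm_ge_zero] by linarith
    then have 2: "norm (k u - k z) \<le> 2 * K * norm (u - z)" using K(2)[of "u - z"] by (simp add: ac_simps)
    have "\<eta> \<le> e / (2 * K * K)" unfolding \<eta>_def by simp
    then have "K * \<eta> * (2 * K) \<le> e" using K(1) by (simp add: field_simps)
    have "norm (k u - k z - E (u - z)) \<le> K * \<eta> * (2 * K * norm (u - z))"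
      using 1 2 K(1) \<eta> by (meson dual_order.trans mult_left_mono mult_nonneg_nonneg less_imp_le)
    also have "\<dots> = (K * \<eta> * (2 * K)) * norm (u - z)" by simp
    also have "\<dots> \<le> e * norm (u - z)"
      using \<open>K * \<eta> * (2 * K) \<le> e\<close> by (intro mult_right_mono) auto
    finally show ?thesis .
  qed
  then show "\<exists>d>0. \<forall>u\<in>ball y d. \<forall>z\<in>ball y d. norm (k u - k z - E (u - z)) \<le> e * norm (u - z)"
    using d2(1) d3(1) by (intro exI[of _ d]) (auto simp: d_def)
qed fact

text \<open>For points with equal images the linear part, at least \<open>m\<close> times their
  distance, would be bounded by the error, which is half of that.\<close>

lemma strict_deriv_locally_injective:
  assumes f: "strict_deriv f D x" and m: "m > 0" "\<And>h. m * norm h \<le> norm (D h)"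
  obtains d where "d > 0" "inj_on f (ball x d)"
proof -
  obtain d where d: "d > 0" "\<And>u z. u \<in> ball x d \<Longrightarrow> z \<in> ball x d \<Longrightarrow>
      norm (f u - f z - D (u - z)) \<le> (m/2) * norm (u - z)"
    using strict_derivD[OF f, of "m/2"] m(1) by auto
  have "u = z" if "u \<in> ball x d" "z \<in> ball x d" "f u = f z" for u z
  proof (rule ccontr)
    assume "u \<noteq> z"
    have "m * norm (u - z) \<le> (m/2) * norm (u - z)"
      using d(2)[OF that(1,2)] m(2)[of "u - z"] that(3) by (simp add: order_trans)
    then show False using m(1) \<open>u \<noteq> z\<close> by simp
  qed
  then show thesis using that[of d] d(1) by (auto simp: inj_on_def)
qed

text \<open>The second difference \<open>f (x + su + sv) - f (x + su) - f (x + sv) + f x\<close> is symmetric in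
  \<open>u\<close> and \<open>v\<close> and equals \<open>s\<^sup>2 D\<^sub>v D\<^sub>u f + o(s\<^sup>2)\<close>.\<close>

lemma symmetric_second_derivative:
  fixes f :: "'a::real_normed_vector \<Rightarrow> 'b::real_normed_vector"
  assumes "open S" "x \<in> S" and f: "\<And>y. y \<in> S \<Longrightarrow> (f has_derivative f' y) (at y)"
    and U: "strict_deriv (\<lambda>y. f' y u) U x" and V: "strict_deriv (\<lambda>y. f' y v) V x"
  shows "U v = V u"
proof -
  have key: "\<exists>d>0. \<forall>s. 0 < s \<and> s < d \<longrightarrow>
      norm (f (x + s *\<^sub>R u + s *\<^sub>R v) - f (x + s *\<^sub>R u) - f (x + s *\<^sub>R v) + f x - (s * s) *\<^sub>R U v) \<le> e * (s * s)"
    if U: "strict_deriv (\<lambda>y. f' y u) U x" and e: "e > 0" for u v U and e :: real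
  proof -
    interpret U: bounded_linear U using U by (rule strict_deriv_bounded_linear)
    define \<eta> where "\<eta> = e / (norm v + 1)"
    have \<eta>: "\<eta> > 0" "\<eta> * norm v \<le> e"
    proof -
      have "norm v + 1 > 0" by (simp add: add_nonneg_pos)
      then show "\<eta> > 0" "\<eta> * norm v \<le> e" using e by (simp_all add: \<eta>_def field_simps)
    qed
    obtain d1 where d1: "d1 > 0" "\<And>y z. y \<in> ball x d1 \<Longrightarrow> z \<in> ball x d1 \<Longrightarrow>
      norm (f' y u - f' z u - U (y - z)) \<le> \<eta> * norm (y - z)"
      using strict_derivD[OF U \<eta>(1)] by blast
    obtain d2 where d2: "d2 > 0" "ball x d2 \<subseteq> S" using assms(1,2) openE by blast
    define d where "d = min d1 d2 / (norm u + norm v + 1)"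
    have dpos: "d > 0" using d1(1) d2(1) unfolding d_def by (simp add: add_nonneg_pos)
    have "norm (f (x + s *\<^sub>R u + s *\<^sub>R v) - f (x + s *\<^sub>R u) - f (x + s *\<^sub>R v) + f x - (s * s) *\<^sub>R U v) \<le> e * (s * s)"
      if s: "0 < s" "s < d" for s
    proof -
      have in_ball: "x + a *\<^sub>R u + b *\<^sub>R v \<in> ball x (min d1 d2)" if "0 \<le> a" "a \<le> s" "0 \<le> b" "b \<le> s" for a b
      proof -
        have "norm (a *\<^sub>R u + b *\<^sub>R v) \<le> s * norm u + s * norm v"
          using that s by (intro norm_triangle_le add_mono) (auto intro: mult_right_mono)
        also have "\<dots> \<le> s * (norm u + norm v + 1)" using s by (simp add: algebra_simps)
        also have "\<dots> < d * (norm u + norm v + 1)"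
          using s by (intro mult_strict_right_mono) (auto simp: add_nonneg_pos)
        also have "\<dots> = min d1 d2" unfolding d_def by (simp add: add_nonneg_eq_0_iff)
        finally have "dist x (x + (a *\<^sub>R u + b *\<^sub>R v)) < min d1 d2"
          by (metis add_diff_cancel_left' dist_commute dist_norm)
        then show ?thesis unfolding mem_ball add.assoc .
      qed
      \<comment> \<open>The mean value inequality is applied in \<open>r\<close> only: the
        derivative of \<open>\<phi>\<close> is an increment of \<open>\<lambda>y. f' y u\<close> in
        direction \<open>v\<close> minus its linear part, which strictness makes small.\<close>
      define \<phi> where "\<phi> r = f (x + r *\<^sub>R u + s *\<^sub>R v) - f (x + r *\<^sub>R u) - (r * s) *\<^sub>R U v" for r
      define \<phi>' where "\<phi>' r = (\<lambda>h. h *\<^sub>R (f' (x + r *\<^sub>R u + s *\<^sub>R v) u - f' (x + r *\<^sub>R u) u - s *\<^sub>R U v))" for r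
      have der: "(\<phi> has_derivative \<phi>' r) (at r within {0..s})" if r: "r \<in> {0..s}" for r
      proof -
        have in1: "x + r *\<^sub>R u + s *\<^sub>R v \<in> S" using in_ball[of r s] r s d2(2) by auto
        have in2: "x + r *\<^sub>R u \<in> S" using in_ball[of r 0] r s d2(2) by auto
        have lin1: "linear (f' (x + r *\<^sub>R u + s *\<^sub>R v))" "linear (f' (x + r *\<^sub>R u))"
          using f[OF in1] f[OF in2] has_derivative_linear by blast+
        have a: "((\<lambda>r. f (x + r *\<^sub>R u + s *\<^sub>R v)) has_derivative (\<lambda>h. f' (x + r *\<^sub>R u + s *\<^sub>R v) (h *\<^sub>R u))) (at r within {0..s})"
          by (rule has_derivative_compose[of "\<lambda>r. x + r *\<^sub>R u + s *\<^sub>R v" "\<lambda>h. h *\<^sub>R u", OF _ f[OF in1]])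
            (auto intro!: derivative_eq_intros)
        have b: "((\<lambda>r. f (x + r *\<^sub>R u)) has_derivative (\<lambda>h. f' (x + r *\<^sub>R u) (h *\<^sub>R u))) (at r within {0..s})"
          by (rule has_derivative_compose[of "\<lambda>r. x + r *\<^sub>R u" "\<lambda>h. h *\<^sub>R u", OF _ f[OF in2]])
            (auto intro!: derivative_eq_intros)
        have c: "((\<lambda>r. (r * s) *\<^sub>R U v) has_derivative (\<lambda>h. (h * s) *\<^sub>R U v)) (at r within {0..s})"
          by (auto intro!: derivative_eq_intros)
        show ?thesis
          using has_derivative_diff[OF has_derivative_diff[OF a b] c] unfolding \<phi>_def \<phi>'_def
          by (simp add: linear_scale[OF lin1(1)] linear_scale[OF lin1(2)] scaleR_diff_right)
      qed
      have bound: "onorm (\<phi>' r) \<le> e * s" if r: "r \<in> {0..s}" for r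
      proof -
        have "norm (f' (x + r *\<^sub>R u + s *\<^sub>R v) u - f' (x + r *\<^sub>R u) u - U (s *\<^sub>R v)) \<le> \<eta> * norm (s *\<^sub>R v)"
          using d1(2)[of "x + r *\<^sub>R u + s *\<^sub>R v" "x + r *\<^sub>R u"] in_ball[of r s] in_ball[of r 0] r s by simp
        also have "\<dots> = s * (\<eta> * norm v)" using s by simp
        also have "\<dots> \<le> s * e" using s \<eta>(2) by (intro mult_left_mono) auto
        finally have *: "norm (f' (x + r *\<^sub>R u + s *\<^sub>R v) u - f' (x + r *\<^sub>R u) u - s *\<^sub>R U v) \<le> e * s"
          by (simp add: U.scaleR ac_simps)
        have "norm (\<phi>' r h) \<le> (e * s) * norm h" for h
          unfolding \<phi>'_def using mult_right_mono[OF *, of "\<bar>h\<bar>"] by (simp add: ac_simps)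
        then show ?thesis by (intro onorm_bound) (use e s in auto)
      qed
      have "norm (\<phi> s - \<phi> 0) \<le> (e * s) * norm (s - 0)"
        by (rule differentiable_bound[OF _ der bound]) (use s in auto)
      then show ?thesis using s unfolding \<phi>_def by (simp add: algebra_simps)
    qed
    then show ?thesis using dpos by blast
  qed
  have "norm (U v - V u) \<le> e" if e: "e > 0" for e :: real
  proof -
    obtain d1 where d1: "d1 > 0" "\<And>s. 0 < s \<Longrightarrow> s < d1 \<Longrightarrow>
      norm (f (x + s *\<^sub>R u + s *\<^sub>R v) - f (x + s *\<^sub>R u) - f (x + s *\<^sub>R v) + f x - (s * s) *\<^sub>R U v) \<le> (e/2) * (s * s)"
      using key[OF U, of "e/2" v] e by auto
    obtain d2 where d2: "d2 > 0" "\<And>s. 0 < s \<Longrightarrow> s < d2 \<Longrightarrow>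
      norm (f (x + s *\<^sub>R v + s *\<^sub>R u) - f (x + s *\<^sub>R v) - f (x + s *\<^sub>R u) + f x - (s * s) *\<^sub>R V u) \<le> (e/2) * (s * s)"
      using key[OF V, of "e/2" u] e by auto
    define s where "s = min d1 d2 / 2"
    have s: "0 < s" "s < d1" "s < d2" using d1(1) d2(1) unfolding s_def by auto
    define W where "W = f (x + s *\<^sub>R u + s *\<^sub>R v) - f (x + s *\<^sub>R u) - f (x + s *\<^sub>R v) + f x"
    have 1: "norm (W - (s * s) *\<^sub>R U v) \<le> (e/2) * (s * s)"
      unfolding W_def by (rule d1(2)) (use s in auto)
    have 2: "norm (W - (s * s) *\<^sub>R V u) \<le> (e/2) * (s * s)"
    proof -
      have "W = f (x + s *\<^sub>R v + s *\<^sub>R u) - f (x + s *\<^sub>R v) - f (x + s *\<^sub>R u) + f x"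
        unfolding W_def by (simp add: algebra_simps)
      then show ?thesis using d2(2)[of s] s by simp
    qed
    have "(s * s) *\<^sub>R (U v - V u) = (W - (s * s) *\<^sub>R V u) - (W - (s * s) *\<^sub>R U v)"
      by (simp add: scaleR_diff_right)
    then have "norm ((s * s) *\<^sub>R (U v - V u)) \<le> norm (W - (s * s) *\<^sub>R V u) + norm (W - (s * s) *\<^sub>R U v)"
      by (simp only: norm_triangle_ineq4)
    then have "(s * s) * norm (U v - V u) \<le> norm (W - (s * s) *\<^sub>R V u) + norm (W - (s * s) *\<^sub>R U v)"
      by (simp only: norm_scaleR) simp
    also have "\<dots> \<le> (s * s) * e" using 1 2 by (simp add: mult.commute[of "s * s"])
    finally show ?thesis using s by simp
  qed
  then show ?thesis by (metis dense_ge eq_iff_diff_eq_0 norm_le_zero_iff)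
qed

section \<open>Functions of class \<open>C\<^sup>k\<close>\<close>

lemma frechet_derivative_at': "(f has_derivative D) (at x) \<Longrightarrow> frechet_derivative f (at x) = D"
  using frechet_derivative_at by metis

lemma frechet_derivative_worksI:
  "f differentiable F \<Longrightarrow> (f has_derivative frechet_derivative f F) F"
  using frechet_derivative_works by blast

lemma frechet_derivative_cong_open:
  assumes "open S" "x \<in> S" "\<And>y. y \<in> S \<Longrightarrow> f y = g y"
  shows "frechet_derivative f (at x) = frechet_derivative g (at x)"
proof -
  have "(f has_derivative D) (at x) \<longleftrightarrow> (g has_derivative D) (at x)" for D
    using has_derivative_transform_within_open[OF _ assms(1,2), of f D UNIV g]
      has_derivative_transform_within_open[OF _ assms(1,2), of g D UNIV f] assms(3) by auto
  then show ?thesis unfolding frechet_derivative_def by simp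
qed

lemma differentiable_cong_open:
  assumes "open S" "x \<in> S" "\<And>y. y \<in> S \<Longrightarrow> f y = g y" "f differentiable (at x)"
  shows "g differentiable (at x)"
  using assms(4) has_derivative_transform_within_open[OF _ assms(1,2), of f _ UNIV g] assms(3)
  unfolding differentiable_def by metis

lemma Ck_on_cong:
  assumes "open S" "\<And>x. x \<in> S \<Longrightarrow> f x = g x" "Ck_on k S f"
  shows "Ck_on k S g"
  using assms(2,3)
proof (induction k arbitrary: f g)
  case 0
  then show ?case by (simp cong: continuous_on_cong)
next
  case (Suc k)
  have "g differentiable (at x)" if "x \<in> S" for x
    using differentiable_cong_open[OF assms(1) that Suc.prems(1)] Suc.prems(2) that by auto
  moreover have "Ck_on k S (\<lambda>x. frechet_derivative g (at x) v)" for v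
    by (rule Suc.IH[of "\<lambda>x. frechet_derivative f (at x) v"])
      (use Suc.prems frechet_derivative_cong_open[OF assms(1) _ Suc.prems(1)] in auto)
  ultimately show ?case by simp
qed

lemma Ck_on_SucD: "Ck_on (Suc k) S f \<Longrightarrow> Ck_on k S f"
proof (induction k arbitrary: f)
  case 0
  then have "f differentiable_on S"
    by (auto simp: differentiable_on_def intro: differentiable_at_withinI)
  then show ?case by (simp add: differentiable_imp_continuous_on)
next
  case (Suc k)
  have "Ck_on k S (\<lambda>x. frechet_derivative f (at x) v)" for v
    using Suc.prems by (intro Suc.IH) simp
  then show ?case using Suc.prems by simp
qed

lemma Ck_on_subset: "Ck_on k S f \<Longrightarrow> T \<subseteq> S \<Longrightarrow> Ck_on k T f"
  by (induction k arbitrary: f) (auto intro: continuous_on_subset)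

lemma Ck_on_local:
  assumes "\<And>x. x \<in> S \<Longrightarrow> \<exists>T. open T \<and> x \<in> T \<and> Ck_on k T f"
  shows "Ck_on k S f"
  using assms
proof (induction k arbitrary: f)
  case 0
  have "isCont f x" if "x \<in> S" for x
    using 0[OF that] by (auto simp: continuous_on_eq_continuous_at)
  then show ?case by (simp add: continuous_at_imp_continuous_on)
next
  case (Suc k)
  have "f differentiable (at x)" if "x \<in> S" for x using Suc.prems[OF that] by auto
  moreover have "Ck_on k S (\<lambda>x. frechet_derivative f (at x) v)" for v
  proof (rule Suc.IH)
    fix x assume "x \<in> S"
    then obtain T where "open T" "x \<in> T" "Ck_on (Suc k) T f" using Suc.prems by blast
    then show "\<exists>T. open T \<and> x \<in> T \<and> Ck_on k T (\<lambda>x. frechet_derivative f (at x) v)" by auto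
  qed
  ultimately show ?case by simp
qed

lemma Ck_on_const: "Ck_on k S (\<lambda>_. c)"
  by (induction k arbitrary: c) auto

lemma Ck_on_bounded_linear:
  assumes "bounded_linear L" shows "Ck_on k S L"
proof (cases k)
  case 0
  then show ?thesis using assms by (simp add: linear_continuous_on)
next
  case (Suc j)
  have "frechet_derivative L (at x) = L" for x
    using assms bounded_linear_imp_has_derivative frechet_derivative_at' by blast
  then show ?thesis
    using Suc assms by (simp add: Ck_on_const bounded_linear_imp_differentiable)
qed

lemma Ck_on_add:
  assumes "open S" "Ck_on k S f" "Ck_on k S g"
  shows "Ck_on k S (\<lambda>x. f x + g x)"
  using assms(2,3)
proof (induction k arbitrary: f g)
  case 0
  then show ?case by (simp add: continuous_on_add)
next
  case (Suc k)
  have d: "f differentiable (at x)" "g differentiable (at x)" if "x \<in> S" for x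
    using Suc.prems that by auto
  have fd: "frechet_derivative (\<lambda>x. f x + g x) (at x) v
      = frechet_derivative f (at x) v + frechet_derivative g (at x) v" if "x \<in> S" for x v
    using frechet_derivative_at'[OF has_derivative_add[OF
        frechet_derivative_worksI[OF d(1)[OF that]] frechet_derivative_worksI[OF d(2)[OF that]]]]
    by simp
  have "Ck_on k S (\<lambda>x. frechet_derivative f (at x) v + frechet_derivative g (at x) v)" for v
    using Suc.prems by (intro Suc.IH) auto
  then have "Ck_on k S (\<lambda>x. frechet_derivative (\<lambda>x. f x + g x) (at x) v)" for v
    by (rule Ck_on_cong[OF assms(1), rotated]) (simp add: fd)
  then show ?case using d by (simp add: differentiable_add)
qed

lemma Ck_on_sum:
  assumes "open S" "finite I" "\<And>i. i \<in> I \<Longrightarrow> Ck_on k S (f i)"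
  shows "Ck_on k S (\<lambda>x. \<Sum>i\<in>I. f i x)"
  using assms(2,3) by (induction I) (auto intro: Ck_on_const Ck_on_add[OF assms(1)])

lemma Ck_on_linear_compose:
  assumes "open S" "bounded_linear L" "Ck_on k S f"
  shows "Ck_on k S (\<lambda>x. L (f x))"
  using assms(3)
proof (induction k arbitrary: f)
  case 0
  then show ?case by (simp add: bounded_linear.continuous_on assms(2))
next
  case (Suc k)
  have d: "((\<lambda>x. L (f x)) has_derivative (\<lambda>v. L (frechet_derivative f (at x) v))) (at x)" if "x \<in> S" for x
    using bounded_linear.has_derivative[OF assms(2)] Suc.prems that frechet_derivative_works by fastforce
  have "Ck_on k S (\<lambda>x. L (frechet_derivative f (at x) v))" for v
    using Suc.prems by (intro Suc.IH) auto
  then have "Ck_on k S (\<lambda>x. frechet_derivative (\<lambda>x. L (f x)) (at x) v)" for v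
    by (rule Ck_on_cong[OF assms(1), rotated]) (simp add: frechet_derivative_at'[OF d])
  then show ?case using d by (auto simp: differentiable_def)
qed

lemma Ck_on_scaleR:
  assumes "open S" "Ck_on k S c" "Ck_on k S f"
  shows "Ck_on k S (\<lambda>x. c x *\<^sub>R f x)"
  using assms(2,3)
proof (induction k arbitrary: c f)
  case 0
  then show ?case by (simp add: continuous_on_scaleR)
next
  case (Suc k)
  have d: "c differentiable (at x)" "f differentiable (at x)" if "x \<in> S" for x
    using Suc.prems that by auto
  have der: "((\<lambda>x. c x *\<^sub>R f x) has_derivative (\<lambda>v. c x *\<^sub>R frechet_derivative f (at x) v
      + frechet_derivative c (at x) v *\<^sub>R f x)) (at x)" if "x \<in> S" for x
    using has_derivative_scaleR[OF frechet_derivative_worksI[OF d(1)[OF that]]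
        frechet_derivative_worksI[OF d(2)[OF that]]] .
  have "Ck_on k S (\<lambda>x. c x *\<^sub>R frechet_derivative f (at x) v + frechet_derivative c (at x) v *\<^sub>R f x)" for v
    using Suc.prems Ck_on_SucD[OF Suc.prems(1)] Ck_on_SucD[OF Suc.prems(2)]
    by (intro Ck_on_add[OF assms(1)] Suc.IH) auto
  then have "Ck_on k S (\<lambda>x. frechet_derivative (\<lambda>x. c x *\<^sub>R f x) (at x) v)" for v
    by (rule Ck_on_cong[OF assms(1), rotated]) (simp add: frechet_derivative_at'[OF der])
  then show ?case using der by (auto simp: differentiable_def)
qed

lemma Ck_on_compose:
  fixes f :: "'a::euclidean_space \<Rightarrow> 'b::euclidean_space" and g :: "'b \<Rightarrow> 'c::euclidean_space"
  assumes "open S" "Ck_on k S f" "open T" "Ck_on k T g" "f ` S \<subseteq> T"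
  shows "Ck_on k S (\<lambda>x. g (f x))"
  using assms(2,4)
proof (induction k arbitrary: g)
  case 0
  then show ?case using continuous_on_compose2[OF _ _ assms(5), of g] by simp
next
  case (Suc k)
  have df: "(f has_derivative frechet_derivative f (at x)) (at x)" if "x \<in> S" for x
    using Suc.prems(1) that by (simp add: frechet_derivative_worksI)
  have dg: "(g has_derivative frechet_derivative g (at (f x))) (at (f x))" if "x \<in> S" for x
  proof -
    have "f x \<in> T" using assms(5) that by blast
    then show ?thesis using Suc.prems(2) by (simp add: frechet_derivative_worksI)
  qed
  have der: "((\<lambda>x. g (f x)) has_derivative
      (\<lambda>v. frechet_derivative g (at (f x)) (frechet_derivative f (at x) v))) (at x)" if "x \<in> S" for x
    using has_derivative_compose[OF df[OF that] dg[OF that]] .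
  have lin: "linear (frechet_derivative g (at (f x)))" if "x \<in> S" for x
    using dg[OF that] has_derivative_linear by blast
  \<comment> \<open>Expanding the inner derivative in the basis leaves only derivatives of
    \<open>g\<close> in fixed directions \<open>b\<close>, to which the induction hypothesis
    applies.\<close>
  have "Ck_on k S (\<lambda>x. \<Sum>b\<in>Basis. (frechet_derivative f (at x) v \<bullet> b) *\<^sub>R frechet_derivative g (at (f x)) b)" for v
  proof (intro Ck_on_sum Ck_on_scaleR assms(1) finite_Basis Suc.IH
        Ck_on_linear_compose[OF assms(1) bounded_linear_inner_left])
    show "Ck_on k S f" by (rule Ck_on_SucD[OF Suc.prems(1)])
    show "Ck_on k S (\<lambda>x. frechet_derivative f (at x) v)" using Suc.prems(1) by simp
    show "Ck_on k T (\<lambda>x. frechet_derivative g (at x) b)" for b using Suc.prems(2) by simp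
  qed
  then have "Ck_on k S (\<lambda>x. frechet_derivative (\<lambda>x. g (f x)) (at x) v)" for v
  proof (rule Ck_on_cong[OF assms(1), rotated])
    fix x assume x: "x \<in> S"
    show "(\<Sum>b\<in>Basis. (frechet_derivative f (at x) v \<bullet> b) *\<^sub>R frechet_derivative g (at (f x)) b)
        = frechet_derivative (\<lambda>x. g (f x)) (at x) v"
    proof -
      let ?g = "frechet_derivative g (at (f x))" and ?f = "frechet_derivative f (at x)"
      have "frechet_derivative (\<lambda>x. g (f x)) (at x) v = ?g (\<Sum>b\<in>Basis. (?f v \<bullet> b) *\<^sub>R b)"
        by (simp add: frechet_derivative_at'[OF der[OF x]] euclidean_representation)
      then show ?thesis by (simp only: linear_sum[OF lin[OF x]] linear_scale[OF lin[OF x]])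
    qed
  qed
  then show ?case using der by (auto simp: differentiable_def)
qed

lemma smooth_on_imp_Ck_on: "smooth_on S f \<Longrightarrow> Ck_on k S f"
  by (simp add: smooth_on_def)

lemma smooth_on_cong: "open S \<Longrightarrow> (\<And>x. x \<in> S \<Longrightarrow> f x = g x) \<Longrightarrow> smooth_on S f \<Longrightarrow> smooth_on S g"
  unfolding smooth_on_def using Ck_on_cong by blast

lemma smooth_on_subset: "smooth_on S f \<Longrightarrow> T \<subseteq> S \<Longrightarrow> smooth_on T f"
  unfolding smooth_on_def using Ck_on_subset by blast

lemma smooth_on_local:
  assumes "\<And>x. x \<in> S \<Longrightarrow> \<exists>T. open T \<and> x \<in> T \<and> smooth_on T f"
  shows "smooth_on S f"
  unfolding smooth_on_def
proof (intro allI Ck_on_local)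
  fix k x assume "x \<in> S"
  then show "\<exists>T. open T \<and> x \<in> T \<and> Ck_on k T f" using assms[of x] unfolding smooth_on_def by blast
qed

lemma smooth_on_bounded_linear: "bounded_linear L \<Longrightarrow> smooth_on S L"
  by (simp add: smooth_on_def Ck_on_bounded_linear)

lemma smooth_on_const: "smooth_on S (\<lambda>_. c)"
  by (simp add: smooth_on_def Ck_on_const)

lemma smooth_on_add:
  "open S \<Longrightarrow> smooth_on S f \<Longrightarrow> smooth_on S g \<Longrightarrow> smooth_on S (\<lambda>x. f x + g x)"
  by (simp add: smooth_on_def Ck_on_add)

lemma smooth_on_compose:
  fixes f :: "'a::euclidean_space \<Rightarrow> 'b::euclidean_space" and g :: "'b \<Rightarrow> 'c::euclidean_space"
  assumes "open S" "smooth_on S f" "open T" "smooth_on T g" "f ` S \<subseteq> T"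
  shows "smooth_on S (\<lambda>x. g (f x))"
  using Ck_on_compose[OF assms(1) _ assms(3) _ assms(5)] assms(2,4) unfolding smooth_on_def by blast

lemma smooth_on_frechet_derivative:
  "smooth_on S f \<Longrightarrow> smooth_on S (\<lambda>x. frechet_derivative f (at x) v)"
  unfolding smooth_on_def by (metis Ck_on.simps(2))

lemma smooth_on_imp_continuous_on: "smooth_on S f \<Longrightarrow> continuous_on S f"
  using smooth_on_imp_Ck_on[of S f 0] by simp

lemma smooth_on_has_derivative:
  "smooth_on S f \<Longrightarrow> x \<in> S \<Longrightarrow> (f has_derivative frechet_derivative f (at x)) (at x)"
  using smooth_on_imp_Ck_on[of S f "Suc 0"] frechet_derivative_works by auto

text \<open>In finite dimension the operator-valued derivative is continuous as soon as each
  directional derivative is, which smoothness provides.\<close>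

lemma smooth_on_strict_deriv:
  assumes "open S" "smooth_on S f" "x \<in> S"
  shows "strict_deriv f (frechet_derivative f (at x)) x"
proof -
  define f' where "f' y = Blinfun (frechet_derivative f (at y))" for y
  have f': "blinfun_apply (f' y) = frechet_derivative f (at y)" if "y \<in> S" for y
    using has_derivative_bounded_linear[OF smooth_on_has_derivative[OF assms(2) that]]
    unfolding f'_def by (rule bounded_linear_Blinfun_apply)
  have "continuous_on S f'"
  proof (rule continuous_on_blinfun_componentwise)
    fix i :: 'a
    have "continuous_on S (\<lambda>x. frechet_derivative f (at x) i)"
      using smooth_on_frechet_derivative[OF assms(2)] smooth_on_imp_continuous_on by blast
    then show "continuous_on S (\<lambda>x. f' x i)" by (rule continuous_on_eq) (simp add: f')
  qed
  then have "isCont f' x" using assms(1,3) by (simp add: continuous_on_eq_continuous_at)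
  from strict_deriv_of_continuous_derivative[OF assms(1,3) _ this, of f]
  show ?thesis using smooth_on_has_derivative[OF assms(2)] f' assms(3) by simp
qed

lemma smooth_on_second_derivative_symmetric:
  assumes "open S" "smooth_on S f" "x \<in> S"
  shows "frechet_derivative (\<lambda>y. frechet_derivative f (at y) u) (at x) v
       = frechet_derivative (\<lambda>y. frechet_derivative f (at y) v) (at x) u"
  by (rule symmetric_second_derivative[OF assms(1,3) smooth_on_has_derivative[OF assms(2)]
        smooth_on_strict_deriv[OF assms(1) smooth_on_frechet_derivative[OF assms(2)] assms(3)]
        smooth_on_strict_deriv[OF assms(1) smooth_on_frechet_derivative[OF assms(2)] assms(3)]])

lemma strict_deriv_basis_expand:
  fixes f :: "'b::euclidean_space \<Rightarrow> 'p::real_normed_vector \<Rightarrow> 'c::real_normed_vector"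
  assumes "strict_deriv a a' x" "\<And>b. b \<in> Basis \<Longrightarrow> strict_deriv (f b) (f' b) x"
  shows "strict_deriv (\<lambda>y. \<Sum>b\<in>Basis. (a y \<bullet> b) *\<^sub>R f b y)
    (\<lambda>h. \<Sum>b\<in>Basis. (a x \<bullet> b) *\<^sub>R f' b h + (a' h \<bullet> b) *\<^sub>R f b x) x"
  by (intro strict_deriv_sum strict_deriv_scaleR finite_Basis assms(2)
      strict_deriv_linear_compose[OF bounded_linear_inner_left assms(1)])

section \<open>Differential inequalities and linear differential equations\<close>

text \<open>Continuous induction. \<open>P\<close> holds at the infimum of the failures by
  \<open>base\<close> or \<open>limit\<close>, and \<open>step\<close> then contradicts the infimum
  property. The continuation arguments below, for geodesics, flows, lifts and sections, take this
  form.\<close>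

lemma interval_induct [consumes 2, case_names base step limit]:
  fixes a b :: real
  assumes "a \<le> b" "t \<in> {a..b}" and base: "P a"
    and step: "\<And>t. a \<le> t \<Longrightarrow> t < b \<Longrightarrow> P t \<Longrightarrow> \<exists>d>0. \<forall>s. t < s \<and> s < t + d \<and> s \<le> b \<longrightarrow> P s"
    and limit: "\<And>t. a < t \<Longrightarrow> t \<le> b \<Longrightarrow> (\<And>s. a \<le> s \<Longrightarrow> s < t \<Longrightarrow> P s) \<Longrightarrow> P t"
  shows "P t"
proof (rule ccontr)
  assume "\<not> P t"
  define S where "S = {s \<in> {a..b}. \<not> P s}"
  have ne: "S \<noteq> {}" using \<open>\<not> P t\<close> assms(2) unfolding S_def by auto
  have bdd: "bdd_below S" unfolding S_def by (rule bdd_belowI[of _ a]) auto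
  define m where "m = Inf S"
  have m: "a \<le> m" "m \<le> b"
    using cInf_greatest[OF ne, of a] cInf_lower[OF _ bdd] ne unfolding m_def S_def by fastforce+
  have below: "P s" if "a \<le> s" "s < m" for s
    using cInf_lower[OF _ bdd, of s] that m unfolding m_def S_def by fastforce
  have "P m" using base limit[of m] below m by (cases "m = a") auto
  then have "m < b" using m \<open>\<not> P t\<close> assms(2) below by (metis atLeastAtMost_iff leD le_less_linear less_le)
  obtain d where d: "d > 0" "\<And>s. m < s \<Longrightarrow> s < m + d \<Longrightarrow> s \<le> b \<Longrightarrow> P s"
    using step[OF m(1) \<open>m < b\<close> \<open>P m\<close>] by blast
  have "m + d \<le> s" if "s \<in> S" for s
  proof (rule ccontr)
    assume "\<not> m + d \<le> s"
    moreover have "m \<le> s" using cInf_lower[OF that bdd] unfolding m_def .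
    ultimately have "P s" using d(2)[of s] \<open>P m\<close> that unfolding S_def by (cases "s = m") auto
    then show False using that unfolding S_def by simp
  qed
  then have "m + d \<le> m" unfolding m_def using cInf_greatest[OF ne] by blast
  then show False using d(1) by simp
qed

text \<open>For each \<open>e > 0\<close> the bound \<open>u t \<le> u a + e * (t - a)\<close>
  propagates by continuous induction; afterwards \<open>e\<close> tends to \<open>0\<close>.\<close>

lemma nonincreasing_of_right_Dini_aux:
  fixes u :: "real \<Rightarrow> real"
  assumes "a \<le> b" "continuous_on {a..b} u"
    and dini: "\<And>s e. a \<le> s \<Longrightarrow> s < b \<Longrightarrow> e > 0 \<Longrightarrow> \<exists>d>0. \<forall>h. 0 < h \<and> h < d \<longrightarrow> u (s + h) \<le> u s + e * h"
  shows "u b \<le> u a"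
proof -
  have *: "u b \<le> u a + e * (b - a)" if e: "e > 0" for e
    using assms(1)
  proof (rule interval_induct[where t = b and P = "\<lambda>t. u t \<le> u a + e * (t - a)"])
    show "b \<in> {a..b}" using assms(1) by simp
    fix t assume t: "a \<le> t" "t < b" "u t \<le> u a + e * (t - a)"
    obtain d where d: "d > 0" "\<And>h. 0 < h \<Longrightarrow> h < d \<Longrightarrow> u (t + h) \<le> u t + e * h"
      using dini[OF t(1,2) e] by blast
    have "u s \<le> u a + e * (s - a)" if "t < s" "s < t + d" for s
      using d(2)[of "s - t"] that t(3) by (simp add: algebra_simps)
    then show "\<exists>d>0. \<forall>s. t < s \<and> s < t + d \<and> s \<le> b \<longrightarrow> u s \<le> u a + e * (s - a)"
      using d(1) by blast
  next
    fix t assume t: "a < t" "t \<le> b" and *: "\<And>s. a \<le> s \<Longrightarrow> s < t \<Longrightarrow> u s \<le> u a + e * (s - a)"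
    have "continuous_on {a..t} (\<lambda>s. u a + e * (s - a) - u s)"
      using t by (intro continuous_intros continuous_on_subset[OF assms(2)]) auto
    moreover have "closure {a..<t} = {a..t}" using t by simp
    ultimately have "u a + e * (t - a) - u t \<ge> 0"
      using continuous_ge_on_closure[of "{a..<t}" "\<lambda>s. u a + e * (s - a) - u s" t 0] * t by auto
    then show "u t \<le> u a + e * (t - a)" by simp
  qed simp
  then have "u b - u a \<le> e * (b - a)" if "e > 0" for e using *[OF that] by simp
  note * = this
  have "u b - u a \<le> 0"
  proof (rule field_le_epsilon)
    fix e :: real assume "e > 0"
    then have "u b - u a \<le> (e / (b - a + 1)) * (b - a)" using assms(1) by (intro *) simp
    also have "\<dots> \<le> e" using \<open>e > 0\<close> assms(1) by (simp add: field_simps)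
    finally show "u b - u a \<le> 0 + e" by simp
  qed
  then show ?thesis by simp
qed

text \<open>The exceptional set \<open>T\<close> will hold the corners of a piecewise smooth curve,
  where no one-sided estimate is assumed. The interval is cut there, and continuity of
  \<open>u\<close> takes care of the left end points.\<close>

lemma nonincreasing_of_right_Dini:
  fixes u :: "real \<Rightarrow> real"
  assumes "finite T" "a \<le> b" "continuous_on {a..b} u"
    and dini: "\<And>s e. a < s \<Longrightarrow> s < b \<Longrightarrow> s \<notin> T \<Longrightarrow> e > 0 \<Longrightarrow>
      \<exists>d>0. \<forall>h. 0 < h \<and> h < d \<longrightarrow> u (s + h) \<le> u s + e * h"
  shows "u b \<le> u a"
  using assms
proof (induction T arbitrary: a b rule: finite_induct)
  case empty
  show ?case
  proof (cases "a = b")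
    case False
    with empty.prems have ab: "a < b" by simp
    have "u b \<le> u c" if "c \<in> {a<..<b}" for c
    proof (rule nonincreasing_of_right_Dini_aux[of c b u])
      show "c \<le> b" "continuous_on {c..b} u"
        using that by (auto intro: continuous_on_subset[OF empty.prems(2)])
      show "\<exists>d>0. \<forall>h. 0 < h \<and> h < d \<longrightarrow> u (s + h) \<le> u s + e * h" if "c \<le> s" "s < b" "e > 0" for s e
        using empty.prems(3)[of s e] that \<open>c \<in> {a<..<b}\<close> by simp
    qed
    moreover have "closure {a<..<b} = {a..b}" using ab by simp
    ultimately show ?thesis
      using continuous_ge_on_closure[of "{a<..<b}" u a "u b"] empty.prems(2) ab by auto
  qed simp
next
  case (insert x T)
  show ?case
  proof (cases "a < x \<and> x < b")
    case True
    have "u x \<le> u a"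
    proof (rule insert.IH[of a x])
      show "\<exists>d>0. \<forall>h. 0 < h \<and> h < d \<longrightarrow> u (s + h) \<le> u s + e * h" if "a < s" "s < x" "s \<notin> T" "e > 0" for s e
        using insert.prems(3)[of s e] that True by simp
    qed (use True in \<open>auto intro: continuous_on_subset[OF insert.prems(2)]\<close>)
    moreover have "u b \<le> u x"
    proof (rule insert.IH[of x b])
      show "\<exists>d>0. \<forall>h. 0 < h \<and> h < d \<longrightarrow> u (s + h) \<le> u s + e * h" if "x < s" "s < b" "s \<notin> T" "e > 0" for s e
        using insert.prems(3)[of s e] that True by simp
    qed (use True in \<open>auto intro: continuous_on_subset[OF insert.prems(2)]\<close>)
    ultimately show ?thesis by simp
  next
    case False
    show ?thesis
    proof (rule insert.IH[OF insert.prems(1,2)])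
      show "\<exists>d>0. \<forall>h. 0 < h \<and> h < d \<longrightarrow> u (s + h) \<le> u s + e * h" if "a < s" "s < b" "s \<notin> T" "e > 0" for s e
        using insert.prems(3)[of s e] that False by auto
    qed
  qed
qed

lemma vector_derivative_bound:
  fixes y :: "real \<Rightarrow> 's::real_normed_vector"
  assumes "\<And>t. t \<in> {a..b} \<Longrightarrow> (y has_vector_derivative y' t) (at t within {a..b})"
    "\<And>t. t \<in> {a..b} \<Longrightarrow> norm (y' t) \<le> M" "s \<in> {a..b}" "t \<in> {a..b}"
  shows "norm (y t - y s) \<le> M * \<bar>t - s\<bar>"
proof -
  have "norm (y t - y s) \<le> M * norm (t - s)"
  proof (rule differentiable_bound[of "{a..b}" y "\<lambda>t h. h *\<^sub>R y' t"])
    show "onorm (\<lambda>h. h *\<^sub>R y' r) \<le> M" if "r \<in> {a..b}" for r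
      by (rule onorm_bound) (use assms(2)[OF that] norm_ge_zero[of "y' r"] in
          \<open>auto simp: mult.commute[of M] intro: mult_left_mono simp del: norm_ge_zero\<close>)
  qed (use assms in \<open>auto simp: has_vector_derivative_def\<close>)
  then show ?thesis by simp
qed

text \<open>On an interval with \<open>L * (b - a) \<le> 1/2\<close> the maximum of
  \<open>norm (y t)\<close> is bounded by terms in the initial value and \<open>e\<close> plus half
  of itself, which is absorbed. Short intervals suffice, since solutions are continued by
  \<open>interval_induct\<close>.\<close>

lemma short_Gronwall:
  fixes y :: "real \<Rightarrow> 's::real_normed_vector"
  assumes "a \<le> b" "L \<ge> 0" "L * (b - a) \<le> 1/2" "e \<ge> 0"
    and der: "\<And>t. t \<in> {a..b} \<Longrightarrow> (y has_vector_derivative y' t) (at t within {a..b})"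
    and bound: "\<And>t. t \<in> {a..b} \<Longrightarrow> norm (y' t) \<le> L * norm (y t) + e"
    and "t \<in> {a..b}"
  shows "norm (y t) \<le> 2 * norm (y a) + 2 * (b - a) * e"
proof -
  have "continuous_on {a..b} (\<lambda>t. norm (y t))"
    using der by (intro continuous_on_norm continuous_on_vector_derivative) auto
  then obtain s where s: "s \<in> {a..b}" "\<And>r. r \<in> {a..b} \<Longrightarrow> norm (y r) \<le> norm (y s)"
    using continuous_attains_sup[of "{a..b}" "\<lambda>t. norm (y t)"] assms(1) by auto
  have "norm (y s - y a) \<le> (L * norm (y s) + e) * \<bar>s - a\<bar>"
  proof (rule vector_derivative_bound[OF der])
    fix r assume r: "r \<in> {a..b}"
    show "norm (y' r) \<le> L * norm (y s) + e"
      using bound[OF r] mult_left_mono[OF s(2)[OF r] assms(2)] by simp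
  qed (use s assms(1) in auto)
  also have "\<dots> \<le> (L * norm (y s) + e) * (b - a)"
    using s(1) assms(2,4) by (intro mult_left_mono) auto
  also have "\<dots> = (L * (b - a)) * norm (y s) + (b - a) * e" by (simp add: algebra_simps)
  also have "\<dots> \<le> 1/2 * norm (y s) + (b - a) * e"
    using assms(3) by (intro add_right_mono mult_right_mono) auto
  finally have "norm (y s) \<le> norm (y a) + 1/2 * norm (y s) + (b - a) * e"
    using norm_triangle_sub[of "y s" "y a"] by simp
  moreover have "2 * (b - a) * e = 2 * ((b - a) * e)" by simp
  ultimately show ?thesis using s(2)[OF assms(7)] by linarith
qed

text \<open>Picard iteration: the integral operator halves distances because
  \<open>L * (b - a) \<le> 1/2\<close>. Functions on \<open>{a..b}\<close> are extended by
  \<open>clamp\<close>, so that the complete space of bounded continuous functions on the whole line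
  can be used.\<close>

lemma lipschitz_ode_exists:
  fixes f :: "real \<Rightarrow> 'z::banach \<Rightarrow> 'z"
  assumes "a \<le> b" "L \<ge> 0" "L * (b - a) \<le> 1/2"
    and cont: "\<And>u. continuous_on {a..b} u \<Longrightarrow> continuous_on {a..b} (\<lambda>t. f t (u t))"
    and lip: "\<And>t x y. t \<in> {a..b} \<Longrightarrow> norm (f t x - f t y) \<le> L * norm (x - y)"
  obtains y where "y a = y0"
    "\<And>t. t \<in> {a..b} \<Longrightarrow> (y has_vector_derivative f t (y t)) (at t within {a..b})"
proof -
  have contb: "continuous_on {a..b} (\<lambda>t. f t (apply_bcontfun u t))" for u :: "real \<Rightarrow>\<^sub>C 'z"
    by (intro cont continuous_on_apply_bcontfun continuous_on_id)
  have int: "(\<lambda>s. f s (apply_bcontfun u s)) integrable_on {a..t}" if "t \<in> {a..b}" for u t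
    using that by (intro integrable_continuous_real continuous_on_subset[OF contb]) auto
  have "\<exists>v :: real \<Rightarrow>\<^sub>C 'z. \<forall>x. apply_bcontfun v x = y0 + integral {a..clamp a b x} (\<lambda>s. f s (apply_bcontfun u s))"
    for u :: "real \<Rightarrow>\<^sub>C 'z"
  proof -
    have "continuous_on (cbox a b) (\<lambda>t. y0 + integral {a..t} (\<lambda>s. f s (apply_bcontfun u s)))"
      using indefinite_integral_continuous_1[OF int[of b u]] assms(1)
      by (auto intro!: continuous_intros)
    then show ?thesis by (rule continuous_on_cbox_bcontfunE) blast
  qed
  then obtain \<Phi> :: "(real \<Rightarrow>\<^sub>C 'z) \<Rightarrow> (real \<Rightarrow>\<^sub>C 'z)" where
    \<Phi>: "\<And>u x. apply_bcontfun (\<Phi> u) x = y0 + integral {a..clamp a b x} (\<lambda>s. f s (apply_bcontfun u s))"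
    by metis
  have "dist (\<Phi> u) (\<Phi> v) \<le> 1/2 * dist u v" for u v
  proof (rule dist_bound)
    fix x
    let ?t = "clamp a b x"
    have t: "?t \<in> {a..b}" using clamp_in_interval[of a b x] assms(1) by simp
    have "dist (\<Phi> u x) (\<Phi> v x) = norm (integral {a..?t} (\<lambda>s. f s (u s) - f s (v s)))"
      by (simp add: \<Phi> dist_norm integral_diff[OF int[OF t] int[OF t]])
    also have "\<dots> \<le> (L * dist u v) * (?t - a)"
    proof (rule integral_bound)
      show "continuous_on {a..?t} (\<lambda>s. f s (u s) - f s (v s))"
        using t by (intro continuous_intros continuous_on_subset[OF contb]) auto
      fix s assume "s \<in> {a..?t}"
      then have "norm (f s (u s) - f s (v s)) \<le> L * norm (u s - v s)" using t by (intro lip) auto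
      also have "\<dots> \<le> L * dist u v"
        using dist_bounded[of u s v] assms(2) by (intro mult_left_mono) (auto simp: dist_norm)
      finally show "norm (f s (u s) - f s (v s)) \<le> L * dist u v" .
    qed (use t in auto)
    also have "\<dots> \<le> (L * dist u v) * (b - a)" using t assms(2) by (intro mult_left_mono) auto
    also have "\<dots> = (L * (b - a)) * dist u v" by simp
    also have "\<dots> \<le> 1/2 * dist u v" using assms(3) by (intro mult_right_mono) auto
    finally show "dist (\<Phi> u x) (\<Phi> v x) \<le> 1/2 * dist u v" .
  qed
  then obtain u where u: "\<Phi> u = u" using banach_fix_type[of "1/2" \<Phi>] by auto
  have ut: "apply_bcontfun u t = y0 + integral {a..t} (\<lambda>s. f s (apply_bcontfun u s))" if "t \<in> {a..b}" for t
    using \<Phi>[of u t] u that by simp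
  show thesis
  proof (rule that[of "apply_bcontfun u"])
    show "apply_bcontfun u a = y0" using ut[of a] assms(1) by simp
    fix t assume t: "t \<in> {a..b}"
    have "((\<lambda>t. y0 + integral {a..t} (\<lambda>s. f s (apply_bcontfun u s))) has_vector_derivative f t (apply_bcontfun u t)) (at t within {a..b})"
      using integral_has_vector_derivative[OF contb t, of u]
      by (auto intro!: derivative_eq_intros)
    then show "(apply_bcontfun u has_vector_derivative f t (apply_bcontfun u t)) (at t within {a..b})"
      by (rule has_vector_derivative_transform[OF t, rotated]) (simp add: ut)
  qed
qed

text \<open>\<open>D\<close> solves the linearised equation. The error
  \<open>y w t - y w' t - D t (w - w')\<close> satisfies a linear differential inequality with
  inhomogeneity at most a small multiple of \<open>norm (w - w')\<close>, and Gronwall bounds it.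
  Comparing two arbitrary parameters \<open>w\<close> and \<open>w'\<close>, rather than
  \<open>w\<close> and \<open>w0\<close>, is what yields a strict derivative.\<close>

lemma strict_deriv_flow:
  fixes F :: "'s::banach \<Rightarrow> 's" and F' :: "'s \<Rightarrow> 's \<Rightarrow>\<^sub>L 's"
    and y :: "'w::real_normed_vector \<Rightarrow> real \<Rightarrow> 's" and D0 :: "'w \<Rightarrow>\<^sub>L 's"
  assumes ab: "a \<le> b" "L \<ge> 0" "L * (b - a) \<le> 1/2" and K: "convex K" "compact K"
    and F: "\<And>s. s \<in> K \<Longrightarrow> (F has_derivative F' s) (at s within K)" "continuous_on K F'"
      "\<And>s. s \<in> K \<Longrightarrow> norm (F' s) \<le> L"
    and y: "eventually (\<lambda>w. \<forall>t\<in>{a..b}. y w t \<in> K \<and>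
        (y w has_vector_derivative F (y w t)) (at t within {a..b})) (nhds w0)"
    and init: "strict_deriv (\<lambda>w. y w a) D0 w0"
  obtains D :: "real \<Rightarrow> 'w \<Rightarrow>\<^sub>L 's" where "D a = D0"
    "\<And>t. t \<in> {a..b} \<Longrightarrow> strict_deriv (\<lambda>w. y w t) (D t) w0"
    "\<And>t. t \<in> {a..b} \<Longrightarrow> (D has_vector_derivative F' (y w0 t) o\<^sub>L D t) (at t within {a..b})"
proof -
  obtain r where r: "r > 0" "\<And>w t. w \<in> ball w0 r \<Longrightarrow> t \<in> {a..b} \<Longrightarrow> y w t \<in> K"
    "\<And>w t. w \<in> ball w0 r \<Longrightarrow> t \<in> {a..b} \<Longrightarrow> (y w has_vector_derivative F (y w t)) (at t within {a..b})"
    using y unfolding eventually_nhds_metric by (auto simp: dist_commute)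
  have w0: "w0 \<in> ball w0 r" using r(1) by simp
  define A where "A t = F' (y w0 t)" for t
  have contA: "continuous_on {a..b} A"
    unfolding A_def
  proof (rule continuous_on_compose2[OF F(2)])
    show "continuous_on {a..b} (y w0)"
      using r(3)[OF w0] by (rule continuous_on_vector_derivative)
  qed (use r(2)[OF w0] in auto)
  have normA: "norm (A t) \<le> L" if "t \<in> {a..b}" for t
    unfolding A_def using F(3) r(2)[OF w0 that] by blast
  obtain D :: "real \<Rightarrow> 'w \<Rightarrow>\<^sub>L 's" where D: "D a = D0"
    "\<And>t. t \<in> {a..b} \<Longrightarrow> (D has_vector_derivative A t o\<^sub>L D t) (at t within {a..b})"
  proof (rule lipschitz_ode_exists[OF ab, of "\<lambda>t D. A t o\<^sub>L D"])
    show "continuous_on {a..b} (\<lambda>t. A t o\<^sub>L u t)" if "continuous_on {a..b} u" for u :: "real \<Rightarrow> 'w \<Rightarrow>\<^sub>L 's"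
      using bounded_bilinear.continuous_on[OF bounded_bilinear_blinfun_compose contA that] .
    show "norm ((A t o\<^sub>L x) - (A t o\<^sub>L z)) \<le> L * norm (x - z)" if "t \<in> {a..b}" for t and x z :: "'w \<Rightarrow>\<^sub>L 's"
    proof -
      have "(A t o\<^sub>L x) - (A t o\<^sub>L z) = A t o\<^sub>L (x - z)"
        by (simp add: bounded_bilinear.diff_right[OF bounded_bilinear_blinfun_compose])
      also have "norm \<dots> \<le> norm (A t) * norm (x - z)" by (rule norm_blinfun_compose)
      also have "\<dots> \<le> L * norm (x - z)" by (intro mult_right_mono normA that) simp
      finally show ?thesis .
    qed
  qed blast
  obtain L0 r0 where L0: "L0 > 0" "r0 > 0" "\<And>w w'. w \<in> ball w0 r0 \<Longrightarrow> w' \<in> ball w0 r0 \<Longrightarrow>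
      norm (y w a - y w' a) \<le> L0 * norm (w - w')"
    using strict_deriv_lipschitz[OF init] by blast
  have lipF: "norm (F s - F s') \<le> L * norm (s - s')" if "s \<in> K" "s' \<in> K" for s s'
    by (rule differentiable_bound[OF K(1) F(1) _ that])
      (use F(3) in \<open>auto simp: norm_blinfun.rep_eq[symmetric]\<close>)
  have dep: "norm (y w t - y w' t) \<le> 2 * L0 * norm (w - w')"
    if w: "w \<in> ball w0 (min r r0)" "w' \<in> ball w0 (min r r0)" and t: "t \<in> {a..b}" for w w' t
  proof -
    have "norm (y w t - y w' t) \<le> 2 * norm (y w a - y w' a) + 2 * (b - a) * 0"
    proof (rule short_Gronwall[OF ab, where y' = "\<lambda>t. F (y w t) - F (y w' t)"])
      fix t assume t: "t \<in> {a..b}"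
      show "((\<lambda>t. y w t - y w' t) has_vector_derivative F (y w t) - F (y w' t)) (at t within {a..b})"
        using w t by (intro has_vector_derivative_diff r(3)) auto
      show "norm (F (y w t) - F (y w' t)) \<le> L * norm (y w t - y w' t) + 0"
        using lipF[OF r(2) r(2), of w t w' t] w t by simp
    qed (use t in auto)
    also have "\<dots> \<le> 2 * (L0 * norm (w - w'))" using L0(3)[of w w'] w by simp
    finally show ?thesis by simp
  qed
  have "strict_deriv (\<lambda>w. y w t) (D t) w0" if t: "t \<in> {a..b}" for t
  proof (rule strict_derivI)
    show "bounded_linear (blinfun_apply (D t))" by (rule blinfun.bounded_linear_right)
    fix e :: real assume e: "e > 0"
    \<comment> \<open>With the Lipschitz constant \<open>2 * L0\<close> of \<open>dep\<close>, this
      makes the Gronwall contribution \<open>2 * (b - a) * e'\<close> at most half of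
      \<open>e * norm (w - w')\<close>; the \<open>+ 1\<close> covers \<open>a = b\<close>.\<close>
    define e1 where "e1 = e / (8 * (b - a + 1) * L0)"
    have e1: "e1 > 0" using e ab(1) L0(1) unfolding e1_def by simp
    obtain r1 where r1: "r1 > 0" "\<And>w w'. w \<in> ball w0 r1 \<Longrightarrow> w' \<in> ball w0 r1 \<Longrightarrow>
        norm (y w a - y w' a - D0 (w - w')) \<le> e / 4 * norm (w - w')"
      using strict_derivD[OF init, of "e/4"] e by auto
    have "uniformly_continuous_on K F'" using F(2) K(2) compact_uniformly_continuous by blast
    then obtain \<eta> where \<eta>: "\<eta> > 0" "\<And>s s'. s \<in> K \<Longrightarrow> s' \<in> K \<Longrightarrow> dist s' s < \<eta> \<Longrightarrow> dist (F' s') (F' s) < e1"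
      using e1 unfolding uniformly_continuous_on_def by metis
    \<comment> \<open>The last entry keeps all solutions within \<open>\<eta>\<close> of
      \<open>y w0\<close>, where \<open>F'\<close> varies by less than \<open>e1\<close>.\<close>
    define d where "d = min (min r r0) (min r1 (\<eta> / (2 * L0)))"
    have d: "d > 0" using r(1) L0 r1(1) \<eta>(1) unfolding d_def by simp
    have "norm (y w t - y w' t - D t (w - w')) \<le> e * norm (w - w')"
      if w: "w \<in> ball w0 d" "w' \<in> ball w0 d" for w w'
    proof -
      have wr: "w \<in> ball w0 (min r r0)" "w' \<in> ball w0 (min r r0)" "w \<in> ball w0 r" "w' \<in> ball w0 r"
        using w unfolding d_def by auto
      have near: "y v s \<in> K \<inter> ball (y w0 s) \<eta>" if v: "v \<in> ball w0 d" and s: "s \<in> {a..b}" for v s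
      proof -
        have vr: "v \<in> ball w0 (min r r0)" "v \<in> ball w0 r" using v unfolding d_def by auto
        have "norm (y v s - y w0 s) \<le> 2 * L0 * norm (v - w0)"
          using dep[OF vr(1) _ s, of w0] r(1) L0(2) by simp
        also have "\<dots> < 2 * L0 * (\<eta> / (2 * L0))"
          using v L0(1) unfolding d_def by (intro mult_strict_left_mono) (auto simp: dist_norm norm_minus_commute)
        also have "\<dots> = \<eta>" using L0(1) by simp
        finally show ?thesis using r(2)[OF vr(2) s] by (simp add: dist_norm norm_minus_commute)
      qed
      define e' where "e' = e1 * (2 * L0 * norm (w - w'))"
      have e'0: "e' \<ge> 0" unfolding e'_def using e1 L0(1) by simp
      have "norm (y w t - y w' t - D t (w - w')) \<le> 2 * norm (y w a - y w' a - D a (w - w')) + 2 * (b - a) * e'"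
      proof (rule short_Gronwall[OF ab e'0, where y' = "\<lambda>t. F (y w t) - F (y w' t) - A t (D t (w - w'))"])
        fix s assume s: "s \<in> {a..b}"
        show "((\<lambda>t. y w t - y w' t - D t (w - w')) has_vector_derivative
            F (y w s) - F (y w' s) - A s (D s (w - w'))) (at s within {a..b})"
          using has_vector_derivative_diff[OF has_vector_derivative_diff[OF r(3)[OF wr(3) s] r(3)[OF wr(4) s]]
            bounded_linear.has_vector_derivative[OF blinfun.bounded_linear_left D(2)[OF s], of "w - w'"]]
          by simp
        have "norm (F (y w s) - F (y w' s) - A s (y w s - y w' s)) \<le> norm (y w s - y w' s) * e1"
          unfolding A_def
        proof (rule differentiable_bound_linearization[where S = "K \<inter> ball (y w0 s) \<eta>" and f' = "\<lambda>s. blinfun_apply (F' s)"])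
          show "y w' s + u *\<^sub>R (y w s - y w' s) \<in> K \<inter> ball (y w0 s) \<eta>" if u: "u \<in> {0..1}" for u
          proof -
            have "(1 - u) *\<^sub>R y w' s + u *\<^sub>R y w s \<in> K \<inter> ball (y w0 s) \<eta>"
              using u near[OF w(1) s] near[OF w(2) s] K(1)
              by (intro convexD[OF convex_Int]) auto
            then show ?thesis by (simp add: algebra_simps)
          qed
          show "(F has_derivative F' x) (at x within K \<inter> ball (y w0 s) \<eta>)" if "x \<in> K \<inter> ball (y w0 s) \<eta>" for x
            using that by (intro has_derivative_subset[OF F(1)]) auto
          show "onorm (blinfun_apply (F' x) - blinfun_apply (F' (y w0 s))) \<le> e1" if x: "x \<in> K \<inter> ball (y w0 s) \<eta>" for x
          proof -
            have "blinfun_apply (F' x) - blinfun_apply (F' (y w0 s)) = blinfun_apply (F' x - F' (y w0 s))"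
              by (auto simp: blinfun.diff_left)
            then show ?thesis
              using \<eta>(2)[of "y w0 s" x] x r(2)[OF w0 s]
              by (simp add: norm_blinfun.rep_eq[symmetric] dist_norm norm_minus_commute)
          qed
          show "y w0 s \<in> K \<inter> ball (y w0 s) \<eta>" using r(2)[OF w0 s] \<eta>(1) by simp
        qed
        also have "\<dots> \<le> (2 * L0 * norm (w - w')) * e1"
          using dep[OF wr(1,2) s] e1 by (intro mult_right_mono) auto
        finally have 1: "norm (F (y w s) - F (y w' s) - A s (y w s - y w' s)) \<le> e'"
          unfolding e'_def by (simp add: ac_simps)
        have "F (y w s) - F (y w' s) - A s (D s (w - w')) =
          A s (y w s - y w' s - D s (w - w')) + (F (y w s) - F (y w' s) - A s (y w s - y w' s))"
          by (simp add: blinfun.diff_right)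
        also have "norm \<dots> \<le> norm (A s (y w s - y w' s - D s (w - w'))) + e'"
          using 1 by (intro norm_triangle_le add_left_mono)
        also have "\<dots> \<le> L * norm (y w s - y w' s - D s (w - w')) + e'"
        proof -
          have "norm (A s (y w s - y w' s - D s (w - w'))) \<le> norm (A s) * norm (y w s - y w' s - D s (w - w'))"
            by (rule norm_blinfun)
          also have "\<dots> \<le> L * norm (y w s - y w' s - D s (w - w'))"
            by (intro mult_right_mono normA s) simp
          finally show ?thesis by simp
        qed
        finally show "norm (F (y w s) - F (y w' s) - A s (D s (w - w'))) \<le> L * norm (y w s - y w' s - D s (w - w')) + e'" .
      qed (use t in auto)
      also have "\<dots> \<le> 2 * (e / 4 * norm (w - w')) + 2 * (b - a) * e'"
        using r1(2)[of w w'] w D(1) unfolding d_def by auto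
      also have "2 * (b - a) * e' \<le> e / 2 * norm (w - w')"
      proof -
        have "2 * (b - a) * e' = (e / 2 * norm (w - w')) * ((b - a) / (b - a + 1))"
        proof -
          define c where "c = b - a + 1"
          have "c > 0" using ab(1) unfolding c_def by simp
          then show ?thesis
            unfolding e'_def e1_def c_def[symmetric] using L0(1) by (simp add: divide_simps)
        qed
        also have "\<dots> \<le> (e / 2 * norm (w - w')) * 1"
          using e ab(1) by (intro mult_left_mono) auto
        finally show ?thesis by simp
      qed
      finally show ?thesis by (simp add: field_simps)
    qed
    then show "\<exists>d>0. \<forall>w\<in>ball w0 d. \<forall>w'\<in>ball w0 d.
        norm (y w t - y w' t - D t (w - w')) \<le> e * norm (w - w')" using d by blast
  qed
  then show thesis using that[of D] D unfolding A_def by blast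
qed

section \<open>Riemannian metrics in coordinates\<close>

text \<open>Linearity in the second argument reduces joint strictness to the finitely many basis
  vectors \<open>i\<close>. That \<open>B'\<close> is itself linear in \<open>a\<close> follows from
  uniqueness of derivatives.\<close>

lemma strict_deriv_parametric_linear:
  fixes B :: "'p::real_normed_vector \<Rightarrow> 'e::euclidean_space \<Rightarrow> 'c::real_normed_vector"
  assumes "open U" "y \<in> U" and lin: "\<And>z. z \<in> U \<Longrightarrow> linear (B z)"
    and B: "\<And>i. strict_deriv (\<lambda>z. B z i) (B' i) y"
  shows "strict_deriv (\<lambda>q. B (fst q) (snd q)) (\<lambda>h. B' a (fst h) + B y (snd h)) (y, a)"
proof -
  have expand: "B z a = (\<Sum>i\<in>Basis. (a \<bullet> i) *\<^sub>R B z i)" if "z \<in> U" for z a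
  proof -
    have "B z a = B z (\<Sum>i\<in>Basis. (a \<bullet> i) *\<^sub>R i)" by (simp add: euclidean_representation)
    then show ?thesis by (simp only: linear_sum[OF lin[OF that]] linear_scale[OF lin[OF that]])
  qed
  let ?f = "\<lambda>q. \<Sum>i\<in>Basis. (snd q \<bullet> i) *\<^sub>R B (fst q) i"
  let ?f' = "\<lambda>h. \<Sum>i\<in>Basis. (a \<bullet> i) *\<^sub>R B' i (fst h) + (snd h \<bullet> i) *\<^sub>R B y i"
  have *: "strict_deriv ?f ?f' (y, a)"
    using strict_deriv_basis_expand[OF strict_deriv_of_bounded_linear[OF bounded_linear_snd],
        of "\<lambda>i q. B (fst q) i" "\<lambda>i h. B' i (fst h)" "(y, a)"]
      strict_deriv_compose[OF strict_deriv_of_bounded_linear[OF bounded_linear_fst], of "\<lambda>z. B z _" _ "(y, a)"] B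
    by simp
  have ev: "eventually (\<lambda>q. ?f q = B (fst q) (snd q)) (nhds (y, a))"
  proof -
    have "open (U \<times> (UNIV :: 'e set))" using assms(1) by (simp add: open_Times)
    then have "eventually (\<lambda>q. q \<in> U \<times> (UNIV :: 'e set)) (nhds (y, a))"
      using assms(2) by (intro eventually_nhds_in_open) auto
    then show ?thesis by eventually_elim (use expand in auto)
  qed
  have B'a: "(\<Sum>i\<in>Basis. (a \<bullet> i) *\<^sub>R B' i h) = B' a h" for h
  proof -
    have "((\<lambda>z. \<Sum>i\<in>Basis. (a \<bullet> i) *\<^sub>R B z i) has_derivative (\<lambda>h. \<Sum>i\<in>Basis. (a \<bullet> i) *\<^sub>R B' i h)) (at y)"
      by (intro has_derivative_sum has_derivative_scaleR_right strict_deriv_imp_has_derivative B)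
    then have "((\<lambda>z. B z a) has_derivative (\<lambda>h. \<Sum>i\<in>Basis. (a \<bullet> i) *\<^sub>R B' i h)) (at y)"
      by (rule has_derivative_transform_within_open[OF _ assms(1,2)]) (simp add: expand)
    then have "(\<lambda>h. \<Sum>i\<in>Basis. (a \<bullet> i) *\<^sub>R B' i h) = B' a"
      by (rule has_derivative_unique[OF _ strict_deriv_imp_has_derivative[OF B]])
    then show ?thesis by (rule fun_cong)
  qed
  have "?f' = (\<lambda>h. B' a (fst h) + B y (snd h))"
    by (auto simp: sum.distrib B'a expand[OF assms(2), symmetric])
  with strict_deriv_cong[OF * ev] show ?thesis by simp
qed

lemma strict_deriv_parametric_bilinear:
  fixes B :: "'p::real_normed_vector \<Rightarrow> 'e::euclidean_space \<Rightarrow> 'f::euclidean_space \<Rightarrow> 'c::real_normed_vector"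
  assumes "open U" "y \<in> U" and bil: "\<And>z. z \<in> U \<Longrightarrow> bilinear (B z)"
    and B: "\<And>i j. strict_deriv (\<lambda>z. B z i j) (B' i j) y"
  shows "strict_deriv (\<lambda>(z, a, b). B z a b) (\<lambda>(h, a', b'). B' a b h + B y a' b + B y a b') (y, a, b)"
proof -
  have lin: "linear (B z x)" "linear (\<lambda>x. B z x w)" if "z \<in> U" for z x w
    using bil[OF that] unfolding bilinear_def by auto
  have 1: "strict_deriv (\<lambda>q. B (fst q) (snd q) j) (\<lambda>h. B' a j (fst h) + B y (snd h) j) (y, a)" for j
    using strict_deriv_parametric_linear[OF assms(1,2), of "\<lambda>z i. B z i j" "\<lambda>i. B' i j" a] lin(2) B by simp
  have "strict_deriv (\<lambda>q. B (fst (fst q)) (snd (fst q)) (snd q))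
      (\<lambda>h. (B' a b (fst (fst h)) + B y (snd (fst h)) b) + B y a (snd h)) ((y, a), b)"
    using strict_deriv_parametric_linear[of "U \<times> UNIV" "(y, a)" "\<lambda>q. B (fst q) (snd q)"
        "\<lambda>j h. B' a j (fst h) + B y (snd h) j" b] 1 lin(1) assms(1,2)
    by (auto simp: open_Times)
  moreover have "strict_deriv (\<lambda>q. ((fst q, fst (snd q)), snd (snd q)))
      (\<lambda>q. ((fst q, fst (snd q)), snd (snd q))) (y, a, b)"
    by (intro strict_deriv_of_bounded_linear bounded_linear_Pair bounded_linear_fst bounded_linear_snd
        bounded_linear_compose[OF bounded_linear_fst bounded_linear_snd]
        bounded_linear_compose[OF bounded_linear_snd bounded_linear_snd])
  ultimately show ?thesis
    using strict_deriv_compose[of "\<lambda>q. ((fst q, fst (snd q)), snd (snd q))"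
        "\<lambda>q. ((fst q, fst (snd q)), snd (snd q))" "(y, a, b)"
        "\<lambda>q. B (fst (fst q)) (snd (fst q)) (snd q)"
        "\<lambda>h. (B' a b (fst (fst h)) + B y (snd (fst h)) b) + B y a (snd h)"]
    by (simp add: case_prod_unfold)
qed

text \<open>The formula of \<open>christoffel\<close> for an arbitrary family \<open>g\<close> of
  forms, so that the local theory can be developed on open sets of a Euclidean space, without
  charts.\<close>

definition chris :: "('e::euclidean_space \<Rightarrow> 'e \<Rightarrow> 'e \<Rightarrow> real) \<Rightarrow> 'e \<Rightarrow> 'e \<Rightarrow> 'e \<Rightarrow> 'e" where
  "chris g y u v =
     (let D = (\<lambda>a b w. frechet_derivative (\<lambda>z. g z a b) (at y) w) in
      THE z. \<forall>w. g y z w = (D v w u + D u w v - D u v w) / 2)"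

definition curv :: "('e::euclidean_space \<Rightarrow> 'e \<Rightarrow> 'e \<Rightarrow> real) \<Rightarrow> 'e \<Rightarrow> 'e \<Rightarrow> 'e \<Rightarrow> 'e \<Rightarrow> 'e" where
  "curv g y u v w =
     frechet_derivative (\<lambda>z. chris g z v w) (at y) u
     - frechet_derivative (\<lambda>z. chris g z u w) (at y) v
     + chris g y u (chris g y v w) - chris g y v (chris g y u w)"

section \<open>Metrics on an open subset of a Euclidean space: Christoffel symbols, geodesic spray,
  curvature\<close>

locale metric_patch =
  fixes U :: "'e::euclidean_space set" and g :: "'e \<Rightarrow> 'e \<Rightarrow> 'e \<Rightarrow> real"
  assumes open_U: "open U"
    and bil: "y \<in> U \<Longrightarrow> bilinear (g y)"
    and sym: "y \<in> U \<Longrightarrow> g y u v = g y v u"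
    and pos: "y \<in> U \<Longrightarrow> u \<noteq> 0 \<Longrightarrow> g y u u > 0"
    and smooth: "smooth_on U (\<lambda>y. g y u v)"
begin

definition dg :: "'e \<Rightarrow> 'e \<Rightarrow> 'e \<Rightarrow> 'e \<Rightarrow> real" where
  "dg y a b = frechet_derivative (\<lambda>z. g z a b) (at y)"

abbreviation \<Gamma> :: "'e \<Rightarrow> 'e \<Rightarrow> 'e \<Rightarrow> 'e" where "\<Gamma> \<equiv> chris g"

definition d\<Gamma> :: "'e \<Rightarrow> 'e \<Rightarrow> 'e \<Rightarrow> 'e \<Rightarrow> 'e" where
  "d\<Gamma> y a b = frechet_derivative (\<lambda>z. \<Gamma> z a b) (at y)"

definition koszul :: "'e \<Rightarrow> 'e \<Rightarrow> 'e \<Rightarrow> 'e \<Rightarrow> real" where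
  "koszul y u v w = (dg y v w u + dg y u w v - dg y u v w) / 2"

lemma linear_g: "y \<in> U \<Longrightarrow> linear (g y u)" "y \<in> U \<Longrightarrow> linear (\<lambda>u. g y u v)"
  using bil unfolding bilinear_def by auto

lemmas g_add = linear_add[OF linear_g(1)] linear_add[OF linear_g(2)]
lemmas g_diff = linear_diff[OF linear_g(1)] linear_diff[OF linear_g(2)]
lemmas g_scale = linear_scale[OF linear_g(1)] linear_scale[OF linear_g(2)]
lemmas g_zero = linear_0[OF linear_g(1)] linear_0[OF linear_g(2)]
lemmas g_neg = linear_neg[OF linear_g(1)] linear_neg[OF linear_g(2)]

lemma g_nonneg: "y \<in> U \<Longrightarrow> g y u u \<ge> 0"
  using pos[of y u] g_zero(1)[of y 0] by (cases "u = 0") auto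

lemma g_strict: "y \<in> U \<Longrightarrow> strict_deriv (\<lambda>z. g z a b) (dg y a b) y"
  unfolding dg_def by (rule smooth_on_strict_deriv[OF open_U smooth])

lemma g_joint_strict:
  "y \<in> U \<Longrightarrow> strict_deriv (\<lambda>(z, a, b). g z a b) (\<lambda>(h, a', b'). dg y a b h + g y a' b + g y a b') (y, a, b)"
  by (rule strict_deriv_parametric_bilinear[OF open_U _ bil g_strict])

lemma linear_dg: "y \<in> U \<Longrightarrow> linear (dg y a b)"
  using strict_deriv_bounded_linear[OF g_strict] bounded_linear.linear by blast

lemma dg_unique: "y \<in> U \<Longrightarrow> ((\<lambda>z. g z a b) has_derivative D) (at y) \<Longrightarrow> D = dg y a b"
  unfolding dg_def by (simp add: frechet_derivative_at')

lemma dg_sym: "y \<in> U \<Longrightarrow> dg y a b = dg y b a"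
  unfolding dg_def by (rule frechet_derivative_cong_open[OF open_U]) (simp_all add: sym)

lemma dg_left:
  assumes "y \<in> U"
  shows "linear (\<lambda>a. dg y a b h)"
proof (rule linearI)
  have D: "((\<lambda>z. g z a b) has_derivative dg y a b) (at y)" for a
    by (rule strict_deriv_imp_has_derivative[OF g_strict[OF assms]])
  fix a a' and r :: real
  have "((\<lambda>z. g z (a + a') b) has_derivative (\<lambda>h. dg y a b h + dg y a' b h)) (at y)"
    by (rule has_derivative_transform_within_open[OF has_derivative_add[OF D D] open_U assms]) (simp add: g_add)
  then show "dg y (a + a') b h = dg y a b h + dg y a' b h"
    using dg_unique[OF assms] by metis
  have "((\<lambda>z. g z (r *\<^sub>R a) b) has_derivative (\<lambda>h. r *\<^sub>R dg y a b h)) (at y)"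
    by (rule has_derivative_transform_within_open[OF has_derivative_scaleR_right[OF D] open_U assms]) (simp add: g_scale)
  then show "dg y (r *\<^sub>R a) b h = r *\<^sub>R dg y a b h"
    using dg_unique[OF assms] by metis
qed

lemma dg_right: "y \<in> U \<Longrightarrow> linear (\<lambda>b. dg y a b h)"
  using dg_left[of y a h] by (simp add: dg_sym)

lemma linear_koszul:
  assumes "y \<in> U"
  shows "linear (koszul y u v)" "linear (\<lambda>u. koszul y u v w)" "linear (\<lambda>v. koszul y u v w)"
  unfolding koszul_def
  by (intro linearI; simp add: linear_add[OF linear_dg[OF assms]] linear_scale[OF linear_dg[OF assms]]
      linear_add[OF dg_left[OF assms]] linear_scale[OF dg_left[OF assms]]
      linear_add[OF dg_right[OF assms]] linear_scale[OF dg_right[OF assms]] field_simps)+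

lemma nondegenerate:
  assumes "y \<in> U" "\<And>w. g y z w = g y z' w"
  shows "z = z'"
proof (rule ccontr)
  assume "z \<noteq> z'"
  then have "g y (z - z') (z - z') > 0" using pos[OF assms(1), of "z - z'"] by simp
  then show False using assms(2)[of "z - z'"] by (simp add: g_diff(2)[OF assms(1)])
qed

text \<open>Lowering of the index: the Euclidean representative of the functional
  \<open>g y z\<close>. Its inverse turns the Koszul functional into
  \<open>\<Gamma>\<close>.\<close>

definition lower :: "'e \<Rightarrow> 'e \<Rightarrow> 'e" where
  "lower y z = (\<Sum>b\<in>Basis. g y z b *\<^sub>R b)"

lemma linear_lower: "y \<in> U \<Longrightarrow> linear (lower y)"
  unfolding lower_def
  by (intro linear_compose_sum ballI linear_compose[of "\<lambda>z. g y z _" "\<lambda>r. r *\<^sub>R _", unfolded o_def]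
      linear_g bounded_linear.linear[OF bounded_linear_scaleR_left])

lemma lower_inner':
  assumes "y \<in> U" shows "lower y z \<bullet> w = g y z w"
proof -
  have "g y z w = g y z (\<Sum>b\<in>Basis. (w \<bullet> b) *\<^sub>R b)" by (simp add: euclidean_representation)
  also have "\<dots> = (\<Sum>b\<in>Basis. (w \<bullet> b) * g y z b)"
    by (simp add: linear_sum[OF linear_g(1)[OF assms]] g_scale(1)[OF assms])
  also have "\<dots> = lower y z \<bullet> w"
    unfolding lower_def by (simp add: inner_sum_left inner_commute[of w] mult.commute)
  finally show ?thesis by simp
qed

lemma ex_lower_eq:
  assumes "y \<in> U" obtains z where "lower y z = r"
proof -
  have "inj (lower y)"
  proof (subst linear_injective_0[OF linear_lower[OF assms]], intro allI impI)
    fix z assume "lower y z = 0"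
    then show "z = 0" using lower_inner'[OF assms, of z z] pos[OF assms, of z] by fastforce
  qed
  then have "surj (lower y)" using linear_injective_imp_surjective[OF linear_lower[OF assms]] by simp
  then show thesis using that by (metis surjD)
qed

text \<open>Positive definiteness makes \<open>lower y\<close> bijective, so exactly one vector
  represents the Koszul functional and the description by \<open>THE\<close> is well
  defined.\<close>

lemma \<Gamma>_eq:
  assumes "y \<in> U" shows "g y (\<Gamma> y u v) w = koszul y u v w"
proof -
  obtain z where z: "lower y z = (\<Sum>b\<in>Basis. koszul y u v b *\<^sub>R b)" using ex_lower_eq[OF assms] by blast
  have z: "g y z w = koszul y u v w" for w
  proof -
    have "g y z w = (\<Sum>b\<in>Basis. koszul y u v b *\<^sub>R b) \<bullet> w" using lower_inner'[OF assms, of z w] z by simp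
    also have "\<dots> = (\<Sum>b\<in>Basis. (w \<bullet> b) *\<^sub>R koszul y u v b)"
      by (simp add: inner_sum_left inner_commute[of w] mult.commute)
    also have "\<dots> = koszul y u v (\<Sum>b\<in>Basis. (w \<bullet> b) *\<^sub>R b)"
      by (simp only: linear_sum[OF linear_koszul(1)[OF assms]] linear_scale[OF linear_koszul(1)[OF assms]])
    finally show ?thesis by (simp add: euclidean_representation)
  qed
  have "\<Gamma> y u v = (THE z. \<forall>w. g y z w = koszul y u v w)"
    unfolding chris_def koszul_def dg_def Let_def ..
  also have "\<dots> = z"
  proof (rule the_equality)
    show "\<forall>w. g y z w = koszul y u v w" using z by blast
    show "z' = z" if "\<forall>w. g y z' w = koszul y u v w" for z'
      by (rule nondegenerate[OF assms]) (use that z in simp)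
  qed
  finally show ?thesis using z by simp
qed

lemma \<Gamma>_unique: "y \<in> U \<Longrightarrow> (\<And>w. g y z w = koszul y u v w) \<Longrightarrow> \<Gamma> y u v = z"
  using \<Gamma>_eq nondegenerate by metis

lemma \<Gamma>_sym: "y \<in> U \<Longrightarrow> \<Gamma> y u v = \<Gamma> y v u"
  by (rule \<Gamma>_unique) (auto simp: \<Gamma>_eq koszul_def dg_sym[of y u v])

lemma linear_\<Gamma>:
  assumes "y \<in> U"
  shows "linear (\<Gamma> y u)"
  by (rule linearI; rule \<Gamma>_unique[OF assms])
    (simp_all add: \<Gamma>_eq assms g_add g_scale linear_add[OF linear_koszul(3)] linear_scale[OF linear_koszul(3)])

lemma linear_\<Gamma>': "y \<in> U \<Longrightarrow> linear (\<lambda>u. \<Gamma> y u v)"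
  using linear_\<Gamma>[of y v] by (simp add: \<Gamma>_sym[of y _ v])

lemma bilinear_\<Gamma>: "y \<in> U \<Longrightarrow> bilinear (\<Gamma> y)"
  unfolding bilinear_def using linear_\<Gamma> linear_\<Gamma>' by blast

text \<open>Sum of the Koszul formulas for \<open>\<Gamma> y w a\<close> and
  \<open>\<Gamma> y w b\<close>, in which everything cancels but one derivative of the
  metric.\<close>

lemma metric_compatible:
  assumes "y \<in> U"
  shows "dg y a b w = g y (\<Gamma> y w a) b + g y a (\<Gamma> y w b)"
  using \<Gamma>_eq[OF assms, of w a b] \<Gamma>_eq[OF assms, of w b a] sym[OF assms, of a]
  unfolding koszul_def by (simp add: dg_sym[OF assms, of b a] dg_sym[OF assms, of w] field_simps)

text \<open>Extreme values on the compact product of \<open>K\<close> with the unit sphere, scaled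
  by homogeneity.\<close>

lemma norm_equivalence:
  assumes "compact K" "K \<subseteq> U"
  obtains m M where "m > 0" "M > 0" "\<And>y z. y \<in> K \<Longrightarrow> m * (norm z)\<^sup>2 \<le> g y z z"
    "\<And>y z. y \<in> K \<Longrightarrow> g y z z \<le> M * (norm z)\<^sup>2"
proof (cases "K = {}")
  case True
  then show thesis using that[of 1 1] by auto
next
  case False
  define S where "S = K \<times> sphere (0::'e) 1"
  have "compact S" unfolding S_def using assms(1) by (intro compact_Times) auto
  have "S \<noteq> {}" unfolding S_def using False by simp
  have cont: "continuous_on S (\<lambda>p. g (fst p) (snd p) (snd p))"
  proof (rule continuous_at_imp_continuous_on, rule ballI)
    fix p assume "p \<in> S"
    then have "fst p \<in> U" unfolding S_def using assms(2) by auto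
    have "isCont (\<lambda>q. (fst q, snd q, snd q)) p" by (intro continuous_intros)
    then have "isCont (\<lambda>q. (\<lambda>(z, a, b). g z a b) (fst q, snd q, snd q)) p"
      by (rule isCont_o2) (rule strict_deriv_isCont[OF g_joint_strict[OF \<open>fst p \<in> U\<close>]])
    then show "isCont (\<lambda>p. g (fst p) (snd p) (snd p)) p" by simp
  qed
  obtain p where p: "p \<in> S" "\<And>q. q \<in> S \<Longrightarrow> g (fst p) (snd p) (snd p) \<le> g (fst q) (snd q) (snd q)"
    using continuous_attains_inf[OF \<open>compact S\<close> \<open>S \<noteq> {}\<close> cont] by blast
  obtain p' where p': "p' \<in> S" "\<And>q. q \<in> S \<Longrightarrow> g (fst q) (snd q) (snd q) \<le> g (fst p') (snd p') (snd p')"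
    using continuous_attains_sup[OF \<open>compact S\<close> \<open>S \<noteq> {}\<close> cont] by blast
  let ?m = "g (fst p) (snd p) (snd p)" and ?M = "g (fst p') (snd p') (snd p')"
  have m: "?m > 0" "?M > 0" using p(1) p'(1) assms(2) unfolding S_def by (intro pos; force)+
  have scale: "g y z z = (norm z)\<^sup>2 * g y (z /\<^sub>R norm z) (z /\<^sub>R norm z)" if "y \<in> K" "z \<noteq> 0" for y z
  proof -
    have "y \<in> U" using that assms(2) by blast
    have "(norm z)\<^sup>2 * (inverse (norm z) * (inverse (norm z) * c)) = c" for c
      using that by (simp add: power2_eq_square field_simps)
    then show ?thesis unfolding g_scale[OF \<open>y \<in> U\<close>] by simp
  qed
  have "?m * (norm z)\<^sup>2 \<le> g y z z \<and> g y z z \<le> ?M * (norm z)\<^sup>2" if y: "y \<in> K" for y z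
  proof (cases "z = 0")
    case True
    then show ?thesis using y assms(2) g_zero(1)[of y 0] by auto
  next
    case False
    have "(y, z /\<^sub>R norm z) \<in> S" unfolding S_def using y False by simp
    from p(2)[OF this] p'(2)[OF this] show ?thesis
      unfolding scale[OF y False] by (simp add: mult.commute[of _ "(norm z)\<^sup>2"] mult_left_mono)
  qed
  then show thesis using that[of ?m ?M] m by blast
qed

lemma lower_strict:
  assumes "y \<in> U"
  shows "strict_deriv (\<lambda>q. lower (fst q) (snd q)) (\<lambda>h. (\<Sum>b\<in>Basis. dg y z b (fst h) *\<^sub>R b) + lower y (snd h)) (y, z)"
proof (rule strict_deriv_parametric_linear[OF open_U assms linear_lower, where B' = "\<lambda>z h. \<Sum>b\<in>Basis. dg y z b h *\<^sub>R b"])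
  show "strict_deriv (\<lambda>z. lower z i) (\<lambda>h. \<Sum>b\<in>Basis. dg y i b h *\<^sub>R b) y" for i
    unfolding lower_def
    by (intro strict_deriv_sum finite_Basis
        strict_deriv_linear_compose[OF bounded_linear_scaleR_left g_strict[OF assms]])
qed

text \<open>\<open>\<Gamma>\<close> is obtained by inverting \<open>(y, z) \<mapsto> (y, g\<^sub>y(z, \<cdot>))\<close>, which is strictly differentiable.\<close>

lemma \<Gamma>_strict:
  assumes "y \<in> U"
  shows "strict_deriv (\<lambda>z. \<Gamma> z u v) (d\<Gamma> y u v) y"
proof -
  define z0 where "z0 = \<Gamma> y u v"
  define f where "f q = (fst q, lower (fst q) (snd q))" for q
  define f' where "f' h = (fst h, (\<Sum>b\<in>Basis. dg y z0 b (fst h) *\<^sub>R b) + lower y (snd h))" for h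
  define \<kappa> where "\<kappa> y = (\<Sum>b\<in>Basis. koszul y u v b *\<^sub>R b)" for y
  define inv where "inv y r = (SOME z. lower y z = r)" for y r
  define k where "k q = (fst q, inv (fst q) (snd q))" for q
  have inv: "lower y (inv y r) = r" if "y \<in> U" for y r
    using ex_lower_eq[OF that, of r] unfolding inv_def by (metis (mono_tags) someI)
  have lower_inj: "z = z'" if "y \<in> U" "lower y z = lower y z'" for y z z'
    using nondegenerate[OF that(1)] lower_inner'[OF that(1)] that(2) by metis
  have low\<Gamma>: "lower y (\<Gamma> y u v) = \<kappa> y" if "y \<in> U" for y
    unfolding lower_def \<kappa>_def \<Gamma>_eq[OF that] ..
  have inv\<Gamma>: "inv y (\<kappa> y) = \<Gamma> y u v" if "y \<in> U" for y
    using lower_inj[OF that] inv[OF that] low\<Gamma>[OF that] by metis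
  have f: "strict_deriv f f' (y, z0)"
    unfolding f_def f'_def
    by (intro strict_deriv_Pair strict_deriv_of_bounded_linear bounded_linear_fst lower_strict assms)
  have lin: "linear f'" using strict_deriv_bounded_linear[OF f] bounded_linear.linear by blast
  have "inj f'"
  proof (subst linear_injective_0[OF lin], intro allI impI)
    fix h assume "f' h = 0"
    then have "fst h = 0" "lower y (snd h) = 0"
      unfolding f'_def by (auto simp: prod_eq_iff linear_0[OF linear_dg[OF assms]])
    then show "h = 0"
      using lower_inj[OF assms, of "snd h" 0] linear_0[OF linear_lower[OF assms]] by (simp add: prod_eq_iff)
  qed
  then obtain E where E: "linear E" "\<And>x. E (f' x) = x" "\<And>x. f' (E x) = x"
    using linear_injective_isomorphism[OF lin] by blast
  obtain d where d: "d > 0" "cball y d \<subseteq> U" using open_U assms open_contains_cball by blast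
  obtain m where m: "m > 0" "\<And>x z. x \<in> cball y d \<Longrightarrow> m * (norm z)\<^sup>2 \<le> g x z z"
    using norm_equivalence[OF compact_cball d(2)] by metis
  \<comment> \<open>A uniform lower bound for \<open>lower x\<close> near \<open>y\<close>; it
    bounds \<open>inv x r - z0\<close> by \<open>norm (r - lower x z0) / m\<close> and thereby gives
    continuity of \<open>k\<close> at the point in question.\<close>
  have lower_bound: "m * norm z \<le> norm (lower x z)" if "x \<in> cball y d" for x z
  proof (cases "z = 0")
    case False
    have "m * (norm z)\<^sup>2 \<le> lower x z \<bullet> z" using m(2)[OF that] lower_inner' that d(2) by auto
    also have "\<dots> \<le> norm (lower x z) * norm z" by (rule norm_cauchy_schwarz)
    finally show ?thesis using False by (simp add: power2_eq_square)
  qed simp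
  have k0: "k (y, \<kappa> y) = (y, z0)" unfolding k_def z0_def using inv\<Gamma>[OF assms] by simp
  have contk: "isCont k (y, \<kappa> y)"
  proof -
    have c: "isCont (\<lambda>q. snd q - lower (fst q) z0) (y, \<kappa> y)"
    proof -
      have "isCont (\<lambda>x. lower x z0) y"
        using isCont_o2[of y "\<lambda>x. (x, z0)" "\<lambda>q. lower (fst q) (snd q)"]
          strict_deriv_isCont[OF lower_strict[OF assms, of z0]] by (simp add: isCont_Pair)
      then have "isCont (\<lambda>q. lower (fst q) z0) (y, \<kappa> y)"
        using isCont_o2[of "(y, \<kappa> y)" fst "\<lambda>x. lower x z0"] by (simp add: isCont_fst)
      then show ?thesis by (intro continuous_intros)
    qed
    have "((\<lambda>q. norm (snd q - lower (fst q) z0) / m) \<longlongrightarrow> 0) (at (y, \<kappa> y))"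
    proof -
      have "((\<lambda>q. snd q - lower (fst q) z0) \<longlongrightarrow> 0) (at (y, \<kappa> y))"
        using c low\<Gamma>[OF assms] unfolding isCont_def z0_def by simp
      then show ?thesis using tendsto_divide[OF tendsto_norm tendsto_const[of m]] m(1) by fastforce
    qed
    moreover have "eventually (\<lambda>q. norm (inv (fst q) (snd q) - z0) \<le> norm (snd q - lower (fst q) z0) / m) (at (y, \<kappa> y))"
    proof -
      have "open (ball y d \<times> (UNIV :: 'e set))" by (simp add: open_Times)
      then have "eventually (\<lambda>q. q \<in> ball y d \<times> (UNIV :: 'e set)) (at (y, \<kappa> y))"
        using d(1) by (intro eventually_at_in_open') auto
      then show ?thesis
      proof eventually_elim
        case (elim q)
        then have q: "fst q \<in> cball y d" "fst q \<in> U" using d(2) by auto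
        have "m * norm (inv (fst q) (snd q) - z0) \<le> norm (lower (fst q) (inv (fst q) (snd q) - z0))"
          by (rule lower_bound[OF q(1)])
        also have "lower (fst q) (inv (fst q) (snd q) - z0) = snd q - lower (fst q) z0"
          by (simp add: linear_diff[OF linear_lower[OF q(2)]] inv[OF q(2)])
        finally show ?case using m(1) by (simp add: field_simps)
      qed
    qed
    ultimately have "((\<lambda>q. inv (fst q) (snd q) - z0) \<longlongrightarrow> 0) (at (y, \<kappa> y))"
      by (rule Lim_null_comparison[rotated])
    then have "((\<lambda>q. inv (fst q) (snd q)) \<longlongrightarrow> z0) (at (y, \<kappa> y))" by (simp add: LIM_zero_iff)
    then have "isCont (\<lambda>q. inv (fst q) (snd q)) (y, \<kappa> y)"
      unfolding isCont_def using inv\<Gamma>[OF assms] z0_def by simp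
    then show ?thesis unfolding k_def by (intro continuous_Pair continuous_intros)
  qed
  have fk: "eventually (\<lambda>q. f (k q) = q) (nhds (y, \<kappa> y))"
  proof -
    have "open (U \<times> (UNIV :: 'e set))" using open_U by (simp add: open_Times)
    then have "eventually (\<lambda>q. q \<in> U \<times> (UNIV :: 'e set)) (nhds (y, \<kappa> y))"
      using assms by (intro eventually_nhds_in_open) auto
    then show ?thesis by eventually_elim (auto simp: f_def k_def inv)
  qed
  have k: "strict_deriv k E (y, \<kappa> y)"
    by (rule strict_deriv_inverse[OF _ _ E(2,3) contk fk])
      (use f k0 E(1) in \<open>auto simp: linear_conv_bounded_linear\<close>)
  have "\<exists>D. strict_deriv (\<lambda>y. koszul y u v b) D y" for b
  proof -
    have s: "smooth_on U (\<lambda>y. koszul y u v b)"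
      unfolding koszul_def dg_def diff_conv_add_uminus
      by (intro smooth_on_compose[OF open_U _ open_UNIV smooth_on_bounded_linear[OF bounded_linear_divide]]
          smooth_on_add[OF open_U] smooth_on_frechet_derivative smooth
          smooth_on_compose[OF open_U _ open_UNIV smooth_on_bounded_linear[OF bounded_linear_minus[OF bounded_linear_ident]]]) auto
    show ?thesis using smooth_on_strict_deriv[OF open_U s assms] by blast
  qed
  then obtain kd where kd: "\<And>b. strict_deriv (\<lambda>y. koszul y u v b) (kd b) y" by metis
  have \<kappa>: "strict_deriv \<kappa> (\<lambda>h. \<Sum>b\<in>Basis. kd b h *\<^sub>R b) y"
    unfolding \<kappa>_def
    by (intro strict_deriv_sum finite_Basis strict_deriv_linear_compose[OF bounded_linear_scaleR_left kd])
  have "strict_deriv (\<lambda>x. snd (k (x, \<kappa> x))) (\<lambda>h. snd (E (h, \<Sum>b\<in>Basis. kd b h *\<^sub>R b))) y"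
    by (intro strict_deriv_snd strict_deriv_compose[OF strict_deriv_Pair[OF _ \<kappa>], of "\<lambda>x. x" "\<lambda>x. x", OF _ k]
        strict_deriv_of_bounded_linear bounded_linear_ident)
  moreover have "eventually (\<lambda>x. snd (k (x, \<kappa> x)) = \<Gamma> x u v) (nhds y)"
    using eventually_nhds_in_open[OF open_U assms] by eventually_elim (simp add: k_def inv\<Gamma>)
  ultimately have *: "strict_deriv (\<lambda>x. \<Gamma> x u v) (\<lambda>h. snd (E (h, \<Sum>b\<in>Basis. kd b h *\<^sub>R b))) y"
    by (rule strict_deriv_cong)
  have "(\<lambda>h. snd (E (h, \<Sum>b\<in>Basis. kd b h *\<^sub>R b))) = d\<Gamma> y u v"
    unfolding d\<Gamma>_def by (rule frechet_derivative_at'[OF strict_deriv_imp_has_derivative[OF *], symmetric])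
  with * show ?thesis by simp
qed

lemma \<Gamma>_joint_strict:
  "y \<in> U \<Longrightarrow> strict_deriv (\<lambda>(z, a, b). \<Gamma> z a b) (\<lambda>(h, a', b'). d\<Gamma> y a b h + \<Gamma> y a' b + \<Gamma> y a b') (y, a, b)"
  by (rule strict_deriv_parametric_bilinear[OF open_U _ bilinear_\<Gamma> \<Gamma>_strict])

definition spray :: "'e \<times> 'e \<Rightarrow> 'e \<times> 'e" where
  "spray = (\<lambda>(q, v). (v, - \<Gamma> q v v))"

text \<open>The linearised spray; its second component is the Jacobi equation in coordinates. The
  derivatives in the two vector slots are merged into \<open>2 *\<^sub>R \<Gamma> q v z'\<close> by
  symmetry of \<open>\<Gamma>\<close>.\<close>

definition dspray :: "'e \<times> 'e \<Rightarrow> 'e \<times> 'e \<Rightarrow> 'e \<times> 'e" where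
  "dspray = (\<lambda>(q, v) (z, z'). (z', - (d\<Gamma> q v v z + 2 *\<^sub>R \<Gamma> q v z')))"

lemma spray_strict:
  assumes "fst s \<in> U" shows "strict_deriv spray (dspray s) s"
proof -
  obtain q v where s: "s = (q, v)" by (cases s)
  have q: "q \<in> U" using assms s by simp
  have l: "strict_deriv (\<lambda>p. (fst p, snd p, snd p)) (\<lambda>p. (fst p, snd p, snd p)) (q, v)"
    by (intro strict_deriv_of_bounded_linear bounded_linear_Pair bounded_linear_fst bounded_linear_snd)
  have "strict_deriv (\<lambda>p. (snd p, - (case (fst p, snd p, snd p) of (z, a, b) \<Rightarrow> \<Gamma> z a b)))
     (\<lambda>h. (snd h, - (case (fst h, snd h, snd h) of (h, a', b') \<Rightarrow> d\<Gamma> q v v h + \<Gamma> q a' v + \<Gamma> q v b'))) (q, v)"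
    by (intro strict_deriv_Pair strict_deriv_minus strict_deriv_compose[OF l]
        strict_deriv_of_bounded_linear bounded_linear_snd)
      (use \<Gamma>_joint_strict[OF q, of v v] in simp)
  then show ?thesis
    unfolding s spray_def dspray_def case_prod_unfold
    by (simp add: \<Gamma>_sym[OF q, of _ v] scaleR_2 algebra_simps)
qed

text \<open>By \<open>metric_compatible\<close> the derivative of the metric along \<open>q\<close>
  supplies exactly the terms that complete \<open>a'\<close> and \<open>b'\<close> to covariant
  derivatives.\<close>

lemma g_curve_derivative:
  assumes "q t \<in> U" "(q has_vector_derivative q') (at t within I)"
    "(a has_vector_derivative a') (at t within I)" "(b has_vector_derivative b') (at t within I)"
  shows "((\<lambda>t. g (q t) (a t) (b t)) has_real_derivative
    g (q t) (a' + \<Gamma> (q t) q' (a t)) (b t) + g (q t) (a t) (b' + \<Gamma> (q t) q' (b t))) (at t within I)"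
proof -
  have "((\<lambda>t. (q t, a t, b t)) has_derivative (\<lambda>h. (h *\<^sub>R q', h *\<^sub>R a', h *\<^sub>R b'))) (at t within I)"
    using assms(2-4) unfolding has_vector_derivative_def by (intro has_derivative_Pair)
  from has_derivative_compose[OF this strict_deriv_imp_has_derivative[OF g_joint_strict[OF assms(1)]]]
  have "((\<lambda>t. g (q t) (a t) (b t)) has_derivative (\<lambda>h. dg (q t) (a t) (b t) (h *\<^sub>R q')
      + g (q t) (h *\<^sub>R a') (b t) + g (q t) (a t) (h *\<^sub>R b'))) (at t within I)" by simp
  then show ?thesis
    unfolding has_field_derivative_def
    by (rule has_derivative_eq_rhs)
      (simp add: fun_eq_iff linear_scale[OF linear_dg[OF assms(1)]] g_scale[OF assms(1)] g_add[OF assms(1)]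
        linear_scale[OF linear_\<Gamma>'[OF assms(1)]] metric_compatible[OF assms(1)] algebra_simps)
qed

lemma \<Gamma>_curve_derivative:
  assumes "q t \<in> U" "(q has_vector_derivative q') (at t within I)"
    "(a has_vector_derivative a') (at t within I)" "(b has_vector_derivative b') (at t within I)"
  shows "((\<lambda>t. \<Gamma> (q t) (a t) (b t)) has_vector_derivative
    d\<Gamma> (q t) (a t) (b t) q' + \<Gamma> (q t) a' (b t) + \<Gamma> (q t) (a t) b') (at t within I)"
proof -
  have "((\<lambda>t. (q t, a t, b t)) has_derivative (\<lambda>h. (h *\<^sub>R q', h *\<^sub>R a', h *\<^sub>R b'))) (at t within I)"
    using assms(2-4) unfolding has_vector_derivative_def by (intro has_derivative_Pair)
  from has_derivative_compose[OF this strict_deriv_imp_has_derivative[OF \<Gamma>_joint_strict[OF assms(1)]]]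
  have "((\<lambda>t. \<Gamma> (q t) (a t) (b t)) has_derivative (\<lambda>h. d\<Gamma> (q t) (a t) (b t) (h *\<^sub>R q')
      + \<Gamma> (q t) (h *\<^sub>R a') (b t) + \<Gamma> (q t) (a t) (h *\<^sub>R b'))) (at t within I)" by simp
  moreover have "linear (d\<Gamma> (q t) (a t) (b t))"
    using strict_deriv_bounded_linear[OF \<Gamma>_strict[OF assms(1)]] bounded_linear.linear by blast
  ultimately show ?thesis
    unfolding has_vector_derivative_def
    by (simp add: linear_scale linear_scale[OF linear_\<Gamma>[OF assms(1)]] linear_scale[OF linear_\<Gamma>'[OF assms(1)]]
        scaleR_add_right)
qed

text \<open>\<open>R(v, z) v = - R(z, v) v\<close>, and \<open>g(R(z, v) v, z)\<close> is the
  sectional curvature times the squared area of the parallelogram spanned by \<open>z\<close> and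
  \<open>v\<close>. Dependent pairs are treated separately: there the curvature term
  vanishes.\<close>

lemma curvature_term_nonneg:
  assumes y: "y \<in> U"
    and K: "\<And>u v. u \<noteq> v \<Longrightarrow> independent {u, v} \<Longrightarrow>
      g y (curv g y u v v) u / (g y u u * g y v v - (g y u v)\<^sup>2) \<le> 0"
  shows "g y z (curv g y v z v) \<ge> 0"
proof -
  have lind: "linear (\<lambda>a. d\<Gamma> y a b h)" for b h
  proof (rule linearI)
    have D: "((\<lambda>z. \<Gamma> z a b) has_derivative d\<Gamma> y a b) (at y)" for a
      by (rule strict_deriv_imp_has_derivative[OF \<Gamma>_strict[OF y]])
    fix a a' and r :: real
    have "((\<lambda>z. \<Gamma> z (a + a') b) has_derivative (\<lambda>h. d\<Gamma> y a b h + d\<Gamma> y a' b h)) (at y)"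
      by (rule has_derivative_transform_within_open[OF has_derivative_add[OF D D] open_U y])
        (simp add: linear_add[OF linear_\<Gamma>'])
    then show "d\<Gamma> y (a + a') b h = d\<Gamma> y a b h + d\<Gamma> y a' b h"
      using has_derivative_unique[OF D] by metis
    have "((\<lambda>z. \<Gamma> z (r *\<^sub>R a) b) has_derivative (\<lambda>h. r *\<^sub>R d\<Gamma> y a b h)) (at y)"
      by (rule has_derivative_transform_within_open[OF has_derivative_scaleR_right[OF D] open_U y])
        (simp add: linear_scale[OF linear_\<Gamma>'])
    then show "d\<Gamma> y (r *\<^sub>R a) b h = r *\<^sub>R d\<Gamma> y a b h"
      using has_derivative_unique[OF D] by metis
  qed
  have lin2: "linear (d\<Gamma> y a b)" for a b
    using strict_deriv_bounded_linear[OF \<Gamma>_strict[OF y]] bounded_linear.linear by blast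
  have curv: "curv g y a b c = d\<Gamma> y b c a - d\<Gamma> y a c b + \<Gamma> y a (\<Gamma> y b c) - \<Gamma> y b (\<Gamma> y a c)" for a b c
    unfolding curv_def d\<Gamma>_def ..
  have anti: "curv g y v z v = - curv g y z v v" unfolding curv by simp
  show ?thesis
  proof (cases "z \<noteq> v \<and> independent {z, v}")
    case True
    then have zv: "z \<noteq> v" "independent {z, v}" by auto
    have v0: "v \<noteq> 0" using zv(2) dependent_zero[of "{z, v}"] by auto
    \<comment> \<open>\<open>z - c *\<^sub>R v\<close> is orthogonal to \<open>v\<close>; its
      positive length is the strict Cauchy-Schwarz inequality, so the denominator of the curvature
      is positive.\<close>
    define c where "c = g y z v / g y v v"
    have gvv: "g y v v > 0" using pos[OF y v0] .
    have "z - c *\<^sub>R v \<noteq> 0"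
    proof
      assume "z - c *\<^sub>R v = 0"
      then have "z = c *\<^sub>R v" by simp
      then have "z \<in> span {v}" by (simp add: span_scale span_base)
      then show False using zv dependent_def[of "{z, v}"] by (auto simp: insert_Diff_if)
    qed
    from pos[OF y this] have "0 < g y z z - c * g y z v - c * g y v z + c * c * g y v v"
      by (simp add: g_diff[OF y] g_scale[OF y] algebra_simps)
    then have "0 < g y z z - c * g y z v"
      using sym[OF y, of v z] gvv unfolding c_def by simp
    then have "0 < (g y z z - c * g y z v) * g y v v" using gvv by simp
    then have area: "g y z z * g y v v - (g y z v)\<^sup>2 > 0"
      using gvv unfolding c_def by (simp add: field_simps power2_eq_square)
    have "g y (curv g y z v v) z \<le> 0" using K[OF zv] area by (simp add: divide_le_0_iff)
    then show ?thesis unfolding anti using sym[OF y, of z] by (simp add: g_neg[OF y])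
  next
    case False
    then obtain c where c: "z = c *\<^sub>R v \<or> v = c *\<^sub>R z"
    proof (cases "z = v")
      case True then show ?thesis using that[of 1] by simp
    next
      case ne: False
      with False have "dependent {z, v}" by simp
      then have "z \<in> span {v} \<or> v \<in> span {z}"
        using ne unfolding dependent_def by (auto simp: insert_Diff_if)
      then show ?thesis using that by (auto simp: span_singleton)
    qed
    have "curv g y z v v = 0"
    proof (cases "z = c *\<^sub>R v")
      case True
      show ?thesis unfolding True curv
        by (simp add: linear_scale[OF lind] linear_scale[OF lin2] linear_scale[OF linear_\<Gamma>[OF y]] linear_scale[OF linear_\<Gamma>'[OF y]])
    next
      case False
      then have v: "v = c *\<^sub>R z" using c by simp
      have "curv g y z (c *\<^sub>R z) w = 0" for w
        unfolding curv
        by (simp add: linear_scale[OF lind] linear_scale[OF lin2] linear_scale[OF linear_\<Gamma>[OF y]] linear_scale[OF linear_\<Gamma>'[OF y]])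
      then show ?thesis using v by simp
    qed
    then show ?thesis unfolding anti using g_zero(1)[OF y] by simp
  qed
qed

text \<open>Jacobi fields: \<open>z\<close> solves the linearised geodesic equation along \<open>q\<close>; \<open>z' + \<Gamma>(v, z)\<close> is its
  covariant derivative, and its second covariant derivative is \<open>R(v, z) v\<close>.\<close>

lemma Jacobi_derivatives:
  assumes I: "\<And>t. t \<in> I \<Longrightarrow> q t \<in> U"
    and q: "\<And>t. t \<in> I \<Longrightarrow> (q has_vector_derivative v t) (at t within I)"
    and v: "\<And>t. t \<in> I \<Longrightarrow> (v has_vector_derivative - \<Gamma> (q t) (v t) (v t)) (at t within I)"
    and z: "\<And>t. t \<in> I \<Longrightarrow> (z has_vector_derivative z' t) (at t within I)"
    and z': "\<And>t. t \<in> I \<Longrightarrow> (z' has_vector_derivative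
        - (d\<Gamma> (q t) (v t) (v t) (z t) + 2 *\<^sub>R \<Gamma> (q t) (v t) (z' t))) (at t within I)"
    and t: "t \<in> I"
  defines "Dz \<equiv> \<lambda>t. z' t + \<Gamma> (q t) (v t) (z t)"
  shows "((\<lambda>t. g (q t) (z t) (z t)) has_real_derivative 2 * g (q t) (z t) (Dz t)) (at t within I)"
    and "((\<lambda>t. 2 * g (q t) (z t) (Dz t)) has_real_derivative
      2 * g (q t) (Dz t) (Dz t) + 2 * g (q t) (z t) (curv g (q t) (v t) (z t) (v t))) (at t within I)"
proof -
  note y = I[OF t]
  show "((\<lambda>t. g (q t) (z t) (z t)) has_real_derivative 2 * g (q t) (z t) (Dz t)) (at t within I)"
    using g_curve_derivative[OF y q[OF t] z[OF t] z[OF t]] sym[OF y, of "z t"] unfolding Dz_def by simp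
  have dDz: "(Dz has_vector_derivative (- (d\<Gamma> (q t) (v t) (v t) (z t) + 2 *\<^sub>R \<Gamma> (q t) (v t) (z' t)))
      + (d\<Gamma> (q t) (v t) (z t) (v t) + \<Gamma> (q t) (- \<Gamma> (q t) (v t) (v t)) (z t) + \<Gamma> (q t) (v t) (z' t))) (at t within I)"
    unfolding Dz_def
    by (intro has_vector_derivative_add z' t \<Gamma>_curve_derivative y q v z)
  have d\<Gamma>_sym: "d\<Gamma> (q t) a b = d\<Gamma> (q t) b a" for a b
    unfolding d\<Gamma>_def by (rule frechet_derivative_cong_open[OF open_U y]) (simp add: \<Gamma>_sym)
  have eq: "(- (d\<Gamma> (q t) (v t) (v t) (z t) + 2 *\<^sub>R \<Gamma> (q t) (v t) (z' t)))
      + (d\<Gamma> (q t) (v t) (z t) (v t) + \<Gamma> (q t) (- \<Gamma> (q t) (v t) (v t)) (z t) + \<Gamma> (q t) (v t) (z' t))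
      + \<Gamma> (q t) (v t) (Dz t) = curv g (q t) (v t) (z t) (v t)"
    unfolding curv_def d\<Gamma>_def[symmetric] Dz_def
    by (simp add: linear_add[OF linear_\<Gamma>[OF y]] linear_neg[OF linear_\<Gamma>'[OF y]] scaleR_2
        \<Gamma>_sym[OF y, of "z t"] d\<Gamma>_sym[of "z t" "v t"])
  show "((\<lambda>t. 2 * g (q t) (z t) (Dz t)) has_real_derivative
      2 * g (q t) (Dz t) (Dz t) + 2 * g (q t) (z t) (curv g (q t) (v t) (z t) (v t))) (at t within I)"
    using DERIV_cmult[OF g_curve_derivative[OF y q[OF t] z[OF t] dDz], of 2]
    unfolding eq unfolding Dz_def[symmetric] by (simp add: distrib_left Dz_def)
qed

end

text \<open>Both sides are tested against \<open>w' = D w\<close>. When the derivative of the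
  pulled-back metric is put into the Koszul formula, the second derivatives of \<open>h\<close>
  cancel by their symmetry, except for \<open>g' (h y) (H u v) (D w)\<close>.\<close>

lemma chris_transform:
  fixes U U' W :: "'e::euclidean_space set"
  assumes "metric_patch U g" "metric_patch U' g'" and W: "open W" "W \<subseteq> U" "h ` W \<subseteq> U'"
    and h: "smooth_on W h"
    and iso: "\<And>y u v. y \<in> W \<Longrightarrow>
      g y u v = g' (h y) (frechet_derivative h (at y) u) (frechet_derivative h (at y) v)"
    and y: "y \<in> W" and surj: "surj (frechet_derivative h (at y))"
  shows "frechet_derivative h (at y) (chris g y u v) =
    frechet_derivative (\<lambda>z. frechet_derivative h (at z) u) (at y) v
    + chris g' (h y) (frechet_derivative h (at y) u) (frechet_derivative h (at y) v)"
proof -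
  interpret A: metric_patch U g by fact
  interpret B: metric_patch U' g' by fact
  have yU: "y \<in> U" "h y \<in> U'" using W y by auto
  define D where "D = frechet_derivative h (at y)"
  define H where "H u = frechet_derivative (\<lambda>z. frechet_derivative h (at z) u) (at y)" for u
  have Hsym: "H u v = H v u" for u v
    unfolding H_def by (rule smooth_on_second_derivative_symmetric[OF W(1) h y])
  have dg: "A.dg y a b w = B.dg (h y) (D a) (D b) (D w) + g' (h y) (H a w) (D b) + g' (h y) (D a) (H b w)" for a b w
  proof -
    have "((\<lambda>z. (h z, frechet_derivative h (at z) a, frechet_derivative h (at z) b)) has_derivative
        (\<lambda>w. (D w, H a w, H b w))) (at y)"
      unfolding D_def H_def
      by (intro has_derivative_Pair smooth_on_has_derivative[OF _ y] h smooth_on_frechet_derivative)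
    from has_derivative_compose[OF this strict_deriv_imp_has_derivative[OF B.g_joint_strict[OF yU(2)]]]
    have "((\<lambda>z. g' (h z) (frechet_derivative h (at z) a) (frechet_derivative h (at z) b)) has_derivative
        (\<lambda>w. B.dg (h y) (D a) (D b) (D w) + g' (h y) (H a w) (D b) + g' (h y) (D a) (H b w))) (at y)"
      by (simp add: D_def)
    then have "((\<lambda>z. g z a b) has_derivative
        (\<lambda>w. B.dg (h y) (D a) (D b) (D w) + g' (h y) (H a w) (D b) + g' (h y) (D a) (H b w))) (at y)"
      by (rule has_derivative_transform_within_open[OF _ W(1) y]) (simp add: iso)
    from fun_cong[OF A.dg_unique[OF yU(1) this], of w] show ?thesis by simp
  qed
  have "D (chris g y u v) = H u v + chris g' (h y) (D u) (D v)"
  proof (rule B.nondegenerate[OF yU(2)])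
    fix w'
    obtain w where w: "w' = D w" using surj unfolding D_def by (metis surjD)
    have "g' (h y) (D (chris g y u v)) w' = g y (chris g y u v) w"
      unfolding w D_def by (simp add: iso[OF y])
    also have "\<dots> = A.koszul y u v w" by (rule A.\<Gamma>_eq[OF yU(1)])
    also have "\<dots> = B.koszul (h y) (D u) (D v) (D w) + g' (h y) (H u v) (D w)"
      unfolding A.koszul_def B.koszul_def dg
      using Hsym[of v u] Hsym[of w u] Hsym[of w v] B.sym[OF yU(2), of "D v" "H u w"]
      by (simp add: field_simps)
    also have "\<dots> = g' (h y) (H u v + chris g' (h y) (D u) (D v)) w'"
      unfolding w by (simp add: B.g_add[OF yU(2)] B.\<Gamma>_eq[OF yU(2)])
    finally show "g' (h y) (D (chris g y u v)) w' = g' (h y) (H u v + chris g' (h y) (D u) (D v)) w'" .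
  qed
  then show ?thesis unfolding D_def H_def .
qed

lemma smooth_on_derivative_joint_strict:
  fixes h :: "'e::euclidean_space \<Rightarrow> 'f::euclidean_space"
  assumes "open W" "smooth_on W h" "y \<in> W"
  shows "strict_deriv (\<lambda>q. frechet_derivative h (at (fst q)) (snd q))
    (\<lambda>k. frechet_derivative (\<lambda>z. frechet_derivative h (at z) v) (at y) (fst k)
       + frechet_derivative h (at y) (snd k)) (y, v)"
proof (rule strict_deriv_parametric_linear[OF assms(1,3)])
  show "linear (frechet_derivative h (at z))" if "z \<in> W" for z
    using smooth_on_has_derivative[OF assms(2) that] has_derivative_linear by blast
  show "strict_deriv (\<lambda>z. frechet_derivative h (at z) i)
      (frechet_derivative (\<lambda>z. frechet_derivative h (at z) i) (at y)) y" for i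
    by (rule smooth_on_strict_deriv[OF assms(1) smooth_on_frechet_derivative[OF assms(2)] assms(3)])
qed

text \<open>The second derivative of \<open>h\<close> that arises from differentiating along the
  curve cancels the one in \<open>chris_transform\<close>.\<close>

lemma geodesic_equation_transform:
  fixes U U' W :: "'e::euclidean_space set"
  assumes "metric_patch U g" "metric_patch U' g'" and W: "open W" "W \<subseteq> U" "h ` W \<subseteq> U'"
    and h: "smooth_on W h"
    and iso: "\<And>y u v. y \<in> W \<Longrightarrow>
      g y u v = g' (h y) (frechet_derivative h (at y) u) (frechet_derivative h (at y) v)"
    and qt: "q t \<in> W" and surj: "surj (frechet_derivative h (at (q t)))"
    and q: "(q has_vector_derivative v t) (at t within I)"
    and v: "(v has_vector_derivative - chris g (q t) (v t) (v t)) (at t within I)"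
  shows "((\<lambda>t. frechet_derivative h (at (q t)) (v t)) has_vector_derivative
    - chris g' (h (q t)) (frechet_derivative h (at (q t)) (v t)) (frechet_derivative h (at (q t)) (v t)))
    (at t within I)"
proof -
  have "((\<lambda>t. (q t, v t)) has_derivative (\<lambda>k. (k *\<^sub>R v t, k *\<^sub>R (- chris g (q t) (v t) (v t))))) (at t within I)"
    using q v unfolding has_vector_derivative_def by (intro has_derivative_Pair)
  from has_derivative_compose[OF this
      strict_deriv_imp_has_derivative[OF smooth_on_derivative_joint_strict[OF W(1) h qt, of "v t"]]]
  have D: "((\<lambda>t. frechet_derivative h (at (q t)) (v t)) has_derivative
      (\<lambda>k. frechet_derivative (\<lambda>z. frechet_derivative h (at z) (v t)) (at (q t)) (k *\<^sub>R v t)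
        + frechet_derivative h (at (q t)) (k *\<^sub>R (- chris g (q t) (v t) (v t))))) (at t within I)" by simp
  have lin: "linear (frechet_derivative h (at (q t)))"
    using smooth_on_has_derivative[OF h qt] has_derivative_linear by blast
  have lin2: "linear (frechet_derivative (\<lambda>z. frechet_derivative h (at z) (v t)) (at (q t)))"
    using smooth_on_has_derivative[OF smooth_on_frechet_derivative[OF h] qt] has_derivative_linear by blast
  show ?thesis
    using D chris_transform[OF assms(1,2) W h iso qt surj, of "v t" "v t"]
    unfolding has_vector_derivative_def
    by (simp add: linear_scale[OF lin] linear_scale[OF lin2] linear_neg[OF lin] algebra_simps)
qed

section \<open>Charts and coordinate changes\<close>

lemma christoffel_eq_chris: "christoffel X c = chris (coord_metric X c)"
  by (intro ext) (simp add: christoffel_def chris_def)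

lemma curvature_eq_curv: "curvature X c = curv (coord_metric X c)"
  by (intro ext) (simp add: curvature_def curv_def christoffel_eq_chris)

locale riem =
  fixes X :: "('a::{t2_space, second_countable_topology}, 'e::euclidean_space) riemannian"
  assumes riem: "riemannian_manifold X"
begin

lemma smooth_atlas: "smooth_atlas (atlas X)"
  using riem unfolding riemannian_manifold_def by blast

lemma chart: "c \<in> atlas X \<Longrightarrow> is_chart c"
  using smooth_atlas unfolding smooth_atlas_def by blast

lemma open_dom: "c \<in> atlas X \<Longrightarrow> open (chart_dom c)"
  using chart unfolding is_chart_def by blast

lemma open_img: "c \<in> atlas X \<Longrightarrow> open (chart_img c)"
  using chart unfolding is_chart_def by blast

lemma chart_homeo:
  "c \<in> atlas X \<Longrightarrow> homeomorphism (chart_dom c) (chart_img c) (chart_map c) (chart_inv c)"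
  using chart unfolding is_chart_def by blast

lemma inv_map: "c \<in> atlas X \<Longrightarrow> x \<in> chart_dom c \<Longrightarrow> chart_inv c (chart_map c x) = x"
  using homeomorphism_apply1[OF chart_homeo] by blast

lemma map_inv: "c \<in> atlas X \<Longrightarrow> y \<in> chart_img c \<Longrightarrow> chart_map c (chart_inv c y) = y"
  using homeomorphism_apply2[OF chart_homeo] by blast

lemma inv_dom: "c \<in> atlas X \<Longrightarrow> y \<in> chart_img c \<Longrightarrow> chart_inv c y \<in> chart_dom c"
  using homeomorphism_image2[OF chart_homeo] by blast

lemma cont_map: "c \<in> atlas X \<Longrightarrow> continuous_on (chart_dom c) (chart_map c)"
  using homeomorphism_cont1[OF chart_homeo] by blast

lemma cont_inv: "c \<in> atlas X \<Longrightarrow> continuous_on (chart_img c) (chart_inv c)"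
  using homeomorphism_cont2[OF chart_homeo] by blast

lemma isCont_map: "c \<in> atlas X \<Longrightarrow> x \<in> chart_dom c \<Longrightarrow> isCont (chart_map c) x"
  using cont_map open_dom continuous_on_eq_continuous_at by blast

lemma isCont_inv: "c \<in> atlas X \<Longrightarrow> y \<in> chart_img c \<Longrightarrow> isCont (chart_inv c) y"
  using cont_inv open_img continuous_on_eq_continuous_at by blast

lemma ex_chart: obtains c where "c \<in> atlas X" "x \<in> chart_dom c"
  using smooth_atlas unfolding smooth_atlas_def by blast

lemma open_chart_image:
  assumes "c \<in> atlas X" "open S" "S \<subseteq> chart_dom c"
  shows "open (chart_map c ` S)"
proof -
  have "openin (top_of_set (chart_img c)) (chart_map c ` S)"
    using homeomorphism_imp_open_map[OF chart_homeo[OF assms(1)]] assms open_dom[OF assms(1)]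
    by (simp add: openin_open_eq)
  then show ?thesis using open_img[OF assms(1)] by (simp add: openin_open_eq)
qed

lemma transition_map:
  "c \<in> atlas X \<Longrightarrow> x \<in> chart_dom c \<Longrightarrow> transition c d (chart_map c x) = chart_map d x"
  unfolding transition_def by (simp add: inv_map)

lemma open_overlap:
  "c \<in> atlas X \<Longrightarrow> d \<in> atlas X \<Longrightarrow> open (chart_map c ` (chart_dom c \<inter> chart_dom d))"
  by (intro open_chart_image) (auto intro: open_dom)

lemma transition_smooth:
  "c \<in> atlas X \<Longrightarrow> d \<in> atlas X \<Longrightarrow> smooth_on (chart_map c ` (chart_dom c \<inter> chart_dom d)) (transition c d)"
  using smooth_atlas unfolding smooth_atlas_def by blast

lemma transition_has_derivative:
  assumes "c \<in> atlas X" "d \<in> atlas X" "x \<in> chart_dom c" "x \<in> chart_dom d"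
  shows "(transition c d has_derivative frechet_derivative (transition c d) (at (chart_map c x))) (at (chart_map c x))"
  by (rule smooth_on_has_derivative[OF transition_smooth[OF assms(1,2)]]) (use assms in auto)

lemma transition_derivative_chain:
  assumes "c \<in> atlas X" "d \<in> atlas X" "e \<in> atlas X"
    "x \<in> chart_dom c" "x \<in> chart_dom d" "x \<in> chart_dom e"
  shows "frechet_derivative (transition d e) (at (chart_map d x))
      (frechet_derivative (transition c d) (at (chart_map c x)) u)
    = frechet_derivative (transition c e) (at (chart_map c x)) u"
proof -
  let ?S = "chart_map c ` (chart_dom c \<inter> chart_dom d \<inter> chart_dom e)"
  have S: "open ?S" "chart_map c x \<in> ?S"
    using assms by (auto intro!: open_chart_image open_Int open_dom)
  have 1: "((\<lambda>y. transition d e (transition c d y)) has_derivative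
     (\<lambda>u. frechet_derivative (transition d e) (at (chart_map d x))
      (frechet_derivative (transition c d) (at (chart_map c x)) u))) (at (chart_map c x))"
    using has_derivative_compose[OF transition_has_derivative[OF assms(1,2,4,5)], of "transition d e"]
      transition_has_derivative[OF assms(2,3,5,6)] transition_map[OF assms(1,4)] by simp
  have "((transition c e) has_derivative
     (\<lambda>u. frechet_derivative (transition d e) (at (chart_map d x))
      (frechet_derivative (transition c d) (at (chart_map c x)) u))) (at (chart_map c x))"
    by (rule has_derivative_transform_within_open[OF 1 S]) (use assms in \<open>auto simp: transition_map\<close>)
  from frechet_derivative_at'[OF this] show ?thesis by simp
qed

lemma transition_self_derivative:
  assumes "c \<in> atlas X" "x \<in> chart_dom c"
  shows "frechet_derivative (transition c c) (at (chart_map c x)) u = u"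
proof -
  have "(transition c c has_derivative (\<lambda>u. u)) (at (chart_map c x))"
    by (rule has_derivative_transform_within_open[of "\<lambda>u. u" _ _ _ "chart_img c"])
      (use assms open_img in \<open>auto simp: transition_map\<close>)
  from frechet_derivative_at'[OF this] show ?thesis by simp
qed

lemma metric_patch: "c \<in> atlas X \<Longrightarrow> metric_patch (chart_img c) (coord_metric X c)"
  using riem open_img unfolding riemannian_manifold_def by unfold_locales auto

lemma tangent_vec_change:
  assumes "c \<in> atlas X" "d \<in> atlas X" "x \<in> chart_dom c" "x \<in> chart_dom d"
  shows "tangent_vec (atlas X) d x (frechet_derivative (transition c d) (at (chart_map c x)) u)
    = tangent_vec (atlas X) c x u"
  unfolding tangent_vec_def using transition_derivative_chain[OF assms(1,2) _ assms(3,4)] by auto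

lemma tangent_vec_in: "c \<in> atlas X \<Longrightarrow> x \<in> chart_dom c \<Longrightarrow> tangent_vec (atlas X) c x u \<in> tangent_space (atlas X) x"
  unfolding tangent_space_def tangent_vec_def by (auto simp: transition_derivative_chain)

lemma tangent_vec_self: "c \<in> atlas X \<Longrightarrow> x \<in> chart_dom c \<Longrightarrow> tangent_vec (atlas X) c x u c = u"
  unfolding tangent_vec_def by (simp add: transition_self_derivative)

lemma tangent_space_eq:
  assumes "\<xi> \<in> tangent_space (atlas X) x" "c \<in> atlas X" "x \<in> chart_dom c"
  shows "\<xi> = tangent_vec (atlas X) c x (\<xi> c)"
proof
  fix d
  have "d \<notin> atlas X \<or> x \<notin> chart_dom d \<Longrightarrow> \<xi> d = 0"
    "d \<in> atlas X \<and> x \<in> chart_dom d \<Longrightarrow>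
      \<xi> d = frechet_derivative (transition c d) (at (chart_map c x)) (\<xi> c)"
    using assms unfolding tangent_space_def by blast+
  then show "\<xi> d = tangent_vec (atlas X) c x (\<xi> c) d" unfolding tangent_vec_def by metis
qed

lemma inner_at_tangent_vec:
  assumes "c \<in> atlas X" "x \<in> chart_dom c"
  shows "inner_at X x (tangent_vec (atlas X) c x u) (tangent_vec (atlas X) c x v)
    = coord_metric X c (chart_map c x) u v"
  unfolding coord_metric_def using assms by (simp add: inv_map)

definition nrm :: "('a, 'e) chart \<Rightarrow> 'a \<Rightarrow> 'e \<Rightarrow> real" where
  "nrm c x u = sqrt (coord_metric X c (chart_map c x) u u)"

lemma tnorm_tangent_vec:
  "c \<in> atlas X \<Longrightarrow> x \<in> chart_dom c \<Longrightarrow> tnorm X x (tangent_vec (atlas X) c x u) = nrm c x u"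
  unfolding tnorm_def nrm_def by (simp add: inner_at_tangent_vec)

lemma nrm_nonneg: "c \<in> atlas X \<Longrightarrow> x \<in> chart_dom c \<Longrightarrow> 0 \<le> nrm c x u"
  unfolding nrm_def using metric_patch.g_nonneg[OF metric_patch] by simp

lemma nrm_scale:
  "c \<in> atlas X \<Longrightarrow> x \<in> chart_dom c \<Longrightarrow> nrm c x (r *\<^sub>R u) = \<bar>r\<bar> * nrm c x u"
  unfolding nrm_def using metric_patch.g_scale[OF metric_patch]
  by (simp add: real_sqrt_mult[symmetric] power2_eq_square[symmetric] mult.assoc[symmetric] real_sqrt_mult)

end

text \<open>Local isometries in coordinates, in a form symmetric in the two charts.\<close>

definition chart_iso ::
    "('a::topological_space, 'e::euclidean_space) riemannian \<Rightarrow> ('a, 'e) chart \<Rightarrow>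
     ('b::topological_space, 'e) riemannian \<Rightarrow> ('b, 'e) chart \<Rightarrow>
     ('e \<Rightarrow> 'e) \<Rightarrow> ('e \<Rightarrow> 'e) \<Rightarrow> 'e set \<Rightarrow> 'e set \<Rightarrow> bool" where
  "chart_iso X c Y d h k W W' \<longleftrightarrow> open W \<and> open W' \<and> W \<subseteq> chart_img c \<and> W' \<subseteq> chart_img d \<and>
     smooth_on W h \<and> smooth_on W' k \<and> (\<forall>y\<in>W. h y \<in> W' \<and> k (h y) = y) \<and> (\<forall>z\<in>W'. k z \<in> W \<and> h (k z) = z) \<and>
     (\<forall>y\<in>W. \<forall>u v. coord_metric X c y u v =
        coord_metric Y d (h y) (frechet_derivative h (at y) u) (frechet_derivative h (at y) v))"

lemma inverse_derivatives:
  assumes "open W" "smooth_on W h" "smooth_on W' k" "\<And>y. y \<in> W \<Longrightarrow> h y \<in> W' \<and> k (h y) = y" "y \<in> W"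
  shows "frechet_derivative k (at (h y)) (frechet_derivative h (at y) u) = u"
proof -
  have "((\<lambda>y. k (h y)) has_derivative (\<lambda>u. frechet_derivative k (at (h y)) (frechet_derivative h (at y) u))) (at y)"
    using assms by (intro has_derivative_compose[OF smooth_on_has_derivative[OF assms(2,5)] smooth_on_has_derivative[OF assms(3)]]) auto
  moreover have "((\<lambda>y. k (h y)) has_derivative (\<lambda>u. u)) (at y)"
    by (rule has_derivative_transform_within_open[of "\<lambda>u. u" _ _ _ W]) (use assms in auto)
  ultimately show ?thesis by (metis has_derivative_unique)
qed

lemma chart_iso_sym:
  assumes "chart_iso X c Y d h k W W'"
  shows "chart_iso Y d X c k h W' W"
proof -
  have *: "open W" "open W'" "smooth_on W h" "smooth_on W' k"
    "\<And>y. y \<in> W \<Longrightarrow> h y \<in> W' \<and> k (h y) = y" "\<And>z. z \<in> W' \<Longrightarrow> k z \<in> W \<and> h (k z) = z"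
    "\<And>y u v. y \<in> W \<Longrightarrow> coord_metric X c y u v =
        coord_metric Y d (h y) (frechet_derivative h (at y) u) (frechet_derivative h (at y) v)"
    using assms unfolding chart_iso_def by auto
  have "coord_metric Y d z u v = coord_metric X c (k z) (frechet_derivative k (at z) u) (frechet_derivative k (at z) v)"
    if "z \<in> W'" for z u v
    using *(7)[of "k z"] *(6)[OF that] inverse_derivatives[OF *(2,4,3,6) that] by simp
  then show ?thesis using assms unfolding chart_iso_def by blast
qed

lemma chart_iso_surj:
  assumes "chart_iso X c Y d h k W W'" "y \<in> W"
  shows "surj (frechet_derivative h (at y))"
proof -
  have *: "open W" "open W'" "smooth_on W h" "smooth_on W' k"
    "\<And>y. y \<in> W \<Longrightarrow> h y \<in> W' \<and> k (h y) = y" "\<And>z. z \<in> W' \<Longrightarrow> k z \<in> W \<and> h (k z) = z"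
    using assms unfolding chart_iso_def by auto
  show ?thesis
    using inverse_derivatives[OF *(2,4,3,6), of "h y"] *(5)[OF assms(2)]
    by (metis surjI)
qed

lemma chart_iso_has_vector_derivative:
  assumes "chart_iso X c Y d h k W W'" "q t \<in> W" "(q has_vector_derivative b) (at t within I)"
  shows "((\<lambda>s. h (q s)) has_vector_derivative frechet_derivative h (at (q t)) b) (at t within I)"
    and "coord_metric Y d (h (q t)) (frechet_derivative h (at (q t)) b) (frechet_derivative h (at (q t)) b)
      = coord_metric X c (q t) b b"
proof -
  have h: "(h has_derivative frechet_derivative h (at (q t))) (at (q t))"
    using assms unfolding chart_iso_def by (auto intro: smooth_on_has_derivative)
  have "((\<lambda>s. h (q s)) has_derivative (\<lambda>r. frechet_derivative h (at (q t)) (r *\<^sub>R b))) (at t within I)"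
    using has_derivative_compose[OF assms(3)[unfolded has_vector_derivative_def] h] .
  then show "((\<lambda>s. h (q s)) has_vector_derivative frechet_derivative h (at (q t)) b) (at t within I)"
    unfolding has_vector_derivative_def using linear_scale[OF has_derivative_linear[OF h]] by simp
  show "coord_metric Y d (h (q t)) (frechet_derivative h (at (q t)) b) (frechet_derivative h (at (q t)) b)
      = coord_metric X c (q t) b b"
    using assms(1,2) unfolding chart_iso_def by auto
qed

text \<open>A relation symmetric in the two curves, so that the same transfer lemmas serve for
  projecting a curve and for lifting it. The coordinate isometry may depend on \<open>t\<close>, and
  of the curves themselves only continuity is asked.\<close>

definition iso_curves ::
    "('a::topological_space, 'e::euclidean_space) riemannian \<Rightarrow> ('b::topological_space, 'e) riemannian \<Rightarrow>
     real set \<Rightarrow> (real \<Rightarrow> 'a) \<Rightarrow> (real \<Rightarrow> 'b) \<Rightarrow> bool" where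
  "iso_curves X Y I \<gamma> \<delta> \<longleftrightarrow> continuous_on I \<gamma> \<and> continuous_on I \<delta> \<and>
     (\<forall>t\<in>I. \<forall>c\<in>atlas X. \<forall>d\<in>atlas Y. \<gamma> t \<in> chart_dom c \<longrightarrow> \<delta> t \<in> chart_dom d \<longrightarrow>
       (\<exists>h k W W' T. chart_iso X c Y d h k W W' \<and> open T \<and> t \<in> T \<and>
          (\<forall>s\<in>T \<inter> I. \<gamma> s \<in> chart_dom c \<and> \<delta> s \<in> chart_dom d \<and> chart_map c (\<gamma> s) \<in> W \<and>
             chart_map d (\<delta> s) = h (chart_map c (\<gamma> s)))))"

lemma iso_curvesE:
  assumes "iso_curves X Y I \<gamma> \<delta>" "t \<in> I" "c \<in> atlas X" "d \<in> atlas Y" "\<gamma> t \<in> chart_dom c" "\<delta> t \<in> chart_dom d"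
  obtains h k W W' T where "chart_iso X c Y d h k W W'" "open T" "t \<in> T"
    "\<forall>s\<in>T \<inter> I. \<gamma> s \<in> chart_dom c \<and> \<delta> s \<in> chart_dom d \<and> chart_map c (\<gamma> s) \<in> W \<and>
      chart_map d (\<delta> s) = h (chart_map c (\<gamma> s))"
proof -
  have "\<exists>h k W W' T. chart_iso X c Y d h k W W' \<and> open T \<and> t \<in> T \<and>
      (\<forall>s\<in>T \<inter> I. \<gamma> s \<in> chart_dom c \<and> \<delta> s \<in> chart_dom d \<and> chart_map c (\<gamma> s) \<in> W \<and>
         chart_map d (\<delta> s) = h (chart_map c (\<gamma> s)))"
    using assms(1)[unfolded iso_curves_def, THEN conjunct2, THEN conjunct2, rule_format, OF assms(2-6)] .
  then show thesis by (elim exE conjE) (rule that)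
qed

lemma iso_curves_sym:
  assumes "iso_curves X Y I \<gamma> \<delta>"
  shows "iso_curves Y X I \<delta> \<gamma>"
  unfolding iso_curves_def
proof (intro conjI ballI impI)
  show "continuous_on I \<gamma>" "continuous_on I \<delta>" using assms unfolding iso_curves_def by blast+
  fix t d c
  assume a: "t \<in> I" "d \<in> atlas Y" "c \<in> atlas X" "\<delta> t \<in> chart_dom d" "\<gamma> t \<in> chart_dom c"
  obtain h k W W' T where iso: "chart_iso X c Y d h k W W'" "open T" "t \<in> T"
      and T: "\<forall>s\<in>T \<inter> I. \<gamma> s \<in> chart_dom c \<and> \<delta> s \<in> chart_dom d \<and> chart_map c (\<gamma> s) \<in> W \<and>
             chart_map d (\<delta> s) = h (chart_map c (\<gamma> s))"
    by (rule iso_curvesE[OF assms a(1,3,2,5,4)])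
  have "\<And>y. y \<in> W \<Longrightarrow> h y \<in> W' \<and> k (h y) = y" using iso(1) unfolding chart_iso_def by blast
  then have *: "\<delta> s \<in> chart_dom d \<and> \<gamma> s \<in> chart_dom c \<and> chart_map d (\<delta> s) \<in> W' \<and>
             chart_map c (\<gamma> s) = k (chart_map d (\<delta> s))" if "s \<in> T \<inter> I" for s
    using T that by simp
  show "\<exists>h k W W' T. chart_iso Y d X c h k W W' \<and> open T \<and> t \<in> T \<and>
          (\<forall>s\<in>T \<inter> I. \<delta> s \<in> chart_dom d \<and> \<gamma> s \<in> chart_dom c \<and> chart_map d (\<delta> s) \<in> W \<and>
             chart_map c (\<gamma> s) = h (chart_map d (\<delta> s)))"
    by (rule exI[of _ k], rule exI[of _ h], rule exI[of _ W'], rule exI[of _ W], rule exI[of _ T])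
      (intro conjI chart_iso_sym[OF iso(1)] iso(2,3) ballI, use * in auto)
qed

lemma has_vector_derivative_cong_local:
  assumes "(f has_vector_derivative b) (at t within I)" "open T" "t \<in> T" "t \<in> I"
    "\<And>s. s \<in> T \<inter> I \<Longrightarrow> f s = g s"
  shows "(g has_vector_derivative b) (at t within I)"
proof -
  have "eventually (\<lambda>s. f s = g s) (at t within I)"
    using assms(5) by (auto simp: eventually_at_topological intro!: exI[of _ T] assms(2,3))
  from has_derivative_transform_eventually[OF assms(1)[unfolded has_vector_derivative_def] this]
  show ?thesis using assms(3-5) unfolding has_vector_derivative_def by blast
qed

lemma iso_curves_derivative:
  assumes "iso_curves X Y I \<gamma> \<delta>" "t \<in> I" "c \<in> atlas X" "d \<in> atlas Y" "\<gamma> t \<in> chart_dom c" "\<delta> t \<in> chart_dom d"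
    "((\<lambda>s. chart_map c (\<gamma> s)) has_vector_derivative b) (at t within I)"
  obtains b' where "((\<lambda>s. chart_map d (\<delta> s)) has_vector_derivative b') (at t within I)"
    "coord_metric Y d (chart_map d (\<delta> t)) b' b' = coord_metric X c (chart_map c (\<gamma> t)) b b"
proof -
  obtain h k W W' T where iso: "chart_iso X c Y d h k W W'" "open T" "t \<in> T"
      "\<forall>s\<in>T \<inter> I. \<gamma> s \<in> chart_dom c \<and> \<delta> s \<in> chart_dom d \<and> chart_map c (\<gamma> s) \<in> W \<and>
         chart_map d (\<delta> s) = h (chart_map c (\<gamma> s))"
    by (rule iso_curvesE[OF assms(1-6)])
  have W: "chart_map c (\<gamma> t) \<in> W" using iso(3,4) assms(2) by blast
  note D = chart_iso_has_vector_derivative[OF iso(1) W assms(7)]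
  show thesis
  proof (rule that)
    show "((\<lambda>s. chart_map d (\<delta> s)) has_vector_derivative
        frechet_derivative h (at (chart_map c (\<gamma> t))) b) (at t within I)"
      by (rule has_vector_derivative_cong_local[OF D(1) iso(2,3) assms(2)]) (use iso(4) in auto)
  qed (use D(2) iso(3,4) assms(2) in auto)
qed

text \<open>Unlike \<^const>\<open>geodesic\<close>, a weak geodesic is not required to be smooth, so lifts of geodesics
  are weak geodesics without a regularity argument.\<close>

definition chart_velocity :: "real set \<Rightarrow> (real \<Rightarrow> 'a) \<Rightarrow> ('a, 'e::euclidean_space) chart \<Rightarrow> real \<Rightarrow> 'e" where
  "chart_velocity I \<gamma> c t = vector_derivative (\<lambda>s. chart_map c (\<gamma> s)) (at t within I)"

definition weak_geodesic ::
    "('a::topological_space, 'e::euclidean_space) riemannian \<Rightarrow> real set \<Rightarrow> (real \<Rightarrow> 'a) \<Rightarrow> bool" where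
  "weak_geodesic X I \<gamma> \<longleftrightarrow> continuous_on I \<gamma> \<and> (\<forall>t\<in>I. \<forall>c\<in>atlas X. \<gamma> t \<in> chart_dom c \<longrightarrow>
     ((\<lambda>s. chart_map c (\<gamma> s)) has_vector_derivative chart_velocity I \<gamma> c t) (at t within I) \<and>
     (chart_velocity I \<gamma> c has_vector_derivative
       - christoffel X c (chart_map c (\<gamma> t)) (chart_velocity I \<gamma> c t) (chart_velocity I \<gamma> c t)) (at t within I))"

text \<open>On such sets \<open>has_vector_derivative\<close> within \<open>I\<close> determines the
  value of \<open>vector_derivative\<close>; at an isolated point derivatives are not
  unique.\<close>

definition no_isolated :: "real set \<Rightarrow> bool" where
  "no_isolated I \<longleftrightarrow> (\<forall>t\<in>I. at t within I \<noteq> bot)"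

lemma no_isolated_UNIV: "no_isolated UNIV"
  unfolding no_isolated_def by simp

lemma no_isolated_atLeastAtMost: "a < b \<Longrightarrow> no_isolated {a..b}"
  unfolding no_isolated_def by (simp add: trivial_limit_within islimpt_Icc)

lemma chart_velocity_eq:
  assumes "no_isolated I" "t \<in> I" "((\<lambda>s. chart_map c (\<gamma> s)) has_vector_derivative b) (at t within I)"
  shows "chart_velocity I \<gamma> c t = b"
  unfolding chart_velocity_def
  by (rule vector_derivative_within[OF _ assms(3)]) (use assms(1,2) in \<open>simp add: no_isolated_def\<close>)

text \<open>The velocity of \<open>\<delta>\<close> is computed on a whole neighbourhood
  \<open>T \<inter> I\<close> of \<open>t\<close> and not only at \<open>t\<close>, since the
  geodesic equation differentiates it again.\<close>

lemma iso_curves_weak_geodesic: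
  assumes X: "riem X" and Y: "riem Y" and I: "no_isolated I"
    and iso: "iso_curves X Y I \<gamma> \<delta>" and geo: "weak_geodesic X I \<gamma>"
  shows "weak_geodesic Y I \<delta>"
  unfolding weak_geodesic_def
proof (intro conjI ballI impI)
  interpret X: riem X by fact
  interpret Y: riem Y by fact
  show "continuous_on I \<delta>" using iso unfolding iso_curves_def by blast
  fix t d assume t: "t \<in> I" and d: "d \<in> atlas Y" "\<delta> t \<in> chart_dom d"
  obtain c where c: "c \<in> atlas X" "\<gamma> t \<in> chart_dom c" by (rule X.ex_chart)
  obtain h k W W' T where h: "chart_iso X c Y d h k W W'" and T: "open T" "t \<in> T"
      and T': "\<forall>s\<in>T \<inter> I. \<gamma> s \<in> chart_dom c \<and> \<delta> s \<in> chart_dom d \<and> chart_map c (\<gamma> s) \<in> W \<and>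
         chart_map d (\<delta> s) = h (chart_map c (\<gamma> s))"
    by (rule iso_curvesE[OF iso t c(1) d(1) c(2) d(2)])
  have T: "open T" "t \<in> T"
      "\<And>s. s \<in> T \<inter> I \<Longrightarrow> \<gamma> s \<in> chart_dom c \<and> chart_map c (\<gamma> s) \<in> W \<and> chart_map d (\<delta> s) = h (chart_map c (\<gamma> s))"
    using T T' by blast+
  define q where "q s = chart_map c (\<gamma> s)" for s
  define v where "v = chart_velocity I \<gamma> c"
  have q: "(q has_vector_derivative v s) (at s within I)" if "s \<in> T \<inter> I" for s
    using geo that T(3)[OF that] c(1) unfolding weak_geodesic_def q_def v_def by auto
  have hq: "((\<lambda>s. chart_map d (\<delta> s)) has_vector_derivative frechet_derivative h (at (q s)) (v s)) (at s within I)"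
    if s: "s \<in> T \<inter> I" for s
  proof (rule has_vector_derivative_cong_local[OF _ T(1)])
    show "((\<lambda>s. h (q s)) has_vector_derivative frechet_derivative h (at (q s)) (v s)) (at s within I)"
      using chart_iso_has_vector_derivative(1)[OF h _ q[OF s]] T(3)[OF s] unfolding q_def by blast
  qed (use s T(3) in \<open>auto simp: q_def\<close>)
  have vel: "chart_velocity I \<delta> d s = frechet_derivative h (at (q s)) (v s)" if "s \<in> T \<inter> I" for s
    using chart_velocity_eq[OF I _ hq[OF that]] that by blast
  have tT: "t \<in> T \<inter> I" using t T(2) by blast
  show "((\<lambda>s. chart_map d (\<delta> s)) has_vector_derivative chart_velocity I \<delta> d t) (at t within I)"
    using hq[OF tT] vel[OF tT] by simp
  have W: "open W" "W \<subseteq> chart_img c" "h ` W \<subseteq> chart_img d" "smooth_on W h" "q t \<in> W"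
    "\<And>y u v. y \<in> W \<Longrightarrow> coord_metric X c y u v =
        coord_metric Y d (h y) (frechet_derivative h (at y) u) (frechet_derivative h (at y) v)"
    using h T(3)[OF tT] unfolding chart_iso_def q_def by auto
  have "((\<lambda>s. frechet_derivative h (at (q s)) (v s)) has_vector_derivative
    - chris (coord_metric Y d) (h (q t)) (frechet_derivative h (at (q t)) (v t)) (frechet_derivative h (at (q t)) (v t)))
    (at t within I)"
    by (rule geodesic_equation_transform[where q = q and v = v and t = t,
          OF X.metric_patch[OF c(1)] Y.metric_patch[OF d(1)] W(1-4) W(6) W(5) chart_iso_surj[OF h W(5)] q[OF tT]])
      (use geo tT T(3)[OF tT] c(1) in \<open>auto simp: weak_geodesic_def q_def v_def christoffel_eq_chris\<close>)
  then have "((\<lambda>s. frechet_derivative h (at (q s)) (v s)) has_vector_derivative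
    - christoffel Y d (chart_map d (\<delta> t)) (chart_velocity I \<delta> d t) (chart_velocity I \<delta> d t)) (at t within I)"
    using T(3)[OF tT] vel[OF tT] by (simp add: christoffel_eq_chris q_def)
  then show "(chart_velocity I \<delta> d has_vector_derivative
    - christoffel Y d (chart_map d (\<delta> t)) (chart_velocity I \<delta> d t) (chart_velocity I \<delta> d t)) (at t within I)"
    by (rule has_vector_derivative_cong_local[OF _ T(1,2) t]) (use vel in auto)
qed

section \<open>Smooth curves, velocities and geodesics in the coordinates of a chart\<close>

context riem
begin

lemma transition_chart_iso:
  assumes "c \<in> atlas X" "d \<in> atlas X"
  shows "chart_iso X c X d (transition c d) (transition d c)
    (chart_map c ` (chart_dom c \<inter> chart_dom d)) (chart_map d ` (chart_dom c \<inter> chart_dom d))"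
  unfolding chart_iso_def
proof (intro conjI ballI allI)
  show "smooth_on (chart_map d ` (chart_dom c \<inter> chart_dom d)) (transition d c)"
    using transition_smooth[OF assms(2,1)] by (simp add: Int_commute)
  show "open (chart_map d ` (chart_dom c \<inter> chart_dom d))"
    using open_overlap[OF assms(2,1)] by (simp add: Int_commute)
  fix y u v assume "y \<in> chart_map c ` (chart_dom c \<inter> chart_dom d)"
  then obtain x where x: "y = chart_map c x" "x \<in> chart_dom c" "x \<in> chart_dom d" by auto
  show "coord_metric X c y u v = coord_metric X d (transition c d y)
      (frechet_derivative (transition c d) (at y) u) (frechet_derivative (transition c d) (at y) v)"
    unfolding x(1) transition_map[OF assms(1) x(2)]
    by (simp add: inner_at_tangent_vec[symmetric] assms x tangent_vec_change)
qed (use assms in \<open>auto simp: transition_map transition_smooth open_overlap\<close>)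

lemma coord_derivative_change:
  assumes "c \<in> atlas X" "d \<in> atlas X" "\<gamma> t \<in> chart_dom c" "\<gamma> t \<in> chart_dom d" "t \<in> I" "continuous_on I \<gamma>"
    "((\<lambda>s. chart_map c (\<gamma> s)) has_vector_derivative b) (at t within I)"
  shows "((\<lambda>s. chart_map d (\<gamma> s)) has_vector_derivative
    frechet_derivative (transition c d) (at (chart_map c (\<gamma> t))) b) (at t within I)"
proof -
  have "open (chart_dom c)" using assms by (simp add: open_dom)
  then obtain T where T: "open T" "T \<inter> I = \<gamma> -` chart_dom c \<inter> I"
    using assms(6) unfolding continuous_on_open_invariant by metis
  with assms have "t \<in> T" by blast
  show ?thesis
    by (rule has_vector_derivative_cong_local[OF chart_iso_has_vector_derivative(1)
          [OF transition_chart_iso[OF assms(1,2)] _ assms(7)] T(1) \<open>t \<in> T\<close> assms(5)])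
      (use assms T(2) in \<open>auto simp: transition_map\<close>)
qed

lemma smooth_curve_iff:
  "smooth_curve (atlas X) I \<gamma> \<longleftrightarrow> (\<exists>J \<beta>. I \<subseteq> J \<and> open J \<and> continuous_on J \<beta> \<and>
     (\<forall>d\<in>atlas X. smooth_on {t \<in> J. \<beta> t \<in> chart_dom d} (\<lambda>t. chart_map d (\<beta> t))) \<and> (\<forall>t\<in>I. \<beta> t = \<gamma> t))"
  unfolding smooth_curve_def smooth_map_def by (simp add: o_def conj_assoc)

lemma open_curve_preimage:
  assumes "open J" "continuous_on J \<beta>" "d \<in> atlas X"
  shows "open {t \<in> J. \<beta> t \<in> chart_dom d}"
proof -
  have "{t \<in> J. \<beta> t \<in> chart_dom d} = J \<inter> \<beta> -` chart_dom d" by auto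
  then show ?thesis using continuous_open_preimage[OF assms(2,1) open_dom[OF assms(3)]] by simp
qed

lemma smooth_curve_extension:
  assumes "smooth_curve (atlas X) I \<gamma>"
  obtains J \<beta> where "I \<subseteq> J" "open J" "continuous_on J \<beta>" "\<forall>t\<in>I. \<beta> t = \<gamma> t"
    "\<forall>d\<in>atlas X. smooth_on {t \<in> J. \<beta> t \<in> chart_dom d} (\<lambda>t. chart_map d (\<beta> t))"
    "\<forall>d\<in>atlas X. open {t \<in> J. \<beta> t \<in> chart_dom d}"
proof -
  obtain J \<beta> where J: "I \<subseteq> J" "open J" "continuous_on J \<beta>"
    "\<forall>d\<in>atlas X. smooth_on {t \<in> J. \<beta> t \<in> chart_dom d} (\<lambda>t. chart_map d (\<beta> t))" "\<forall>t\<in>I. \<beta> t = \<gamma> t"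
    using assms unfolding smooth_curve_iff by (elim exE conjE) (rule that)
  have "\<forall>d\<in>atlas X. open {t \<in> J. \<beta> t \<in> chart_dom d}"
    using open_curve_preimage[OF J(2,3)] by blast
  then show thesis by (rule that[OF J(1,2,3,5,4)])
qed

lemma smooth_curve_continuous:
  assumes "smooth_curve (atlas X) I \<gamma>" shows "continuous_on I \<gamma>"
proof -
  obtain J \<beta> where J: "I \<subseteq> J" "continuous_on J \<beta>" "\<forall>t\<in>I. \<beta> t = \<gamma> t"
    by (rule smooth_curve_extension[OF assms])
  show ?thesis
    by (rule continuous_on_eq[OF continuous_on_subset[OF J(2,1)]]) (use J(3) in simp)
qed

lemma smooth_has_vector_derivative:
  assumes "smooth_on S f" "t \<in> S"
  shows "(f has_vector_derivative frechet_derivative f (at t) 1) (at t)"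
proof -
  have D: "(f has_derivative frechet_derivative f (at t)) (at t)" using smooth_on_has_derivative[OF assms] .
  have "frechet_derivative f (at t) r = r *\<^sub>R frechet_derivative f (at t) 1" for r
    using linear_scale[OF has_derivative_linear[OF D], of r 1] by simp
  then have "frechet_derivative f (at t) = (\<lambda>r. r *\<^sub>R frechet_derivative f (at t) 1)" by blast
  with D show ?thesis unfolding has_vector_derivative_def by simp
qed

lemma smooth_curve_coord_derivatives:
  assumes "smooth_curve (atlas X) I \<gamma>" "no_isolated I" "t \<in> I" "c \<in> atlas X" "\<gamma> t \<in> chart_dom c"
  shows "((\<lambda>s. chart_map c (\<gamma> s)) has_vector_derivative chart_velocity I \<gamma> c t) (at t within I)"
    and "\<exists>b. (chart_velocity I \<gamma> c has_vector_derivative b) (at t within I)"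
proof -
  obtain J \<beta> where J0: "I \<subseteq> J" "open J" "continuous_on J \<beta>" "\<forall>t\<in>I. \<beta> t = \<gamma> t"
    "\<forall>d\<in>atlas X. smooth_on {t \<in> J. \<beta> t \<in> chart_dom d} (\<lambda>t. chart_map d (\<beta> t))"
    "\<forall>d\<in>atlas X. open {t \<in> J. \<beta> t \<in> chart_dom d}"
    by (rule smooth_curve_extension[OF assms(1)])
  have J: "I \<subseteq> J" "open J" "continuous_on J \<beta>" "\<And>t. t \<in> I \<Longrightarrow> \<beta> t = \<gamma> t"
    "smooth_on {t \<in> J. \<beta> t \<in> chart_dom c} (\<lambda>t. chart_map c (\<beta> t))"
    "open {t \<in> J. \<beta> t \<in> chart_dom c}"
    using J0 assms(4) by blast+
  let ?T = "{t \<in> J. \<beta> t \<in> chart_dom c}"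
  let ?b = "\<lambda>s. frechet_derivative (\<lambda>t. chart_map c (\<beta> t)) (at s) 1"
  have D: "((\<lambda>s. chart_map c (\<gamma> s)) has_vector_derivative ?b s) (at s within I)" if "s \<in> ?T \<inter> I" for s
    by (rule has_vector_derivative_cong_local[OF has_vector_derivative_at_within
          [OF smooth_has_vector_derivative[OF J(5)]] J(6)]) (use that J(4) in auto)
  have vel: "chart_velocity I \<gamma> c s = ?b s" if "s \<in> ?T \<inter> I" for s
    using chart_velocity_eq[OF assms(2) _ D[OF that]] that by blast
  have t: "t \<in> ?T \<inter> I" "t \<in> ?T" using assms(3,5) J(1,4) by auto
  show "((\<lambda>s. chart_map c (\<gamma> s)) has_vector_derivative chart_velocity I \<gamma> c t) (at t within I)"
    using D[OF t(1)] vel[OF t(1)] by simp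
  have "(?b has_vector_derivative frechet_derivative ?b (at t) 1) (at t within I)"
    by (rule has_vector_derivative_at_within[OF smooth_has_vector_derivative[OF smooth_on_frechet_derivative[OF J(5)] t(2)]])
  then have "(chart_velocity I \<gamma> c has_vector_derivative frechet_derivative ?b (at t) 1) (at t within I)"
    by (rule has_vector_derivative_cong_local[OF _ J(6) t(2) assms(3)]) (use vel in auto)
  then show "\<exists>b. (chart_velocity I \<gamma> c has_vector_derivative b) (at t within I)" by blast
qed

lemma velocity_eq:
  assumes "c \<in> atlas X" "\<gamma> t \<in> chart_dom c" "t \<in> I" "continuous_on I \<gamma>" "no_isolated I"
    "((\<lambda>s. chart_map c (\<gamma> s)) has_vector_derivative b) (at t within I)"
  shows "velocity (atlas X) I \<gamma> t = tangent_vec (atlas X) c (\<gamma> t) b"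
proof
  fix d
  show "velocity (atlas X) I \<gamma> t d = tangent_vec (atlas X) c (\<gamma> t) b d"
  proof (cases "d \<in> atlas X \<and> \<gamma> t \<in> chart_dom d")
    case True
    then have "((\<lambda>s. chart_map d (\<gamma> s)) has_vector_derivative
        frechet_derivative (transition c d) (at (chart_map c (\<gamma> t))) b) (at t within I)"
      using assms by (intro coord_derivative_change) auto
    from vector_derivative_within[OF _ this] assms(3,5) True show ?thesis
      unfolding velocity_def tangent_vec_def no_isolated_def by (simp add: o_def)
  qed (auto simp: velocity_def tangent_vec_def)
qed

lemma tnorm_velocity:
  assumes "c \<in> atlas X" "\<gamma> t \<in> chart_dom c" "t \<in> I" "continuous_on I \<gamma>" "no_isolated I"
    "((\<lambda>s. chart_map c (\<gamma> s)) has_vector_derivative b) (at t within I)"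
  shows "tnorm X (\<gamma> t) (velocity (atlas X) I \<gamma> t) = nrm c (\<gamma> t) b"
  using velocity_eq[OF assms] tnorm_tangent_vec[OF assms(1,2)] by simp

text \<open>\<open>geodesic\<close> speaks of \<open>vector_derivative\<close>, a total function;
  smoothness of the curve supplies the derivatives whose existence \<open>weak_geodesic\<close>
  asserts.\<close>

lemma geodesic_imp_weak:
  assumes "geodesic X I \<gamma>" "no_isolated I"
  shows "weak_geodesic X I \<gamma>"
  unfolding weak_geodesic_def
proof (intro conjI ballI impI)
  have sm: "smooth_curve (atlas X) I \<gamma>" using assms(1) unfolding geodesic_def by blast
  show "continuous_on I \<gamma>" using smooth_curve_continuous[OF sm] .
  fix t c assume a: "t \<in> I" "c \<in> atlas X" "\<gamma> t \<in> chart_dom c"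
  note D = smooth_curve_coord_derivatives[OF sm assms(2) a]
  show "((\<lambda>s. chart_map c (\<gamma> s)) has_vector_derivative chart_velocity I \<gamma> c t) (at t within I)" by (rule D(1))
  obtain b where b: "(chart_velocity I \<gamma> c has_vector_derivative b) (at t within I)" using D(2) by blast
  have "at t within I \<noteq> bot" using assms(2) a(1) unfolding no_isolated_def by blast
  from vector_derivative_within[OF this b]
  have "vector_derivative (chart_velocity I \<gamma> c) (at t within I) = b" .
  moreover have "vector_derivative (chart_velocity I \<gamma> c) (at t within I)
      + christoffel X c (chart_map c (\<gamma> t)) (chart_velocity I \<gamma> c t) (chart_velocity I \<gamma> c t) = 0"
    using assms(1) a unfolding geodesic_def chart_velocity_def by (auto simp: Let_def o_def)
  ultimately have "b = - christoffel X c (chart_map c (\<gamma> t)) (chart_velocity I \<gamma> c t) (chart_velocity I \<gamma> c t)"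
    by (simp add: eq_neg_iff_add_eq_0)
  with b show "(chart_velocity I \<gamma> c has_vector_derivative
      - christoffel X c (chart_map c (\<gamma> t)) (chart_velocity I \<gamma> c t) (chart_velocity I \<gamma> c t)) (at t within I)"
    by simp
qed

lemma weak_imp_geodesic:
  assumes "weak_geodesic X I \<gamma>" "no_isolated I" "smooth_curve (atlas X) I \<gamma>"
  shows "geodesic X I \<gamma>"
  unfolding geodesic_def Let_def o_def
proof (intro conjI ballI impI assms(3))
  fix t c assume a: "t \<in> I" "c \<in> atlas X" "\<gamma> t \<in> chart_dom c"
  then have "(chart_velocity I \<gamma> c has_vector_derivative
      - christoffel X c (chart_map c (\<gamma> t)) (chart_velocity I \<gamma> c t) (chart_velocity I \<gamma> c t)) (at t within I)"
    using assms(1) unfolding weak_geodesic_def by blast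
  moreover have "at t within I \<noteq> bot" using assms(2) a(1) unfolding no_isolated_def by blast
  ultimately have "vector_derivative (chart_velocity I \<gamma> c) (at t within I)
      = - christoffel X c (chart_map c (\<gamma> t)) (chart_velocity I \<gamma> c t) (chart_velocity I \<gamma> c t)"
    using vector_derivative_within by blast
  then show "vector_derivative (\<lambda>s. vector_derivative (\<lambda>x. chart_map c (\<gamma> x)) (at s within I)) (at t within I)
      + christoffel X c (chart_map c (\<gamma> t)) (vector_derivative (\<lambda>x. chart_map c (\<gamma> x)) (at t within I))
       (vector_derivative (\<lambda>x. chart_map c (\<gamma> x)) (at t within I)) = 0"
    unfolding chart_velocity_def[abs_def] by simp
qed

text \<open>Both the second derivative and the quadratic Christoffel term acquire the factor
  \<open>m * m\<close>. With \<open>m = 1\<close> this restricts a geodesic to a smaller set, with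
  \<open>m = -1\<close> it reverses one, and other values rescale time.\<close>

lemma weak_geodesic_affine:
  assumes geo: "weak_geodesic X I \<gamma>" and K: "no_isolated K" "(\<lambda>t. m * t + b) ` K \<subseteq> I"
  shows "weak_geodesic X K (\<lambda>t. \<gamma> (m * t + b))"
    and "\<And>t c. t \<in> K \<Longrightarrow> c \<in> atlas X \<Longrightarrow> \<gamma> (m * t + b) \<in> chart_dom c \<Longrightarrow>
      chart_velocity K (\<lambda>t. \<gamma> (m * t + b)) c t = m *\<^sub>R chart_velocity I \<gamma> c (m * t + b)"
proof -
  have cont: "continuous_on I \<gamma>" using geo unfolding weak_geodesic_def by blast
  have cont': "continuous_on K (\<lambda>t. \<gamma> (m * t + b))"
    by (rule continuous_on_compose2[OF cont _ K(2)]) (intro continuous_intros)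
  have aff: "((\<lambda>t. m * t + b) has_vector_derivative m) (at t within K)" for t
    by (auto intro!: derivative_eq_intros simp: has_real_derivative_iff_has_vector_derivative[symmetric])
  have D: "((\<lambda>s. chart_map c (\<gamma> (m * s + b))) has_vector_derivative
      m *\<^sub>R chart_velocity I \<gamma> c (m * t + b)) (at t within K)"
    if "t \<in> K" "c \<in> atlas X" "\<gamma> (m * t + b) \<in> chart_dom c" for t c
  proof -
    have "((\<lambda>s. chart_map c (\<gamma> s)) has_vector_derivative chart_velocity I \<gamma> c (m * t + b)) (at (m * t + b) within I)"
      using geo that K(2) unfolding weak_geodesic_def by blast
    then have "((\<lambda>s. chart_map c (\<gamma> s)) has_vector_derivative chart_velocity I \<gamma> c (m * t + b))
        (at (m * t + b) within (\<lambda>t. m * t + b) ` K)"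
      using K(2) has_vector_derivative_within_subset by blast
    from vector_diff_chain_within[OF aff this] show ?thesis by (simp add: o_def)
  qed
  show vel: "chart_velocity K (\<lambda>t. \<gamma> (m * t + b)) c t = m *\<^sub>R chart_velocity I \<gamma> c (m * t + b)"
    if "t \<in> K" "c \<in> atlas X" "\<gamma> (m * t + b) \<in> chart_dom c" for t c
    by (rule chart_velocity_eq[OF K(1) that(1) D[OF that]])
  show "weak_geodesic X K (\<lambda>t. \<gamma> (m * t + b))"
    unfolding weak_geodesic_def
  proof (intro conjI ballI impI cont')
    fix t c assume a: "t \<in> K" "c \<in> atlas X" "\<gamma> (m * t + b) \<in> chart_dom c"
    show "((\<lambda>s. chart_map c (\<gamma> (m * s + b))) has_vector_derivative
        chart_velocity K (\<lambda>t. \<gamma> (m * t + b)) c t) (at t within K)"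
      using D[OF a] vel[OF a] by simp
    interpret P: metric_patch "chart_img c" "coord_metric X c" using metric_patch[OF a(2)] .
    have img: "chart_map c (\<gamma> (m * t + b)) \<in> chart_img c" using a(3) by blast
    have "(chart_velocity I \<gamma> c has_vector_derivative - christoffel X c (chart_map c (\<gamma> (m * t + b)))
        (chart_velocity I \<gamma> c (m * t + b)) (chart_velocity I \<gamma> c (m * t + b))) (at (m * t + b) within I)"
      using geo a K(2) unfolding weak_geodesic_def by blast
    then have "(chart_velocity I \<gamma> c has_vector_derivative - christoffel X c (chart_map c (\<gamma> (m * t + b)))
        (chart_velocity I \<gamma> c (m * t + b)) (chart_velocity I \<gamma> c (m * t + b))) (at (m * t + b) within (\<lambda>t. m * t + b) ` K)"
      using K(2) has_vector_derivative_within_subset by blast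
    from bounded_linear.has_vector_derivative[OF bounded_linear_scaleR_right vector_diff_chain_within[OF aff this], of m]
    have E: "((\<lambda>t. m *\<^sub>R chart_velocity I \<gamma> c (m * t + b)) has_vector_derivative
      - christoffel X c (chart_map c (\<gamma> (m * t + b))) (m *\<^sub>R chart_velocity I \<gamma> c (m * t + b))
        (m *\<^sub>R chart_velocity I \<gamma> c (m * t + b))) (at t within K)"
      by (simp add: o_def christoffel_eq_chris linear_scale[OF P.linear_\<Gamma>[OF img]] linear_scale[OF P.linear_\<Gamma>'[OF img]])
    obtain T where T: "open T" "T \<inter> K = (\<lambda>t. \<gamma> (m * t + b)) -` chart_dom c \<inter> K"
      using cont' open_dom[OF a(2)] unfolding continuous_on_open_invariant by metis
    have "t \<in> T" using T(2) a by blast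
    show "(chart_velocity K (\<lambda>t. \<gamma> (m * t + b)) c has_vector_derivative - christoffel X c (chart_map c (\<gamma> (m * t + b)))
       (chart_velocity K (\<lambda>t. \<gamma> (m * t + b)) c t) (chart_velocity K (\<lambda>t. \<gamma> (m * t + b)) c t)) (at t within K)"
      unfolding vel[OF a]
      by (rule has_vector_derivative_cong_local[OF E T(1) \<open>t \<in> T\<close> a(1)]) (use T(2) a(2) vel in auto)
  qed
qed

lemma smooth_curve_affine:
  assumes "smooth_curve (atlas X) I \<gamma>" "(\<lambda>t. m * t + b) ` K \<subseteq> I"
  shows "smooth_curve (atlas X) K (\<lambda>t. \<gamma> (m * t + b))"
proof -
  obtain J \<beta> where J0: "I \<subseteq> J" "open J" "continuous_on J \<beta>" "\<forall>t\<in>I. \<beta> t = \<gamma> t"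
    "\<forall>d\<in>atlas X. smooth_on {t \<in> J. \<beta> t \<in> chart_dom d} (\<lambda>t. chart_map d (\<beta> t))"
    "\<forall>d\<in>atlas X. open {t \<in> J. \<beta> t \<in> chart_dom d}"
    by (rule smooth_curve_extension[OF assms(1)])
  note J = J0(1-3) J0(4-6)[rule_format]
  let ?a = "\<lambda>t. m * t + b"
  have ca: "continuous_on S ?a" for S by (intro continuous_intros)
  have op: "open (?a -` S)" if "open S" for S
    using continuous_open_preimage[OF ca[of UNIV] open_UNIV that] by simp
  have sa: "smooth_on S ?a" for S
  proof (cases "open S")
    case True
    have "bounded_linear (\<lambda>t::real. m * t)" by (rule bounded_linear_mult_right)
    show ?thesis
      by (rule smooth_on_subset[of UNIV, OF smooth_on_add[OF open_UNIV
              smooth_on_bounded_linear[OF bounded_linear_mult_right] smooth_on_const]]) simp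
  next
    case False
    show ?thesis
      by (rule smooth_on_subset[of UNIV, OF smooth_on_add[OF open_UNIV
              smooth_on_bounded_linear[OF bounded_linear_mult_right] smooth_on_const]]) simp
  qed
  show ?thesis
    unfolding smooth_curve_iff
  proof (intro exI conjI ballI)
    show "K \<subseteq> ?a -` J" using assms(2) J(1) by blast
    show "open (?a -` J)" using op J(2) by blast
    show "continuous_on (?a -` J) (\<lambda>t. \<beta> (?a t))"
      by (rule continuous_on_compose2[OF J(3) ca]) auto
    fix d assume d: "d \<in> atlas X"
    have "{t \<in> ?a -` J. \<beta> (?a t) \<in> chart_dom d} = ?a -` {t \<in> J. \<beta> t \<in> chart_dom d}" by auto
    then show "smooth_on {t \<in> ?a -` J. \<beta> (?a t) \<in> chart_dom d} (\<lambda>t. chart_map d (\<beta> (?a t)))"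
      using smooth_on_compose[OF op[OF J(6)[OF d]] sa J(6)[OF d] J(5)[OF d]] by auto
  next
    fix t assume "t \<in> K"
    then show "\<beta> (?a t) = \<gamma> (?a t)" using assms(2) J(4) by blast
  qed
qed

lemma geodesic_affine:
  assumes "geodesic X UNIV \<gamma>" "no_isolated K"
  shows "geodesic X K (\<lambda>t. \<gamma> (m * t + b))"
proof -
  have "smooth_curve (atlas X) UNIV \<gamma>" using assms(1) unfolding geodesic_def by blast
  then show ?thesis
    using weak_imp_geodesic[OF weak_geodesic_affine(1)[OF geodesic_imp_weak[OF assms(1) no_isolated_UNIV]] assms(2)]
      smooth_curve_affine assms(2) by blast
qed

end

section \<open>The geodesic flow\<close>

definition geodesic_state ::
    "real set \<Rightarrow> (real \<Rightarrow> 'a) \<Rightarrow> ('a, 'e::euclidean_space) chart \<Rightarrow> real \<Rightarrow> 'e \<times> 'e" where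
  "geodesic_state I \<gamma> c t = (chart_map c (\<gamma> t), chart_velocity I \<gamma> c t)"

lemma isCont_eventually_nhds:
  assumes "isCont f x" "open S" "f x \<in> S"
  shows "eventually (\<lambda>y. f y \<in> S) (nhds x)"
proof -
  have "(f \<longlongrightarrow> f x) (nhds x)" using assms(1) unfolding isCont_def tendsto_at_iff_tendsto_nhds .
  from topological_tendstoD[OF this assms(2,3)] show ?thesis .
qed

section \<open>Uniqueness of geodesics and strict differentiability of the flow within a
  chart\<close>

context riem
begin

abbreviation spr :: "('a, 'e) chart \<Rightarrow> 'e \<times> 'e \<Rightarrow> 'e \<times> 'e" where
  "spr c \<equiv> metric_patch.spray (coord_metric X c)"

abbreviation dspr :: "('a, 'e) chart \<Rightarrow> 'e \<times> 'e \<Rightarrow> 'e \<times> 'e \<Rightarrow> 'e \<times> 'e" where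
  "dspr c \<equiv> metric_patch.dspray (coord_metric X c)"

lemma state_derivative:
  assumes "weak_geodesic X I \<gamma>" "t \<in> I" "c \<in> atlas X" "\<gamma> t \<in> chart_dom c"
  shows "(geodesic_state I \<gamma> c has_vector_derivative spr c (geodesic_state I \<gamma> c t)) (at t within I)"
proof -
  interpret P: metric_patch "chart_img c" "coord_metric X c" by (rule metric_patch[OF assms(3)])
  have "((\<lambda>s. chart_map c (\<gamma> s)) has_vector_derivative chart_velocity I \<gamma> c t) (at t within I)"
    "(chart_velocity I \<gamma> c has_vector_derivative
       - christoffel X c (chart_map c (\<gamma> t)) (chart_velocity I \<gamma> c t) (chart_velocity I \<gamma> c t)) (at t within I)"
    using assms unfolding weak_geodesic_def by blast+
  from has_vector_derivative_Pair[OF this] show ?thesis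
    unfolding geodesic_state_def[abs_def] P.spray_def by (simp add: christoffel_eq_chris)
qed

lemma weak_geodesic_continuous: "weak_geodesic X I \<gamma> \<Longrightarrow> continuous_on I \<gamma>"
  unfolding weak_geodesic_def by blast

lemma weak_geodesic_subset:
  assumes "weak_geodesic X I \<gamma>" "K \<subseteq> I" "no_isolated K"
  shows "weak_geodesic X K \<gamma>"
    and "\<And>t c. t \<in> K \<Longrightarrow> c \<in> atlas X \<Longrightarrow> \<gamma> t \<in> chart_dom c \<Longrightarrow> chart_velocity K \<gamma> c t = chart_velocity I \<gamma> c t"
  using weak_geodesic_affine[OF assms(1,3), of 1 0] assms(2) by auto

lemma velocity_change:
  assumes "weak_geodesic X I \<gamma>" "no_isolated I" "t \<in> I"
    "c \<in> atlas X" "d \<in> atlas X" "\<gamma> t \<in> chart_dom c" "\<gamma> t \<in> chart_dom d"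
  shows "chart_velocity I \<gamma> d t =
    frechet_derivative (transition c d) (at (chart_map c (\<gamma> t))) (chart_velocity I \<gamma> c t)"
  using assms weak_geodesic_continuous[OF assms(1)]
  by (intro chart_velocity_eq coord_derivative_change) (auto simp: weak_geodesic_def)

text \<open>On a compact ball one constant \<open>L\<close> bounds the derivative of the spray,
  hence its Lipschitz constant, and also its size, hence the rate at which a state can move.\<close>

lemma spray_ball:
  assumes "c \<in> atlas X" "fst s0 \<in> chart_img c"
  obtains R L S' where "R > 0" "L > 0" "cball s0 R \<subseteq> chart_img c \<times> UNIV"
    "\<forall>s\<in>cball s0 R. (spr c has_derivative blinfun_apply (S' s)) (at s)"
    "\<forall>s\<in>cball s0 R. blinfun_apply (S' s) = dspr c s"
    "continuous_on (cball s0 R) S'" "\<forall>s\<in>cball s0 R. norm (S' s) \<le> L" "\<forall>s\<in>cball s0 R. norm (spr c s) \<le> L"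
proof -
  interpret P: metric_patch "chart_img c" "coord_metric X c" by (rule metric_patch[OF assms(1)])
  have op: "open (chart_img c \<times> (UNIV :: 'e set))" using P.open_U by (simp add: open_Times)
  have "s0 \<in> chart_img c \<times> UNIV" using assms(2) by (cases s0) auto
  then obtain R where R: "R > 0" "cball s0 R \<subseteq> chart_img c \<times> UNIV"
    using op open_contains_cball by meson
  define S' where "S' s = Blinfun (dspr c s)" for s
  have S: "blinfun_apply (S' s) = dspr c s" if "s \<in> chart_img c \<times> UNIV" for s
    unfolding S'_def
    by (rule bounded_linear_Blinfun_apply, rule strict_deriv_bounded_linear[OF P.spray_strict])
      (use that in auto)
  have st: "strict_deriv (spr c) (blinfun_apply (S' s)) s" if "s \<in> chart_img c \<times> UNIV" for s
    unfolding S[OF that] by (rule P.spray_strict) (use that in auto)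
  have cont: "continuous_on (cball s0 R) S'"
    using continuous_on_subset[OF strict_deriv_continuous_derivative[OF op st] R(2)] by blast
  have cont2: "continuous_on (cball s0 R) (spr c)"
    using strict_deriv_isCont[OF st] R(2) by (intro continuous_at_imp_continuous_on) blast
  obtain L1 where L1: "\<forall>s\<in>cball s0 R. norm (S' s) \<le> L1"
    using compact_imp_bounded[OF compact_continuous_image[OF cont compact_cball]]
    unfolding bounded_iff by blast
  obtain L2 where L2: "\<forall>s\<in>cball s0 R. norm (spr c s) \<le> L2"
    using compact_imp_bounded[OF compact_continuous_image[OF cont2 compact_cball]]
    unfolding bounded_iff by blast
  show thesis
  proof (rule that[of R "max 1 (max L1 L2)" S'])
    show "\<forall>s\<in>cball s0 R. (spr c has_derivative blinfun_apply (S' s)) (at s)"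
      using strict_deriv_imp_has_derivative[OF st] R(2) by blast
    show "\<forall>s\<in>cball s0 R. blinfun_apply (S' s) = dspr c s" using S R(2) by blast
    show "\<forall>s\<in>cball s0 R. norm (S' s) \<le> max 1 (max L1 L2)" "\<forall>s\<in>cball s0 R. norm (spr c s) \<le> max 1 (max L1 L2)"
      using L1 L2 by (meson max.coboundedI1 max.coboundedI2)+
  qed (use R cont in auto)
qed

lemma spray_lipschitz:
  assumes "\<forall>s\<in>cball s0 R. (spr c has_derivative blinfun_apply (S' s)) (at s)"
    "\<forall>s\<in>cball s0 R. norm (S' s) \<le> L" "s \<in> cball s0 R" "s' \<in> cball s0 R"
  shows "norm (spr c s - spr c s') \<le> L * norm (s - s')"
  by (rule differentiable_bound[OF convex_cball _ _ assms(3,4), of _ "\<lambda>s. blinfun_apply (S' s)"])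
    (use assms(1,2) in \<open>auto simp: norm_blinfun.rep_eq[symmetric] intro: has_derivative_at_withinI\<close>)

lemma state_continuous:
  assumes "weak_geodesic X I \<gamma>" "t \<in> I" "c \<in> atlas X" "\<gamma> t \<in> chart_dom c"
  shows "continuous (at t within I) (geodesic_state I \<gamma> c)"
  using has_vector_derivative_continuous[OF state_derivative[OF assms]] .

lemma curve_in_dom_near:
  fixes I :: "real set"
  assumes "continuous_on I \<gamma>" "t \<in> I" "c \<in> atlas X" "\<gamma> t \<in> chart_dom c"
  obtains d where "d > 0" "\<And>s. s \<in> I \<Longrightarrow> \<bar>s - t\<bar> < d \<Longrightarrow> \<gamma> s \<in> chart_dom c"
proof -
  obtain T where T: "open T" "T \<inter> I = \<gamma> -` chart_dom c \<inter> I"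
    using assms(1) open_dom[OF assms(3)] unfolding continuous_on_open_invariant by metis
  have "t \<in> T" using T(2) assms by blast
  then obtain d where "d > 0" "ball t d \<subseteq> T" using T(1) openE by blast
  then show thesis using that[of d] T(2) by (auto simp: dist_real_def abs_minus_commute subset_iff)
qed

lemma state_in_ball_near:
  assumes "weak_geodesic X I \<gamma>" "t \<in> I" "c \<in> atlas X" "\<gamma> t \<in> chart_dom c" "dist (geodesic_state I \<gamma> c t) s0 < r"
  obtains d where "d > 0" "\<And>s. s \<in> I \<Longrightarrow> \<bar>s - t\<bar> < d \<Longrightarrow> \<gamma> s \<in> chart_dom c \<and> geodesic_state I \<gamma> c s \<in> ball s0 r"
proof -
  obtain d1 where d1: "d1 > 0" "\<And>s. s \<in> I \<Longrightarrow> \<bar>s - t\<bar> < d1 \<Longrightarrow> \<gamma> s \<in> chart_dom c"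
    using curve_in_dom_near[OF weak_geodesic_continuous[OF assms(1)] assms(2-4)] by blast
  define e where "e = r - dist (geodesic_state I \<gamma> c t) s0"
  have "e > 0" using assms(5) unfolding e_def by simp
  then obtain d2 where d2: "d2 > 0" "\<And>s. s \<in> I \<Longrightarrow> dist s t < d2 \<Longrightarrow> dist (geodesic_state I \<gamma> c s) (geodesic_state I \<gamma> c t) < e"
    using state_continuous[OF assms(1-4)] unfolding continuous_within_eps_delta by blast
  have "geodesic_state I \<gamma> c s \<in> ball s0 r" if "s \<in> I" "\<bar>s - t\<bar> < d2" for s
    using d2(2)[of s] that dist_triangle[of "geodesic_state I \<gamma> c s" s0 "geodesic_state I \<gamma> c t"]
    unfolding e_def by (auto simp: dist_real_def dist_commute)
  then show thesis using that[of "min d1 d2"] d1 d2(1) by auto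
qed

text \<open>Continuous induction on agreement of position and velocity. The step is Gronwall's
  inequality in one chart; the limit uses that the manifold is Hausdorff and that states are
  continuous.\<close>

lemma weak_geodesic_unique:
  assumes ab: "a < b" and geo: "weak_geodesic X {a..b} \<gamma>" "weak_geodesic X {a..b} \<delta>"
    and start: "\<gamma> a = \<delta> a" "c \<in> atlas X" "\<gamma> a \<in> chart_dom c"
      "chart_velocity {a..b} \<gamma> c a = chart_velocity {a..b} \<delta> c a"
    and t: "t \<in> {a..b}"
  shows "\<gamma> t = \<delta> t"
proof -
  let ?I = "{a..b}"
  note ni = no_isolated_atLeastAtMost[OF ab]
  have change: "\<forall>d\<in>atlas X. \<gamma> t \<in> chart_dom d \<longrightarrow> chart_velocity ?I \<gamma> d t = chart_velocity ?I \<delta> d t"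
    if "t \<in> ?I" "\<gamma> t = \<delta> t" "c \<in> atlas X" "\<gamma> t \<in> chart_dom c"
      "chart_velocity ?I \<gamma> c t = chart_velocity ?I \<delta> c t" for t c
  proof (intro ballI impI)
    fix d assume d: "d \<in> atlas X" "\<gamma> t \<in> chart_dom d"
    show "chart_velocity ?I \<gamma> d t = chart_velocity ?I \<delta> d t"
      using velocity_change[OF geo(1) ni that(1,3) d(1) that(4) d(2)]
        velocity_change[OF geo(2) ni that(1,3) d(1)] that d(2) by simp
  qed
  \<comment> \<open>Agreement of velocities is required in all charts, so that each step can choose
    a chart around the current point.\<close>
  define P where "P t \<longleftrightarrow> \<gamma> t = \<delta> t \<and>
      (\<forall>d\<in>atlas X. \<gamma> t \<in> chart_dom d \<longrightarrow> chart_velocity ?I \<gamma> d t = chart_velocity ?I \<delta> d t)" for t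
  have "P t"
    using less_imp_le[OF ab] t
  proof (rule interval_induct[where P = P])
    show "P a" unfolding P_def using change[OF _ start] start(1) ab by auto
  next
    fix t assume t: "a \<le> t" "t < b" "P t"
    then have tI: "t \<in> ?I" by simp
    obtain c where c: "c \<in> atlas X" "\<gamma> t \<in> chart_dom c" by (rule ex_chart)
    have eq: "geodesic_state ?I \<gamma> c t = geodesic_state ?I \<delta> c t"
      using t(3) c unfolding P_def geodesic_state_def by auto
    define s0 where "s0 = geodesic_state ?I \<gamma> c t"
    have c': "\<delta> t \<in> chart_dom c" using t(3) c unfolding P_def by simp
    have "fst s0 \<in> chart_img c" using c unfolding s0_def geodesic_state_def by auto
    then obtain R L S' where R: "R > 0" "L > 0"
      and S: "\<forall>s\<in>cball s0 R. (spr c has_derivative blinfun_apply (S' s)) (at s)" "\<forall>s\<in>cball s0 R. norm (S' s) \<le> L"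
      using spray_ball[OF c(1)] by metis
    have lt: "dist (geodesic_state ?I \<gamma> c t) s0 < R" "dist (geodesic_state ?I \<delta> c t) s0 < R"
      using R(1) eq unfolding s0_def by auto
    obtain d1 where d1: "d1 > 0" "\<And>s. s \<in> ?I \<Longrightarrow> \<bar>s - t\<bar> < d1 \<Longrightarrow> \<gamma> s \<in> chart_dom c \<and> geodesic_state ?I \<gamma> c s \<in> ball s0 R"
      using state_in_ball_near[OF geo(1) tI c lt(1)] by blast
    obtain d2 where d2: "d2 > 0" "\<And>s. s \<in> ?I \<Longrightarrow> \<bar>s - t\<bar> < d2 \<Longrightarrow> \<delta> s \<in> chart_dom c \<and> geodesic_state ?I \<delta> c s \<in> ball s0 R"
      using state_in_ball_near[OF geo(2) tI c(1) c' lt(2)] by blast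
    define d where "d = min (min d1 d2) (1 / (2 * L))"
    have d: "d > 0" using d1(1) d2(1) R(2) unfolding d_def by simp
    have "P s" if s: "t < s" "s < t + d" "s \<le> b" for s
    proof -
      have sub: "{t..s} \<subseteq> ?I" using t s by auto
      have near: "\<gamma> r \<in> chart_dom c" "\<delta> r \<in> chart_dom c" "geodesic_state ?I \<gamma> c r \<in> cball s0 R" "geodesic_state ?I \<delta> c r \<in> cball s0 R"
        if "r \<in> {t..s}" for r
      proof -
        have "r \<in> ?I" "\<bar>r - t\<bar> < d1" "\<bar>r - t\<bar> < d2" using that s sub unfolding d_def by auto
        then show "\<gamma> r \<in> chart_dom c" "\<delta> r \<in> chart_dom c"
          "geodesic_state ?I \<gamma> c r \<in> cball s0 R" "geodesic_state ?I \<delta> c r \<in> cball s0 R"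
          using d1(2) d2(2) ball_subset_cball by blast+
      qed
      have "norm (geodesic_state ?I \<gamma> c s - geodesic_state ?I \<delta> c s)
          \<le> 2 * norm (geodesic_state ?I \<gamma> c t - geodesic_state ?I \<delta> c t) + 2 * (s - t) * 0"
      proof (rule short_Gronwall[where L = L])
        show "L * (s - t) \<le> 1/2"
        proof -
          have "L * (s - t) \<le> L * (1 / (2 * L))"
            using s R(2) unfolding d_def by (intro mult_left_mono) auto
          then show ?thesis using R(2) by simp
        qed
        fix r assume r: "r \<in> {t..s}"
        then have rI: "r \<in> ?I" using sub by blast
        show "((\<lambda>r. geodesic_state ?I \<gamma> c r - geodesic_state ?I \<delta> c r) has_vector_derivative
            spr c (geodesic_state ?I \<gamma> c r) - spr c (geodesic_state ?I \<delta> c r)) (at r within {t..s})"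
          by (intro has_vector_derivative_diff has_vector_derivative_within_subset[OF _ sub]
              state_derivative[OF geo(1) rI c(1) near(1)[OF r]] state_derivative[OF geo(2) rI c(1) near(2)[OF r]])
        show "norm (spr c (geodesic_state ?I \<gamma> c r) - spr c (geodesic_state ?I \<delta> c r))
            \<le> L * norm (geodesic_state ?I \<gamma> c r - geodesic_state ?I \<delta> c r) + 0"
          using spray_lipschitz[OF S near(3,4)[OF r]] by simp
      qed (use s R(2) in auto)
      then have eqs: "geodesic_state ?I \<gamma> c s = geodesic_state ?I \<delta> c s" using eq by simp
      have dom: "\<gamma> s \<in> chart_dom c" "\<delta> s \<in> chart_dom c" "s \<in> ?I" using near[of s] s sub by auto
      have "chart_map c (\<gamma> s) = chart_map c (\<delta> s)" using eqs unfolding geodesic_state_def by blast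
      from arg_cong[OF this, of "chart_inv c"] have e1: "\<gamma> s = \<delta> s"
        unfolding inv_map[OF c(1) dom(1)] inv_map[OF c(1) dom(2)] .
      have e2: "chart_velocity ?I \<gamma> c s = chart_velocity ?I \<delta> c s"
        using eqs unfolding geodesic_state_def by blast
      show ?thesis unfolding P_def using e1 change[OF dom(3) e1 c(1) dom(1) e2] by blast
    qed
    then show "\<exists>d>0. \<forall>s. t < s \<and> s < t + d \<and> s \<le> b \<longrightarrow> P s" using d by blast
  next
    fix t assume t: "a < t" "t \<le> b" "\<And>s. a \<le> s \<Longrightarrow> s < t \<Longrightarrow> P s"
    then have tI: "t \<in> ?I" by simp
    have ntl: "at t within {a..<t} \<noteq> bot" using t(1) by (simp add: trivial_limit_within)
    have sub: "{a..<t} \<subseteq> ?I" using t(2) by auto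
    have ev: "eventually (\<lambda>s. P s) (at t within {a..<t})"
      using t(3) by (auto simp: eventually_at_filter)
    have lim: "((\<lambda>s. \<zeta> s) \<longlongrightarrow> \<zeta> t) (at t within {a..<t})" if "continuous_on ?I \<zeta>" for \<zeta> :: "real \<Rightarrow> 'a"
      using tendsto_within_subset[OF _ sub] that tI unfolding continuous_on_def by blast
    have "(\<gamma> \<longlongrightarrow> \<delta> t) (at t within {a..<t})"
      by (rule Lim_transform_eventually[OF lim[OF weak_geodesic_continuous[OF geo(2)]]])
        (use ev in eventually_elim, simp add: P_def)
    from tendsto_unique[OF ntl lim[OF weak_geodesic_continuous[OF geo(1)]] this]
    have e1: "\<gamma> t = \<delta> t" .
    obtain c where c: "c \<in> atlas X" "\<gamma> t \<in> chart_dom c" by (rule ex_chart)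
    have c': "\<delta> t \<in> chart_dom c" using c e1 by simp
    have l1: "(geodesic_state ?I \<gamma> c \<longlongrightarrow> geodesic_state ?I \<gamma> c t) (at t within {a..<t})"
      using state_continuous[OF geo(1) tI c] tendsto_within_subset[OF _ sub] unfolding continuous_within by blast
    have l2: "(geodesic_state ?I \<delta> c \<longlongrightarrow> geodesic_state ?I \<delta> c t) (at t within {a..<t})"
      using state_continuous[OF geo(2) tI c(1) c'] tendsto_within_subset[OF _ sub] unfolding continuous_within by blast
    have "eventually (\<lambda>s. \<gamma> s \<in> chart_dom c) (at t within {a..<t})"
      using topological_tendstoD[OF lim[OF weak_geodesic_continuous[OF geo(1)]] open_dom[OF c(1)] c(2)] .
    with ev have "eventually (\<lambda>s. geodesic_state ?I \<delta> c s = geodesic_state ?I \<gamma> c s) (at t within {a..<t})"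
      by eventually_elim (auto simp: P_def geodesic_state_def c)
    from tendsto_unique[OF ntl l1 Lim_transform_eventually[OF l2 this]]
    have "chart_velocity ?I \<gamma> c t = chart_velocity ?I \<delta> c t" unfolding geodesic_state_def by simp
    from change[OF tI e1 c this] show "P t" unfolding P_def using e1 by blast
  qed
  then show ?thesis unfolding P_def by blast
qed

text \<open>Up to time \<open>t0 + d\<close> a state of speed at most \<open>L\<close> covers at
  most \<open>R/4\<close>, so from within \<open>R/2\<close> of the centre it cannot leave the ball.
  The curve must also be kept inside the chart, where the state has a meaning; hence the two clauses
  of \<open>P\<close>.\<close>

lemma state_stays:
  assumes c: "c \<in> atlas X" and R: "R > 0" "L > 0" "cball s0 R \<subseteq> chart_img c \<times> UNIV"
    "\<forall>s\<in>cball s0 R. norm (spr c s) \<le> L"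
    and geo: "weak_geodesic X UNIV \<gamma>" and t0: "\<gamma> t0 \<in> chart_dom c" "geodesic_state UNIV \<gamma> c t0 \<in> ball s0 (R/2)"
    and d: "0 \<le> d" "L * d \<le> R/4" and t: "t \<in> {t0..t0 + d}"
  shows "\<gamma> t \<in> chart_dom c \<and> geodesic_state UNIV \<gamma> c t \<in> cball s0 R"
proof -
  let ?s = "geodesic_state UNIV \<gamma> c"
  define P where "P t \<longleftrightarrow> \<gamma> t \<in> chart_dom c \<and> norm (?s t - ?s t0) \<le> L * (t - t0)" for t
  have in_ball: "?s t \<in> ball s0 R" if "P t" "t \<le> t0 + d" for t
  proof -
    have "L * (t - t0) \<le> L * d" using that(2) R(2) by simp
    then have "dist (?s t) (?s t0) \<le> R/4" using that(1) d(2) unfolding P_def by (simp add: dist_norm)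
    moreover have "dist (?s t0) s0 < R/2" using t0(2) by (simp add: dist_commute)
    ultimately have "dist (?s t) s0 < R"
      using dist_triangle[of "?s t" s0 "?s t0"] R(1) by linarith
    then show ?thesis by (simp add: dist_commute)
  qed
  have "t0 \<le> t0 + d" using d(1) by simp
  then have "P t"
    using t
  proof (rule interval_induct[where P = P])
    show "P t0" unfolding P_def using t0(1) by simp
  next
    fix t assume t: "t0 \<le> t" "t < t0 + d" "P t"
    have "dist (?s t) s0 < R" using in_ball[OF t(3)] t(2) by (simp add: dist_commute)
    then obtain e where e: "e > 0" "\<And>s. \<bar>s - t\<bar> < e \<Longrightarrow> \<gamma> s \<in> chart_dom c \<and> ?s s \<in> ball s0 R"
      using state_in_ball_near[OF geo UNIV_I c] t(3) unfolding P_def by (metis UNIV_I)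
    have "P s" if s: "t < s" "s < t + e" for s
    proof -
      have "norm (?s s - ?s t) \<le> L * \<bar>s - t\<bar>"
      proof (rule vector_derivative_bound[of t s ?s "\<lambda>r. spr c (?s r)"])
        fix r assume r: "r \<in> {t..s}"
        then have r': "\<gamma> r \<in> chart_dom c" "?s r \<in> cball s0 R" using e(2)[of r] s by auto
        show "(?s has_vector_derivative spr c (?s r)) (at r within {t..s})"
          by (rule has_vector_derivative_within_subset[OF state_derivative[OF geo UNIV_I c r'(1)]]) simp
        show "norm (spr c (?s r)) \<le> L" using R(4) r'(2) by blast
      qed (use s in auto)
      moreover have "norm (?s s - ?s t0) \<le> norm (?s s - ?s t) + norm (?s t - ?s t0)"
        using norm_triangle_ineq[of "?s s - ?s t" "?s t - ?s t0"] by simp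
      ultimately have "norm (?s s - ?s t0) \<le> L * (s - t0)"
        using t(3) s unfolding P_def by (simp add: algebra_simps)
      then show ?thesis unfolding P_def using e(2)[of s] s by simp
    qed
    then show "\<exists>e>0. \<forall>s. t < s \<and> s < t + e \<and> s \<le> t0 + d \<longrightarrow> P s" using e(1) by blast
  next
    fix t assume t: "t0 < t" "t \<le> t0 + d" "\<And>s. t0 \<le> s \<Longrightarrow> s < t \<Longrightarrow> P s"
    have ntl: "at t within {t0..<t} \<noteq> bot" using t(1) by (simp add: trivial_limit_within)
    \<comment> \<open>The points whose coordinates come from the ball form a compact, hence closed
      set; it contains the limit of the curve and lies inside the chart.\<close>
    define C where "C = chart_inv c ` (fst ` cball s0 R)"
    have img: "fst ` cball s0 R \<subseteq> chart_img c" using R(3) by auto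
    have "compact C" unfolding C_def
      by (intro compact_continuous_image continuous_on_subset[OF cont_inv[OF c] img] compact_cball
          continuous_on_fst continuous_on_id)
    then have "closed C" by (rule compact_imp_closed)
    have inC: "\<gamma> s \<in> C" if "P s" "s \<le> t0 + d" for s
    proof -
      have "chart_map c (\<gamma> s) \<in> fst ` cball s0 R"
        using in_ball[OF that] image_eqI[of "chart_map c (\<gamma> s)" fst "?s s" "cball s0 R"]
        unfolding geodesic_state_def by simp
      then show ?thesis unfolding C_def using inv_map[OF c, of "\<gamma> s"] that(1) unfolding P_def by force
    qed
    have lim: "(\<gamma> \<longlongrightarrow> \<gamma> t) (at t within {t0..<t})"
      using weak_geodesic_continuous[OF geo] tendsto_within_subset[OF _ subset_UNIV] unfolding continuous_on_def by blast
    have "eventually (\<lambda>s. s \<in> {t0..<t}) (at t within {t0..<t})" by (simp add: eventually_at_filter)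
    then have "eventually (\<lambda>s. \<gamma> s \<in> C) (at t within {t0..<t})"
      by eventually_elim (use t inC in auto)
    from Lim_in_closed_set[OF \<open>closed C\<close> this ntl lim] have "\<gamma> t \<in> C" .
    then have dom: "\<gamma> t \<in> chart_dom c" unfolding C_def using img inv_dom[OF c] by auto
    have lims: "(?s \<longlongrightarrow> ?s t) (at t within {t0..<t})"
      using state_continuous[OF geo UNIV_I c dom] tendsto_within_subset[OF _ subset_UNIV]
      unfolding continuous_within by blast
    have "norm (?s t - ?s t0) \<le> L * (t - t0)"
    proof (rule tendsto_le[OF ntl])
      show "((\<lambda>s. norm (?s s - ?s t0)) \<longlongrightarrow> norm (?s t - ?s t0)) (at t within {t0..<t})"
        by (intro tendsto_intros lims)
      show "((\<lambda>s. L * (s - t0)) \<longlongrightarrow> L * (t - t0)) (at t within {t0..<t})"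
        by (intro tendsto_intros)
      show "eventually (\<lambda>s. norm (?s s - ?s t0) \<le> L * (s - t0)) (at t within {t0..<t})"
        using t(3) by (auto simp: eventually_at_filter P_def)
    qed
    with dom show "P t" unfolding P_def by blast
  qed
  then show ?thesis using in_ball[of t] t unfolding P_def by auto
qed

text \<open>\<open>r\<close> and \<open>\<delta>\<close> depend only on the chart and on
  \<open>s0\<close>, not on \<open>t0\<close>. This uniformity allows the limit step of the
  continuation to start shortly before the limit time and to reach it.\<close>

lemma local_geodesic_flow:
  assumes c: "c \<in> atlas X" and s0: "fst s0 \<in> chart_img c"
  obtains r \<delta> where "r > 0" "\<delta> > 0"
    "\<And>\<gamma> (w0::'w::real_normed_vector) t0 D0.
      (\<And>w. weak_geodesic X UNIV (\<gamma> w)) \<Longrightarrow>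
      geodesic_state UNIV (\<gamma> w0) c t0 \<in> ball s0 r \<Longrightarrow>
      eventually (\<lambda>w. \<gamma> w t0 \<in> chart_dom c) (nhds w0) \<Longrightarrow>
      strict_deriv (\<lambda>w. geodesic_state UNIV (\<gamma> w) c t0) (blinfun_apply D0) w0 \<Longrightarrow>
      \<exists>D :: real \<Rightarrow> 'w \<Rightarrow>\<^sub>L ('e \<times> 'e). \<forall>t\<in>{t0..t0 + \<delta>}.
        eventually (\<lambda>w. \<gamma> w t \<in> chart_dom c) (nhds w0) \<and>
        strict_deriv (\<lambda>w. geodesic_state UNIV (\<gamma> w) c t) (blinfun_apply (D t)) w0 \<and>
        (\<forall>a. ((\<lambda>t. D t a) has_vector_derivative dspr c (geodesic_state UNIV (\<gamma> w0) c t) (D t a)) (at t within {t0..t0 + \<delta>}))"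
proof -
  obtain R L S' where R: "R > 0" "L > 0" "cball s0 R \<subseteq> chart_img c \<times> UNIV"
    and S: "\<forall>s\<in>cball s0 R. (spr c has_derivative blinfun_apply (S' s)) (at s)"
    "\<forall>s\<in>cball s0 R. blinfun_apply (S' s) = dspr c s"
    "continuous_on (cball s0 R) S'" "\<forall>s\<in>cball s0 R. norm (S' s) \<le> L" "\<forall>s\<in>cball s0 R. norm (spr c s) \<le> L"
    by (rule spray_ball[OF c s0])
  \<comment> \<open>The first entry keeps the states in the ball by \<open>state_stays\<close>; the
    second is the short-interval condition of \<open>strict_deriv_flow\<close>.\<close>
  define \<delta> where "\<delta> = min (R / (4 * L)) (1 / (2 * L))"
  have \<delta>: "\<delta> > 0" "L * \<delta> \<le> R/4" "L * \<delta> \<le> 1/2"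
  proof -
    show "\<delta> > 0" using R(1,2) unfolding \<delta>_def by simp
    have "L * \<delta> \<le> L * (R / (4 * L))" "L * \<delta> \<le> L * (1 / (2 * L))"
      using R(2) unfolding \<delta>_def by (intro mult_left_mono; simp)+
    then show "L * \<delta> \<le> R/4" "L * \<delta> \<le> 1/2" using R(2) by auto
  qed
  show thesis
  proof (rule that[of "R/2" \<delta>])
    fix \<gamma> and w0 :: 'w and t0 D0
    assume geo: "\<And>w. weak_geodesic X UNIV (\<gamma> w)"
      and init: "geodesic_state UNIV (\<gamma> w0) c t0 \<in> ball s0 (R/2)"
        "eventually (\<lambda>w. \<gamma> w t0 \<in> chart_dom c) (nhds w0)"
        "strict_deriv (\<lambda>w. geodesic_state UNIV (\<gamma> w) c t0) (blinfun_apply D0) w0"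
    have "eventually (\<lambda>w. geodesic_state UNIV (\<gamma> w) c t0 \<in> ball s0 (R/2)) (nhds w0)"
      by (rule isCont_eventually_nhds[OF strict_deriv_isCont[OF init(3)] open_ball init(1)])
    with init(2) have ev: "eventually (\<lambda>w. \<forall>t\<in>{t0..t0 + \<delta>}. \<gamma> w t \<in> chart_dom c \<and> geodesic_state UNIV (\<gamma> w) c t \<in> cball s0 R) (nhds w0)"
    proof eventually_elim
      case (elim w)
      show ?case
        by (intro ballI state_stays[OF c R S(5) geo elim less_imp_le[OF \<delta>(1)] \<delta>(2)])
    qed
    have w0: "\<gamma> w0 t \<in> chart_dom c \<and> geodesic_state UNIV (\<gamma> w0) c t \<in> cball s0 R" if "t \<in> {t0..t0 + \<delta>}" for t
      using eventually_nhds_x_imp_x[OF ev] that by blast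
    obtain D :: "real \<Rightarrow> 'w \<Rightarrow>\<^sub>L ('e \<times> 'e)" where D: "D t0 = D0"
      "\<And>t. t \<in> {t0..t0+\<delta>} \<Longrightarrow> strict_deriv (\<lambda>w. geodesic_state UNIV (\<gamma> w) c t) (D t) w0"
      "\<And>t. t \<in> {t0..t0+\<delta>} \<Longrightarrow> (D has_vector_derivative S' (geodesic_state UNIV (\<gamma> w0) c t) o\<^sub>L D t) (at t within {t0..t0+\<delta>})"
    proof (rule strict_deriv_flow[of t0 "t0 + \<delta>" L "cball s0 R" "spr c" S' "\<lambda>w. geodesic_state UNIV (\<gamma> w) c" w0 D0])
      show "(spr c has_derivative blinfun_apply (S' s)) (at s within cball s0 R)" if "s \<in> cball s0 R" for s
        using S(1) that has_derivative_at_withinI by blast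
      show "eventually (\<lambda>w. \<forall>t\<in>{t0..t0 + \<delta>}. geodesic_state UNIV (\<gamma> w) c t \<in> cball s0 R \<and>
          (geodesic_state UNIV (\<gamma> w) c has_vector_derivative spr c (geodesic_state UNIV (\<gamma> w) c t)) (at t within {t0..t0+\<delta>})) (nhds w0)"
        using ev
      proof eventually_elim
        case (elim w)
        show ?case
        proof
          fix t assume "t \<in> {t0..t0 + \<delta>}"
          with elim have "\<gamma> w t \<in> chart_dom c" "geodesic_state UNIV (\<gamma> w) c t \<in> cball s0 R" by auto
          with has_vector_derivative_within_subset[OF state_derivative[OF geo UNIV_I c], of w t "{t0..t0+\<delta>}"]
          show "geodesic_state UNIV (\<gamma> w) c t \<in> cball s0 R \<and>
          (geodesic_state UNIV (\<gamma> w) c has_vector_derivative spr c (geodesic_state UNIV (\<gamma> w) c t)) (at t within {t0..t0+\<delta>})"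
            by auto
        qed
      qed
    qed (use \<delta> R S init(3) in auto)
    show "\<exists>D :: real \<Rightarrow> 'w \<Rightarrow>\<^sub>L ('e \<times> 'e). \<forall>t\<in>{t0..t0 + \<delta>}.
        eventually (\<lambda>w. \<gamma> w t \<in> chart_dom c) (nhds w0) \<and>
        strict_deriv (\<lambda>w. geodesic_state UNIV (\<gamma> w) c t) (blinfun_apply (D t)) w0 \<and>
        (\<forall>a. ((\<lambda>t. D t a) has_vector_derivative dspr c (geodesic_state UNIV (\<gamma> w0) c t) (D t a)) (at t within {t0..t0 + \<delta>}))"
    proof (intro exI[of _ D] ballI conjI allI)
      fix t assume t: "t \<in> {t0..t0 + \<delta>}"
      show "eventually (\<lambda>w. \<gamma> w t \<in> chart_dom c) (nhds w0)"
        using ev by eventually_elim (use t in blast)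
      show "strict_deriv (\<lambda>w. geodesic_state UNIV (\<gamma> w) c t) (blinfun_apply (D t)) w0" by (rule D(2)[OF t])
      fix a
      show "((\<lambda>t. D t a) has_vector_derivative dspr c (geodesic_state UNIV (\<gamma> w0) c t) (D t a)) (at t within {t0..t0 + \<delta>})"
        using bounded_linear.has_vector_derivative[OF blinfun.bounded_linear_left D(3)[OF t], of a] S(2) w0[OF t]
        by simp
    qed
  qed (use R \<delta> in auto)
qed

end

section \<open>The exponential map of a Hadamard manifold\<close>

text \<open>Convexity of \<open>\<surd>(j + e)\<close> for every \<open>e > 0\<close> avoids the zeros of \<open>j\<close>.\<close>

lemma sqrt_le_of_convexity:
  fixes j :: "real \<Rightarrow> real"
  assumes j0: "j 0 = 0" "continuous (at 0 within {0..}) j"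
    and loc: "\<And>t. t > 0 \<Longrightarrow> \<exists>l u f1 f2. l < t \<and> t < u \<and> (\<forall>s\<in>{l<..<u}. (j has_real_derivative f1 s) (at s)
      \<and> (f1 has_real_derivative f2 s) (at s) \<and> f2 s \<ge> 0 \<and> (f1 s)\<^sup>2 \<le> 2 * j s * f2 s \<and> j s \<ge> 0)"
    and t: "t \<in> {0..1}"
  shows "sqrt (j t) \<le> t * sqrt (j 1)"
proof -
  have jn: "j t \<ge> 0" if "t \<ge> 0" for t
  proof (cases "t = 0")
    case False
    with that obtain l u f1 f2 where "l < t" "t < u" "\<forall>s\<in>{l<..<u}. (j has_real_derivative f1 s) (at s)
      \<and> (f1 has_real_derivative f2 s) (at s) \<and> f2 s \<ge> 0 \<and> (f1 s)\<^sup>2 \<le> 2 * j s * f2 s \<and> j s \<ge> 0"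
      using loc[of t] by auto
    then show ?thesis by auto
  qed (use j0 in simp)
  have key: "sqrt (j t + e) \<le> (1 - t) * sqrt e + t * sqrt (j 1 + e)" if e: "e > 0" for e
  proof -
    define h where "h s = sqrt (j s + e)" for s
    have ders: "DERIV h s :> deriv h s \<and> (\<exists>D\<ge>0. DERIV (deriv h) s :> D)" if s: "s > 0" for s
    proof -
      obtain l u f1 f2 where lu: "l < s" "s < u" and f': "\<forall>r\<in>{l<..<u}. (j has_real_derivative f1 r) (at r)
        \<and> (f1 has_real_derivative f2 r) (at r) \<and> f2 r \<ge> 0 \<and> (f1 r)\<^sup>2 \<le> 2 * j r * f2 r \<and> j r \<ge> 0"
        using loc[OF s] by blast
      note f = f'[rule_format]
      have dh: "DERIV h r :> f1 r / (2 * sqrt (j r + e))" if "r \<in> {l<..<u}" for r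
        unfolding h_def using f[OF that] e
        by (auto intro!: derivative_eq_intros simp: field_simps)
      have dh': "deriv h r = f1 r / (2 * sqrt (j r + e))" if "r \<in> {l<..<u}" for r
        by (rule DERIV_imp_deriv[OF dh[OF that]])
      have si: "s \<in> {l<..<u}" using lu by simp
      define q where "q = sqrt (j s + e)"
      have q: "q > 0" "q\<^sup>2 = j s + e" unfolding q_def using f[OF si] e by auto
      \<comment> \<open>The second derivative of \<open>sqrt (j + e)\<close> at \<open>s\<close>;
        its sign is read off from the bound on \<open>(f1 s)\<^sup>2\<close>.\<close>
      define D where "D = (2 * (j s + e) * f2 s - (f1 s)\<^sup>2) / (4 * q ^ 3)"
      have "((\<lambda>r. f1 r / (2 * sqrt (j r + e))) has_real_derivative
          (f2 s * (2 * q) - f1 s * (2 * (f1 s / (2 * q)))) / ((2 * q) * (2 * q))) (at s)"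
        using f[OF si] e unfolding q_def
        by (auto intro!: derivative_eq_intros simp: divide_simps)
      also have "(f2 s * (2 * q) - f1 s * (2 * (f1 s / (2 * q)))) / ((2 * q) * (2 * q)) = D"
        unfolding D_def q(2)[symmetric] using q(1) by (simp add: divide_simps power2_eq_square power3_eq_cube)
      finally have "DERIV (\<lambda>r. f1 r / (2 * sqrt (j r + e))) s :> D" .
      then have "DERIV (deriv h) s :> D"
        by (rule has_field_derivative_transform_within_open[of _ _ _ "{l<..<u}"]) (use si dh' in auto)
      moreover have "D \<ge> 0"
      proof -
        have "(f1 s)\<^sup>2 \<le> 2 * j s * f2 s" "2 * j s * f2 s \<le> 2 * (j s + e) * f2 s"
          using f[OF si] e by (auto intro!: mult_right_mono)
        then show ?thesis unfolding D_def using q(1) by simp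
      qed
      ultimately show ?thesis using dh[OF si] dh'[OF si] by auto
    qed
    then obtain h2 where h2: "\<And>s. s > 0 \<Longrightarrow> h2 s \<ge> 0 \<and> DERIV (deriv h) s :> h2 s" by metis
    have conv: "convex_on {0<..} h"
      by (rule f''_ge0_imp_convex[of _ _ "deriv h" h2]) (use ders h2 in auto)
    show ?thesis
    proof (cases "t = 0 \<or> t = 1")
      case True then show ?thesis using j0 by auto
    next
      case False
      with t have t01: "0 < t" "t < 1" by auto
      \<comment> \<open>Convexity is known on \<open>{0<..}\<close>, so it is applied between
        \<open>s\<close> and \<open>1\<close>, and \<open>s\<close> then tends to \<open>0\<close>
        from the right.\<close>
      have ev: "eventually (\<lambda>s. h ((1 - t) * s + t) \<le> (1 - t) * h s + t * h 1) (at_right 0)"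
        using eventually_at_right_less[of 0]
      proof eventually_elim
        case (elim s)
        show ?case using convex_onD[OF conv, of t s 1] t01 elim by simp
      qed
      have c1: "continuous (at t) h"
        using ders[OF t01(1)] DERIV_isCont by blast
      have c0: "(h \<longlongrightarrow> sqrt e) (at_right 0)"
      proof -
        have "(j \<longlongrightarrow> 0) (at 0 within {0..})" using j0 unfolding continuous_within by simp
        then have "(j \<longlongrightarrow> 0) (at_right 0)" by (rule tendsto_within_subset) auto
        then have "((\<lambda>s. sqrt (j s + e)) \<longlongrightarrow> sqrt (0 + e)) (at_right 0)" by (intro tendsto_intros)
        then show ?thesis unfolding h_def by simp
      qed
      have "((\<lambda>s. (1 - t) * s + t) \<longlongrightarrow> (1 - t) * 0 + t) (at_right 0)" by (intro tendsto_intros)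
      then have "((\<lambda>s. h ((1 - t) * s + t)) \<longlongrightarrow> h t) (at_right 0)"
        using isCont_tendsto_compose[OF c1] by simp
      moreover have "((\<lambda>s. (1 - t) * h s + t * h 1) \<longlongrightarrow> (1 - t) * sqrt e + t * h 1) (at_right 0)"
        by (intro tendsto_intros c0)
      ultimately have "h t \<le> (1 - t) * sqrt e + t * h 1"
        using tendsto_le[OF _ _ _ ev] by simp
      then show ?thesis unfolding h_def .
    qed
  qed
  have ev: "eventually (\<lambda>e. sqrt (j t + e) \<le> (1 - t) * sqrt e + t * sqrt (j 1 + e)) (at_right 0)"
    using eventually_at_right_less[of 0] by eventually_elim (rule key)
  have "((\<lambda>e. sqrt (j t + e)) \<longlongrightarrow> sqrt (j t + 0)) (at_right 0)"
    "((\<lambda>e. (1 - t) * sqrt e + t * sqrt (j 1 + e)) \<longlongrightarrow> (1 - t) * sqrt 0 + t * sqrt (j 1 + 0)) (at_right 0)"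
    by (intro tendsto_intros)+
  from tendsto_le[OF _ this(2,1) ev] show ?thesis by simp
qed

section \<open>Change of chart for the flow and constancy of the speed\<close>

context riem
begin

lemma state_chart_change:
  fixes \<gamma> :: "'w::real_normed_vector \<Rightarrow> real \<Rightarrow> 'a"
  assumes geo: "\<And>w. weak_geodesic X UNIV (\<gamma> w)"
    and cd: "c \<in> atlas X" "d \<in> atlas X" "\<gamma> w0 t \<in> chart_dom c" "\<gamma> w0 t \<in> chart_dom d"
    and ev: "eventually (\<lambda>w. \<gamma> w t \<in> chart_dom c) (nhds w0)"
    and D: "strict_deriv (\<lambda>w. geodesic_state UNIV (\<gamma> w) c t) D w0"
  obtains D' where "eventually (\<lambda>w. \<gamma> w t \<in> chart_dom d) (nhds w0)"
    "strict_deriv (\<lambda>w. geodesic_state UNIV (\<gamma> w) d t) D' w0"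
    "\<forall>a. fst (D' a) = frechet_derivative (transition c d) (at (chart_map c (\<gamma> w0 t))) (fst (D a))"
proof -
  let ?\<tau> = "transition c d"
  let ?W = "chart_map c ` (chart_dom c \<inter> chart_dom d)"
  have W: "open ?W" "smooth_on ?W ?\<tau>" using open_overlap transition_smooth cd by auto
  have "isCont (\<lambda>w. chart_map c (\<gamma> w t)) w0"
    using isCont_o2[OF strict_deriv_isCont[OF D] isCont_fst[OF continuous_ident]]
    unfolding geodesic_state_def by simp
  then have "isCont (\<lambda>w. chart_inv c (chart_map c (\<gamma> w t))) w0"
    by (rule isCont_o2) (use isCont_inv cd in auto)
  from isCont_eventually_nhds[OF this open_dom[OF cd(2)]]
  have "eventually (\<lambda>w. chart_inv c (chart_map c (\<gamma> w t)) \<in> chart_dom d) (nhds w0)"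
    using inv_map[OF cd(1,3)] cd(4) by simp
  with ev have ev2: "eventually (\<lambda>w. \<gamma> w t \<in> chart_dom c \<and> \<gamma> w t \<in> chart_dom d) (nhds w0)"
    by eventually_elim (use inv_map[OF cd(1)] in auto)
  \<comment> \<open>The tangent map of the transition, which carries states in \<open>c\<close> to
    states in \<open>d\<close>.\<close>
  define \<Psi> where "\<Psi> s = (?\<tau> (fst s), frechet_derivative ?\<tau> (at (fst s)) (snd s))" for s
  let ?s = "geodesic_state UNIV (\<gamma> w0) c t"
  have fs: "fst ?s = chart_map c (\<gamma> w0 t)" unfolding geodesic_state_def by simp
  have in_W: "fst ?s \<in> ?W" using fs cd by simp
  have \<Psi>: "strict_deriv \<Psi> (\<lambda>k. (frechet_derivative ?\<tau> (at (fst ?s)) (fst k),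
      frechet_derivative (\<lambda>z. frechet_derivative ?\<tau> (at z) (snd ?s)) (at (fst ?s)) (fst k)
       + frechet_derivative ?\<tau> (at (fst ?s)) (snd k))) ?s"
    unfolding \<Psi>_def
  proof (rule strict_deriv_Pair)
    show "strict_deriv (\<lambda>s. ?\<tau> (fst s)) (\<lambda>k. frechet_derivative ?\<tau> (at (fst ?s)) (fst k)) ?s"
      by (rule strict_deriv_compose[OF strict_deriv_of_bounded_linear[OF bounded_linear_fst]
            smooth_on_strict_deriv[OF W in_W]])
    show "strict_deriv (\<lambda>s. frechet_derivative ?\<tau> (at (fst s)) (snd s))
      (\<lambda>k. frechet_derivative (\<lambda>z. frechet_derivative ?\<tau> (at z) (snd ?s)) (at (fst ?s)) (fst k)
       + frechet_derivative ?\<tau> (at (fst ?s)) (snd k)) ?s"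
      using smooth_on_derivative_joint_strict[OF W in_W, of "snd ?s"] by simp
  qed
  have eq: "eventually (\<lambda>w. \<Psi> (geodesic_state UNIV (\<gamma> w) c t) = geodesic_state UNIV (\<gamma> w) d t) (nhds w0)"
    using ev2
  proof eventually_elim
    case (elim w)
    then show ?case
      using velocity_change[OF geo no_isolated_UNIV UNIV_I cd(1,2), of w t] transition_map[OF cd(1), of "\<gamma> w t" d]
      unfolding \<Psi>_def geodesic_state_def by simp
  qed
  show thesis
    by (rule that[OF _ strict_deriv_cong[OF strict_deriv_compose[OF D \<Psi>] eq]])
      (use ev2 in \<open>auto simp: fs elim: eventually_mono\<close>)
qed

text \<open>The covariant derivative of the velocity vanishes, so \<open>g_curve_derivative\<close>
  gives derivative \<open>0\<close> for the squared speed.\<close>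

lemma geodesic_speed_constant:
  assumes geo: "weak_geodesic X UNIV \<gamma>"
  shows "tnorm X (\<gamma> t) (velocity (atlas X) UNIV \<gamma> t) = tnorm X (\<gamma> 0) (velocity (atlas X) UNIV \<gamma> 0)"
proof -
  define S where "S t = (tnorm X (\<gamma> t) (velocity (atlas X) UNIV \<gamma> t))\<^sup>2" for t
  have S: "S t = coord_metric X c (chart_map c (\<gamma> t)) (chart_velocity UNIV \<gamma> c t) (chart_velocity UNIV \<gamma> c t)"
    if "c \<in> atlas X" "\<gamma> t \<in> chart_dom c" for c t
    using tnorm_velocity[OF that UNIV_I weak_geodesic_continuous[OF geo] no_isolated_UNIV, of "chart_velocity UNIV \<gamma> c t"]
      geo that metric_patch.g_nonneg[OF metric_patch[OF that(1)]]
    unfolding S_def nrm_def weak_geodesic_def by auto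
  have "DERIV S t :> 0" for t
  proof -
    obtain c where c: "c \<in> atlas X" "\<gamma> t \<in> chart_dom c" by (rule ex_chart)
    interpret P: metric_patch "chart_img c" "coord_metric X c" by (rule metric_patch[OF c(1)])
    have img: "chart_map c (\<gamma> t) \<in> chart_img c" using c(2) by blast
    have D: "((\<lambda>s. chart_map c (\<gamma> s)) has_vector_derivative chart_velocity UNIV \<gamma> c t) (at t)"
      "(chart_velocity UNIV \<gamma> c has_vector_derivative
         - chris (coord_metric X c) (chart_map c (\<gamma> t)) (chart_velocity UNIV \<gamma> c t) (chart_velocity UNIV \<gamma> c t)) (at t)"
      using geo c unfolding weak_geodesic_def christoffel_eq_chris by auto
    have "DERIV (\<lambda>s. coord_metric X c (chart_map c (\<gamma> s)) (chart_velocity UNIV \<gamma> c s) (chart_velocity UNIV \<gamma> c s)) t :> 0"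
      using P.g_curve_derivative[OF img D(1) D(2) D(2)] by (simp add: P.g_zero[OF img])
    moreover obtain e where e: "e > 0" "\<And>s. s \<in> UNIV \<Longrightarrow> \<bar>s - t\<bar> < e \<Longrightarrow> \<gamma> s \<in> chart_dom c"
      using curve_in_dom_near[OF weak_geodesic_continuous[OF geo] UNIV_I c] by blast
    ultimately show ?thesis
      by (rule_tac has_field_derivative_transform_within_open[of _ _ _ "ball t e"])
        (auto simp: S[OF c(1)] dist_real_def abs_minus_commute)
  qed
  then have "S t = S 0" using DERIV_isconst_all by blast
  moreover have "tnorm X (\<gamma> t) (velocity (atlas X) UNIV \<gamma> t) \<ge> 0" for t
  proof -
    obtain c where c: "c \<in> atlas X" "\<gamma> t \<in> chart_dom c" by (rule ex_chart)
    have "((\<lambda>s. chart_map c (\<gamma> s)) has_vector_derivative chart_velocity UNIV \<gamma> c t) (at t)"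
      using geo c unfolding weak_geodesic_def by auto
    from tnorm_velocity[OF c UNIV_I weak_geodesic_continuous[OF geo] no_isolated_UNIV this]
    show ?thesis using nrm_nonneg[OF c] by simp
  qed
  ultimately show ?thesis unfolding S_def by (simp add: power2_eq_iff_nonneg)
qed

end

text \<open>The chart \<open>c0\<close> identifies the tangent space at \<open>p\<close> with the
  Euclidean space \<open>'e\<close>, which makes the exponential map a map defined on
  \<open>'e\<close>.\<close>

locale hadamard_point = riem X
  for X :: "('a::{t2_space, second_countable_topology}, 'e::euclidean_space) riemannian" +
  fixes p :: 'a and c0 :: "('a, 'e) chart"
  assumes hadamard: "hadamard_manifold X" and c0: "c0 \<in> atlas X" "p \<in> chart_dom c0"
begin

definition geod :: "'e \<Rightarrow> real \<Rightarrow> 'a" where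
  "geod w = (SOME \<gamma>. geodesic X UNIV \<gamma> \<and> \<gamma> 0 = p \<and> velocity (atlas X) UNIV \<gamma> 0 = tangent_vec (atlas X) c0 p w)"

definition Exp :: "'e \<Rightarrow> 'a" where "Exp w = geod w 1"

abbreviation pnorm :: "'e \<Rightarrow> real" where "pnorm \<equiv> nrm c0 p"

lemma geod: "geodesic X UNIV (geod w)" "geod w 0 = p"
  "velocity (atlas X) UNIV (geod w) 0 = tangent_vec (atlas X) c0 p w"
proof -
  have "\<exists>\<gamma>. geodesic X UNIV \<gamma> \<and> \<gamma> 0 = p \<and> velocity (atlas X) UNIV \<gamma> 0 = tangent_vec (atlas X) c0 p w"
    using hadamard tangent_vec_in[OF c0] unfolding hadamard_manifold_def geodesically_complete_def by blast
  from someI_ex[OF this]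
  show "geodesic X UNIV (geod w)" "geod w 0 = p"
    "velocity (atlas X) UNIV (geod w) 0 = tangent_vec (atlas X) c0 p w"
    unfolding geod_def by blast+
qed

lemma weak_geod: "weak_geodesic X UNIV (geod w)"
  by (rule geodesic_imp_weak[OF geod(1) no_isolated_UNIV])

lemma geod_velocity: "chart_velocity UNIV (geod w) c0 0 = w"
proof -
  have "velocity (atlas X) UNIV (geod w) 0 c0 = chart_velocity UNIV (geod w) c0 0"
    unfolding velocity_def chart_velocity_def using c0 geod(2) by (simp add: o_def)
  then show ?thesis using geod(3)[of w] tangent_vec_self[OF c0] by simp
qed

text \<open>Both sides are geodesics in \<open>t\<close> with initial velocity
  \<open>r *\<^sub>R w\<close>. Uniqueness is available forward in time, whence
  \<open>t \<ge> 0\<close>; the case \<open>t = 1\<close> already gives \<open>geod_eq_Exp\<close>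
  for every real parameter.\<close>

lemma geod_scale:
  assumes "t \<ge> 0" shows "geod (r *\<^sub>R w) t = geod w (r * t)"
proof (cases "t = 0")
  case True then show ?thesis by (simp add: geod(2))
next
  case False
  with assms have t: "0 < t" by simp
  note ni = no_isolated_atLeastAtMost[OF t]
  note A = weak_geodesic_subset[OF weak_geod[of "r *\<^sub>R w"] subset_UNIV ni]
  note B = weak_geodesic_affine[where m = r and b = 0, OF weak_geod[of w] ni subset_UNIV]
  have "geod (r *\<^sub>R w) t = geod w (r * t + 0)"
  proof (rule weak_geodesic_unique[OF t A(1) B(1) _ c0(1)])
    show "chart_velocity {0..t} (geod (r *\<^sub>R w)) c0 0 = chart_velocity {0..t} (\<lambda>s. geod w (r * s + 0)) c0 0"
      using A(2)[of 0 c0] B(2)[of 0 c0] t c0 by (simp add: geod(2) geod_velocity)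
  qed (use t geod(2) c0 in auto)
  then show ?thesis by simp
qed

lemma geod_eq_Exp: "geod w t = Exp (t *\<^sub>R w)"
  unfolding Exp_def using geod_scale[of 1 t w] by (simp add: geod_scale)

definition flow_diff :: "('a, 'e) chart \<Rightarrow> 'e \<Rightarrow> real \<Rightarrow> bool" where
  "flow_diff c w0 t \<longleftrightarrow> eventually (\<lambda>w. geod w t \<in> chart_dom c) (nhds w0) \<and>
    (\<exists>D. strict_deriv (\<lambda>w. geodesic_state UNIV (geod w) c t) D w0)"

text \<open>The derivative of the geodesic flow in the initial velocity; its first component is a Jacobi field.\<close>

definition dflow :: "('a, 'e) chart \<Rightarrow> 'e \<Rightarrow> real \<Rightarrow> 'e \<Rightarrow> 'e \<times> 'e" where
  "dflow c w0 t = frechet_derivative (\<lambda>w. geodesic_state UNIV (geod w) c t) (at w0)"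

lemma dflow_eq:
  "strict_deriv (\<lambda>w. geodesic_state UNIV (geod w) c t) D w0 \<Longrightarrow> dflow c w0 t = D"
  unfolding dflow_def by (rule frechet_derivative_at'[OF strict_deriv_imp_has_derivative])

lemma dflow_strict:
  "flow_diff c w0 t \<Longrightarrow> strict_deriv (\<lambda>w. geodesic_state UNIV (geod w) c t) (dflow c w0 t) w0"
  unfolding flow_diff_def using dflow_eq by metis

lemma flow_diff_in_dom: "flow_diff c w0 t \<Longrightarrow> geod w0 t \<in> chart_dom c"
  unfolding flow_diff_def by (blast dest: eventually_nhds_x_imp_x)

lemma local_flow:
  assumes "c \<in> atlas X" "fst s0 \<in> chart_img c"
  obtains r \<delta> where "r > 0" "\<delta> > 0"
    "\<forall>w0 t0. geodesic_state UNIV (geod w0) c t0 \<in> ball s0 r \<longrightarrow> flow_diff c w0 t0 \<longrightarrow>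
      (\<forall>t\<in>{t0..t0 + \<delta>}. flow_diff c w0 t \<and> (\<forall>a. ((\<lambda>t. dflow c w0 t a) has_vector_derivative
        dspr c (geodesic_state UNIV (geod w0) c t) (dflow c w0 t a)) (at t within {t0..t0 + \<delta>})))"
proof (rule local_geodesic_flow[OF assms, where 'w = 'e])
  fix r \<delta> :: real
  assume r: "r > 0" "\<delta> > 0" and
    fl: "\<And>\<gamma> (w0::'e) t0 D0.
      (\<And>w. weak_geodesic X UNIV (\<gamma> w)) \<Longrightarrow>
      geodesic_state UNIV (\<gamma> w0) c t0 \<in> ball s0 r \<Longrightarrow>
      eventually (\<lambda>w. \<gamma> w t0 \<in> chart_dom c) (nhds w0) \<Longrightarrow>
      strict_deriv (\<lambda>w. geodesic_state UNIV (\<gamma> w) c t0) (blinfun_apply D0) w0 \<Longrightarrow>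
      \<exists>D :: real \<Rightarrow> 'e \<Rightarrow>\<^sub>L ('e \<times> 'e). \<forall>t\<in>{t0..t0 + \<delta>}.
        eventually (\<lambda>w. \<gamma> w t \<in> chart_dom c) (nhds w0) \<and>
        strict_deriv (\<lambda>w. geodesic_state UNIV (\<gamma> w) c t) (blinfun_apply (D t)) w0 \<and>
        (\<forall>a. ((\<lambda>t. D t a) has_vector_derivative dspr c (geodesic_state UNIV (\<gamma> w0) c t) (D t a)) (at t within {t0..t0 + \<delta>}))"
  show thesis
  proof (rule that[OF r], intro allI impI)
    fix w0 :: 'e and t0
    assume s: "geodesic_state UNIV (geod w0) c t0 \<in> ball s0 r" and fd: "flow_diff c w0 t0"
    note st = dflow_strict[OF fd]
    have "strict_deriv (\<lambda>w. geodesic_state UNIV (geod w) c t0) (blinfun_apply (Blinfun (dflow c w0 t0))) w0"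
      using st bounded_linear_Blinfun_apply[OF strict_deriv_bounded_linear[OF st]] by simp
    from fl[OF weak_geod s _ this] fd obtain D :: "real \<Rightarrow> 'e \<Rightarrow>\<^sub>L ('e \<times> 'e)" where D: "\<forall>t\<in>{t0..t0 + \<delta>}.
        eventually (\<lambda>w. geod w t \<in> chart_dom c) (nhds w0) \<and>
        strict_deriv (\<lambda>w. geodesic_state UNIV (geod w) c t) (blinfun_apply (D t)) w0 \<and>
        (\<forall>a. ((\<lambda>t. D t a) has_vector_derivative dspr c (geodesic_state UNIV (geod w0) c t) (D t a)) (at t within {t0..t0 + \<delta>}))"
      unfolding flow_diff_def by blast
    have eq: "dflow c w0 t = blinfun_apply (D t)" if "t \<in> {t0..t0 + \<delta>}" for t
      using D that dflow_eq by blast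
    show "\<forall>t\<in>{t0..t0 + \<delta>}. flow_diff c w0 t \<and> (\<forall>a. ((\<lambda>t. dflow c w0 t a) has_vector_derivative
        dspr c (geodesic_state UNIV (geod w0) c t) (dflow c w0 t a)) (at t within {t0..t0 + \<delta>}))"
    proof (intro ballI conjI allI)
      fix t a assume t: "t \<in> {t0..t0 + \<delta>}"
      show "flow_diff c w0 t" unfolding flow_diff_def using D t by blast
      have "((\<lambda>t. D t a) has_vector_derivative dspr c (geodesic_state UNIV (geod w0) c t) (D t a)) (at t within {t0..t0 + \<delta>})"
        using D t by blast
      then show "((\<lambda>t. dflow c w0 t a) has_vector_derivative
          dspr c (geodesic_state UNIV (geod w0) c t) (dflow c w0 t a)) (at t within {t0..t0 + \<delta>})"
        unfolding eq[OF t] by (rule has_vector_derivative_transform[OF t, rotated]) (simp add: eq)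
    qed
  qed
qed

lemma flow_diff_change:
  assumes "flow_diff c w0 t" "c \<in> atlas X" "d \<in> atlas X" "geod w0 t \<in> chart_dom d"
  shows "flow_diff d w0 t"
    and "fst (dflow d w0 t a) = frechet_derivative (transition c d) (at (chart_map c (geod w0 t))) (fst (dflow c w0 t a))"
proof -
  obtain D' where D': "eventually (\<lambda>w. geod w t \<in> chart_dom d) (nhds w0)"
    "strict_deriv (\<lambda>w. geodesic_state UNIV (geod w) d t) D' w0"
    "\<forall>a. fst (D' a) = frechet_derivative (transition c d) (at (chart_map c (geod w0 t))) (fst (dflow c w0 t a))"
  proof (rule state_chart_change[OF weak_geod assms(2,3) flow_diff_in_dom[OF assms(1)] assms(4) _ dflow_strict[OF assms(1)]])
    show "eventually (\<lambda>w. geod w t \<in> chart_dom c) (nhds w0)" using assms(1) unfolding flow_diff_def by blast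
  qed (rule that)
  show "flow_diff d w0 t" unfolding flow_diff_def using D' by blast
  show "fst (dflow d w0 t a) = frechet_derivative (transition c d) (at (chart_map c (geod w0 t))) (fst (dflow c w0 t a))"
    using D'(3) dflow_eq[OF D'(2)] by simp
qed

lemma flow_diff_0: "flow_diff c0 w0 0" "dflow c0 w0 0 = (\<lambda>a. (0, a))"
proof -
  have "(\<lambda>w. geodesic_state UNIV (geod w) c0 0) = (\<lambda>w. (chart_map c0 p, w))"
    unfolding geodesic_state_def by (simp add: geod(2) geod_velocity)
  moreover have "strict_deriv (\<lambda>w. (chart_map c0 p, w)) (\<lambda>a. (0, a)) w0"
    by (intro strict_deriv_Pair strict_deriv_const strict_deriv_of_bounded_linear bounded_linear_ident)
  ultimately have *: "strict_deriv (\<lambda>w. geodesic_state UNIV (geod w) c0 0) (\<lambda>a. (0, a)) w0" by simp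
  show "dflow c0 w0 0 = (\<lambda>a. (0, a))" by (rule dflow_eq[OF *])
  have "eventually (\<lambda>w. geod w 0 \<in> chart_dom c0) (nhds w0)" by (simp add: geod(2) c0)
  with * show "flow_diff c0 w0 0" unfolding flow_diff_def by blast
qed

lemma flow_diff:
  assumes "t \<ge> 0" "c \<in> atlas X" "geod w0 t \<in> chart_dom c"
  shows "flow_diff c w0 t"
proof -
  define P where "P t \<longleftrightarrow> (\<forall>c\<in>atlas X. geod w0 t \<in> chart_dom c \<longrightarrow> flow_diff c w0 t)" for t
  have change: "P t" if "c \<in> atlas X" "flow_diff c w0 t" for c t
    unfolding P_def using flow_diff_change(1)[OF that(2,1)] by blast
  have "t \<in> {0..t}" using assms(1) by simp
  with assms(1) have "P t"
  proof (rule interval_induct[where P = P])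
    show "P 0" by (rule change[OF c0(1) flow_diff_0(1)])
  next
    fix s assume s: "0 \<le> s" "s < t" "P s"
    obtain c where c: "c \<in> atlas X" "geod w0 s \<in> chart_dom c" by (rule ex_chart)
    have "fst (geodesic_state UNIV (geod w0) c s) \<in> chart_img c" using c unfolding geodesic_state_def by simp
    from local_flow[OF c(1) this] obtain r \<delta> where r: "r > 0" "\<delta> > 0" and
      fl: "\<forall>w1 t0. geodesic_state UNIV (geod w1) c t0 \<in> ball (geodesic_state UNIV (geod w0) c s) r \<longrightarrow> flow_diff c w1 t0 \<longrightarrow>
      (\<forall>t\<in>{t0..t0 + \<delta>}. flow_diff c w1 t \<and> (\<forall>a. ((\<lambda>t. dflow c w1 t a) has_vector_derivative
        dspr c (geodesic_state UNIV (geod w1) c t) (dflow c w1 t a)) (at t within {t0..t0 + \<delta>})))"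
      by blast
    have "geodesic_state UNIV (geod w0) c s \<in> ball (geodesic_state UNIV (geod w0) c s) r" using r by simp
    moreover have "flow_diff c w0 s" using s(3) c unfolding P_def by blast
    ultimately have fd: "flow_diff c w0 u" if "u \<in> {s..s+\<delta>}" for u using fl that by blast
    show "\<exists>d>0. \<forall>u. s < u \<and> u < s + d \<and> u \<le> t \<longrightarrow> P u"
      using r(2) change[OF c(1) fd] by (intro exI[of _ \<delta>]) auto
  next
    fix s assume s: "0 < s" "s \<le> t" "\<And>u. 0 \<le> u \<Longrightarrow> u < s \<Longrightarrow> P u"
    obtain c where c: "c \<in> atlas X" "geod w0 s \<in> chart_dom c" by (rule ex_chart)
    have "fst (geodesic_state UNIV (geod w0) c s) \<in> chart_img c" using c unfolding geodesic_state_def by simp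
    from local_flow[OF c(1) this] obtain r \<delta> where r: "r > 0" "\<delta> > 0" and
      fl: "\<forall>w1 t0. geodesic_state UNIV (geod w1) c t0 \<in> ball (geodesic_state UNIV (geod w0) c s) r \<longrightarrow> flow_diff c w1 t0 \<longrightarrow>
      (\<forall>t\<in>{t0..t0 + \<delta>}. flow_diff c w1 t \<and> (\<forall>a. ((\<lambda>t. dflow c w1 t a) has_vector_derivative
        dspr c (geodesic_state UNIV (geod w1) c t) (dflow c w1 t a)) (at t within {t0..t0 + \<delta>})))"
      by blast
    have "dist (geodesic_state UNIV (geod w0) c s) (geodesic_state UNIV (geod w0) c s) < r" using r by simp
    then obtain e where e: "e > 0" "\<And>u. u \<in> UNIV \<Longrightarrow> \<bar>u - s\<bar> < e \<Longrightarrow> geod w0 u \<in> chart_dom c \<and>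
        geodesic_state UNIV (geod w0) c u \<in> ball (geodesic_state UNIV (geod w0) c s) r"
      by (rule state_in_ball_near[OF weak_geod UNIV_I c]) blast
    \<comment> \<open>A time shortly before \<open>s\<close>: nonnegative, with state in the ball of
      the local flow, and less than \<open>\<delta>\<close> before \<open>s\<close>, so that one
      application of the local flow reaches \<open>s\<close>.\<close>
    define u where "u = s - min s (min e \<delta>) / 2"
    have u: "0 \<le> u" "u < s" "\<bar>u - s\<bar> < e" "s \<in> {u..u+\<delta>}" using s(1) e(1) r(2) unfolding u_def by (auto simp: min_def)
    have "flow_diff c w0 u" using s(3)[OF u(1,2)] e(2)[OF UNIV_I u(3)] c(1) unfolding P_def by blast
    then have "flow_diff c w0 s" using fl e(2)[OF UNIV_I u(3)] u(4) by blast
    then show "P s" by (rule change[OF c(1)])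
  qed
  then show ?thesis using assms unfolding P_def by blast
qed

text \<open>The local flow is started at some \<open>l < t\<close> and runs past \<open>t\<close>,
  so that the derivatives around \<open>t\<close> are two-sided.\<close>

lemma dflow_ode:
  assumes "t > 0" "c \<in> atlas X" "geod w0 t \<in> chart_dom c"
  obtains l u where "0 \<le> l" "l < t" "t < u" "\<forall>s\<in>{l<..<u}. geod w0 s \<in> chart_dom c \<and>
    (\<forall>a. ((\<lambda>s. dflow c w0 s a) has_vector_derivative dspr c (geodesic_state UNIV (geod w0) c s) (dflow c w0 s a)) (at s))"
proof -
  have "fst (geodesic_state UNIV (geod w0) c t) \<in> chart_img c" using assms unfolding geodesic_state_def by simp
  from local_flow[OF assms(2) this] obtain r \<delta> where r: "r > 0" "\<delta> > 0" and
    fl: "\<forall>w1 t0. geodesic_state UNIV (geod w1) c t0 \<in> ball (geodesic_state UNIV (geod w0) c t) r \<longrightarrow> flow_diff c w1 t0 \<longrightarrow>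
    (\<forall>t\<in>{t0..t0 + \<delta>}. flow_diff c w1 t \<and> (\<forall>a. ((\<lambda>t. dflow c w1 t a) has_vector_derivative
      dspr c (geodesic_state UNIV (geod w1) c t) (dflow c w1 t a)) (at t within {t0..t0 + \<delta>})))"
    by blast
  have "dist (geodesic_state UNIV (geod w0) c t) (geodesic_state UNIV (geod w0) c t) < r" using r by simp
  then obtain e where e: "e > 0" "\<And>u. u \<in> UNIV \<Longrightarrow> \<bar>u - t\<bar> < e \<Longrightarrow> geod w0 u \<in> chart_dom c \<and>
      geodesic_state UNIV (geod w0) c u \<in> ball (geodesic_state UNIV (geod w0) c t) r"
    by (rule state_in_ball_near[OF weak_geod UNIV_I assms(2,3)]) blast
  define l where "l = t - min t (min e \<delta>) / 2"
  have l: "0 \<le> l" "l < t" "\<bar>l - t\<bar> < e" "t < l + \<delta>" using assms(1) e(1) r(2) unfolding l_def by (auto simp: min_def)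
  have "flow_diff c w0 l" using flow_diff[OF l(1) assms(2)] e(2)[OF UNIV_I l(3)] by blast
  then have D: "\<forall>s\<in>{l..l + \<delta>}. flow_diff c w0 s \<and> (\<forall>a. ((\<lambda>t. dflow c w0 t a) has_vector_derivative
      dspr c (geodesic_state UNIV (geod w0) c s) (dflow c w0 s a)) (at s within {l..l + \<delta>}))"
    using fl e(2)[OF UNIV_I l(3)] by blast
  show thesis
  proof (rule that[OF l(1,2,4)], intro ballI conjI allI)
    fix s a assume s: "s \<in> {l<..<l + \<delta>}"
    then have s': "s \<in> {l..l+\<delta>}" by auto
    show "geod w0 s \<in> chart_dom c" using D s' flow_diff_in_dom by blast
    have "at s within {l..l+\<delta>} = at s" using s by (simp add: at_within_Icc_at)
    then show "((\<lambda>s. dflow c w0 s a) has_vector_derivative dspr c (geodesic_state UNIV (geod w0) c s) (dflow c w0 s a)) (at s)"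
      using D s' by metis
  qed
qed

text \<open>In the chart \<open>c0\<close> the derivative of the state at time \<open>0\<close> is
  \<open>(0, a)\<close>: the Jacobi field vanishes there and has initial derivative
  \<open>a\<close>.\<close>

lemma dflow_derivative_0:
  "((\<lambda>s. fst (dflow c0 w0 s a)) has_vector_derivative a) (at 0 within {0..})"
proof -
  have dom: "geod w0 0 \<in> chart_dom c0" by (simp add: geod(2) c0)
  then have "fst (geodesic_state UNIV (geod w0) c0 0) \<in> chart_img c0" unfolding geodesic_state_def by simp
  from local_flow[OF c0(1) this] obtain r \<delta> where r: "r > 0" "\<delta> > 0" and
    fl: "\<forall>w1 t0. geodesic_state UNIV (geod w1) c0 t0 \<in> ball (geodesic_state UNIV (geod w0) c0 0) r \<longrightarrow> flow_diff c0 w1 t0 \<longrightarrow>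
    (\<forall>t\<in>{t0..t0 + \<delta>}. flow_diff c0 w1 t \<and> (\<forall>a. ((\<lambda>t. dflow c0 w1 t a) has_vector_derivative
      dspr c0 (geodesic_state UNIV (geod w1) c0 t) (dflow c0 w1 t a)) (at t within {t0..t0 + \<delta>})))"
    by blast
  have "geodesic_state UNIV (geod w0) c0 0 \<in> ball (geodesic_state UNIV (geod w0) c0 0) r" using r by simp
  with fl flow_diff_0(1) r(2) have "((\<lambda>t. dflow c0 w0 t a) has_vector_derivative
      dspr c0 (geodesic_state UNIV (geod w0) c0 0) (dflow c0 w0 0 a)) (at 0 within {0..0 + \<delta>})"
    by (metis add_0 atLeastAtMost_iff less_imp_le order_refl)
  from bounded_linear.has_vector_derivative[OF bounded_linear_fst this]
  have "((\<lambda>t. fst (dflow c0 w0 t a)) has_vector_derivative a) (at 0 within {0..\<delta>})"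
    unfolding flow_diff_0(2) metric_patch.dspray_def[OF metric_patch[OF c0(1)]] by (simp add: case_prod_unfold)
  moreover have "at 0 within {0..\<delta>} = at 0 within {0..}"
    by (rule at_within_nhd[of _ "{..<\<delta>}"]) (use r in auto)
  ultimately show ?thesis by simp
qed

text \<open>The squared length of the Jacobi field along \<open>geod w0\<close> with value
  \<open>0\<close> and derivative \<open>a\<close> at time \<open>0\<close>; by
  \<open>jac_eq\<close> any chart computes it for \<open>t \<ge> 0\<close>.\<close>

definition jac :: "'e \<Rightarrow> 'e \<Rightarrow> real \<Rightarrow> real" where
  "jac w0 a t = (let c = (SOME c. c \<in> atlas X \<and> geod w0 t \<in> chart_dom c) in
    coord_metric X c (chart_map c (geod w0 t)) (fst (dflow c w0 t a)) (fst (dflow c w0 t a)))"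

lemma jac_eq:
  assumes "t \<ge> 0" "c \<in> atlas X" "geod w0 t \<in> chart_dom c"
  shows "jac w0 a t = coord_metric X c (chart_map c (geod w0 t)) (fst (dflow c w0 t a)) (fst (dflow c w0 t a))"
proof -
  define d where "d = (SOME c. c \<in> atlas X \<and> geod w0 t \<in> chart_dom c)"
  have d: "d \<in> atlas X" "geod w0 t \<in> chart_dom d"
    using someI[of "\<lambda>c. c \<in> atlas X \<and> geod w0 t \<in> chart_dom c" c] assms(2,3) unfolding d_def by blast+
  have f: "fst (dflow d w0 t a) = frechet_derivative (transition c d) (at (chart_map c (geod w0 t))) (fst (dflow c w0 t a))"
    by (rule flow_diff_change(2)[OF flow_diff[OF assms] assms(2) d])
  have "jac w0 a t = coord_metric X d (chart_map d (geod w0 t)) (fst (dflow d w0 t a)) (fst (dflow d w0 t a))"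
    unfolding jac_def d_def[symmetric] Let_def ..
  also have "\<dots> = coord_metric X c (chart_map c (geod w0 t)) (fst (dflow c w0 t a)) (fst (dflow c w0 t a))"
    unfolding f inner_at_tangent_vec[OF d, symmetric] inner_at_tangent_vec[OF assms(2,3), symmetric]
    using tangent_vec_change[OF assms(2) d(1) assms(3) d(2)] by simp
  finally show ?thesis .
qed

lemma Cauchy_Schwarz_metric:
  assumes "c \<in> atlas X" "y \<in> chart_img c"
  shows "(coord_metric X c y u v)\<^sup>2 \<le> coord_metric X c y u u * coord_metric X c y v v"
proof -
  interpret P: metric_patch "chart_img c" "coord_metric X c" by (rule metric_patch[OF assms(1)])
  let ?g = "coord_metric X c y"
  show ?thesis
  proof (cases "v = 0")
    case False
    then have v: "?g v v > 0" using P.pos[OF assms(2)] by blast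
    define c where "c = ?g u v / ?g v v"
    have "0 \<le> ?g (u - c *\<^sub>R v) (u - c *\<^sub>R v)" by (rule P.g_nonneg[OF assms(2)])
    also have "\<dots> = ?g u u - c * ?g u v - c * ?g v u + c * c * ?g v v"
      by (simp add: P.g_diff[OF assms(2)] P.g_scale[OF assms(2)] algebra_simps)
    also have "\<dots> = ?g u u - c * ?g u v"
      using v P.sym[OF assms(2), of v u] unfolding c_def by simp
    finally have "c * ?g u v * ?g v v \<le> ?g u u * ?g v v" using v by (intro mult_right_mono) auto
    then show ?thesis using v unfolding c_def by (simp add: power2_eq_square)
  qed (use P.g_zero[OF assms(2)] in simp)
qed

text \<open>With the covariant derivative \<open>Dz\<close> of the Jacobi field \<open>z\<close>,
  the first derivative is \<open>2 g(z, Dz)\<close> and the second is \<open>2 g(Dz, Dz)\<close>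
  plus a curvature term that is nonnegative. The bound on \<open>(f1 s)\<^sup>2\<close>, which
  expresses convexity of the square root of \<open>jac\<close>, is then the Cauchy-Schwarz
  inequality.\<close>

lemma jac_second_derivative:
  assumes t: "t > 0"
  shows "\<exists>l u f1 f2. l < t \<and> t < u \<and> (\<forall>s\<in>{l<..<u}. (jac w0 a has_real_derivative f1 s) (at s)
    \<and> (f1 has_real_derivative f2 s) (at s) \<and> f2 s \<ge> 0 \<and> (f1 s)\<^sup>2 \<le> 2 * jac w0 a s * f2 s \<and> jac w0 a s \<ge> 0)"
proof -
  obtain c where c: "c \<in> atlas X" "geod w0 t \<in> chart_dom c" by (rule ex_chart)
  obtain l u where lu: "0 \<le> l" "l < t" "t < u" and D: "\<forall>s\<in>{l<..<u}. geod w0 s \<in> chart_dom c \<and>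
    (\<forall>a. ((\<lambda>s. dflow c w0 s a) has_vector_derivative dspr c (geodesic_state UNIV (geod w0) c s) (dflow c w0 s a)) (at s))"
    by (rule dflow_ode[OF t c])
  interpret P: metric_patch "chart_img c" "coord_metric X c" by (rule metric_patch[OF c(1)])
  let ?I = "{l<..<u}"
  define q where "q s = chart_map c (geod w0 s)" for s
  define v where "v = chart_velocity UNIV (geod w0) c"
  define z where "z s = fst (dflow c w0 s a)" for s
  define z' where "z' s = snd (dflow c w0 s a)" for s
  define Dz where "Dz s = z' s + P.\<Gamma> (q s) (v s) (z s)" for s
  have qU: "q s \<in> chart_img c" if "s \<in> ?I" for s using D that unfolding q_def by blast
  have dq: "(q has_vector_derivative v s) (at s within ?I)"
    "(v has_vector_derivative - P.\<Gamma> (q s) (v s) (v s)) (at s within ?I)" if "s \<in> ?I" for s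
    using weak_geod[of w0] D that c(1) unfolding weak_geodesic_def q_def v_def christoffel_eq_chris
    by (auto intro: has_vector_derivative_at_within)
  have dd: "((\<lambda>s. dflow c w0 s a) has_vector_derivative
      (z' s, - (P.d\<Gamma> (q s) (v s) (v s) (z s) + 2 *\<^sub>R P.\<Gamma> (q s) (v s) (z' s)))) (at s within ?I)" if "s \<in> ?I" for s
  proof -
    have "((\<lambda>s. dflow c w0 s a) has_vector_derivative dspr c (geodesic_state UNIV (geod w0) c s) (dflow c w0 s a)) (at s within ?I)"
      using D that by (blast intro: has_vector_derivative_at_within)
    then show ?thesis
      unfolding P.dspray_def geodesic_state_def q_def v_def z_def z'_def by (simp add: case_prod_unfold)
  qed
  have dz: "(z has_vector_derivative z' s) (at s within ?I)"
    "(z' has_vector_derivative - (P.d\<Gamma> (q s) (v s) (v s) (z s) + 2 *\<^sub>R P.\<Gamma> (q s) (v s) (z' s))) (at s within ?I)"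
    if "s \<in> ?I" for s
  proof -
    have zf: "z = (\<lambda>s. fst (dflow c w0 s a))" "z' = (\<lambda>s. snd (dflow c w0 s a))"
      by (intro ext z_def z'_def)+
    show "(z has_vector_derivative z' s) (at s within ?I)"
      using bounded_linear.has_vector_derivative[OF bounded_linear_fst dd[OF that]]
      unfolding zf(1)[symmetric] fst_conv .
    show "(z' has_vector_derivative - (P.d\<Gamma> (q s) (v s) (v s) (z s) + 2 *\<^sub>R P.\<Gamma> (q s) (v s) (z' s))) (at s within ?I)"
      using bounded_linear.has_vector_derivative[OF bounded_linear_snd dd[OF that]]
      unfolding zf(2)[symmetric] snd_conv .
  qed
  let ?g = "\<lambda>s. coord_metric X c (q s)"
  let ?f1 = "\<lambda>s. 2 * ?g s (z s) (Dz s)"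
  let ?f2 = "\<lambda>s. 2 * ?g s (Dz s) (Dz s) + 2 * ?g s (z s) (curv (coord_metric X c) (q s) (v s) (z s) (v s))"
  have J: "((\<lambda>s. ?g s (z s) (z s)) has_real_derivative ?f1 s) (at s within ?I)"
    "(?f1 has_real_derivative ?f2 s) (at s within ?I)" if "s \<in> ?I" for s
    unfolding Dz_def
    by (rule P.Jacobi_derivatives(1)[where I = ?I and q = q and v = v and z = z and z' = z' and t = s, OF _ _ _ _ _ that],
        (rule qU, assumption), (rule dq(1), assumption), (rule dq(2), assumption),
        (rule dz(1), assumption), (rule dz(2), assumption),
        rule P.Jacobi_derivatives(2)[where I = ?I and q = q and v = v and z = z and z' = z' and t = s, OF _ _ _ _ _ that],
        (rule qU, assumption), (rule dq(1), assumption), (rule dq(2), assumption),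
        (rule dz(1), assumption), (rule dz(2), assumption))
  have at: "at s within ?I = at s" if "s \<in> ?I" for s by (rule at_within_open[OF that open_greaterThanLessThan])
  have jac: "jac w0 a s = ?g s (z s) (z s)" if "s \<in> ?I" for s
    unfolding q_def z_def by (rule jac_eq[OF _ c(1)]) (use D that lu(1) in auto)
  have all: "\<forall>s\<in>?I. (jac w0 a has_real_derivative ?f1 s) (at s) \<and> (?f1 has_real_derivative ?f2 s) (at s)
      \<and> ?f2 s \<ge> 0 \<and> (?f1 s)\<^sup>2 \<le> 2 * jac w0 a s * ?f2 s \<and> jac w0 a s \<ge> 0"
  proof
    fix s assume s: "s \<in> ?I"
    have d1: "(jac w0 a has_real_derivative ?f1 s) (at s)"
      by (rule has_field_derivative_transform_within_open[OF J(1)[OF s, unfolded at[OF s]] open_greaterThanLessThan s])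
        (simp add: jac)
    have K: "?g s (z s) (curv (coord_metric X c) (q s) (v s) (z s) (v s)) \<ge> 0"
    proof (rule P.curvature_term_nonneg[OF qU[OF s]])
      fix u v :: 'e assume "u \<noteq> v" "independent {u, v}"
      then have "sectional_curvature X c (q s) u v \<le> 0"
        using hadamard c(1) qU[OF s] unfolding hadamard_manifold_def nonpositive_curvature_def by blast
      then show "?g s (curv (coord_metric X c) (q s) u v v) u / (?g s u u * ?g s v v - (?g s u v)\<^sup>2) \<le> 0"
        unfolding sectional_curvature_def curvature_eq_curv .
    qed
    have n: "?g s (Dz s) (Dz s) \<ge> 0" "?g s (z s) (z s) \<ge> 0" using P.g_nonneg[OF qU[OF s]] by blast+
    have "(?f1 s)\<^sup>2 = 4 * (?g s (z s) (Dz s))\<^sup>2" by (simp add: power_mult_distrib)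
    also have "\<dots> \<le> 4 * (?g s (z s) (z s) * ?g s (Dz s) (Dz s))"
      using Cauchy_Schwarz_metric[OF c(1) qU[OF s]] by simp
    also have "\<dots> = 2 * ?g s (z s) (z s) * (2 * ?g s (Dz s) (Dz s))" by simp
    also have "\<dots> \<le> 2 * ?g s (z s) (z s) * ?f2 s" using K n by (intro mult_left_mono) auto
    finally show "(jac w0 a has_real_derivative ?f1 s) (at s) \<and> (?f1 has_real_derivative ?f2 s) (at s)
      \<and> ?f2 s \<ge> 0 \<and> (?f1 s)\<^sup>2 \<le> 2 * jac w0 a s * ?f2 s \<and> jac w0 a s \<ge> 0"
      using d1 J(2)[OF s, unfolded at[OF s]] K n jac[OF s] by simp
  qed
  show ?thesis
    by (rule exI[of _ l], rule exI[of _ u], rule exI[of _ ?f1], rule exI[of _ ?f2],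
        rule conjI[OF lu(2) conjI[OF lu(3) all]])
qed

lemma nrm_square: "c \<in> atlas X \<Longrightarrow> x \<in> chart_dom c \<Longrightarrow> (nrm c x u)\<^sup>2 = coord_metric X c (chart_map c x) u u"
  unfolding nrm_def using metric_patch.g_nonneg[OF metric_patch] by simp

definition dExp :: "('a, 'e) chart \<Rightarrow> 'e \<Rightarrow> 'e \<Rightarrow> 'e" where
  "dExp c w = frechet_derivative (\<lambda>u. chart_map c (Exp u)) (at w)"

lemma Exp_strict:
  assumes "c \<in> atlas X" "Exp w \<in> chart_dom c"
  shows "eventually (\<lambda>u. Exp u \<in> chart_dom c) (nhds w)"
    and "strict_deriv (\<lambda>u. chart_map c (Exp u)) (dExp c w) w"
proof -
  have fd: "flow_diff c w 1" by (rule flow_diff) (use assms in \<open>simp_all add: Exp_def\<close>)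
  then show "eventually (\<lambda>u. Exp u \<in> chart_dom c) (nhds w)" unfolding flow_diff_def Exp_def by blast
  have *: "strict_deriv (\<lambda>u. chart_map c (Exp u)) (\<lambda>a. fst (dflow c w 1 a)) w"
    using strict_deriv_fst[OF dflow_strict[OF fd]] unfolding geodesic_state_def Exp_def by simp
  then show "strict_deriv (\<lambda>u. chart_map c (Exp u)) (dExp c w) w"
    unfolding dExp_def frechet_derivative_at'[OF strict_deriv_imp_has_derivative[OF *]] .
qed

lemma Exp_0: "Exp 0 = p"
  using geod_eq_Exp[of 0 0] geod(2)[of 0] by simp

lemma isCont_Exp: "isCont Exp w"
proof -
  obtain c where c: "c \<in> atlas X" "Exp w \<in> chart_dom c" by (rule ex_chart)
  have "isCont (\<lambda>u. chart_inv c (chart_map c (Exp u))) w"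
    by (rule isCont_o2[OF strict_deriv_isCont[OF Exp_strict(2)[OF c]]]) (use isCont_inv c in auto)
  moreover have "eventually (\<lambda>u. chart_inv c (chart_map c (Exp u)) = Exp u) (nhds w)"
    using Exp_strict(1)[OF c] by eventually_elim (rule inv_map[OF c(1)])
  ultimately show ?thesis by (rule isCont_cong[THEN iffD1, rotated])
qed

text \<open>\<open>geod u t\<close> is \<open>Exp (t *\<^sub>R u)\<close>, so the chain rule relates
  the derivative of the flow at time \<open>t\<close> to that of the exponential map at
  \<open>t *\<^sub>R w\<close>.\<close>

lemma dflow_eq_dExp:
  assumes "t \<ge> 0" "c \<in> atlas X" "Exp (t *\<^sub>R w) \<in> chart_dom c"
  shows "fst (dflow c w t a) = t *\<^sub>R dExp c (t *\<^sub>R w) a"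
proof -
  have fd: "flow_diff c w t" by (rule flow_diff) (use assms in \<open>simp_all add: geod_eq_Exp\<close>)
  have 1: "((\<lambda>u. chart_map c (Exp (t *\<^sub>R u))) has_derivative (\<lambda>a. fst (dflow c w t a))) (at w)"
    using strict_deriv_imp_has_derivative[OF strict_deriv_fst[OF dflow_strict[OF fd]]]
    unfolding geodesic_state_def geod_eq_Exp by simp
  have ex: "strict_deriv (\<lambda>u. chart_map c (Exp u)) (dExp c (t *\<^sub>R w)) (t *\<^sub>R w)"
    by (rule Exp_strict(2)[OF assms(2,3)])
  have "strict_deriv (\<lambda>u. chart_map c (Exp (t *\<^sub>R u))) (\<lambda>a. dExp c (t *\<^sub>R w) (t *\<^sub>R a)) w"
    by (rule strict_deriv_compose[OF strict_deriv_of_bounded_linear[OF bounded_linear_scaleR_right] ex])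
  from fun_cong[OF has_derivative_unique[OF 1 strict_deriv_imp_has_derivative[OF this]], of a]
  have "fst (dflow c w t a) = dExp c (t *\<^sub>R w) (t *\<^sub>R a)" .
  then show ?thesis
    using linear_scale[OF bounded_linear.linear[OF strict_deriv_bounded_linear[OF ex]]] by simp
qed

lemma jac_Exp:
  assumes "t \<ge> 0" "c \<in> atlas X" "Exp (t *\<^sub>R w) \<in> chart_dom c"
  shows "jac w a t = (nrm c (Exp (t *\<^sub>R w)) (t *\<^sub>R dExp c (t *\<^sub>R w) a))\<^sup>2"
  unfolding nrm_square[OF assms(2,3)] dflow_eq_dExp[OF assms, symmetric]
  using jac_eq[OF assms(1,2)] assms(3) by (simp add: geod_eq_Exp)

lemma geod_near_0:
  obtains d where "d > 0" "\<And>t. \<bar>t\<bar> < d \<Longrightarrow> geod w t \<in> chart_dom c0"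
proof -
  have "geod w 0 \<in> chart_dom c0" by (simp add: geod(2) c0)
  from curve_in_dom_near[OF weak_geodesic_continuous[OF weak_geod] UNIV_I c0(1) this]
  show thesis using that by (metis UNIV_I diff_zero)
qed

lemma jac_expansion:
  assumes "(\<zeta> \<longlongrightarrow> b) (at 0 within S)"
  shows "((\<lambda>t. coord_metric X c0 (chart_map c0 (geod w t)) (\<zeta> t) (\<zeta> t)) \<longlongrightarrow> coord_metric X c0 (chart_map c0 p) b b) (at 0 within S)"
proof -
  interpret P: metric_patch "chart_img c0" "coord_metric X c0" by (rule metric_patch[OF c0(1)])
  have img: "chart_map c0 p \<in> chart_img c0" using c0 by blast
  have "isCont (geod w) 0"
    using weak_geodesic_continuous[OF weak_geod] by (simp add: continuous_on_eq_continuous_at)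
  then have "isCont (\<lambda>t. chart_map c0 (geod w t)) 0"
    by (rule isCont_o2) (use isCont_map c0 geod(2) in auto)
  then have "((\<lambda>t. chart_map c0 (geod w t)) \<longlongrightarrow> chart_map c0 p) (at 0 within S)"
    unfolding isCont_def geod(2) by (rule tendsto_within_subset) simp
  then have "((\<lambda>t. (chart_map c0 (geod w t), \<zeta> t, \<zeta> t)) \<longlongrightarrow> (chart_map c0 p, b, b)) (at 0 within S)"
    by (intro tendsto_Pair assms)
  from isCont_tendsto_compose[OF strict_deriv_isCont[OF P.g_joint_strict[OF img]] this]
  show ?thesis by simp
qed

lemma sqrt_jac_le:
  assumes "t \<in> {0..1}"
  shows "sqrt (jac w a t) \<le> t * sqrt (jac w a 1)"
proof (rule sqrt_le_of_convexity[OF _ _ jac_second_derivative assms])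
  have dom: "Exp (0 *\<^sub>R w) \<in> chart_dom c0" by (simp add: Exp_0 c0)
  show z: "jac w a 0 = 0"
    using jac_Exp[OF order_refl c0(1) dom, of a] nrm_scale[OF c0, of 0] by (simp add: Exp_0)
  obtain d where d: "d > 0" "\<And>t. \<bar>t\<bar> < d \<Longrightarrow> geod w t \<in> chart_dom c0" by (rule geod_near_0[of w]) blast
  have "((\<lambda>t. fst (dflow c0 w t a)) \<longlongrightarrow> fst (dflow c0 w 0 a)) (at 0 within {0..})"
    using has_vector_derivative_continuous[OF dflow_derivative_0] unfolding continuous_within .
  from jac_expansion[OF this, of w]
  have "((\<lambda>t. coord_metric X c0 (chart_map c0 (geod w t)) (fst (dflow c0 w t a)) (fst (dflow c0 w t a))) \<longlongrightarrow> 0) (at 0 within {0..})"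
    using z jac_eq[OF order_refl c0(1), of w a] c0(2) by (simp add: geod(2))
  moreover have "eventually (\<lambda>t. coord_metric X c0 (chart_map c0 (geod w t)) (fst (dflow c0 w t a)) (fst (dflow c0 w t a))
      = jac w a t) (at 0 within {0..})"
    unfolding eventually_at
    using d jac_eq[OF _ c0(1)] by (intro exI[of _ d]) (auto simp: dist_real_def)
  ultimately show "continuous (at 0 within {0..}) (jac w a)"
    unfolding continuous_within z by (rule Lim_transform_eventually)
qed

lemma Exp_contract:
  assumes "t \<in> {0..1}" "c \<in> atlas X" "Exp (t *\<^sub>R w) \<in> chart_dom c" "d \<in> atlas X" "Exp w \<in> chart_dom d"
  shows "nrm c (Exp (t *\<^sub>R w)) (t *\<^sub>R dExp c (t *\<^sub>R w) a) \<le> t * nrm d (Exp w) (dExp d w a)"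
  using sqrt_jac_le[OF assms(1), of w a] jac_Exp[of t c w a] jac_Exp[of 1 d w a] assms
    nrm_nonneg[OF assms(2,3)] nrm_nonneg[OF assms(4,5)] by simp

text \<open>\<open>sqrt (jac w a t) / t\<close> is at most its value at \<open>t = 1\<close> and
  tends to \<open>pnorm a\<close> as \<open>t\<close> tends to \<open>0\<close>, because the Jacobi
  field has initial derivative \<open>a\<close>.\<close>

lemma Exp_expand:
  assumes "d \<in> atlas X" "Exp w \<in> chart_dom d"
  shows "pnorm a \<le> nrm d (Exp w) (dExp d w a)"
proof -
  obtain e where e: "e > 0" "\<And>t. \<bar>t\<bar> < e \<Longrightarrow> geod w t \<in> chart_dom c0" by (rule geod_near_0[of w]) blast
  interpret P: metric_patch "chart_img c0" "coord_metric X c0" by (rule metric_patch[OF c0(1)])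
  define \<zeta> where "\<zeta> t = fst (dflow c0 w t a) /\<^sub>R t" for t
  have "((\<lambda>t. fst (dflow c0 w t a) /\<^sub>R t) \<longlongrightarrow> a) (at 0 within {0<..})"
  proof -
    have "((\<lambda>t. fst (dflow c0 w t a)) has_vector_derivative a) (at 0 within {0<..})"
      by (rule has_vector_derivative_within_subset[OF dflow_derivative_0]) auto
    then have "((\<lambda>t. (1 / norm (t - 0)) *\<^sub>R (fst (dflow c0 w t a) - (fst (dflow c0 w 0 a) + (t - 0) *\<^sub>R a))) \<longlongrightarrow> 0) (at 0 within {0<..})"
      unfolding has_vector_derivative_def has_derivative_within by blast
    then have "((\<lambda>t. (1 / norm (t - 0)) *\<^sub>R (fst (dflow c0 w t a) - (fst (dflow c0 w 0 a) + (t - 0) *\<^sub>R a)) + a) \<longlongrightarrow> 0 + a) (at 0 within {0<..})"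
      by (intro tendsto_add tendsto_const)
    moreover have "eventually (\<lambda>t. (1 / norm (t - 0)) *\<^sub>R (fst (dflow c0 w t a) - (fst (dflow c0 w 0 a) + (t - 0) *\<^sub>R a)) + a
        = fst (dflow c0 w t a) /\<^sub>R t) (at 0 within {0<..})"
      unfolding eventually_at
      by (intro exI[of _ 1]) (auto simp: flow_diff_0(2) scaleR_diff_right divide_inverse)
    ultimately show ?thesis by (simp add: Lim_transform_eventually)
  qed
  then have lim: "(\<zeta> \<longlongrightarrow> a) (at 0 within {0<..})" unfolding \<zeta>_def[abs_def] .
  have ev: "eventually (\<lambda>t. coord_metric X c0 (chart_map c0 (geod w t)) (\<zeta> t) (\<zeta> t) \<le> jac w a 1) (at 0 within {0<..})"
    unfolding eventually_at
  proof (intro exI[of _ "min e 1"] conjI ballI impI)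
    fix t :: real assume t: "t \<in> {0<..}" "t \<noteq> 0 \<and> dist t 0 < min e 1"
    then have t: "0 < t" "t < 1" "\<bar>t\<bar> < e" by auto
    have img: "chart_map c0 (geod w t) \<in> chart_img c0" using e(2)[OF t(3)] by blast
    have j0: "jac w a t \<ge> 0" "jac w a 1 \<ge> 0"
      using jac_eq[of t c0 w a] e(2)[OF t(3)] c0(1) P.g_nonneg[OF img] t jac_Exp[of 1 d w a] assms by auto
    have "sqrt (jac w a t) \<le> t * sqrt (jac w a 1)" by (rule sqrt_jac_le) (use t in auto)
    then have "(sqrt (jac w a t))\<^sup>2 \<le> (t * sqrt (jac w a 1))\<^sup>2" by (intro power_mono) (use j0 in auto)
    then have "jac w a t \<le> t * t * jac w a 1" using j0 unfolding power_mult_distrib by (simp add: power2_eq_square[of t])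
    moreover have "jac w a t = t * t * coord_metric X c0 (chart_map c0 (geod w t)) (\<zeta> t) (\<zeta> t)"
    proof -
      have "fst (dflow c0 w t a) = t *\<^sub>R \<zeta> t" unfolding \<zeta>_def using t by simp
      then show ?thesis
        using jac_eq[of t c0 w a] e(2)[OF t(3)] c0(1) t by (simp add: P.g_scale[OF img])
    qed
    ultimately show "coord_metric X c0 (chart_map c0 (geod w t)) (\<zeta> t) (\<zeta> t) \<le> jac w a 1" using t by simp
  qed (use e in auto)
  have "coord_metric X c0 (chart_map c0 p) a a \<le> jac w a 1"
    by (rule tendsto_upperbound[OF jac_expansion[OF lim] ev]) simp
  also have "\<dots> = (nrm d (Exp w) (dExp d w a))\<^sup>2" using jac_Exp[of 1 d w a] assms by simp
  finally have "(pnorm a)\<^sup>2 \<le> (nrm d (Exp w) (dExp d w a))\<^sup>2" using nrm_square[OF c0] by simp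
  then show ?thesis by (rule power2_le_imp_le[OF _ nrm_nonneg[OF assms]])
qed

end

section \<open>Lifting through coverings of general topological spaces\<close>

text \<open>The lifting theorems of the library need a covering of normed spaces. The following property
  of covering maps, which mentions no sheets, is easier to verify for the exponential map.\<close>

definition section_covering :: "('a::topological_space \<Rightarrow> 'b::topological_space) \<Rightarrow> bool" where
  "section_covering q \<longleftrightarrow> continuous_on UNIV q \<and> (\<forall>c. \<exists>U. open U \<and> c \<in> U \<and> inj_on q U) \<and>
     (\<forall>s. \<exists>V. open V \<and> s \<in> V \<and> (\<forall>c. q c \<in> V \<longrightarrow>
        (\<exists>\<sigma>. continuous_on V \<sigma> \<and> (\<forall>v\<in>V. q (\<sigma> v) = v) \<and> \<sigma> (q c) = c)))"

lemma covering_space_imp_section_covering: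
  assumes "covering_space UNIV q UNIV"
  shows "section_covering q"
  unfolding section_covering_def
proof (intro conjI allI)
  show "continuous_on UNIV q" using assms by (rule covering_space_imp_continuous)
  have cov: "\<exists>T v. open T \<and> s \<in> T \<and> \<Union>v = q -` T \<and> (\<forall>u\<in>v. open u) \<and> (\<forall>u\<in>v. \<exists>k. homeomorphism u T q k)" for s
    using assms unfolding covering_space_def by simp blast
  show "\<exists>U. open U \<and> c \<in> U \<and> inj_on q U" for c
  proof -
    obtain T v where T: "q c \<in> T" "\<Union>v = q -` T" "\<forall>u\<in>v. open u" "\<forall>u\<in>v. \<exists>k. homeomorphism u T q k"
      using cov[of "q c"] by (elim exE conjE) (rule that)
    then have "c \<in> \<Union>v" by simp
    then obtain u where u: "u \<in> v" "c \<in> u" by (rule UnionE)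
    then obtain k where k: "homeomorphism u T q k" using T(4) by (meson bspec)
    have "inj_on q u" by (rule inj_on_inverseI[of _ k]) (rule homeomorphism_apply1[OF k])
    then show ?thesis using u T(3) by (intro exI[of _ u]) simp
  qed
  show "\<exists>V. open V \<and> s \<in> V \<and> (\<forall>c. q c \<in> V \<longrightarrow>
        (\<exists>\<sigma>. continuous_on V \<sigma> \<and> (\<forall>v\<in>V. q (\<sigma> v) = v) \<and> \<sigma> (q c) = c))" for s
  proof -
    obtain T v where T: "open T" "s \<in> T" "\<Union>v = q -` T" "\<forall>u\<in>v. \<exists>k. homeomorphism u T q k"
      using cov[of s] by (elim exE conjE) (rule that)
    have "\<exists>\<sigma>. continuous_on T \<sigma> \<and> (\<forall>v\<in>T. q (\<sigma> v) = v) \<and> \<sigma> (q c) = c" if "q c \<in> T" for c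
    proof -
      have "c \<in> \<Union>v" using T(3) that by simp
      then obtain u where u: "u \<in> v" "c \<in> u" by (rule UnionE)
      then obtain k where k: "homeomorphism u T q k" using T(4) by (meson bspec)
      show ?thesis
        by (intro exI[of _ k] conjI ballI homeomorphism_cont2[OF k] homeomorphism_apply2[OF k] homeomorphism_apply1[OF k u(2)])
    qed
    then show ?thesis using T(1,2) by (intro exI[of _ T]) simp
  qed
qed

lemma section_covering_locally_injective: "section_covering q \<Longrightarrow> \<exists>U. open U \<and> c \<in> U \<and> inj_on q U"
  unfolding section_covering_def by blast

text \<open>The set where \<open>f\<close> and \<open>g\<close> agree is open because
  \<open>q\<close> is locally injective, and closed because the lifts take values in a Hausdorff
  space.\<close>

lemma continuous_lift_unique:
  fixes q :: "'a::t2_space \<Rightarrow> 'b::topological_space" and f g :: "'z::topological_space \<Rightarrow> 'a"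
  assumes loc: "\<And>c. \<exists>U. open U \<and> c \<in> U \<and> inj_on q U" and T: "connected T" "a \<in> T" "x \<in> T"
    and f: "continuous_on T f" and g: "continuous_on T g"
    and eq: "\<And>y. y \<in> T \<Longrightarrow> q (f y) = q (g y)" "f a = g a"
  shows "f x = g x"
proof -
  let ?S = "{y \<in> T. f y = g y}"
  have "openin (top_of_set T) ?S"
  proof (subst openin_subopen, intro ballI)
    fix y assume y: "y \<in> ?S"
    obtain U where U: "open U" "f y \<in> U" "inj_on q U" using loc by blast
    have "openin (top_of_set T) ((T \<inter> f -` U) \<inter> (T \<inter> g -` U))"
      by (intro openin_Int continuous_openin_preimage_gen f g U(1))
    moreover have "y \<in> (T \<inter> f -` U) \<inter> (T \<inter> g -` U)" using y U(2) by auto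
    moreover have "(T \<inter> f -` U) \<inter> (T \<inter> g -` U) \<subseteq> ?S"
      using eq(1) U(3) by (auto simp: inj_on_def)
    ultimately show "\<exists>V. openin (top_of_set T) V \<and> y \<in> V \<and> V \<subseteq> ?S" by blast
  qed
  moreover have "closedin (top_of_set T) ?S"
    using closedin_continuous_maps_eq[of euclidean "top_of_set T" f g] f g
    by (simp add: Hausdorff_space_def separation_t2 disjnt_def)
  moreover have "a \<in> ?S" using T(2) eq(2) by simp
  ultimately have "?S = T" using T(1) unfolding connected_clopen by blast
  then show ?thesis using T(3) by blast
qed

text \<open>Continuous induction: a lift on \<open>{a..s}\<close> is prolonged by the local section
  \<open>\<sigma>\<close> through its end point.\<close>

lemma path_lift:
  fixes q :: "'a::t2_space \<Rightarrow> 'b::topological_space" and f :: "real \<Rightarrow> 'b"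
  assumes q: "section_covering q" and ab: "a \<le> b" and f: "continuous_on {a..b} f" and c: "q c = f a"
  obtains l where "continuous_on {a..b} l" "l a = c" "\<forall>t\<in>{a..b}. q (l t) = f t"
proof -
  define P where "P t \<longleftrightarrow> (\<exists>l. continuous_on {a..t} l \<and> l a = c \<and> (\<forall>s\<in>{a..t}. q (l s) = f s))" for t
  have ext: "P u" if s: "P s" "a \<le> s" "s \<le> u" "u \<le> b" "\<forall>r\<in>{s..u}. f r \<in> V"
    and V: "\<forall>c. q c \<in> V \<longrightarrow> (\<exists>\<sigma>. continuous_on V \<sigma> \<and> (\<forall>v\<in>V. q (\<sigma> v) = v) \<and> \<sigma> (q c) = c)" for s u V
  proof -
    obtain l where l: "continuous_on {a..s} l" "l a = c" "\<forall>r\<in>{a..s}. q (l r) = f r"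
      using s(1) unfolding P_def by blast
    have ls: "q (l s) = f s" using l(3) s(2) by auto
    have "q (l s) \<in> V" using s(3,5) ls by auto
    then obtain \<sigma> where \<sigma>: "continuous_on V \<sigma>" "\<forall>v\<in>V. q (\<sigma> v) = v" "\<sigma> (q (l s)) = l s"
      using V by blast
    define l' where "l' r = (if r \<le> s then l r else \<sigma> (f r))" for r
    have eq: "l' r = \<sigma> (f r)" if "r \<in> {s..u}" for r
      using that \<sigma>(3) ls unfolding l'_def by (cases "r = s") auto
    have c1: "continuous_on {a..s} l'"
      by (rule continuous_on_eq[OF l(1)]) (simp add: l'_def)
    have "continuous_on {s..u} (\<lambda>r. \<sigma> (f r))"
      by (rule continuous_on_compose2[OF \<sigma>(1) continuous_on_subset[OF f]]) (use s in auto)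
    then have c2: "continuous_on {s..u} l'" by (rule continuous_on_eq) (simp add: eq)
    have "continuous_on ({a..s} \<union> {s..u}) l'" by (intro continuous_on_closed_Un c1 c2) auto
    moreover have "{a..s} \<union> {s..u} = {a..u}" using s by auto
    moreover have "q (l' r) = f r" if "r \<in> {a..u}" for r
      using that l(3) \<sigma>(2) s(5) unfolding l'_def by auto
    moreover have "l' a = c" using l(2) s(2) unfolding l'_def by simp
    ultimately show ?thesis unfolding P_def by metis
  qed
  have near: "\<exists>V d. d > 0 \<and> (\<forall>r\<in>{a..b}. \<bar>r - t\<bar> < d \<longrightarrow> f r \<in> V) \<and>
      (\<forall>c. q c \<in> V \<longrightarrow> (\<exists>\<sigma>. continuous_on V \<sigma> \<and> (\<forall>v\<in>V. q (\<sigma> v) = v) \<and> \<sigma> (q c) = c))" if t: "t \<in> {a..b}" for t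
  proof -
    obtain V where V: "open V" "f t \<in> V"
      "\<forall>c. q c \<in> V \<longrightarrow> (\<exists>\<sigma>. continuous_on V \<sigma> \<and> (\<forall>v\<in>V. q (\<sigma> v) = v) \<and> \<sigma> (q c) = c)"
      using q unfolding section_covering_def by meson
    have "eventually (\<lambda>r. f r \<in> V) (at t within {a..b})"
      by (rule topological_tendstoD[OF _ V(1,2)]) (use f t in \<open>auto simp: continuous_on_def\<close>)
    then obtain d where "d > 0" "\<forall>r\<in>{a..b}. r \<noteq> t \<and> dist r t < d \<longrightarrow> f r \<in> V"
      unfolding eventually_at by blast
    then show ?thesis using V(2,3) by (intro exI[of _ V] exI[of _ d]) (auto simp: dist_real_def)
  qed
  have "b \<in> {a..b}" using ab by simp
  with ab have "P b"
  proof (rule interval_induct[where P = P])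
    show "P a" unfolding P_def using c by (intro exI[of _ "\<lambda>_. c"]) auto
  next
    fix t assume t: "a \<le> t" "t < b" "P t"
    obtain V d where d: "d > 0" "\<forall>r\<in>{a..b}. \<bar>r - t\<bar> < d \<longrightarrow> f r \<in> V" and
      V: "\<forall>c. q c \<in> V \<longrightarrow> (\<exists>\<sigma>. continuous_on V \<sigma> \<and> (\<forall>v\<in>V. q (\<sigma> v) = v) \<and> \<sigma> (q c) = c)"
      using near[of t] t by auto
    have "P s" if "t < s" "s < t + d" "s \<le> b" for s
      by (rule ext[OF t(3,1) _ that(3) _ V]) (use that t d(2) in auto)
    then show "\<exists>d>0. \<forall>s. t < s \<and> s < t + d \<and> s \<le> b \<longrightarrow> P s" using d(1) by blast
  next
    fix t assume t: "a < t" "t \<le> b" "\<And>s. a \<le> s \<Longrightarrow> s < t \<Longrightarrow> P s"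
    obtain V d where d: "d > 0" "\<forall>r\<in>{a..b}. \<bar>r - t\<bar> < d \<longrightarrow> f r \<in> V" and
      V: "\<forall>c. q c \<in> V \<longrightarrow> (\<exists>\<sigma>. continuous_on V \<sigma> \<and> (\<forall>v\<in>V. q (\<sigma> v) = v) \<and> \<sigma> (q c) = c)"
      using near[of t] t by auto
    define s where "s = max a (t - d/2)"
    have s: "a \<le> s" "s < t" "t - s < d" using t(1) d(1) unfolding s_def by auto
    show "P t"
      by (rule ext[OF t(3)[OF s(1,2)] s(1) _ t(2) _ V]) (use s t d(2) in auto)
  qed
  then show thesis using that unfolding P_def by blast
qed

text \<open>Each path \<open>t \<mapsto> h (t, y)\<close> is lifted separately, so only joint
  continuity remains. It is local in \<open>y\<close> and proved by continuous induction in
  \<open>t\<close>, on short intervals where the lift coincides with a section of \<open>q\<close>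
  composed with \<open>h\<close>.\<close>

lemma homotopy_lift:
  fixes q :: "'a::t2_space \<Rightarrow> 'b::topological_space" and h :: "real \<times> 'y::topological_space \<Rightarrow> 'b"
  assumes q: "section_covering q" and h: "continuous_on ({0..1} \<times> S) h"
    and k0: "continuous_on S k0" "\<And>y. y \<in> S \<Longrightarrow> q (k0 y) = h (0, y)"
  obtains k where "continuous_on ({0..1} \<times> S) k" "\<forall>y\<in>S. k (0, y) = k0 y"
    "\<forall>t\<in>{0..1}. \<forall>y\<in>S. q (k (t, y)) = h (t, y)"
proof -
  have hy: "continuous_on {0..1} (\<lambda>t. h (t, y))" if "y \<in> S" for y
    by (rule continuous_on_compose2[OF h]) (use that in \<open>auto intro!: continuous_intros\<close>)
  have "\<exists>l. continuous_on {0..1} l \<and> l 0 = k0 y \<and> (\<forall>t\<in>{0..1}. q (l t) = h (t, y))" if "y \<in> S" for y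
    by (rule path_lift[OF q zero_le_one hy[OF that] k0(2)[OF that]]) (intro exI conjI)
  then obtain l where l: "\<And>y. y \<in> S \<Longrightarrow> continuous_on {0..1} (l y)" "\<And>y. y \<in> S \<Longrightarrow> l y 0 = k0 y"
    "\<And>y t. y \<in> S \<Longrightarrow> t \<in> {0..1} \<Longrightarrow> q (l y t) = h (t, y)"
    by metis
  define k where "k = (\<lambda>(t, y). l y t)"
  have k: "k (t, y) = l y t" for t y unfolding k_def by simp
  have local: "\<exists>N. open N \<and> y0 \<in> N \<and> continuous_on ({0..1} \<times> (N \<inter> S)) k" if y0: "y0 \<in> S" for y0
  proof -
    define P where "P t \<longleftrightarrow> (\<exists>N. open N \<and> y0 \<in> N \<and> continuous_on ({0..t} \<times> (N \<inter> S)) k)" for t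
    have ext: "P u" if s: "P s" "0 \<le> s" "s \<le> u" "u \<le> 1" and N': "open N'" "y0 \<in> N'"
      and hV: "\<forall>r\<in>{s..u}. \<forall>y\<in>N' \<inter> S. h (r, y) \<in> V"
      and V: "\<forall>c. q c \<in> V \<longrightarrow> (\<exists>\<sigma>. continuous_on V \<sigma> \<and> (\<forall>v\<in>V. q (\<sigma> v) = v) \<and> \<sigma> (q c) = c)" for s u V N'
    proof -
      obtain N where N: "open N" "y0 \<in> N" "continuous_on ({0..s} \<times> (N \<inter> S)) k" using s(1) unfolding P_def by blast
      have s01: "s \<in> {0..1}" using s by auto
      have "q (l y0 s) \<in> V" using l(3)[OF y0 s01] hV s(3) N'(2) y0 by auto
      then obtain \<sigma> where \<sigma>: "continuous_on V \<sigma>" "\<forall>v\<in>V. q (\<sigma> v) = v" "\<sigma> (q (l y0 s)) = l y0 s"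
        using V by blast
      obtain U where U: "open U" "l y0 s \<in> U" "inj_on q U" using q unfolding section_covering_def by blast
      let ?D = "N \<inter> N' \<inter> S"
      have c1: "continuous_on ?D (\<lambda>y. l y s)"
      proof -
        have "continuous_on ?D (\<lambda>y. k (s, y))"
          by (rule continuous_on_compose2[OF N(3)]) (use s in \<open>auto intro!: continuous_intros\<close>)
        then show ?thesis by (simp add: k)
      qed
      have c2: "continuous_on ?D (\<lambda>y. \<sigma> (h (s, y)))"
      proof (rule continuous_on_compose2[OF \<sigma>(1)])
        show "continuous_on ?D (\<lambda>y. h (s, y))"
          by (rule continuous_on_compose2[OF h]) (use s01 in \<open>auto intro!: continuous_intros\<close>)
      qed (use hV s(3) in auto)
      obtain A1 where A1: "open A1" "A1 \<inter> ?D = (\<lambda>y. l y s) -` U \<inter> ?D"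
        using c1 U(1) unfolding continuous_on_open_invariant by metis
      obtain A2 where A2: "open A2" "A2 \<inter> ?D = (\<lambda>y. \<sigma> (h (s, y))) -` U \<inter> ?D"
        using c2 U(1) unfolding continuous_on_open_invariant by metis
      \<comment> \<open>For \<open>y\<close> in \<open>N2 \<inter> S\<close> both
        \<open>l y s\<close> and \<open>\<sigma> (h (s, y))\<close> lie in \<open>U\<close>, on
        which \<open>q\<close> is injective, so they agree; unique lifting extends this to
        \<open>{s..u}\<close>.\<close>
      define N2 where "N2 = N \<inter> N' \<inter> A1 \<inter> A2"
      have N2: "open N2" unfolding N2_def by (intro open_Int N N' A1 A2)
      have "y0 \<in> A1" using A1(2) N(2) N'(2) y0 U(2) by auto
      moreover have "y0 \<in> A2" using A2(2) N(2) N'(2) y0 U(2) \<sigma>(3) l(3)[OF y0 s01] by auto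
      ultimately have y0N: "y0 \<in> N2" unfolding N2_def using N(2) N'(2) by blast
      have eqs: "l y s = \<sigma> (h (s, y))" if y: "y \<in> N2 \<inter> S" for y
      proof -
        have "l y s \<in> U" "\<sigma> (h (s, y)) \<in> U" using y A1(2) A2(2) unfolding N2_def by auto
        moreover have "q (l y s) = q (\<sigma> (h (s, y)))"
          using l(3)[OF _ s01] \<sigma>(2) hV y s(3) unfolding N2_def by auto
        ultimately show ?thesis using U(3) by (auto dest: inj_onD)
      qed
      have eq: "k (r, y) = \<sigma> (h (r, y))" if r: "r \<in> {s..u}" and y: "y \<in> N2 \<inter> S" for r y
      proof -
        have su: "{s..u} \<subseteq> {0..1}" using s by auto
        have "l y r = \<sigma> (h (r, y))"
        proof (rule continuous_lift_unique[OF section_covering_locally_injective[OF q], of "{s..u}" s r "l y" "\<lambda>r. \<sigma> (h (r, y))"])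
          show "continuous_on {s..u} (l y)" using l(1) y su continuous_on_subset by blast
          show "continuous_on {s..u} (\<lambda>r. \<sigma> (h (r, y)))"
            by (rule continuous_on_compose2[OF \<sigma>(1) continuous_on_subset[OF hy su]])
              (use y hV in \<open>auto simp: N2_def\<close>)
          show "q (l y v) = q (\<sigma> (h (v, y)))" if "v \<in> {s..u}" for v
            using l(3)[of y v] \<sigma>(2) hV y su that unfolding N2_def by auto
        qed (use r s eqs[OF y] in auto)
        then show ?thesis by (simp add: k)
      qed
      let ?T = "{0..u} \<times> (N2 \<inter> S)"
      have T: "?T = {0..s} \<times> (N2 \<inter> S) \<union> {s..u} \<times> (N2 \<inter> S)" using s by auto
      have cl: "closedin (top_of_set ?T) ({0..s} \<times> (N2 \<inter> S))" "closedin (top_of_set ?T) ({s..u} \<times> (N2 \<inter> S))"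
      proof -
        have "{0..s} \<times> (N2 \<inter> S) = ?T \<inter> ({..s} \<times> UNIV)" "{s..u} \<times> (N2 \<inter> S) = ?T \<inter> ({s..} \<times> UNIV)"
          using s by auto
        then show "closedin (top_of_set ?T) ({0..s} \<times> (N2 \<inter> S))" "closedin (top_of_set ?T) ({s..u} \<times> (N2 \<inter> S))"
          by (simp_all only: closedin_closed_Int closed_Times closed_atMost closed_atLeast closed_UNIV)
      qed
      have "continuous_on ({0..s} \<times> (N2 \<inter> S)) k"
        by (rule continuous_on_subset[OF N(3)]) (auto simp: N2_def)
      moreover have "continuous_on ({s..u} \<times> (N2 \<inter> S)) k"
      proof -
        have "continuous_on ({s..u} \<times> (N2 \<inter> S)) (\<lambda>x. \<sigma> (h x))"
          by (rule continuous_on_compose2[OF \<sigma>(1) continuous_on_subset[OF h]])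
            (use s hV in \<open>auto simp: N2_def\<close>)
        then show ?thesis by (rule continuous_on_eq) (use eq in auto)
      qed
      ultimately have "continuous_on ?T k"
        using continuous_on_Un_local[OF cl[unfolded T]] unfolding T by blast
      then show ?thesis unfolding P_def using N2 y0N by blast
    qed
    have near: "\<exists>V d N'. d > 0 \<and> open N' \<and> y0 \<in> N' \<and> (\<forall>r\<in>{0..1}. \<bar>r - t\<bar> < d \<longrightarrow> (\<forall>y\<in>N' \<inter> S. h (r, y) \<in> V)) \<and>
        (\<forall>c. q c \<in> V \<longrightarrow> (\<exists>\<sigma>. continuous_on V \<sigma> \<and> (\<forall>v\<in>V. q (\<sigma> v) = v) \<and> \<sigma> (q c) = c))" if t: "t \<in> {0..1}" for t
    proof -
      obtain V where V: "open V" "h (t, y0) \<in> V"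
        "\<forall>c. q c \<in> V \<longrightarrow> (\<exists>\<sigma>. continuous_on V \<sigma> \<and> (\<forall>v\<in>V. q (\<sigma> v) = v) \<and> \<sigma> (q c) = c)"
        using q unfolding section_covering_def by meson
      obtain W where W: "open W" "W \<inter> ({0..1} \<times> S) = h -` V \<inter> ({0..1} \<times> S)"
        using h V(1) unfolding continuous_on_open_invariant by metis
      have "(t, y0) \<in> W" using W(2) t y0 V(2) by blast
      then obtain A N' where A: "open A" "open N'" "(t, y0) \<in> A \<times> N'" "A \<times> N' \<subseteq> W"
        using W(1) by (rule_tac open_prod_elim) auto
      obtain d where d: "d > 0" "ball t d \<subseteq> A" using A(1,3) openE by blast
      have "h (r, y) \<in> V" if "r \<in> {0..1}" "\<bar>r - t\<bar> < d" "y \<in> N' \<inter> S" for r y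
      proof -
        have "r \<in> A" using that(2) d(2) by (auto simp: dist_real_def abs_minus_commute)
        then have "(r, y) \<in> W" using A(4) that(3) by blast
        then show ?thesis using W(2) that by blast
      qed
      then show ?thesis using d(1) A(2,3) V(3) by (intro exI[of _ V] exI[of _ d] exI[of _ N']) blast
    qed
    have "(0::real) \<le> 1" "(1::real) \<in> {0..1}" by auto
    then have "P 1"
    proof (rule interval_induct[where P = P])
      have "continuous_on ({0..0} \<times> (UNIV \<inter> S)) (\<lambda>x. k0 (snd x))"
        by (rule continuous_on_compose2[OF k0(1)]) (auto intro!: continuous_intros)
      then have "continuous_on ({0..0} \<times> (UNIV \<inter> S)) k"
        by (rule continuous_on_eq) (auto simp: k l(2))
      then show "P 0" unfolding P_def by blast
    next
      fix t :: real assume t: "0 \<le> t" "t < 1" "P t"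
      obtain V d N' where d: "d > 0" "open N'" "y0 \<in> N'" "\<forall>r\<in>{0..1}. \<bar>r - t\<bar> < d \<longrightarrow> (\<forall>y\<in>N' \<inter> S. h (r, y) \<in> V)" and
        V: "\<forall>c. q c \<in> V \<longrightarrow> (\<exists>\<sigma>. continuous_on V \<sigma> \<and> (\<forall>v\<in>V. q (\<sigma> v) = v) \<and> \<sigma> (q c) = c)"
        using near[of t] t by auto
      have "P s" if s: "t < s" "s < t + d" "s \<le> 1" for s
      proof (rule ext[OF t(3,1) _ s(3) d(2,3) _ V])
        show "\<forall>r\<in>{t..s}. \<forall>y\<in>N' \<inter> S. h (r, y) \<in> V"
          using d(4) s t by (intro ballI) (auto dest!: bspec)
      qed (use s in simp)
      then show "\<exists>d>0. \<forall>s. t < s \<and> s < t + d \<and> s \<le> 1 \<longrightarrow> P s" using d(1) by blast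
    next
      fix t :: real assume t: "0 < t" "t \<le> 1" "\<And>s. 0 \<le> s \<Longrightarrow> s < t \<Longrightarrow> P s"
      obtain V d N' where d: "d > 0" "open N'" "y0 \<in> N'" "\<forall>r\<in>{0..1}. \<bar>r - t\<bar> < d \<longrightarrow> (\<forall>y\<in>N' \<inter> S. h (r, y) \<in> V)" and
        V: "\<forall>c. q c \<in> V \<longrightarrow> (\<exists>\<sigma>. continuous_on V \<sigma> \<and> (\<forall>v\<in>V. q (\<sigma> v) = v) \<and> \<sigma> (q c) = c)"
        using near[of t] t by auto
      define s where "s = max 0 (t - d/2)"
      have s: "0 \<le> s" "s < t" "t - s < d" using t(1) d(1) unfolding s_def by auto
      show "P t"
      proof (rule ext[OF t(3)[OF s(1,2)] s(1) _ t(2) d(2,3) _ V])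
        show "\<forall>r\<in>{s..t}. \<forall>y\<in>N' \<inter> S. h (r, y) \<in> V"
          using d(4) s t by (intro ballI) (auto dest!: bspec)
      qed (use s in simp)
    qed
    then show ?thesis unfolding P_def .
  qed
  have "continuous_on ({0..1} \<times> S) k"
    unfolding continuous_on_def
  proof
    fix x :: "real \<times> 'y" assume x: "x \<in> {0..1} \<times> S"
    then obtain N where N: "open N" "snd x \<in> N" "continuous_on ({0..1} \<times> (N \<inter> S)) k" using local[of "snd x"] by auto
    have "(k \<longlongrightarrow> k x) (at x within {0..1} \<times> (N \<inter> S))"
      using N(2,3) x unfolding continuous_on_def by auto
    moreover have "at x within {0..1} \<times> (N \<inter> S) = at x within {0..1} \<times> S"
      by (rule at_within_nhd[of _ "UNIV \<times> N"]) (use N(1,2) x in \<open>auto intro: open_Times\<close>)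
    ultimately show "(k \<longlongrightarrow> k x) (at x within {0..1} \<times> S)" by simp
  qed
  then show thesis using that[of k] l(2,3) by (auto simp: k)
qed

text \<open>A null homotopy of the loop \<open>q \<circ> \<gamma>\<close> lifts to a homotopy
  starting at \<open>\<gamma>\<close>. Its last stage lifts a constant path and is therefore
  constant. Going back along the two sides, which lift the same path, the end points of
  \<open>\<gamma>\<close> coincide.\<close>

lemma section_covering_path_endpoints:
  fixes q :: "'a::t2_space \<Rightarrow> 'b::topological_space"
  assumes q: "section_covering q" and sc: "simply_connected (UNIV :: 'b set)"
    and \<gamma>: "path \<gamma>" "q (pathstart \<gamma>) = q (pathfinish \<gamma>)"
  shows "pathstart \<gamma> = pathfinish \<gamma>"
proof -
  have cq: "continuous_on UNIV q" using q unfolding section_covering_def by blast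
  have loop: "path (q \<circ> \<gamma>)" "pathfinish (q \<circ> \<gamma>) = pathstart (q \<circ> \<gamma>)"
    using \<gamma> cq by (auto simp: path_continuous_image continuous_on_subset pathstart_def pathfinish_def)
  have const: "path (\<lambda>_. q (\<gamma> 0))" "pathfinish (\<lambda>_. q (\<gamma> 0)) = pathstart (\<lambda>_. q (\<gamma> 0))"
    by (auto simp: path_def pathstart_def pathfinish_def)
  have "homotopic_loops UNIV (q \<circ> \<gamma>) (\<lambda>_. q (\<gamma> 0))"
    using sc loop const unfolding simply_connected_def by blast
  then obtain h where h: "continuous_on ({0..1::real} \<times> {0..1::real}) h"
    "\<forall>x\<in>{0..1}. h (0, x) = (q \<circ> \<gamma>) x" "\<forall>x\<in>{0..1}. h (1, x) = q (\<gamma> 0)"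
    "\<forall>t\<in>{0..1}. pathfinish (h \<circ> Pair t) = pathstart (h \<circ> Pair t)"
    unfolding homotopic_loops by blast
  have c\<gamma>: "continuous_on {0..1} \<gamma>" using \<gamma>(1) unfolding path_def .
  obtain k where k: "continuous_on ({0..1} \<times> {0..1}) k" "\<forall>y\<in>{0..1}. k (0, y) = \<gamma> y"
    "\<forall>t\<in>{0..1}. \<forall>y\<in>{0..1}. q (k (t, y)) = h (t, y)"
    by (rule homotopy_lift[OF q h(1) c\<gamma>]) (use h(2) in auto)
  have k1: "continuous_on {0..1} (\<lambda>y. k (1, y))" "continuous_on {0..1} (\<lambda>t. k (t, 0))" "continuous_on {0..1} (\<lambda>t. k (t, 1))"
    by (rule continuous_on_compose2[OF k(1)]; auto intro!: continuous_intros)+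
  have "k (1, 1) = k (1, 0)"
    by (rule continuous_lift_unique[OF section_covering_locally_injective[OF q], of "{0..1}" 0 1 "\<lambda>y. k (1, y)" "\<lambda>_. k (1, 0)"])
      (use k1(1) k(3) h(3) in auto)
  moreover have "h (t, 1) = h (t, 0)" if "t \<in> {0..1}" for t
    using h(4) that by (auto simp: pathstart_def pathfinish_def)
  ultimately have "k (0, 1) = k (0, 0)"
    by (intro continuous_lift_unique[OF section_covering_locally_injective[OF q], of "{0..1}" 1 0 "\<lambda>t. k (t, 1)" "\<lambda>t. k (t, 0)"])
      (use k1(2,3) k(3) in auto)
  then show ?thesis using k(2) by (simp add: pathstart_def pathfinish_def)
qed

text \<open>Otherwise there are pairs of distinct points with equal images ever closer to
  \<open>K\<close>. Along a subsequence both members converge; the limits have the same image, hence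
  coincide, and local injectivity there is violated.\<close>

lemma injective_near_compact:
  fixes E :: "'e::euclidean_space \<Rightarrow> 'b::t2_space"
  assumes K: "compact K" and inj: "inj_on E K" and cont: "continuous_on UNIV E"
    and loc: "\<And>x. \<exists>U. open U \<and> x \<in> U \<and> inj_on E U"
  obtains O' where "open O'" "K \<subseteq> O'" "inj_on E O'"
proof (rule ccontr)
  assume no: "\<not> thesis"
  have open_nb: "open (\<Union>x\<in>K. ball x (inverse (Suc n)))" for n by blast
  have "\<not> inj_on E (\<Union>x\<in>K. ball x (inverse (Suc n)))" for n
  proof
    assume "inj_on E (\<Union>x\<in>K. ball x (inverse (Suc n)))"
    moreover have "K \<subseteq> (\<Union>x\<in>K. ball x (inverse (Suc n)))" by force
    ultimately show False using no that[OF open_nb] by blast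
  qed
  then have "\<exists>x y a b. a \<in> K \<and> b \<in> K \<and> dist a x < inverse (Suc n) \<and> dist b y < inverse (Suc n) \<and> x \<noteq> y \<and> E x = E y" for n
    unfolding inj_on_def by fastforce
  then obtain x y a b where xy: "\<And>n. a n \<in> K" "\<And>n. b n \<in> K" "\<And>n. dist (a n) (x n) < inverse (Suc n)"
    "\<And>n. dist (b n) (y n) < inverse (Suc n)" "\<And>n. x n \<noteq> y n" "\<And>n. E (x n) = E (y n)"
    by metis
  obtain p r where r: "p \<in> K \<times> K" "strict_mono r" "((\<lambda>n. (a n, b n)) \<circ> r) \<longlonglongrightarrow> p"
  proof (rule seq_compactE[of "K \<times> K" "\<lambda>n. (a n, b n)"])
    show "seq_compact (K \<times> K)" using compact_Times[OF K K] by (simp add: compact_eq_seq_compact_metric)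
    show "\<forall>n. (a n, b n) \<in> K \<times> K" using xy(1,2) by blast
  qed (rule that)
  have lim: "(\<lambda>n. a (r n)) \<longlonglongrightarrow> fst p" "(\<lambda>n. b (r n)) \<longlonglongrightarrow> snd p"
    using tendsto_fst[OF r(3)] tendsto_snd[OF r(3)] by (simp_all add: o_def)
  have z: "(\<lambda>n. inverse (real (Suc (r n)))) \<longlonglongrightarrow> 0"
    using LIMSEQ_subseq_LIMSEQ[OF LIMSEQ_inverse_real_of_nat r(2)] by (simp add: o_def)
  have lx: "(\<lambda>n. x (r n)) \<longlonglongrightarrow> fst p"
  proof (rule Lim_transform[OF lim(1)])
    show "(\<lambda>n. x (r n) - a (r n)) \<longlonglongrightarrow> 0"
      by (rule Lim_null_comparison[OF _ z]) (use xy(3) in \<open>auto simp: dist_norm norm_minus_commute less_imp_le\<close>)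
  qed
  have ly: "(\<lambda>n. y (r n)) \<longlonglongrightarrow> snd p"
  proof (rule Lim_transform[OF lim(2)])
    show "(\<lambda>n. y (r n) - b (r n)) \<longlonglongrightarrow> 0"
      by (rule Lim_null_comparison[OF _ z]) (use xy(4) in \<open>auto simp: dist_norm norm_minus_commute less_imp_le\<close>)
  qed
  have cE: "isCont E u" for u using cont by (simp add: continuous_on_eq_continuous_at)
  have "(\<lambda>n. E (x (r n))) \<longlonglongrightarrow> E (fst p)" by (rule isCont_tendsto_compose[OF cE lx])
  moreover have "(\<lambda>n. E (x (r n))) \<longlonglongrightarrow> E (snd p)"
    using isCont_tendsto_compose[OF cE ly] xy(6) by simp
  ultimately have "E (fst p) = E (snd p)" by (rule LIMSEQ_unique)
  then have p: "snd p = fst p" using inj r(1) by (auto dest: inj_onD)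
  obtain U where U: "open U" "fst p \<in> U" "inj_on E U" using loc by blast
  have "eventually (\<lambda>n. x (r n) \<in> U \<and> y (r n) \<in> U) sequentially"
    using topological_tendstoD[OF lx U(1,2)] topological_tendstoD[OF ly U(1)] U(2) p
    by (auto intro: eventually_conj)
  then obtain n where "x (r n) \<in> U" "y (r n) \<in> U" unfolding eventually_sequentially by blast
  then show False using U(3) xy(5,6) by (metis inj_onD)
qed

section \<open>Cartan-Hadamard: the exponential map is a homeomorphism\<close>

context hadamard_point
begin

lemma pnorm_lower: obtains m where "m > 0" "\<And>a. m * norm a \<le> pnorm a"
proof -
  interpret P: metric_patch "chart_img c0" "coord_metric X c0" by (rule metric_patch[OF c0(1)])
  have "{chart_map c0 p} \<subseteq> chart_img c0" using c0 by auto
  from P.norm_equivalence[OF compact_sing this] obtain m where m: "m > 0"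
    "\<And>z. m * (norm z)\<^sup>2 \<le> coord_metric X c0 (chart_map c0 p) z z" by (metis singletonI)
  show thesis
  proof (rule that[of "sqrt m"])
    fix a
    have "sqrt (m * (norm a)\<^sup>2) \<le> pnorm a" unfolding nrm_def using m(2) by simp
    then show "sqrt m * norm a \<le> pnorm a" by (simp add: real_sqrt_mult)
  qed (use m(1) in simp)
qed

text \<open>Combines \<open>Exp_expand\<close> with the comparison of norms on the compact set
  \<open>B\<close>. The constant is uniform over all \<open>w\<close> mapped into \<open>B\<close>,
  a set not known to be bounded at this point; this makes sections over \<open>B\<close> uniformly
  Lipschitz.\<close>

lemma dExp_lower:
  assumes c: "c \<in> atlas X" and B: "compact B" "B \<subseteq> chart_img c"
  obtains C where "C > 0"
    "\<forall>w. Exp w \<in> chart_dom c \<longrightarrow> chart_map c (Exp w) \<in> B \<longrightarrow> (\<forall>a. norm a \<le> C * norm (dExp c w a))"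
proof -
  interpret P: metric_patch "chart_img c" "coord_metric X c" by (rule metric_patch[OF c])
  obtain M where M: "M > 0" "\<And>y z. y \<in> B \<Longrightarrow> coord_metric X c y z z \<le> M * (norm z)\<^sup>2"
    by (rule P.norm_equivalence[OF B]) blast
  obtain m where m: "m > 0" "\<And>a. m * norm a \<le> pnorm a" by (rule pnorm_lower) blast
  show thesis
  proof (rule that[of "sqrt M / m"], use M m in simp, intro allI impI)
    fix w a assume w: "Exp w \<in> chart_dom c" "chart_map c (Exp w) \<in> B"
    have "m * norm a \<le> nrm c (Exp w) (dExp c w a)" using m(2)[of a] Exp_expand[OF c w(1), of a] by simp
    also have "\<dots> \<le> sqrt (M * (norm (dExp c w a))\<^sup>2)"
      unfolding nrm_def using M(2)[OF w(2)] by simp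
    also have "\<dots> = sqrt M * norm (dExp c w a)" by (simp add: real_sqrt_mult)
    finally show "norm a \<le> sqrt M / m * norm (dExp c w a)" using m(1) by (simp add: field_simps)
  qed
qed

lemma dExp_lower_at:
  assumes "c \<in> atlas X" "Exp w \<in> chart_dom c"
  obtains C where "C > 0" "\<forall>a. norm a \<le> C * norm (dExp c w a)"
proof -
  have "{chart_map c (Exp w)} \<subseteq> chart_img c" using assms by auto
  from dExp_lower[OF assms(1) compact_sing this] obtain C where "C > 0"
    "\<forall>u. Exp u \<in> chart_dom c \<longrightarrow> chart_map c (Exp u) \<in> {chart_map c (Exp w)} \<longrightarrow> (\<forall>a. norm a \<le> C * norm (dExp c u a))"
    by blast
  then show thesis using that assms(2) by blast
qed

lemma Exp_locally_injective:
  assumes "c \<in> atlas X" "Exp w \<in> chart_dom c"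
  obtains d where "d > 0" "Exp ` ball w d \<subseteq> chart_dom c" "inj_on (\<lambda>u. chart_map c (Exp u)) (ball w d)"
proof -
  obtain C where C: "C > 0" "\<forall>a. norm a \<le> C * norm (dExp c w a)" by (rule dExp_lower_at[OF assms])
  have "1 / C * norm a \<le> norm (dExp c w a)" for a using C by (simp add: field_simps)
  then obtain d1 where d1: "d1 > 0" "inj_on (\<lambda>u. chart_map c (Exp u)) (ball w d1)"
    using strict_deriv_locally_injective[OF Exp_strict(2)[OF assms], of "1 / C"] C(1) by (metis divide_pos_pos zero_less_one)
  obtain d2 where d2: "d2 > 0" "\<And>u. dist u w < d2 \<Longrightarrow> Exp u \<in> chart_dom c"
    using Exp_strict(1)[OF assms] unfolding eventually_nhds_metric by blast
  show thesis
  proof (rule that[of "min d1 d2"])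
    show "inj_on (\<lambda>u. chart_map c (Exp u)) (ball w (min d1 d2))" by (rule inj_on_subset[OF d1(2)]) auto
    show "Exp ` ball w (min d1 d2) \<subseteq> chart_dom c" using d2(2) by (auto simp: dist_commute)
  qed (use d1 d2 in auto)
qed

lemma continuous_Exp: "continuous_on S Exp"
  using isCont_Exp by (simp add: continuous_at_imp_continuous_on)

lemma Exp_local_inj: "\<exists>U. open U \<and> w \<in> U \<and> inj_on Exp U"
proof -
  obtain c where c: "c \<in> atlas X" "Exp w \<in> chart_dom c" by (rule ex_chart)
  obtain d where "d > 0" "inj_on (\<lambda>u. chart_map c (Exp u)) (ball w d)"
    by (rule Exp_locally_injective[OF c])
  then show ?thesis by (intro exI[of _ "ball w d"]) (auto simp: inj_on_def)
qed

text \<open>In coordinates the map is locally injective, and invariance of domain gives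
  openness.\<close>

lemma open_Exp_image:
  assumes "open S" shows "open (Exp ` S)"
proof (subst open_subopen, intro ballI)
  fix x assume "x \<in> Exp ` S"
  then obtain w where w: "w \<in> S" "x = Exp w" by blast
  obtain c where c: "c \<in> atlas X" "Exp w \<in> chart_dom c" by (rule ex_chart)
  obtain d where d: "d > 0" "Exp ` ball w d \<subseteq> chart_dom c" "inj_on (\<lambda>u. chart_map c (Exp u)) (ball w d)"
    by (rule Exp_locally_injective[OF c])
  obtain e where e: "e > 0" "ball w e \<subseteq> S" using assms w(1) openE by blast
  let ?B = "ball w (min d e)"
  have "continuous_on ?B (\<lambda>u. chart_map c (Exp u))"
    by (rule continuous_on_compose2[OF cont_map[OF c(1)] continuous_Exp]) (use d(2) in auto)
  moreover have "inj_on (\<lambda>u. chart_map c (Exp u)) ?B" by (rule inj_on_subset[OF d(3)]) auto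
  ultimately have o: "open ((\<lambda>u. chart_map c (Exp u)) ` ?B)" by (intro invariance_of_domain) auto
  have "Exp ` ?B = chart_dom c \<inter> chart_map c -` ((\<lambda>u. chart_map c (Exp u)) ` ?B)"
  proof
    show "Exp ` ?B \<subseteq> chart_dom c \<inter> chart_map c -` ((\<lambda>u. chart_map c (Exp u)) ` ?B)" using d(2) by auto
    show "chart_dom c \<inter> chart_map c -` ((\<lambda>u. chart_map c (Exp u)) ` ?B) \<subseteq> Exp ` ?B"
    proof
      fix y assume y: "y \<in> chart_dom c \<inter> chart_map c -` ((\<lambda>u. chart_map c (Exp u)) ` ?B)"
      then obtain u where u: "u \<in> ?B" "chart_map c y = chart_map c (Exp u)" by auto
      have "Exp u \<in> chart_dom c" using u(1) d(2) by auto
      then have "y = Exp u" using u(2) y inv_map[OF c(1)] by (metis IntD1)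
      then show "y \<in> Exp ` ?B" using u(1) by blast
    qed
  qed
  then have "open (Exp ` ?B)" using continuous_open_preimage[OF cont_map[OF c(1)] open_dom[OF c(1)] o] by simp
  then show "\<exists>T. open T \<and> x \<in> T \<and> T \<subseteq> Exp ` S"
    using w d(1) e by (intro exI[of _ "Exp ` ?B"]) auto
qed

text \<open>Along the segment from \<open>z1\<close> to \<open>z2\<close> the section moves at rate
  at most \<open>C + 1\<close> times that of its image. As the section is only continuous, its
  displacements are bounded through the strict derivative of \<open>Exp\<close> at
  \<open>s (y t)\<close>.\<close>

lemma section_lipschitz:
  assumes c: "c \<in> atlas X" and K: "convex K" "K \<subseteq> chart_img c"
    and C: "C > 0" "\<forall>w. Exp w \<in> chart_dom c \<longrightarrow> chart_map c (Exp w) \<in> K \<longrightarrow> (\<forall>a. norm a \<le> C * norm (dExp c w a))"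
    and s: "continuous_on K s" "\<forall>z\<in>K. Exp (s z) = chart_inv c z"
    and z: "z1 \<in> K" "z2 \<in> K"
  shows "norm (s z2 - s z1) \<le> (C + 1) * norm (z2 - z1)"
proof -
  define y where "y t = z1 + t *\<^sub>R (z2 - z1)" for t
  have yK: "y t \<in> K" if "t \<in> {0..1}" for t
  proof -
    have "(1 - t) *\<^sub>R z1 + t *\<^sub>R z2 \<in> K" using convexD[OF K(1) z, of "1 - t" t] that by auto
    then show ?thesis unfolding y_def by (simp add: algebra_simps)
  qed
  have cont: "continuous_on {0..1} (\<lambda>t. s (y t))"
    by (rule continuous_on_compose2[OF s(1)]) (use yK in \<open>auto simp: y_def intro!: continuous_intros\<close>)
  let ?L = "(C + 1) * norm (z2 - z1)"
  define u where "u t = norm (s (y t) - s z1) - ?L * t" for t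
  have "u 1 \<le> u 0"
  proof (rule nonincreasing_of_right_Dini_aux[of 0 1 u])
    show "continuous_on {0..1} u" unfolding u_def by (intro continuous_intros cont)
    fix t e :: real assume t: "0 \<le> t" "t < 1" "e > 0"
    define w where "w = s (y t)"
    have yt: "y t \<in> K" "y t \<in> chart_img c" using yK[of t] t K(2) by auto
    have w: "Exp w = chart_inv c (y t)" using s(2) yt(1) unfolding w_def by blast
    have dom: "Exp w \<in> chart_dom c" "chart_map c (Exp w) = y t"
      using w inv_dom[OF c yt(2)] map_inv[OF c yt(2)] by auto
    \<comment> \<open>The error allowed to the linear approximation; it degrades the lower bound
      \<open>1 / C\<close> to \<open>1 / (C + 1)\<close>.\<close>
    define \<eta> where "\<eta> = 1 / C - 1 / (C + 1)"
    have \<eta>: "\<eta> > 0" using C(1) unfolding \<eta>_def by (simp add: frac_less2)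
    obtain d where d: "d > 0" "\<And>a b. a \<in> ball w d \<Longrightarrow> b \<in> ball w d \<Longrightarrow>
        norm (chart_map c (Exp a) - chart_map c (Exp b) - dExp c w (a - b)) \<le> \<eta> * norm (a - b)"
      using strict_derivD[OF Exp_strict(2)[OF c dom(1)] \<eta>] by blast
    have lip: "norm (a - w) \<le> (C + 1) * norm (chart_map c (Exp a) - y t)" if a: "a \<in> ball w d" for a
    proof -
      have "norm (a - w) \<le> C * norm (dExp c w (a - w))" using C(2) dom yt(1) by auto
      then have 1: "1 / C * norm (a - w) \<le> norm (dExp c w (a - w))" using C(1) by (simp add: field_simps)
      have "norm (chart_map c (Exp a) - y t - dExp c w (a - w)) \<le> \<eta> * norm (a - w)"
        using d(2)[OF a, of w] d(1) dom(2) by simp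
      then have "norm (dExp c w (a - w)) \<le> norm (chart_map c (Exp a) - y t) + \<eta> * norm (a - w)"
        using norm_triangle_sub[of "dExp c w (a - w)" "chart_map c (Exp a) - y t"] by (simp add: norm_minus_commute)
      with 1 have "(1 / C - \<eta>) * norm (a - w) \<le> norm (chart_map c (Exp a) - y t)" by (simp add: left_diff_distrib)
      moreover have "1 / C - \<eta> = 1 / (C + 1)" unfolding \<eta>_def by simp
      ultimately have "norm (a - w) / (C + 1) \<le> norm (chart_map c (Exp a) - y t)" by simp
      then show ?thesis using C(1) by (simp add: pos_divide_le_eq mult.commute)
    qed
    have "continuous (at t within {0..1}) (\<lambda>t. s (y t))"
      using cont t unfolding continuous_on_eq_continuous_within by auto
    then obtain d' where d': "d' > 0" "\<And>r. r \<in> {0..1} \<Longrightarrow> dist r t < d' \<Longrightarrow> dist (s (y r)) w < d"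
      using d(1) unfolding continuous_within_eps_delta w_def by blast
    have "u (t + h) \<le> u t + e * h" if h: "0 < h" "h < min d' (1 - t)" for h
    proof -
      have th: "t + h \<in> {0..1}" "dist (t + h) t < d'" using h t by (auto simp: dist_real_def)
      have "s (y (t + h)) \<in> ball w d" using d'(2)[OF th] by (simp add: dist_commute)
      from lip[OF this] have "norm (s (y (t + h)) - w) \<le> (C + 1) * norm (y (t + h) - y t)"
        using s(2) yK[OF th(1)] map_inv[OF c, of "y (t + h)"] K(2) by auto
      also have "norm (y (t + h) - y t) = h * norm (z2 - z1)"
        unfolding y_def using h by (simp add: algebra_simps scaleR_diff_left[symmetric] flip: scaleR_diff_right)
      finally have "norm (s (y (t + h)) - s (y t)) \<le> ?L * h" unfolding w_def by (simp add: ac_simps)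
      moreover have "norm (s (y (t + h)) - s z1) \<le> norm (s (y (t + h)) - s (y t)) + norm (s (y t) - s z1)"
        using norm_triangle_ineq[of "s (y (t + h)) - s (y t)" "s (y t) - s z1"] by simp
      moreover have "e * h \<ge> 0" using t h by simp
      ultimately show ?thesis unfolding u_def by (simp add: algebra_simps)
    qed
    then show "\<exists>d>0. \<forall>h. 0 < h \<and> h < d \<longrightarrow> u (t + h) \<le> u t + e * h"
      using d'(1) t by (intro exI[of _ "min d' (1 - t)"]) auto
  qed simp
  then show ?thesis unfolding u_def y_def by simp
qed

text \<open>Continuous induction on the scale \<open>r\<close> of the copies \<open>K r\<close> of
  \<open>B\<close> shrunk towards \<open>z0\<close>. A section over \<open>K r\<close> has a compact
  image on which \<open>Exp\<close> is injective, so it extends to a neighbourhood; at a limit scale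
  the uniform Lipschitz constant extends it to the closure.\<close>

lemma section_exists:
  assumes c: "c \<in> atlas X" and B: "compact B" "convex B" "B \<subseteq> chart_img c"
    and z0: "z0 \<in> B" "Exp u = chart_inv c z0"
  obtains s where "continuous_on B s" "\<forall>z\<in>B. Exp (s z) = chart_inv c z" "s z0 = u"
proof -
  obtain C where C: "C > 0" "\<forall>w. Exp w \<in> chart_dom c \<longrightarrow> chart_map c (Exp w) \<in> B \<longrightarrow> (\<forall>a. norm a \<le> C * norm (dExp c w a))"
    by (rule dExp_lower[OF c B(1,3)])
  define K where "K r = (\<lambda>z. z0 + r *\<^sub>R (z - z0)) ` B" for r :: real
  have K_alt: "K r = (\<lambda>z. (1 - r) *\<^sub>R z0 + r *\<^sub>R z) ` B" for r
    unfolding K_def by (intro image_cong) (auto simp: algebra_simps)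
  have Kcompact: "compact (K r)" for r
    unfolding K_def by (intro compact_continuous_image B(1) continuous_intros)
  have Kconvex: "convex (K r)" for r
  proof -
    have "K r = (+) ((1 - r) *\<^sub>R z0) ` (*\<^sub>R) r ` B" unfolding K_alt image_image ..
    then show ?thesis by (simp only: convex_translation convex_scaling B(2))
  qed
  have Kmono: "K r \<subseteq> K r'" if "0 \<le> r" "r \<le> r'" for r r'
  proof
    fix y assume "y \<in> K r"
    then obtain z where z: "z \<in> B" "y = z0 + r *\<^sub>R (z - z0)" unfolding K_def by blast
    define z' where "z' = (1 - r / r') *\<^sub>R z0 + (r / r') *\<^sub>R z"
    have "z' \<in> B" unfolding z'_def
      using that by (intro convexD[OF B(2) z0(1) z(1)]) (auto simp: divide_le_eq_1)
    moreover have "y = z0 + r' *\<^sub>R (z' - z0)"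
      using that z(2) unfolding z'_def by (cases "r' = 0") (auto simp: algebra_simps)
    ultimately show "y \<in> K r'" unfolding K_def by blast
  qed
  have K1: "K 1 = B" unfolding K_def by simp
  have KB: "K r \<subseteq> B" if "0 \<le> r" "r \<le> 1" for r using Kmono[OF that] K1 by simp
  have z0K: "z0 \<in> K r" for r unfolding K_def using z0(1) by (intro image_eqI[of _ _ z0]) auto
  have lift_unique: "s z = s' z"
    if "continuous_on S s" "continuous_on S s'" "convex S" "z0 \<in> S" "z \<in> S" "s z0 = s' z0"
      "\<And>z. z \<in> S \<Longrightarrow> Exp (s z) = Exp (s' z)" for S s s' z
    by (rule continuous_lift_unique[OF Exp_local_inj convex_connected[OF that(3)] that(4,5,1,2,7,6)])
  define P where "P r \<longleftrightarrow> (\<exists>s. continuous_on (K r) s \<and> (\<forall>z\<in>K r. Exp (s z) = chart_inv c z) \<and> s z0 = u)" for r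
  have "(0::real) \<le> 1" "(1::real) \<in> {0..1}" by auto
  then have "P 1"
  proof (rule interval_induct[where P = P])
    have "K 0 = {z0}" unfolding K_def using z0(1) by auto
    then show "P 0" unfolding P_def using z0(2) by (intro exI[of _ "\<lambda>_. u"]) simp
  next
    fix r :: real assume r: "0 \<le> r" "r < 1" "P r"
    obtain s where s: "continuous_on (K r) s" "\<forall>z\<in>K r. Exp (s z) = chart_inv c z" "s z0 = u"
      using r(3) unfolding P_def by blast
    have Kr: "K r \<subseteq> chart_img c" using KB[of r] r B(3) by auto
    have "inj_on Exp (s ` K r)"
    proof (rule inj_onI)
      fix a b assume "a \<in> s ` K r" "b \<in> s ` K r" "Exp a = Exp b"
      then obtain x y where xy: "x \<in> K r" "y \<in> K r" "a = s x" "b = s y" "chart_inv c x = chart_inv c y"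
        using s(2) by auto
      from arg_cong[OF xy(5), of "chart_map c"] have "x = y"
        using map_inv[OF c] Kr xy(1,2) by (metis subsetD)
      then show "a = b" using xy by simp
    qed
    then obtain N where N: "open N" "s ` K r \<subseteq> N" "inj_on Exp N"
      by (rule injective_near_compact[OF compact_continuous_image[OF s(1) Kcompact] _ continuous_Exp Exp_local_inj])
    define G where "G = chart_img c \<inter> chart_inv c -` (Exp ` N)"
    have "open G" unfolding G_def
      by (rule continuous_open_preimage[OF cont_inv[OF c] open_img[OF c] open_Exp_image[OF N(1)]])
    moreover have "K r \<subseteq> G"
    proof
      fix z assume z: "z \<in> K r"
      then have "chart_inv c z = Exp (s z)" "s z \<in> N" using s(2) N(2) by auto
      then show "z \<in> G" unfolding G_def using Kr z by auto
    qed
    ultimately obtain e where e: "e > 0" "(\<Union>x\<in>K r. ball x e) \<subseteq> G"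
      using compact_subset_open_imp_ball_epsilon_subset[OF Kcompact] by metis
    obtain D where D: "D > 0" "\<And>z. z \<in> B \<Longrightarrow> norm (z - z0) \<le> D"
    proof -
      have "bounded ((\<lambda>z. z - z0) ` B)"
        by (intro compact_imp_bounded compact_continuous_image B(1) continuous_intros)
      then show thesis using that unfolding bounded_pos by auto
    qed
    \<comment> \<open>Points of \<open>K r'\<close> are within \<open>(r' - r) * D\<close> of points
      of \<open>K r\<close>, where \<open>D\<close> bounds \<open>B\<close> seen from
      \<open>z0\<close>; this is the origin of the step \<open>e / D\<close>.\<close>
    have KG: "K r' \<subseteq> G" if r': "r < r'" "r' < r + e / D" for r'
    proof
      fix y assume "y \<in> K r'"
      then obtain z where z: "z \<in> B" "y = z0 + r' *\<^sub>R (z - z0)" unfolding K_def by blast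
      have "norm ((r' - r) *\<^sub>R (z - z0)) \<le> (r' - r) * D"
        using r'(1) D(2)[OF z(1)] by (simp add: mult_left_mono)
      also have "\<dots> < e" using r'(2) D(1) by (simp add: field_simps)
      finally have "dist (z0 + r *\<^sub>R (z - z0)) y < e"
        unfolding z(2) dist_norm by (simp add: algebra_simps norm_minus_commute)
      then have "y \<in> ball (z0 + r *\<^sub>R (z - z0)) e" by simp
      moreover have "z0 + r *\<^sub>R (z - z0) \<in> K r" unfolding K_def using z(1) by blast
      ultimately have "y \<in> (\<Union>x\<in>K r. ball x e)" by (rule UN_I[rotated])
      then show "y \<in> G" using e(2) by blast
    qed
    have "P r'" if r': "r < r'" "r' < r + e / D" for r'
    proof -
      define k where "k = inv_into N Exp"
      have k: "Exp (k x) = x" "k x \<in> N" if "x \<in> Exp ` N" for x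
        using that unfolding k_def by (auto simp: f_inv_into_f inv_into_into)
      have contk: "continuous_on (Exp ` N) k"
      proof (subst continuous_on_open_gen[of _ _ N])
        show "k \<in> Exp ` N \<rightarrow> N" using k(2) by blast
        show "\<forall>U. openin (top_of_set N) U \<longrightarrow> openin (top_of_set (Exp ` N)) (Exp ` N \<inter> k -` U)"
        proof (intro allI impI)
          fix U assume "openin (top_of_set N) U"
          then have U: "open U" "U \<subseteq> N" using N(1) by (auto simp: openin_open_eq)
          have kE: "k (Exp x) = x" if "x \<in> N" for x unfolding k_def by (rule inv_into_f_f[OF N(3) that])
          have "Exp ` N \<inter> k -` U = Exp ` U"
          proof
            show "Exp ` N \<inter> k -` U \<subseteq> Exp ` U" using kE by auto
            show "Exp ` U \<subseteq> Exp ` N \<inter> k -` U" using kE U(2) by auto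
          qed
          then show "openin (top_of_set (Exp ` N)) (Exp ` N \<inter> k -` U)"
            using open_Exp_image[OF U(1)] U(2) open_Exp_image[OF N(1)] by (auto simp: openin_open_eq)
        qed
      qed
      have G: "z \<in> chart_img c" "chart_inv c z \<in> Exp ` N" if "z \<in> K r'" for z
        using KG[OF r'] that unfolding G_def by auto
      have "continuous_on (K r') (\<lambda>z. k (chart_inv c z))"
        by (rule continuous_on_compose2[OF contk continuous_on_subset[OF cont_inv[OF c]]]) (use G in auto)
      moreover have "Exp (k (chart_inv c z)) = chart_inv c z" if "z \<in> K r'" for z using k(1) G(2)[OF that] by blast
      moreover have "k (chart_inv c z0) = u"
      proof -
        have "u \<in> N" using N(2) s(3) z0K by blast
        then show ?thesis unfolding z0(2)[symmetric] k_def by (rule inv_into_f_f[OF N(3)])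
      qed
      ultimately show ?thesis unfolding P_def by blast
    qed
    then show "\<exists>d>0. \<forall>r'. r < r' \<and> r' < r + d \<and> r' \<le> 1 \<longrightarrow> P r'"
      using e(1) D(1) by (intro exI[of _ "e / D"]) simp
  next
    fix r :: real assume r: "0 < r" "r \<le> 1" "\<And>q. 0 \<le> q \<Longrightarrow> q < r \<Longrightarrow> P q"
    have "\<exists>s. continuous_on (K q) s \<and> (\<forall>z\<in>K q. Exp (s z) = chart_inv c z) \<and> s z0 = u" if "q \<in> {0..<r}" for q
      using r(3) that unfolding P_def by simp
    then obtain S where S: "\<And>q. q \<in> {0..<r} \<Longrightarrow> continuous_on (K q) (S q)"
      "\<And>q z. q \<in> {0..<r} \<Longrightarrow> z \<in> K q \<Longrightarrow> Exp (S q z) = chart_inv c z" "\<And>q. q \<in> {0..<r} \<Longrightarrow> S q z0 = u"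
      by metis
    have agree: "S q z = S q' z" if q: "q \<in> {0..<r}" "q' \<in> {0..<r}" "q \<le> q'" "z \<in> K q" for q q' z
    proof (rule lift_unique[OF S(1)[OF q(1)] continuous_on_subset[OF S(1)[OF q(2)]] Kconvex z0K q(4)])
      show sub: "K q \<subseteq> K q'" using Kmono q by auto
      show "S q z0 = S q' z0" using S(3) q by simp
      show "Exp (S q z) = Exp (S q' z)" if "z \<in> K q" for z using S(2) q(1,2) sub that by auto
    qed
    define D where "D = (\<Union>q\<in>{0..<r}. K q)"
    \<comment> \<open>The sections over the smaller scales agree by unique lifting and are glued;
      the result is Lipschitz on the union \<open>D\<close> with the one constant
      \<open>C + 1\<close>.\<close>
    define \<sigma> where "\<sigma> z = S (SOME q. q \<in> {0..<r} \<and> z \<in> K q) z" for z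
    have \<sigma>: "\<sigma> z = S q z" if q: "q \<in> {0..<r}" "z \<in> K q" for q z
    proof -
      define q' where "q' = (SOME q. q \<in> {0..<r} \<and> z \<in> K q)"
      have q': "q' \<in> {0..<r} \<and> z \<in> K q'" unfolding q'_def by (rule someI[of _ q]) (use q in blast)
      have "S q' z = S q z"
      proof (cases "q \<le> q'")
        case True
        from agree[OF q(1) _ True q(2)] q' show ?thesis by metis
      next
        case False
        then have "q' \<le> q" by simp
        from agree[OF _ q(1) this] q' show ?thesis by blast
      qed
      then show ?thesis unfolding \<sigma>_def q'_def .
    qed
    have lip: "norm (\<sigma> z2 - \<sigma> z1) \<le> (C + 1) * norm (z2 - z1)" if z: "z1 \<in> D" "z2 \<in> D" for z1 z2
    proof -
      obtain q1 q2 where q: "q1 \<in> {0..<r}" "z1 \<in> K q1" "q2 \<in> {0..<r}" "z2 \<in> K q2" using z unfolding D_def by blast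
      define q where "q = max q1 q2"
      have q': "q \<in> {0..<r}" "z1 \<in> K q" "z2 \<in> K q"
        using q Kmono[of q1 q] Kmono[of q2 q] unfolding q_def by auto
      have "K q \<subseteq> B" using KB[of q] q'(1) r(2) by auto
      then have "norm (S q z2 - S q z1) \<le> (C + 1) * norm (z2 - z1)"
        using C(2) B(3) S(2)[OF q'(1)]
        by (intro section_lipschitz[OF c Kconvex _ C(1) _ S(1)[OF q'(1)] _ q'(2,3)]) auto
      then show ?thesis using \<sigma> q' by simp
    qed
    have "(C + 1)-lipschitz_on D \<sigma>"
      using lip C(1) by (intro lipschitz_onI) (auto simp: dist_norm norm_minus_commute)
    then have "uniformly_continuous_on D \<sigma>" by (rule lipschitz_on_uniformly_continuous)
    then obtain g where g: "uniformly_continuous_on (closure D) g" "\<And>z. z \<in> D \<Longrightarrow> \<sigma> z = g z"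
      by (rule uniformly_continuous_on_extension_on_closure) blast
    have cg: "continuous_on (closure D) g" by (rule uniformly_continuous_imp_continuous[OF g(1)])
    have DB: "closure D \<subseteq> B"
    proof (rule closure_minimal[OF _ compact_imp_closed[OF B(1)]])
      have "K q \<subseteq> B" if "q \<in> {0..<r}" for q using KB[of q] that r(2) by simp
      then show "D \<subseteq> B" unfolding D_def by blast
    qed
    have KD: "K r \<subseteq> closure D"
    proof
      fix y assume "y \<in> K r"
      then obtain z where z: "z \<in> B" "y = z0 + r *\<^sub>R (z - z0)" unfolding K_def by blast
      have "((\<lambda>q. z0 + q *\<^sub>R (z - z0)) \<longlongrightarrow> y) (at_left r)" unfolding z(2) by (intro tendsto_intros)
      moreover have "eventually (\<lambda>q. z0 + q *\<^sub>R (z - z0) \<in> closure D) (at_left r)"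
        using eventually_at_left_real[OF r(1)]
      proof eventually_elim
        case (elim q)
        then have "z0 + q *\<^sub>R (z - z0) \<in> D" unfolding D_def K_def using z(1) by auto
        then show ?case using closure_subset by blast
      qed
      ultimately show "y \<in> closure D"
        by (rule Lim_in_closed_set[OF closed_closure, rotated 2]) simp
    qed
    have Eg: "Exp (g z) = chart_inv c z" if z: "z \<in> closure D" for z
    proof -
      obtain x where x: "\<And>n. x n \<in> D" "x \<longlonglongrightarrow> z" using z closure_sequential by blast
      have "(\<lambda>n. g (x n)) \<longlonglongrightarrow> g z"
        using cg z x closure_subset unfolding continuous_on_sequentially o_def by blast
      from isCont_tendsto_compose[OF isCont_Exp this] have 1: "(\<lambda>n. Exp (g (x n))) \<longlonglongrightarrow> Exp (g z)" .
      have "z \<in> chart_img c" using z DB B(3) by blast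
      from isCont_tendsto_compose[OF isCont_inv[OF c this] x(2)]
      have 2: "(\<lambda>n. chart_inv c (x n)) \<longlonglongrightarrow> chart_inv c z" .
      have "Exp (g (x n)) = chart_inv c (x n)" for n
      proof -
        obtain q where q: "q \<in> {0..<r}" "x n \<in> K q" using x(1)[of n] unfolding D_def by blast
        have "g (x n) = S q (x n)" using g(2)[OF x(1)[of n]] \<sigma>[OF q] by simp
        then show ?thesis using S(2)[OF q] by simp
      qed
      with 1 2 show ?thesis using LIMSEQ_unique by auto
    qed
    have "0 \<in> {0..<r}" using r(1) by simp
    then have "z0 \<in> D" "\<sigma> z0 = u" using \<sigma>[OF _ z0K] S(3) z0K unfolding D_def by blast+
    then have "g z0 = u" using g(2) by metis
    then show "P r" unfolding P_def using Eg KD continuous_on_subset[OF cg KD] by blast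
  qed
  then show thesis using that unfolding P_def K1 by blast
qed

lemma Exp_section_covering: "section_covering Exp"
  unfolding section_covering_def
proof (intro conjI allI continuous_Exp Exp_local_inj)
  fix x
  obtain c where c: "c \<in> atlas X" "x \<in> chart_dom c" by (rule ex_chart)
  have "chart_map c x \<in> chart_img c" using c(2) by blast
  then obtain r where r: "r > 0" "cball (chart_map c x) r \<subseteq> chart_img c"
    using open_img[OF c(1)] open_contains_cball by meson
  let ?b = "ball (chart_map c x) r" and ?B = "cball (chart_map c x) r"
  define V where "V = chart_dom c \<inter> chart_map c -` ?b"
  have V: "open V" unfolding V_def
    by (rule continuous_open_preimage[OF cont_map[OF c(1)] open_dom[OF c(1)] open_ball])
  have xV: "x \<in> V" unfolding V_def using c(2) r(1) by simp
  have "\<exists>\<sigma>. continuous_on V \<sigma> \<and> (\<forall>v\<in>V. Exp (\<sigma> v) = v) \<and> \<sigma> (Exp u) = u" if u: "Exp u \<in> V" for u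
  proof -
    have u': "chart_map c (Exp u) \<in> ?B" "Exp u = chart_inv c (chart_map c (Exp u))"
      using u inv_map[OF c(1)] unfolding V_def by auto
    obtain s where s: "continuous_on ?B s" "\<forall>z\<in>?B. Exp (s z) = chart_inv c z" "s (chart_map c (Exp u)) = u"
      by (rule section_exists[OF c(1) compact_cball convex_cball r(2) u'])
    have "continuous_on V (\<lambda>v. s (chart_map c v))"
      by (rule continuous_on_compose2[OF s(1) continuous_on_subset[OF cont_map[OF c(1)]]]) (auto simp: V_def)
    moreover have "Exp (s (chart_map c v)) = v" if "v \<in> V" for v
      using s(2) that inv_map[OF c(1), of v] unfolding V_def by auto
    ultimately show ?thesis using s(3) by blast
  qed
  then show "\<exists>V. open V \<and> x \<in> V \<and> (\<forall>u. Exp u \<in> V \<longrightarrow>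
      (\<exists>\<sigma>. continuous_on V \<sigma> \<and> (\<forall>v\<in>V. Exp (\<sigma> v) = v) \<and> \<sigma> (Exp u) = u))"
    using V xV by blast
qed

text \<open>If a neighbourhood as in \<open>section_covering\<close> meets the range, a section
  shows that it is contained in it. So the range is closed as well as open, and the manifold is
  connected.\<close>

lemma surj_Exp: "range Exp = UNIV"
proof -
  have o: "open (range Exp)" by (rule open_Exp_image) simp
  have "open (- range Exp)"
  proof (subst open_subopen, intro ballI)
    fix x assume x: "x \<in> - range Exp"
    obtain V where V: "open V" "x \<in> V" "\<forall>c. Exp c \<in> V \<longrightarrow> (\<exists>\<sigma>. continuous_on V \<sigma> \<and> (\<forall>v\<in>V. Exp (\<sigma> v) = v) \<and> \<sigma> (Exp c) = c)"
      using Exp_section_covering unfolding section_covering_def by meson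
    have "V \<subseteq> - range Exp"
    proof
      fix y assume y: "y \<in> V"
      show "y \<in> - range Exp"
      proof
        assume "y \<in> range Exp"
        then obtain c where "y = Exp c" by blast
        then obtain \<sigma> where "\<forall>v\<in>V. Exp (\<sigma> v) = v" using V(3) y by blast
        then show False using V(2) x by (metis ComplD rangeI)
      qed
    qed
    then show "\<exists>T. open T \<and> x \<in> T \<and> T \<subseteq> - range Exp" using V(1,2) by blast
  qed
  then have "closed (range Exp)" by (simp add: closed_def)
  moreover have "connected (UNIV :: 'a set)" using hadamard unfolding hadamard_manifold_def by blast
  ultimately show ?thesis using o connected_clopen[of "UNIV :: 'a set"] by auto
qed

text \<open>The segment between two points with equal image is a path over a loop, and over a simply
  connected space such a path is itself closed.\<close>

lemma inj_Exp: "inj Exp"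
proof (rule injI)
  fix u w assume "Exp u = Exp w"
  then show "u = w"
    using section_covering_path_endpoints[OF Exp_section_covering, of "linepath u w"] hadamard
    unfolding hadamard_manifold_def by simp
qed

definition Log :: "'a \<Rightarrow> 'e" where "Log = inv Exp"

lemma Exp_Log: "Exp (Log x) = x"
  unfolding Log_def using surj_Exp by (simp add: surj_f_inv_f)

lemma Log_Exp: "Log (Exp w) = w"
  unfolding Log_def using inj_Exp by simp

lemma continuous_Log: "continuous_on S Log"
proof -
  have "open (Log -` S)" if "open S" for S
  proof -
    have "Log -` S = Exp ` S" using Exp_Log Log_Exp by (auto simp: image_iff) metis
    then show ?thesis using open_Exp_image[OF that] by simp
  qed
  then have "continuous_on UNIV Log" by (simp add: continuous_on_open_vimage)
  then show ?thesis using continuous_on_subset by blast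
qed

end

section \<open>Lengths and distances\<close>

lemma integrable_piecewise:
  fixes f :: "real \<Rightarrow> real"
  assumes "finite T" "a \<le> b"
    "\<And>s t. a \<le> s \<Longrightarrow> s < t \<Longrightarrow> t \<le> b \<Longrightarrow> {s<..<t} \<inter> T = {} \<Longrightarrow> f integrable_on {s..t}"
  shows "f integrable_on {a..b}"
  using assms
proof (induction T arbitrary: a b rule: finite_induct)
  case empty
  show ?case
  proof (cases "a = b")
    case True
    then show ?thesis using integrable_on_refl[of f b] by simp
  qed (use empty in auto)
next
  case (insert x T)
  show ?case
  proof (cases "a < x \<and> x < b")
    case True
    have "f integrable_on {a..x}"
    proof (rule insert.IH)
      show "f integrable_on {s..t}" if "a \<le> s" "s < t" "t \<le> x" "{s<..<t} \<inter> T = {}" for s t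
        using insert.prems(2)[of s t] that True by auto
    qed (use True in simp)
    moreover have "f integrable_on {x..b}"
    proof (rule insert.IH)
      show "f integrable_on {s..t}" if "x \<le> s" "s < t" "t \<le> b" "{s<..<t} \<inter> T = {}" for s t
        using insert.prems(2)[of s t] that True by auto
    qed (use True in simp)
    ultimately show ?thesis
      using Henstock_Kurzweil_Integration.integrable_combine[of a x b f] True by simp
  next
    case False
    show ?thesis
    proof (rule insert.IH[OF insert.prems(1)])
      show "f integrable_on {s..t}" if "a \<le> s" "s < t" "t \<le> b" "{s<..<t} \<inter> T = {}" for s t
        using insert.prems(2)[of s t] that False by auto
    qed
  qed
qed

lemma at_within_interior_Icc:
  "a < (t::real) \<Longrightarrow> t < b \<Longrightarrow> at t within {a..b} = at t"
  by (simp add: at_within_Icc_at)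

lemma difference_quotient_tendsto:
  assumes der: "(\<phi> has_vector_derivative b) (at s)"
  shows "((\<lambda>h. (\<phi> (s + h) - \<phi> s) /\<^sub>R h) \<longlongrightarrow> b) (at 0)"
proof -
  have "((\<lambda>y. (\<phi> y - \<phi> s - (y - s) *\<^sub>R b) /\<^sub>R norm (y - s)) \<longlongrightarrow> 0) (at s)"
    using der unfolding has_vector_derivative_def has_derivative_def by auto
  then have "((\<lambda>h. (\<phi> (s + h) - \<phi> s - h *\<^sub>R b) /\<^sub>R \<bar>h\<bar>) \<longlongrightarrow> 0) (at 0)"
    by (subst (asm) LIM_offset_zero_iff) simp_all
  then have "((\<lambda>h. norm ((\<phi> (s + h) - \<phi> s - h *\<^sub>R b) /\<^sub>R \<bar>h\<bar>)) \<longlongrightarrow> 0) (at 0)"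
    by (simp only: tendsto_norm_zero_iff)
  moreover have "eventually (\<lambda>h. norm ((\<phi> (s + h) - \<phi> s - h *\<^sub>R b) /\<^sub>R \<bar>h\<bar>) = norm ((\<phi> (s + h) - \<phi> s) /\<^sub>R h - b)) (at 0)"
    unfolding eventually_at
  proof (intro exI[of _ 1] conjI ballI impI)
    fix h :: real assume "h \<noteq> 0 \<and> dist h 0 < 1"
    then have "(\<phi> (s + h) - \<phi> s) /\<^sub>R h - b = (\<phi> (s + h) - \<phi> s - h *\<^sub>R b) /\<^sub>R h"
      by (simp add: scaleR_diff_right)
    then show "norm ((\<phi> (s + h) - \<phi> s - h *\<^sub>R b) /\<^sub>R \<bar>h\<bar>) = norm ((\<phi> (s + h) - \<phi> s) /\<^sub>R h - b)" by simp
  qed simp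
  ultimately have "((\<lambda>h. norm ((\<phi> (s + h) - \<phi> s) /\<^sub>R h - b)) \<longlongrightarrow> 0) (at 0)"
    by (rule Lim_transform_eventually)
  then show ?thesis by (simp add: tendsto_norm_zero_iff LIM_zero_iff)
qed

section \<open>Speed, arc length and the Riemannian distance\<close>

context riem
begin

abbreviation speed :: "real \<Rightarrow> real \<Rightarrow> (real \<Rightarrow> 'a) \<Rightarrow> real \<Rightarrow> real" where
  "speed a b \<gamma> t \<equiv> tnorm X (\<gamma> t) (velocity (atlas X) {a..b} \<gamma> t)"

lemma isCont_nrm:
  assumes "c \<in> atlas X" "z \<in> chart_img c"
  shows "isCont (\<lambda>q. sqrt (coord_metric X c (fst q) (snd q) (snd q))) (z, b)"
proof -
  interpret P: metric_patch "chart_img c" "coord_metric X c" by (rule metric_patch[OF assms(1)])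
  have "isCont (\<lambda>q. (fst q, snd q, snd q)) (z, b)" by (intro continuous_intros)
  then have "isCont (\<lambda>q. (\<lambda>(z, a, b). coord_metric X c z a b) (fst q, snd q, snd q)) (z, b)"
    by (rule isCont_o2) (simp add: strict_deriv_isCont[OF P.g_joint_strict[OF assms(2)]])
  then have "isCont (\<lambda>q. coord_metric X c (fst q) (snd q) (snd q)) (z, b)" by simp
  then show ?thesis by (rule continuous_real_sqrt)
qed

lemma speed_eq:
  assumes "c \<in> atlas X" "\<gamma> t \<in> chart_dom c" "a < t" "t < b" "continuous_on {a..b} \<gamma>"
    "((\<lambda>s. chart_map c (\<gamma> s)) has_vector_derivative v) (at t)"
  shows "speed a b \<gamma> t = nrm c (\<gamma> t) v"
  using assms
  by (intro tnorm_velocity) (auto simp: no_isolated_atLeastAtMost at_within_interior_Icc)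

text \<open>Finitely many points, among them the end points where the velocity is one-sided, do not
  affect the integral, so two-sided coordinate derivatives off \<open>T\<close> are enough.\<close>

lemma length_of:
  assumes "finite T" "a < b" "continuous_on {a..b} \<gamma>"
    and k: "\<And>t. a < t \<Longrightarrow> t < b \<Longrightarrow> t \<notin> T \<Longrightarrow> \<exists>c\<in>atlas X. \<gamma> t \<in> chart_dom c \<and>
      (\<exists>v. ((\<lambda>s. chart_map c (\<gamma> s)) has_vector_derivative v) (at t) \<and> k t = nrm c (\<gamma> t) v)"
    and L: "(k has_integral L) {a..b}"
  shows "curve_length X a b \<gamma> = L"
proof -
  have "(speed a b \<gamma> has_integral L) {a..b}"
  proof (rule has_integral_spike_finite[OF _ _ L])
    show "finite (T \<union> {a, b})" using assms(1) by simp
    fix t assume t: "t \<in> {a..b} - (T \<union> {a, b})"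
    then have t': "a < t" "t < b" "t \<notin> T" by auto
    obtain c v where c: "c \<in> atlas X" "\<gamma> t \<in> chart_dom c"
      "((\<lambda>s. chart_map c (\<gamma> s)) has_vector_derivative v) (at t)" "k t = nrm c (\<gamma> t) v"
      using k[OF t'] by blast
    show "speed a b \<gamma> t = k t" using speed_eq[OF c(1,2) t'(1,2) assms(3) c(3)] c(4) by simp
  qed
  then show ?thesis unfolding curve_length_def by (rule integral_unique)
qed

lemma smooth_curve_speed:
  assumes sm: "smooth_curve (atlas X) {a..b} \<gamma>" and ab: "a < b"
  shows "continuous_on {a..b} (speed a b \<gamma>)"
    and "\<And>t c. a < t \<Longrightarrow> t < b \<Longrightarrow> c \<in> atlas X \<Longrightarrow> \<gamma> t \<in> chart_dom c \<Longrightarrow>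
      ((\<lambda>s. chart_map c (\<gamma> s)) has_vector_derivative chart_velocity {a..b} \<gamma> c t) (at t)"
proof -
  note ni = no_isolated_atLeastAtMost[OF ab]
  note cont = smooth_curve_continuous[OF sm]
  show "((\<lambda>s. chart_map c (\<gamma> s)) has_vector_derivative chart_velocity {a..b} \<gamma> c t) (at t)"
    if "a < t" "t < b" "c \<in> atlas X" "\<gamma> t \<in> chart_dom c" for t c
    using smooth_curve_coord_derivatives(1)[OF sm ni _ that(3,4)] that(1,2) by (simp add: at_within_interior_Icc)
  show "continuous_on {a..b} (speed a b \<gamma>)"
    unfolding continuous_on_def
  proof
    fix t assume t: "t \<in> {a..b}"
    obtain c where c: "c \<in> atlas X" "\<gamma> t \<in> chart_dom c" by (rule ex_chart)
    obtain d where d: "d > 0" "\<And>s. s \<in> {a..b} \<Longrightarrow> \<bar>s - t\<bar> < d \<Longrightarrow> \<gamma> s \<in> chart_dom c"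
      using curve_in_dom_near[OF cont t c] by blast
    let ?v = "chart_velocity {a..b} \<gamma> c"
    have sp: "speed a b \<gamma> s = sqrt (coord_metric X c (chart_map c (\<gamma> s)) (?v s) (?v s))"
      if "s \<in> {a..b}" "\<bar>s - t\<bar> < d" for s
      using tnorm_velocity[OF c(1) d(2)[OF that] that(1) cont ni
          smooth_curve_coord_derivatives(1)[OF sm ni that(1) c(1) d(2)[OF that]]] unfolding nrm_def .
    obtain v' where "(?v has_vector_derivative v') (at t within {a..b})"
      using smooth_curve_coord_derivatives(2)[OF sm ni t c] by blast
    then have l1: "(?v \<longlongrightarrow> ?v t) (at t within {a..b})"
      using has_vector_derivative_continuous continuous_within by blast
    have l2: "((\<lambda>s. chart_map c (\<gamma> s)) \<longlongrightarrow> chart_map c (\<gamma> t)) (at t within {a..b})"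
      using has_vector_derivative_continuous[OF smooth_curve_coord_derivatives(1)[OF sm ni t c]] continuous_within by blast
    have "chart_map c (\<gamma> t) \<in> chart_img c" using c(2) by blast
    from isCont_tendsto_compose[OF isCont_nrm[OF c(1) this] tendsto_Pair[OF l2 l1]]
    have "((\<lambda>s. sqrt (coord_metric X c (chart_map c (\<gamma> s)) (?v s) (?v s))) \<longlongrightarrow> speed a b \<gamma> t) (at t within {a..b})"
      using sp[OF t] d(1) by simp
    moreover have "eventually (\<lambda>s. sqrt (coord_metric X c (chart_map c (\<gamma> s)) (?v s) (?v s)) = speed a b \<gamma> s) (at t within {a..b})"
      unfolding eventually_at using d(1) sp by (intro exI[of _ d]) (auto simp: dist_real_def)
    ultimately show "(speed a b \<gamma> \<longlongrightarrow> speed a b \<gamma> t) (at t within {a..b})" by (rule Lim_transform_eventually)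
  qed
qed

lemma piecewise_smooth_curveE:
  assumes "piecewise_smooth_curve (atlas X) a b \<gamma>"
  obtains T where "continuous_on {a..b} \<gamma>" "finite T"
    "\<forall>s t. a \<le> s \<and> s < t \<and> t \<le> b \<and> {s<..<t} \<inter> T = {} \<longrightarrow> smooth_curve (atlas X) {s..t} \<gamma>"
  using assms unfolding piecewise_smooth_curve_def by blast

lemma piecewise_smooth_speed:
  assumes pw: "continuous_on {a..b} \<gamma>" "finite T"
    "\<forall>s t. a \<le> s \<and> s < t \<and> t \<le> b \<and> {s<..<t} \<inter> T = {} \<longrightarrow> smooth_curve (atlas X) {s..t} \<gamma>"
    and ab: "a \<le> b"
  shows "speed a b \<gamma> integrable_on {a..b}"
    and "\<And>t. a < t \<Longrightarrow> t < b \<Longrightarrow> t \<notin> T \<Longrightarrow> isCont (speed a b \<gamma>) t \<and>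
      (\<forall>c\<in>atlas X. \<gamma> t \<in> chart_dom c \<longrightarrow> (\<exists>v. ((\<lambda>s. chart_map c (\<gamma> s)) has_vector_derivative v) (at t)
        \<and> speed a b \<gamma> t = nrm c (\<gamma> t) v))"
proof -
  \<comment> \<open>Inside a smooth piece both speeds are computed from the same two-sided
    derivative.\<close>
  have eq: "speed a b \<gamma> r = speed s t \<gamma> r"
    if st: "a \<le> s" "s < t" "t \<le> b" "{s<..<t} \<inter> T = {}" "s < r" "r < t" for s t r
  proof -
    have sm: "smooth_curve (atlas X) {s..t} \<gamma>" using pw(3) st by blast
    obtain c where c: "c \<in> atlas X" "\<gamma> r \<in> chart_dom c" by (rule ex_chart)
    note D = smooth_curve_speed(2)[OF sm st(2,5,6) c]
    have "continuous_on {s..t} \<gamma>" using continuous_on_subset[OF pw(1)] st by auto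
    then show ?thesis
      using speed_eq[OF c st(5,6) _ D] speed_eq[OF c _ _ pw(1) D] st by simp
  qed
  show "speed a b \<gamma> integrable_on {a..b}"
  proof (rule integrable_piecewise[OF pw(2) ab])
    fix s t assume st: "a \<le> s" "s < t" "t \<le> b" "{s<..<t} \<inter> T = {}"
    have sm: "smooth_curve (atlas X) {s..t} \<gamma>" using pw(3) st by blast
    have "speed s t \<gamma> integrable_on {s..t}"
      by (rule integrable_continuous_real[OF smooth_curve_speed(1)[OF sm st(2)]])
    then show "speed a b \<gamma> integrable_on {s..t}"
      by (rule integrable_spike_finite[of "{s, t}", rotated 2]) (use eq[OF st] in auto)
  qed
  fix t assume t: "a < t" "t < b" "t \<notin> T"
  obtain e where e: "e > 0" "ball t e \<inter> (T \<union> {a, b}) \<subseteq> {t}"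
  proof -
    have "\<exists>e>0. \<forall>x\<in>T \<union> {a, b}. x \<noteq> t \<longrightarrow> e \<le> dist t x"
      by (rule finite_set_avoid) (use pw(2) in simp)
    then show thesis using that by (metis IntE mem_ball not_le singletonI subsetI)
  qed
  define s1 where "s1 = max a (t - e)"
  define s2 where "s2 = min b (t + e)"
  have s: "a \<le> s1" "s1 < s2" "s2 \<le> b" "s1 < t" "t < s2" using t e(1) unfolding s1_def s2_def by auto
  have disj: "{s1<..<s2} \<inter> T = {}"
  proof -
    have "{s1<..<s2} \<subseteq> ball t e" unfolding s1_def s2_def by (auto simp: dist_real_def)
    then show ?thesis using e(2) t(3) by blast
  qed
  have sm: "smooth_curve (atlas X) {s1..s2} \<gamma>" using pw(3) s(1-3) disj by blast
  show "isCont (speed a b \<gamma>) t \<and>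
      (\<forall>c\<in>atlas X. \<gamma> t \<in> chart_dom c \<longrightarrow> (\<exists>v. ((\<lambda>s. chart_map c (\<gamma> s)) has_vector_derivative v) (at t)
        \<and> speed a b \<gamma> t = nrm c (\<gamma> t) v))"
  proof (intro conjI ballI impI)
    have "continuous_on {s1<..<s2} (speed s1 s2 \<gamma>)"
      by (rule continuous_on_subset[OF smooth_curve_speed(1)[OF sm s(2)]]) auto
    then have "continuous_on {s1<..<s2} (speed a b \<gamma>)"
      by (rule continuous_on_eq) (use eq[OF s(1-3) disj] in auto)
    then show "isCont (speed a b \<gamma>) t" using s(4,5) by (simp add: continuous_on_eq_continuous_at)
    fix c assume c: "c \<in> atlas X" "\<gamma> t \<in> chart_dom c"
    note D = smooth_curve_speed(2)[OF sm s(2,4,5) c]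
    show "\<exists>v. ((\<lambda>s. chart_map c (\<gamma> s)) has_vector_derivative v) (at t) \<and> speed a b \<gamma> t = nrm c (\<gamma> t) v"
      using D speed_eq[OF c t(1,2) pw(1) D] by blast
  qed
qed

text \<open>\<open>u\<close> minus the arc length has nonpositive upper right derivative away from
  the corners. The hypothesis is phrased by coordinate derivatives, the form in which lifts and
  exponential coordinates provide it.\<close>

lemma length_comparison:
  assumes pw: "piecewise_smooth_curve (atlas X) 0 1 \<sigma>" and u: "continuous_on {0..1} u"
    and dini: "\<And>s c v e. 0 < s \<Longrightarrow> s < 1 \<Longrightarrow> c \<in> atlas X \<Longrightarrow> \<sigma> s \<in> chart_dom c \<Longrightarrow>
      ((\<lambda>t. chart_map c (\<sigma> t)) has_vector_derivative v) (at s) \<Longrightarrow> e > 0 \<Longrightarrow>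
      \<exists>d>0. \<forall>h. 0 < h \<and> h < d \<longrightarrow> u (s + h) \<le> u s + (nrm c (\<sigma> s) v + e) * h"
  shows "u 1 \<le> u 0 + curve_length X 0 1 \<sigma>"
proof -
  obtain T where T: "continuous_on {0..1} \<sigma>" "finite T"
    "\<forall>s t. 0 \<le> s \<and> s < t \<and> t \<le> 1 \<and> {s<..<t} \<inter> T = {} \<longrightarrow> smooth_curve (atlas X) {s..t} \<sigma>"
    by (rule piecewise_smooth_curveE[OF pw])
  note S = piecewise_smooth_speed[OF T zero_le_one]
  define K where "K s = integral {0..s} (speed 0 1 \<sigma>)" for s
  have "u 1 - K 1 \<le> u 0 - K 0"
  proof (rule nonincreasing_of_right_Dini[OF T(2) zero_le_one, of "\<lambda>s. u s - K s"])
    show "continuous_on {0..1} (\<lambda>s. u s - K s)"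
      unfolding K_def by (intro continuous_intros u indefinite_integral_continuous_1 S(1))
    fix s e :: real assume s: "0 < s" "s < 1" "s \<notin> T" "e > 0"
    obtain c where c: "c \<in> atlas X" "\<sigma> s \<in> chart_dom c" by (rule ex_chart)
    obtain v where v: "((\<lambda>t. chart_map c (\<sigma> t)) has_vector_derivative v) (at s)" "speed 0 1 \<sigma> s = nrm c (\<sigma> s) v"
      using S(2)[OF s(1-3)] c by blast
    obtain d1 where d1: "d1 > 0" "\<forall>h. 0 < h \<and> h < d1 \<longrightarrow> u (s + h) \<le> u s + (nrm c (\<sigma> s) v + e/2) * h"
      using dini[OF s(1,2) c v(1), of "e/2"] s(4) by auto
    have "((\<lambda>r. integral {0..r} (speed 0 1 \<sigma>)) has_vector_derivative speed 0 1 \<sigma> s) (at s within ({0..1} - {}))"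
      by (rule integral_has_vector_derivative_continuous_at[OF S(1)])
        (use s S(2)[OF s(1-3)] in \<open>auto intro: continuous_at_imp_continuous_at_within\<close>)
    then have "(K has_real_derivative speed 0 1 \<sigma> s) (at s)"
      using s(1,2) unfolding K_def[abs_def] by (simp add: at_within_interior_Icc has_real_derivative_iff_has_vector_derivative)
    then obtain d2 where d2: "d2 > 0" "\<And>y. norm (y - s) < d2 \<Longrightarrow> norm (K y - K s - speed 0 1 \<sigma> s * (y - s)) \<le> e/2 * norm (y - s)"
      unfolding has_field_derivative_def has_derivative_at_alt using s(4) by (metis half_gt_zero)
    have "u (s + h) - K (s + h) \<le> u s - K s + e * h" if h: "0 < h" "h < min d1 d2" for h
    proof -
      have "u (s + h) \<le> u s + (nrm c (\<sigma> s) v + e/2) * h" using d1(2) h by simp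
      moreover have "\<bar>K (s + h) - K s - nrm c (\<sigma> s) v * h\<bar> \<le> e/2 * h"
        using d2(2)[of "s + h"] h v(2) by (simp add: mult.commute)
      then have "- (e/2 * h) \<le> K (s + h) - K s - nrm c (\<sigma> s) v * h" by linarith
      ultimately show ?thesis by (simp add: algebra_simps)
    qed
    then show "\<exists>d>0. \<forall>h. 0 < h \<and> h < d \<longrightarrow> u (s + h) - K (s + h) \<le> u s - K s + e * h"
      using d1(1) d2(1) by (intro exI[of _ "min d1 d2"]) auto
  qed
  moreover have "K 0 = 0" "K 1 = curve_length X 0 1 \<sigma>" unfolding K_def curve_length_def by auto
  ultimately show ?thesis by simp
qed

text \<open>Comparison of the arc length with the constant function \<open>0\<close>.\<close>

lemma curve_length_nonneg:
  assumes "piecewise_smooth_curve (atlas X) 0 1 \<sigma>"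
  shows "0 \<le> curve_length X 0 1 \<sigma>"
proof -
  have "0 \<le> 0 + curve_length X 0 1 \<sigma>"
  proof (rule length_comparison[OF assms, of "\<lambda>_. 0"])
    fix s c and v :: 'e and e :: real
    assume "c \<in> atlas X" "\<sigma> s \<in> chart_dom c" "e > 0"
    then have "0 \<le> nrm c (\<sigma> s) v + e" using nrm_nonneg[of c "\<sigma> s" v] by simp
    then show "\<exists>d>0. \<forall>h. 0 < h \<and> h < d \<longrightarrow> 0 \<le> 0 + (nrm c (\<sigma> s) v + e) * h"
      by (intro exI[of _ 1]) simp
  qed simp
  then show ?thesis by simp
qed

lemma smooth_curve_subset: "smooth_curve (atlas X) I \<gamma> \<Longrightarrow> K \<subseteq> I \<Longrightarrow> smooth_curve (atlas X) K \<gamma>"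
  unfolding smooth_curve_def by (meson subsetD subset_trans)

lemma smooth_imp_piecewise_smooth:
  assumes "smooth_curve (atlas X) {a..b} \<gamma>"
  shows "piecewise_smooth_curve (atlas X) a b \<gamma>"
  unfolding piecewise_smooth_curve_def
  using smooth_curve_continuous[OF assms] smooth_curve_subset[OF assms]
  by (intro conjI exI[of _ "{}"]) auto

definition joining :: "'a \<Rightarrow> 'a \<Rightarrow> (real \<Rightarrow> 'a) \<Rightarrow> bool" where
  "joining x y \<gamma> \<longleftrightarrow> piecewise_smooth_curve (atlas X) 0 1 \<gamma> \<and> \<gamma> 0 = x \<and> \<gamma> 1 = y"

lemma dist_eq: "riemannian_dist X x y = Inf {curve_length X 0 1 \<gamma> |\<gamma>. joining x y \<gamma>}"
  unfolding riemannian_dist_def joining_def ..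

lemma dist_le: "joining x y \<gamma> \<Longrightarrow> riemannian_dist X x y \<le> curve_length X 0 1 \<gamma>"
  unfolding dist_eq
  by (intro cInf_lower bdd_belowI[of _ 0]) (auto simp: joining_def curve_length_nonneg)

lemma dist_greatest:
  assumes "joining x y \<gamma>0" "\<And>\<gamma>. joining x y \<gamma> \<Longrightarrow> r \<le> curve_length X 0 1 \<gamma>"
  shows "r \<le> riemannian_dist X x y"
  unfolding dist_eq by (rule cInf_greatest) (use assms in auto)

end

section \<open>Distances in a Hadamard manifold\<close>

lemma isCont_interior_Icc:
  fixes s :: real
  assumes "continuous_on {a..b} \<sigma>" "a < s" "s < b"
  shows "isCont \<sigma> s"
  using continuous_on_interior[OF assms(1), of s] assms(2,3) by simp

section \<open>Derivative of the logarithm and distances from the base point\<close>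

context hadamard_point
begin

lemma linear_dExp:
  assumes "c \<in> atlas X" "Exp w \<in> chart_dom c"
  shows "linear (dExp c w)"
  using strict_deriv_imp_has_derivative[OF Exp_strict(2)[OF assms]] has_derivative_linear by blast

lemma Exp_chart_derivative:
  assumes "c \<in> atlas X" "Exp w \<in> chart_dom c"
  shows "((\<lambda>u. chart_map c (Exp u)) has_derivative dExp c w) (at w)"
  by (rule strict_deriv_imp_has_derivative[OF Exp_strict(2)[OF assms]])

text \<open>The injective linear map \<open>dExp\<close> is invertible and \<open>Log\<close> is
  continuous, so the rule for inverse functions applies to \<open>Log\<close> in coordinates, which
  is then composed with the coordinate curve.\<close>

lemma Log_derivative:
  assumes c: "c \<in> atlas X" "\<sigma> s \<in> chart_dom c" and cont: "isCont \<sigma> s"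
    and der: "((\<lambda>t. chart_map c (\<sigma> t)) has_vector_derivative b) (at s)"
  obtains a where "((\<lambda>t. Log (\<sigma> t)) has_vector_derivative a) (at s)" "dExp c (Log (\<sigma> s)) a = b"
proof -
  define w where "w = Log (\<sigma> s)"
  have w: "Exp w \<in> chart_dom c" "Exp w = \<sigma> s" using c(2) unfolding w_def by (auto simp: Exp_Log)
  note lin = linear_dExp[OF c(1) w(1)]
  obtain C where "\<forall>a. norm a \<le> C * norm (dExp c w a)" using dExp_lower_at[OF c(1) w(1)] by metis
  then have "dExp c w a = 0 \<Longrightarrow> a = 0" for a by (metis mult_zero_right norm_le_zero_iff norm_zero)
  then have "inj (dExp c w)" using linear_injective_0[OF lin] by blast
  then obtain D' where D': "linear D'" "\<forall>a. D' (dExp c w a) = a" "\<forall>b. dExp c w (D' b) = b"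
    using linear_injective_isomorphism[OF lin] by blast
  define z where "z = chart_map c (\<sigma> s)"
  define k where "k y = Log (chart_inv c y)" for y
  have z: "z \<in> chart_img c" "chart_inv c z = \<sigma> s" using c inv_map unfolding z_def by auto
  have "(k has_derivative D') (at z)"
  proof (rule has_derivative_inverse_basic[where f = "\<lambda>u. chart_map c (Exp u)" and T = "chart_img c"])
    show "((\<lambda>u. chart_map c (Exp u)) has_derivative dExp c w) (at (k z))"
      using Exp_chart_derivative[OF c(1) w(1)] unfolding k_def z w_def .
    show "bounded_linear D'" using D'(1) linear_conv_bounded_linear by blast
    show "D' \<circ> dExp c w = id" using D'(2) by auto
    show "continuous (at z) k" unfolding k_def
      using isCont_o2[OF isCont_inv[OF c(1) z(1)], of Log] continuous_Log[of UNIV]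
      by (simp add: continuous_on_eq_continuous_at)
    show "open (chart_img c)" by (rule open_img[OF c(1)])
    show "chart_map c (Exp (k y)) = y" if "y \<in> chart_img c" for y
      unfolding k_def Exp_Log by (rule map_inv[OF c(1) that])
  qed (rule z(1))
  then have "(k has_derivative D') (at ((\<lambda>t. chart_map c (\<sigma> t)) s))" unfolding z_def .
  from vector_derivative_diff_chain_within[OF der has_derivative_at_withinI[OF this]]
  have "((\<lambda>t. k (chart_map c (\<sigma> t))) has_vector_derivative D' b) (at s)" by (simp add: o_def)
  moreover obtain T where T: "open T" "s \<in> T" "\<forall>t\<in>T. \<sigma> t \<in> chart_dom c"
    using isCont_eventually_nhds[OF cont open_dom[OF c(1)] c(2)] unfolding eventually_nhds by blast
  ultimately have "((\<lambda>t. Log (\<sigma> t)) has_vector_derivative D' b) (at s)"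
    using has_vector_derivative_cong_local[of _ _ s UNIV T "\<lambda>t. Log (\<sigma> t)"] by (auto simp: k_def inv_map[OF c(1)])
  then show thesis using that D'(3) unfolding w_def by blast
qed

lemma pnorm_triangle: "pnorm (a + b) \<le> pnorm a + pnorm b"
proof -
  define z where "z = chart_map c0 p"
  have z: "z \<in> chart_img c0" unfolding z_def using c0(2) by blast
  interpret P: metric_patch "chart_img c0" "coord_metric X c0" by (rule metric_patch[OF c0(1)])
  have eq: "pnorm v = sqrt (coord_metric X c0 z v v)" for v unfolding nrm_def z_def ..
  have nn: "pnorm v \<ge> 0" for v by (rule nrm_nonneg[OF c0])
  have sq: "(pnorm v)\<^sup>2 = coord_metric X c0 z v v" for v using nrm_square[OF c0] unfolding z_def .
  have "(coord_metric X c0 z a b)\<^sup>2 \<le> (pnorm a * pnorm b)\<^sup>2"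
    unfolding power_mult_distrib sq by (rule Cauchy_Schwarz_metric[OF c0(1) z])
  then have "coord_metric X c0 z a b \<le> pnorm a * pnorm b"
    using nn by (meson abs_le_square_iff abs_le_D1 order_trans abs_of_nonneg mult_nonneg_nonneg power2_le_imp_le)
  then have "(pnorm (a + b))\<^sup>2 \<le> (pnorm a + pnorm b)\<^sup>2"
    unfolding sq power2_sum using P.g_add[OF z] P.sym[OF z, of b a] sq by (simp add: algebra_simps)
  then show ?thesis using nn by (meson add_nonneg_nonneg power2_le_imp_le)
qed

lemma continuous_pnorm: "continuous_on S pnorm"
proof (rule continuous_at_imp_continuous_on, rule ballI)
  fix a assume "a \<in> S"
  have "chart_map c0 p \<in> chart_img c0" using c0(2) by blast
  from isCont_nrm[OF c0(1) this]
  have "isCont (\<lambda>q. sqrt (coord_metric X c0 (fst q) (snd q) (snd q))) (chart_map c0 p, a)" .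
  then have "isCont (\<lambda>a. sqrt (coord_metric X c0 (fst (chart_map c0 p, a)) (snd (chart_map c0 p, a)) (snd (chart_map c0 p, a)))) a"
    by (rule isCont_o2[rotated]) (intro continuous_intros)
  then show "isCont pnorm a" unfolding nrm_def by simp
qed

text \<open>The triangle inequality for the fixed norm at \<open>p\<close>:
  \<open>Log \<sigma>\<close> moves with a velocity \<open>a\<close> for which
  \<open>pnorm a\<close> is at most the speed of \<open>\<sigma>\<close>, since \<open>Exp\<close>
  expands. One-sided quotients avoid differentiating the norm, which fails at
  \<open>0\<close>.\<close>

lemma pnorm_Log_Dini:
  assumes c: "c \<in> atlas X" "\<sigma> s \<in> chart_dom c" and cont: "isCont \<sigma> s"
    and v: "((\<lambda>t. chart_map c (\<sigma> t)) has_vector_derivative v) (at s)" and e: "e > 0"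
  shows "\<exists>d>0. \<forall>h. 0 < h \<and> h < d \<longrightarrow> pnorm (Log (\<sigma> (s + h))) \<le> pnorm (Log (\<sigma> s)) + (nrm c (\<sigma> s) v + e) * h"
proof -
  obtain a where a: "((\<lambda>t. Log (\<sigma> t)) has_vector_derivative a) (at s)" "dExp c (Log (\<sigma> s)) a = v"
    by (rule Log_derivative[OF c cont v])
  have av: "pnorm a \<le> nrm c (\<sigma> s) v"
    using Exp_expand[of c "Log (\<sigma> s)" a] c a(2) by (simp add: Exp_Log)
  define q where "q h = (Log (\<sigma> (s + h)) - Log (\<sigma> s)) /\<^sub>R h" for h
  have "(q \<longlongrightarrow> a) (at 0)" unfolding q_def by (rule difference_quotient_tendsto[OF a(1)])
  then have "((\<lambda>h. pnorm (q h)) \<longlongrightarrow> pnorm a) (at 0)"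
    using continuous_pnorm[of UNIV] by (auto intro: isCont_tendsto_compose simp: continuous_on_eq_continuous_at)
  then have "eventually (\<lambda>h. dist (pnorm (q h)) (pnorm a) < e) (at 0)" using e by (rule tendstoD)
  then obtain d where d: "d > 0" "\<And>h. h \<noteq> 0 \<Longrightarrow> dist h 0 < d \<Longrightarrow> dist (pnorm (q h)) (pnorm a) < e"
    unfolding eventually_at by blast
  have "pnorm (Log (\<sigma> (s + h))) \<le> pnorm (Log (\<sigma> s)) + (nrm c (\<sigma> s) v + e) * h" if h: "0 < h" "h < d" for h
  proof -
    have "Log (\<sigma> (s + h)) = Log (\<sigma> s) + h *\<^sub>R q h" using h unfolding q_def by simp
    then have "pnorm (Log (\<sigma> (s + h))) \<le> pnorm (Log (\<sigma> s)) + h * pnorm (q h)"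
      using pnorm_triangle[of "Log (\<sigma> s)" "h *\<^sub>R q h"] nrm_scale[OF c0, of h] h by simp
    moreover have "pnorm (q h) \<le> nrm c (\<sigma> s) v + e"
      using d(2)[of h] h av by (simp add: dist_real_def)
    then have "h * pnorm (q h) \<le> h * (nrm c (\<sigma> s) v + e)" using h by (intro mult_left_mono) auto
    ultimately show ?thesis by (simp add: mult.commute)
  qed
  then show ?thesis using d(1) by blast
qed

lemma pnorm_Log_le_length:
  assumes "piecewise_smooth_curve (atlas X) 0 1 \<sigma>"
  shows "pnorm (Log (\<sigma> 1)) \<le> pnorm (Log (\<sigma> 0)) + curve_length X 0 1 \<sigma>"
proof -
  have \<sigma>: "continuous_on {0..1} \<sigma>" using assms unfolding piecewise_smooth_curve_def by simp
  show ?thesis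
    by (rule length_comparison[OF assms], rule continuous_on_compose2[OF continuous_pnorm[of UNIV]],
        rule continuous_on_compose2[OF continuous_Log[of UNIV] \<sigma>])
      (auto intro!: pnorm_Log_Dini isCont_interior_Icc[OF \<sigma>] simp del: split_paired_Ex)
qed

lemma smooth_geod: "smooth_curve (atlas X) UNIV (geod w)"
  using geod(1) unfolding geodesic_def by blast

lemma geod_speed:
  assumes "c \<in> atlas X" "geod w t \<in> chart_dom c"
  shows "nrm c (geod w t) (chart_velocity UNIV (geod w) c t) = pnorm w"
proof -
  note W = weak_geod[of w]
  have "tnorm X (geod w t) (velocity (atlas X) UNIV (geod w) t) = nrm c (geod w t) (chart_velocity UNIV (geod w) c t)"
    by (rule tnorm_velocity[where t = t and \<gamma> = "geod w", OF assms]) (use W assms no_isolated_UNIV in \<open>auto simp: weak_geodesic_def\<close>)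
  then show ?thesis using geodesic_speed_constant[OF W, of t] geod(2,3)[of w] tnorm_tangent_vec[OF c0, of w] by simp
qed

lemma joining_geod: "joining p (Exp w) (geod w)"
  using smooth_imp_piecewise_smooth[OF smooth_curve_subset[OF smooth_geod]] geod(2)
  unfolding joining_def by (simp add: Exp_def)

lemma curve_length_geod: "curve_length X 0 1 (geod w) = pnorm w"
proof (rule length_of[of "{}" _ _ _ "\<lambda>_. pnorm w"])
  show "continuous_on {0..1} (geod w)" using smooth_curve_continuous[OF smooth_geod] continuous_on_subset by blast
  show "((\<lambda>_. pnorm w) has_integral pnorm w) {0..1::real}" using has_integral_const_real[of "pnorm w" 0 1] by simp
  fix t :: real
  obtain c where c: "c \<in> atlas X" "geod w t \<in> chart_dom c" by (rule ex_chart)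
  then show "\<exists>c\<in>atlas X. geod w t \<in> chart_dom c \<and> (\<exists>v. ((\<lambda>s. chart_map c (geod w s)) has_vector_derivative v) (at t)
      \<and> pnorm w = nrm c (geod w t) v)"
    using geod_speed[OF c] weak_geod[of w] unfolding weak_geodesic_def by force
qed auto

text \<open>The radial geodesic run backwards. With an arbitrary base point this gives the symmetry
  of the distance in \<open>dist_commute\<close>.\<close>

lemma dist_from_Exp_le: "riemannian_dist X (Exp w) p \<le> pnorm w"
proof -
  let ?\<gamma> = "\<lambda>t. geod w (-1 * t + 1)"
  have sm: "smooth_curve (atlas X) {0..1} ?\<gamma>" by (rule smooth_curve_affine[OF smooth_geod]) simp
  have "curve_length X 0 1 ?\<gamma> = pnorm w"
  proof (rule length_of[of "{}" _ _ _ "\<lambda>_. pnorm w"])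
    show "((\<lambda>_. pnorm w) has_integral pnorm w) {0..1::real}" using has_integral_const_real[of "pnorm w" 0 1] by simp
    fix t :: real
    obtain c where c: "c \<in> atlas X" "?\<gamma> t \<in> chart_dom c" by (rule ex_chart)
    note A = weak_geodesic_affine[where m = "-1" and b = 1, OF weak_geod[of w] no_isolated_UNIV subset_UNIV]
    have "((\<lambda>s. chart_map c (?\<gamma> s)) has_vector_derivative chart_velocity UNIV ?\<gamma> c t) (at t)"
      using A(1) c unfolding weak_geodesic_def by blast
    then show "\<exists>c\<in>atlas X. ?\<gamma> t \<in> chart_dom c \<and> (\<exists>v. ((\<lambda>s. chart_map c (?\<gamma> s)) has_vector_derivative v) (at t)
        \<and> pnorm w = nrm c (?\<gamma> t) v)"
      unfolding A(2)[OF UNIV_I c] using c nrm_scale[OF c, of "-1"] geod_speed[OF c] by fastforce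
  qed (use smooth_curve_continuous[OF sm] in auto)
  moreover have "joining (Exp w) p ?\<gamma>"
    using smooth_imp_piecewise_smooth[OF sm] geod(2) unfolding joining_def by (simp add: Exp_def)
  ultimately show ?thesis using dist_le by fastforce
qed

text \<open>Radial geodesics have length \<open>pnorm w\<close>, and by
  \<open>pnorm_Log_le_length\<close> no curve from \<open>p\<close> to the same point is
  shorter.\<close>

lemma dist_Exp: "riemannian_dist X p (Exp w) = pnorm w"
proof (rule antisym)
  show "riemannian_dist X p (Exp w) \<le> pnorm w" using dist_le[OF joining_geod] curve_length_geod by metis
  show "pnorm w \<le> riemannian_dist X p (Exp w)"
  proof (rule dist_greatest[OF joining_geod])
    fix \<gamma> assume "joining p (Exp w) \<gamma>"
    then have "pnorm (Log (Exp w)) \<le> pnorm (Log (Exp 0)) + curve_length X 0 1 \<gamma>"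
      using pnorm_Log_le_length[of \<gamma>] unfolding joining_def by (auto simp: Exp_0)
    then show "pnorm w \<le> curve_length X 0 1 \<gamma>" using nrm_scale[OF c0, of 0 0] by (simp add: Log_Exp)
  qed
qed

end

text \<open>For statements about distances without a distinguished base point; each proof interprets
  \<open>hadamard_point\<close> at the point that suits it.\<close>

locale hadamard_space = riem X
  for X :: "('a::{t2_space, second_countable_topology}, 'e::euclidean_space) riemannian" +
  assumes hadamard: "hadamard_manifold X"
begin

lemma hadamard_point: "c \<in> atlas X \<Longrightarrow> x \<in> chart_dom c \<Longrightarrow> hadamard_point X x c"
  by unfold_locales (rule hadamard)

lemma ex_joining: obtains \<gamma> where "joining x y \<gamma>"
proof -
  obtain c where "c \<in> atlas X" "x \<in> chart_dom c" by (rule ex_chart)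
  then interpret H: hadamard_point X x c by (rule hadamard_point)
  show thesis using that H.joining_geod H.Exp_Log by metis
qed

lemma dist_refl: "riemannian_dist X x x = 0"
proof -
  obtain c where c: "c \<in> atlas X" "x \<in> chart_dom c" by (rule ex_chart)
  then interpret H: hadamard_point X x c by (rule hadamard_point)
  show ?thesis using H.dist_Exp[of 0] nrm_scale[OF c, of 0 0] by (simp add: H.Exp_0)
qed

lemma dist_commute: "riemannian_dist X x y = riemannian_dist X y x"
proof -
  have "riemannian_dist X y x \<le> riemannian_dist X x y" for x y
  proof -
    obtain c where "c \<in> atlas X" "x \<in> chart_dom c" by (rule ex_chart)
    then interpret H: hadamard_point X x c by (rule hadamard_point)
    show ?thesis using H.dist_Exp[of "H.Log y"] H.dist_from_Exp_le[of "H.Log y"] unfolding H.Exp_Log by linarith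
  qed
  then show ?thesis using antisym by blast
qed

text \<open>The distance from \<open>x\<close>, written as the norm of \<open>Log\<close>, grows
  along a curve from \<open>y\<close> to \<open>z\<close> by at most its length; no curves have to
  be concatenated.\<close>

lemma dist_triangle: "riemannian_dist X x z \<le> riemannian_dist X x y + riemannian_dist X y z"
proof -
  obtain c where "c \<in> atlas X" "x \<in> chart_dom c" by (rule ex_chart)
  then interpret H: hadamard_point X x c by (rule hadamard_point)
  have dx: "riemannian_dist X x q = H.pnorm (H.Log q)" for q using H.dist_Exp[of "H.Log q"] by (simp add: H.Exp_Log)
  obtain \<gamma>0 where "joining y z \<gamma>0" by (rule ex_joining)
  then have "riemannian_dist X x z - riemannian_dist X x y \<le> riemannian_dist X y z"
  proof (rule dist_greatest)
    fix \<gamma> assume "joining y z \<gamma>"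
    then show "riemannian_dist X x z - riemannian_dist X x y \<le> curve_length X 0 1 \<gamma>"
      using H.pnorm_Log_le_length[of \<gamma>] unfolding dx joining_def by auto
  qed
  then show ?thesis by simp
qed

lemma continuous_dist: "continuous_on S (riemannian_dist X x)"
proof -
  obtain c where "c \<in> atlas X" "x \<in> chart_dom c" by (rule ex_chart)
  then interpret H: hadamard_point X x c by (rule hadamard_point)
  have "riemannian_dist X x = (\<lambda>q. H.pnorm (H.Log q))" using H.dist_Exp[of "H.Log q" for q] by (auto simp: H.Exp_Log)
  then show ?thesis using continuous_on_compose2[OF H.continuous_pnorm[of UNIV] H.continuous_Log[of S]] by simp
qed

text \<open>With base point \<open>\<tau> s\<close> the distance starts from \<open>0\<close>, so
  that its growth is bounded by the speed alone.\<close>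

lemma dist_along_curve:
  assumes c: "c \<in> atlas X" "\<tau> s \<in> chart_dom c" and cont: "isCont \<tau> s"
    and der: "((\<lambda>t. chart_map c (\<tau> t)) has_vector_derivative b) (at s)" and e: "e > 0"
  obtains d where "d > 0" "\<forall>h. 0 < h \<and> h < d \<longrightarrow> riemannian_dist X (\<tau> s) (\<tau> (s + h)) \<le> (nrm c (\<tau> s) b + e) * h"
proof -
  interpret H: hadamard_point X "\<tau> s" c by (rule hadamard_point[OF c])
  have d0: "H.pnorm (H.Log q) = riemannian_dist X (\<tau> s) q" for q using H.dist_Exp[of "H.Log q"] by (simp add: H.Exp_Log)
  show thesis using that H.pnorm_Log_Dini[OF c cont der e] unfolding d0 dist_refl by auto
qed

text \<open>The distance from \<open>\<tau> 0\<close> grows at most \<open>r\<close> times as fast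
  as the length of \<open>\<sigma>\<close>, so the length of \<open>\<tau>\<close> itself is never
  formed. As \<open>\<sigma>\<close> may lie in another manifold, this covers contraction, lifts of
  curves through the covering, and deck transformations.\<close>

lemma dist_le_length_mult:
  assumes Y: "riem Y" and \<sigma>: "piecewise_smooth_curve (atlas Y) 0 1 \<sigma>"
    and \<tau>: "continuous_on {0..1} \<tau>" and r: "r > 0"
    and der: "\<And>s c v. 0 < s \<Longrightarrow> s < 1 \<Longrightarrow> c \<in> atlas Y \<Longrightarrow> \<sigma> s \<in> chart_dom c \<Longrightarrow>
      ((\<lambda>t. chart_map c (\<sigma> t)) has_vector_derivative v) (at s) \<Longrightarrow>
      \<exists>d\<in>atlas X. \<tau> s \<in> chart_dom d \<and> (\<exists>b. ((\<lambda>t. chart_map d (\<tau> t)) has_vector_derivative b) (at s)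
        \<and> nrm d (\<tau> s) b \<le> r * riem.nrm Y c (\<sigma> s) v)"
  shows "riemannian_dist X (\<tau> 0) (\<tau> 1) \<le> r * curve_length Y 0 1 \<sigma>"
proof -
  interpret Y: riem Y by (rule Y)
  have "riemannian_dist X (\<tau> 0) (\<tau> 1) / r \<le> riemannian_dist X (\<tau> 0) (\<tau> 0) / r + curve_length Y 0 1 \<sigma>"
  proof (rule Y.length_comparison[OF \<sigma>, of "\<lambda>s. riemannian_dist X (\<tau> 0) (\<tau> s) / r"])
    show "continuous_on {0..1} (\<lambda>s. riemannian_dist X (\<tau> 0) (\<tau> s) / r)"
      using r by (intro continuous_intros continuous_on_compose2[OF continuous_dist[of UNIV] \<tau>]) auto
    fix s c v and e :: real
    assume s: "0 < s" "s < 1" and c: "c \<in> atlas Y" "\<sigma> s \<in> chart_dom c"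
      and v: "((\<lambda>t. chart_map c (\<sigma> t)) has_vector_derivative v) (at s)" and e: "e > 0"
    obtain d b where d: "d \<in> atlas X" "\<tau> s \<in> chart_dom d"
      and b: "((\<lambda>t. chart_map d (\<tau> t)) has_vector_derivative b) (at s)" "nrm d (\<tau> s) b \<le> r * Y.nrm c (\<sigma> s) v"
      using der[OF s c v] by blast
    have cont: "isCont \<tau> s" by (rule isCont_interior_Icc[OF \<tau> s])
    obtain \<delta> where \<delta>: "\<delta> > 0" "\<forall>h. 0 < h \<and> h < \<delta> \<longrightarrow> riemannian_dist X (\<tau> s) (\<tau> (s + h)) \<le> (nrm d (\<tau> s) b + r * e) * h"
      by (rule dist_along_curve[OF d cont b(1) mult_pos_pos[OF r e]])
    have "riemannian_dist X (\<tau> 0) (\<tau> (s + h)) / r \<le> riemannian_dist X (\<tau> 0) (\<tau> s) / r + (Y.nrm c (\<sigma> s) v + e) * h"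
      if h: "0 < h" "h < \<delta>" for h
    proof -
      have "riemannian_dist X (\<tau> s) (\<tau> (s + h)) \<le> (nrm d (\<tau> s) b + r * e) * h" using \<delta>(2) h by blast
      also have "\<dots> \<le> (r * Y.nrm c (\<sigma> s) v + r * e) * h" using b(2) h by (intro mult_right_mono) auto
      finally have "riemannian_dist X (\<tau> 0) (\<tau> (s + h)) \<le> riemannian_dist X (\<tau> 0) (\<tau> s) + r * ((Y.nrm c (\<sigma> s) v + e) * h)"
        using dist_triangle[of "\<tau> 0" "\<tau> (s + h)" "\<tau> s"] by (simp add: algebra_simps)
      then have "riemannian_dist X (\<tau> 0) (\<tau> (s + h)) / r \<le> (riemannian_dist X (\<tau> 0) (\<tau> s) + r * ((Y.nrm c (\<sigma> s) v + e) * h)) / r"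
        using r by (intro divide_right_mono) auto
      then show ?thesis using r by (simp add: add_divide_distrib)
    qed
    then show "\<exists>d>0. \<forall>h. 0 < h \<and> h < d \<longrightarrow>
        riemannian_dist X (\<tau> 0) (\<tau> (s + h)) / r \<le> riemannian_dist X (\<tau> 0) (\<tau> s) / r + (Y.nrm c (\<sigma> s) v + e) * h"
      using \<delta>(1) by blast
  qed
  then show ?thesis using r by (simp add: dist_refl field_simps)
qed

end

sublocale hadamard_point \<subseteq> hadamard_space X
  by unfold_locales (rule hadamard)

context hadamard_point
begin

text \<open>For a curve \<open>\<sigma>\<close> joining the two points, \<open>Exp_contract\<close>
  bounds the speed of the curve with coordinates \<open>r *\<^sub>R Log (\<sigma> s)\<close> by
  \<open>r\<close> times the speed of \<open>\<sigma>\<close>. The factor \<open>1/2\<close> will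
  give the midpoint inequality.\<close>

lemma dist_Exp_contract:
  assumes r: "0 < r" "r \<le> 1"
  shows "riemannian_dist X (Exp (r *\<^sub>R u)) (Exp (r *\<^sub>R w)) \<le> r * riemannian_dist X (Exp u) (Exp w)"
proof -
  obtain \<gamma>0 where "joining (Exp u) (Exp w) \<gamma>0" by (rule ex_joining)
  then have "riemannian_dist X (Exp (r *\<^sub>R u)) (Exp (r *\<^sub>R w)) / r \<le> riemannian_dist X (Exp u) (Exp w)"
  proof (rule dist_greatest)
    fix \<sigma> assume J: "joining (Exp u) (Exp w) \<sigma>"
    define \<tau> where "\<tau> s = Exp (r *\<^sub>R Log (\<sigma> s))" for s
    have pw: "piecewise_smooth_curve (atlas X) 0 1 \<sigma>" using J unfolding joining_def by simp
    then have \<sigma>: "continuous_on {0..1} \<sigma>" unfolding piecewise_smooth_curve_def by simp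
    have "riemannian_dist X (\<tau> 0) (\<tau> 1) \<le> r * curve_length X 0 1 \<sigma>"
    proof (rule dist_le_length_mult[OF riem_axioms pw _ r(1)])
      show "continuous_on {0..1} \<tau>" unfolding \<tau>_def
        by (intro continuous_on_compose2[OF continuous_Exp[of UNIV]] continuous_intros
            continuous_on_compose2[OF continuous_Log[of UNIV] \<sigma>]) auto
      fix s c v
      assume s: "0 < s" "s < 1" and c: "c \<in> atlas X" "\<sigma> s \<in> chart_dom c"
        and v: "((\<lambda>t. chart_map c (\<sigma> t)) has_vector_derivative v) (at s)"
      have "isCont \<sigma> s" by (rule isCont_interior_Icc[OF \<sigma> s])
      then obtain a where a: "((\<lambda>t. Log (\<sigma> t)) has_vector_derivative a) (at s)" "dExp c (Log (\<sigma> s)) a = v"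
        using Log_derivative[where \<sigma> = \<sigma>] c v by metis
      obtain d where d: "d \<in> atlas X" "\<tau> s \<in> chart_dom d" by (rule ex_chart)
      have d': "Exp (r *\<^sub>R Log (\<sigma> s)) \<in> chart_dom d" using d(2) unfolding \<tau>_def .
      have "((\<lambda>t. r *\<^sub>R Log (\<sigma> t)) has_vector_derivative r *\<^sub>R a) (at s)"
        using has_vector_derivative_scaleR[OF DERIV_const a(1), of r] by simp
      from vector_derivative_diff_chain_within[OF this has_derivative_at_withinI[OF Exp_chart_derivative[OF d(1) d']]]
      have "((\<lambda>t. chart_map d (\<tau> t)) has_vector_derivative dExp d (r *\<^sub>R Log (\<sigma> s)) (r *\<^sub>R a)) (at s)"
        unfolding \<tau>_def by (simp add: o_def)
      moreover have "nrm d (\<tau> s) (dExp d (r *\<^sub>R Log (\<sigma> s)) (r *\<^sub>R a)) \<le> r * nrm c (\<sigma> s) v"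
        using Exp_contract[of r d "Log (\<sigma> s)" c a] r d(1) d' c a(2)
        unfolding \<tau>_def by (simp add: Exp_Log linear_scale[OF linear_dExp[OF d(1) d']])
      ultimately show "\<exists>d\<in>atlas X. \<tau> s \<in> chart_dom d \<and> (\<exists>b. ((\<lambda>t. chart_map d (\<tau> t)) has_vector_derivative b) (at s)
          \<and> nrm d (\<tau> s) b \<le> r * nrm c (\<sigma> s) v)" using d by blast
    qed
    then show "riemannian_dist X (Exp (r *\<^sub>R u)) (Exp (r *\<^sub>R w)) / r \<le> curve_length X 0 1 \<sigma>"
      using J r(1) unfolding \<tau>_def joining_def by (simp add: Log_Exp field_simps)
  qed
  then show ?thesis using r(1) by (simp add: field_simps)
qed

end

section \<open>Local isometries\<close>

locale local_iso = X: riem X + Y: riem Y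
  for X :: "('a::{t2_space, second_countable_topology}, 'e::euclidean_space) riemannian"
    and Y :: "('b::{t2_space, second_countable_topology}, 'e) riemannian" +
  fixes f :: "'a \<Rightarrow> 'b"
  assumes loc_iso: "local_isometry X Y f"
begin

lemma open_chart_preimage:
  assumes "open U" "continuous_on U f" "c \<in> atlas X" "d \<in> atlas Y"
  shows "open {z \<in> chart_dom c \<inter> U. f z \<in> chart_dom d}"
proof -
  have "open ((chart_dom c \<inter> U) \<inter> f -` chart_dom d)"
    by (rule continuous_open_preimage)
      (use assms X.open_dom Y.open_dom continuous_on_subset[OF assms(2)] in \<open>auto simp: open_Int\<close>)
  moreover have "(chart_dom c \<inter> U) \<inter> f -` chart_dom d = {z \<in> chart_dom c \<inter> U. f z \<in> chart_dom d}" by auto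
  ultimately show ?thesis by simp
qed

text \<open>\<open>differential\<close> is computed in a chart \<open>c'\<close> picked by
  \<open>SOME\<close>, which must be compared with the given \<open>c\<close>. Both sides are the
  derivative of the one coordinate map \<open>r c e\<close>, factored through
  \<open>transition c c'\<close> in the source and through \<open>transition d e\<close> in the
  target.\<close>

lemma differential_tangent_vec:
  assumes U: "x \<in> U" "smooth_map (atlas X) (atlas Y) U f"
    and c: "c \<in> atlas X" "x \<in> chart_dom c" and d: "d \<in> atlas Y" "f x \<in> chart_dom d"
  shows "differential (atlas X) (atlas Y) f x (tangent_vec (atlas X) c x u) = tangent_vec (atlas Y) d (f x)
    (frechet_derivative (chart_map d \<circ> f \<circ> chart_inv c) (at (chart_map c x)) u)"
proof
  fix e
  define c' where "c' = (SOME c. c \<in> atlas X \<and> x \<in> chart_dom c)"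
  have c': "c' \<in> atlas X" "x \<in> chart_dom c'"
    using someI[of "\<lambda>c. c \<in> atlas X \<and> x \<in> chart_dom c" c] c unfolding c'_def by auto
  define r where "r a b = chart_map b \<circ> f \<circ> chart_inv a" for a :: "('a, 'e) chart" and b :: "('b, 'e) chart"
  define D where "D a b = frechet_derivative (r a b) (at (chart_map a x))" for a b
  have D: "(r a b has_derivative D a b) (at (chart_map a x))"
    if "a \<in> atlas X" "x \<in> chart_dom a" "b \<in> atlas Y" "f x \<in> chart_dom b" for a b
    unfolding D_def r_def by (rule smooth_on_has_derivative) (use U that in \<open>auto simp: smooth_map_def\<close>)
  have r: "r a b (chart_map a z) = chart_map b (f z)" if "a \<in> atlas X" "z \<in> chart_dom a" for a b z
    unfolding r_def using X.inv_map[OF that] by simp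
  show "differential (atlas X) (atlas Y) f x (tangent_vec (atlas X) c x u) e = tangent_vec (atlas Y) d (f x)
    (frechet_derivative (chart_map d \<circ> f \<circ> chart_inv c) (at (chart_map c x)) u) e"
  proof (cases "e \<in> atlas Y \<and> f x \<in> chart_dom e")
    case True
    then have e: "e \<in> atlas Y" "f x \<in> chart_dom e" by auto
    have t1: "(transition c c' has_derivative frechet_derivative (transition c c') (at (chart_map c x))) (at (chart_map c x))"
      by (rule X.transition_has_derivative[OF c(1) c'(1) c(2) c'(2)])
    have "(r c' e has_derivative D c' e) (at (transition c c' (chart_map c x)))"
      unfolding X.transition_map[OF c] by (rule D[OF c' e])
    from has_derivative_compose[OF t1 this]
    have 1: "(r c e has_derivative (\<lambda>u. D c' e (frechet_derivative (transition c c') (at (chart_map c x)) u))) (at (chart_map c x))"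
    proof (rule has_derivative_transform_within_open[OF _ X.open_overlap[OF c(1) c'(1)]])
      show "chart_map c x \<in> chart_map c ` (chart_dom c \<inter> chart_dom c')" using c c' by blast
      show "r c' e (transition c c' y) = r c e y" if "y \<in> chart_map c ` (chart_dom c \<inter> chart_dom c')" for y
      proof -
        obtain z where z: "y = chart_map c z" "z \<in> chart_dom c" "z \<in> chart_dom c'" using \<open>y \<in> _\<close> by blast
        show ?thesis unfolding z(1) X.transition_map[OF c(1) z(2)] r[OF c'(1) z(3)] r[OF c(1) z(2)] ..
      qed
    qed
    let ?N = "{z \<in> chart_dom c \<inter> U. f z \<in> chart_dom d}"
    have "open ?N" by (rule open_chart_preimage[OF _ _ c(1) d(1)]) (use U(2) in \<open>auto simp: smooth_map_def\<close>)
    then have N: "open (chart_map c ` ?N)" by (rule X.open_chart_image[OF c(1)]) auto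
    have "(transition d e has_derivative frechet_derivative (transition d e) (at (chart_map d (f x)))) (at (r c d (chart_map c x)))"
      using Y.transition_has_derivative[OF d(1) e(1) d(2) e(2)] r[OF c] by simp
    from has_derivative_compose[OF D[OF c d] this]
    have 2: "(r c e has_derivative (\<lambda>u. frechet_derivative (transition d e) (at (chart_map d (f x))) (D c d u))) (at (chart_map c x))"
    proof (rule has_derivative_transform_within_open[OF _ N])
      show "chart_map c x \<in> chart_map c ` ?N" using c d U(1) by blast
      show "transition d e (r c d y) = r c e y" if "y \<in> chart_map c ` ?N" for y
      proof -
        obtain z where z: "y = chart_map c z" "z \<in> chart_dom c" "f z \<in> chart_dom d" using \<open>y \<in> _\<close> by blast
        show ?thesis unfolding z(1) r[OF c(1) z(2)] Y.transition_map[OF d(1) z(3)] ..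
      qed
    qed
    have "D c' e (tangent_vec (atlas X) c x u c') = frechet_derivative (transition d e) (at (chart_map d (f x))) (D c d u)"
      using has_derivative_unique[OF 1 2] c' unfolding tangent_vec_def by (auto dest: fun_cong)
    then show ?thesis
      using e unfolding differential_def tangent_vec_def[of "atlas Y"] Let_def c'_def[symmetric] D_def r_def by simp
  qed (auto simp: differential_def tangent_vec_def[of "atlas Y"] Let_def)
qed

lemma local_chart_iso:
  assumes c: "c \<in> atlas X" "x \<in> chart_dom c" and d: "d \<in> atlas Y" "f x \<in> chart_dom d"
  obtains h k W W' N where "chart_iso X c Y d h k W W'" "open N" "x \<in> N"
    "\<forall>z\<in>N. z \<in> chart_dom c \<and> f z \<in> chart_dom d \<and> chart_map c z \<in> W \<and> chart_map d (f z) = h (chart_map c z)"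
proof -
  obtain U where U: "x \<in> U" "inj_on f U" "smooth_map (atlas X) (atlas Y) U f"
    "smooth_map (atlas Y) (atlas X) (f ` U) (inv_into U f)"
    and iso: "\<And>y \<xi> \<eta>. y \<in> U \<Longrightarrow> \<xi> \<in> tangent_space (atlas X) y \<Longrightarrow> \<eta> \<in> tangent_space (atlas X) y \<Longrightarrow>
      inner_at Y (f y) (differential (atlas X) (atlas Y) f y \<xi>) (differential (atlas X) (atlas Y) f y \<eta>) = inner_at X y \<xi> \<eta>"
    using loc_iso unfolding local_isometry_def by metis
  define N where "N = {z \<in> chart_dom c \<inter> U. f z \<in> chart_dom d}"
  define N' where "N' = {z \<in> chart_dom d \<inter> f ` U. inv_into U f z \<in> chart_dom c}"
  define h where "h = chart_map d \<circ> f \<circ> chart_inv c"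
  define k where "k = chart_map c \<circ> inv_into U f \<circ> chart_inv d"
  have inv: "inv_into U f (f z) = z" if "z \<in> U" for z using U(2) that by simp
  have N: "open N" unfolding N_def
    by (rule open_chart_preimage[OF _ _ c(1) d(1)]) (use U(3) in \<open>auto simp: smooth_map_def\<close>)
  have "open (f ` U)" "continuous_on (f ` U) (inv_into U f)" using U(4) unfolding smooth_map_def by auto
  then have "open ((chart_dom d \<inter> f ` U) \<inter> inv_into U f -` chart_dom c)"
    by (intro continuous_open_preimage open_Int X.open_dom[OF c(1)] Y.open_dom[OF d(1)])
      (auto elim: continuous_on_subset)
  moreover have "(chart_dom d \<inter> f ` U) \<inter> inv_into U f -` chart_dom c = N'" unfolding N'_def by auto
  ultimately have N': "open N'" by simp
  have N'_eq: "N' = f ` N" unfolding N_def N'_def using inv by auto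
  have h: "h (chart_map c z) = chart_map d (f z)" if "z \<in> N" for z
    using that X.inv_map[OF c(1)] unfolding h_def N_def by simp
  have k: "k (chart_map d (f z)) = chart_map c z" if "z \<in> N" for z
    using that Y.inv_map[OF d(1)] inv unfolding k_def N_def by simp
  have "chart_iso X c Y d h k (chart_map c ` N) (chart_map d ` N')"
    unfolding chart_iso_def
  proof (intro conjI ballI allI)
    show "open (chart_map c ` N)" by (rule X.open_chart_image[OF c(1) N]) (auto simp: N_def)
    show "open (chart_map d ` N')" by (rule Y.open_chart_image[OF d(1) N']) (auto simp: N'_def)
    show "smooth_on (chart_map c ` N) h"
      using U(3) c(1) d(1) unfolding smooth_map_def N_def h_def by blast
    show "smooth_on (chart_map d ` N') k"
      using U(4) c(1) d(1) unfolding smooth_map_def N'_def k_def by blast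
    fix y u v assume "y \<in> chart_map c ` N"
    then obtain z where z: "y = chart_map c z" "z \<in> N" by blast
    have zN: "z \<in> chart_dom c" "z \<in> U" "f z \<in> chart_dom d" using z(2) unfolding N_def by auto
    have "coord_metric X c y u v = inner_at X z (tangent_vec (atlas X) c z u) (tangent_vec (atlas X) c z v)"
      using X.inner_at_tangent_vec[OF c(1) zN(1)] z(1) by simp
    also have "\<dots> = inner_at Y (f z) (differential (atlas X) (atlas Y) f z (tangent_vec (atlas X) c z u))
        (differential (atlas X) (atlas Y) f z (tangent_vec (atlas X) c z v))"
      by (rule iso[symmetric, OF zN(2) X.tangent_vec_in[OF c(1) zN(1)] X.tangent_vec_in[OF c(1) zN(1)]])
    also have "\<dots> = coord_metric Y d (h y) (frechet_derivative h (at y) u) (frechet_derivative h (at y) v)"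
      unfolding differential_tangent_vec[OF zN(2) U(3) c(1) zN(1) d(1) zN(3)] Y.inner_at_tangent_vec[OF d(1) zN(3)]
        h_def[symmetric] z(1) h[OF z(2)] ..
    finally show "coord_metric X c y u v = coord_metric Y d (h y) (frechet_derivative h (at y) u) (frechet_derivative h (at y) v)" .
  qed (use h k N'_eq in \<open>auto simp: N_def\<close>)
  moreover have "\<forall>z\<in>N. z \<in> chart_dom c \<and> f z \<in> chart_dom d \<and> chart_map c z \<in> chart_map c ` N \<and> chart_map d (f z) = h (chart_map c z)"
    using h unfolding N_def by auto
  moreover have "x \<in> N" using c d U(1) unfolding N_def by auto
  ultimately show thesis using that N by blast
qed

lemma isCont_local_iso: "isCont f x"
proof -
  obtain U where "x \<in> U" "smooth_map (atlas X) (atlas Y) U f" using loc_iso unfolding local_isometry_def by metis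
  then show ?thesis unfolding smooth_map_def using continuous_on_eq_continuous_at by blast
qed

lemma continuous_local_iso: "continuous_on S f"
  by (rule continuous_at_imp_continuous_on) (simp add: isCont_local_iso)

lemma iso_curves_image:
  assumes \<gamma>: "continuous_on I \<gamma>"
  shows "iso_curves X Y I \<gamma> (\<lambda>t. f (\<gamma> t))"
  unfolding iso_curves_def
proof (intro conjI ballI impI \<gamma>)
  show "continuous_on I (\<lambda>t. f (\<gamma> t))" by (rule continuous_on_compose2[OF continuous_local_iso[of UNIV] \<gamma>]) simp
  fix t c d assume a: "t \<in> I" "c \<in> atlas X" "d \<in> atlas Y" "\<gamma> t \<in> chart_dom c" "f (\<gamma> t) \<in> chart_dom d"
  obtain h k W W' N where iso: "chart_iso X c Y d h k W W'" "open N" "\<gamma> t \<in> N"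
    "\<forall>z\<in>N. z \<in> chart_dom c \<and> f z \<in> chart_dom d \<and> chart_map c z \<in> W \<and> chart_map d (f z) = h (chart_map c z)"
    by (rule local_chart_iso[OF a(2,4,3,5)])
  obtain T where T: "open T" "T \<inter> I = \<gamma> -` N \<inter> I"
    using \<gamma> iso(2) unfolding continuous_on_open_invariant by metis
  with a iso(3) have "t \<in> T" by blast
  with iso T show "\<exists>h k W W' T. chart_iso X c Y d h k W W' \<and> open T \<and> t \<in> T \<and>
          (\<forall>s\<in>T \<inter> I. \<gamma> s \<in> chart_dom c \<and> f (\<gamma> s) \<in> chart_dom d \<and> chart_map c (\<gamma> s) \<in> W \<and>
             chart_map d (f (\<gamma> s)) = h (chart_map c (\<gamma> s)))"
    by (intro exI[of _ h] exI[of _ k] exI[of _ W] exI[of _ W'] exI[of _ T]) blast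
qed

lemma smooth_curve_image:
  assumes "smooth_curve (atlas X) I \<gamma>"
  shows "smooth_curve (atlas Y) I (\<lambda>t. f (\<gamma> t))"
proof -
  obtain J \<beta> where J: "I \<subseteq> J" "open J" "continuous_on J \<beta>" "\<forall>t\<in>I. \<beta> t = \<gamma> t"
    and sm: "\<forall>d\<in>atlas X. smooth_on {t \<in> J. \<beta> t \<in> chart_dom d} (\<lambda>t. chart_map d (\<beta> t))"
    by (rule X.smooth_curve_extension[OF assms])
  have c: "continuous_on J (\<lambda>t. f (\<beta> t))" by (rule continuous_on_compose2[OF continuous_local_iso[of UNIV] J(3)]) simp
  have "smooth_on {t \<in> J. f (\<beta> t) \<in> chart_dom d} (\<lambda>t. chart_map d (f (\<beta> t)))" if d: "d \<in> atlas Y" for d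
  proof (rule smooth_on_local)
    fix t assume t: "t \<in> {t \<in> J. f (\<beta> t) \<in> chart_dom d}"
    obtain c where c: "c \<in> atlas X" "\<beta> t \<in> chart_dom c" by (rule X.ex_chart)
    obtain h k W W' N where iso: "chart_iso X c Y d h k W W'" "open N" "\<beta> t \<in> N"
      "\<forall>z\<in>N. z \<in> chart_dom c \<and> f z \<in> chart_dom d \<and> chart_map c z \<in> W \<and> chart_map d (f z) = h (chart_map c z)"
      using local_chart_iso[OF c d] t by blast
    define T where "T = J \<inter> \<beta> -` N"
    have T: "open T" unfolding T_def by (rule continuous_open_preimage[OF J(3,2) iso(2)])
    have "smooth_on T (\<lambda>t. chart_map c (\<beta> t))"
      by (rule smooth_on_subset[OF bspec[OF sm c(1)]]) (use iso(4) in \<open>auto simp: T_def\<close>)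
    moreover have "open W" "smooth_on W h" using iso(1) unfolding chart_iso_def by auto
    moreover have "(\<lambda>t. chart_map c (\<beta> t)) ` T \<subseteq> W" using iso(4) unfolding T_def by auto
    ultimately have "smooth_on T (\<lambda>t. h (chart_map c (\<beta> t)))" using smooth_on_compose[OF T] by blast
    then have "smooth_on T (\<lambda>t. chart_map d (f (\<beta> t)))"
      by (rule smooth_on_cong[OF T, rotated]) (use iso(4) in \<open>auto simp: T_def\<close>)
    then show "\<exists>T. open T \<and> t \<in> T \<and> smooth_on T (\<lambda>t. chart_map d (f (\<beta> t)))"
      using T t iso(3) unfolding T_def by blast
  qed
  then show ?thesis unfolding Y.smooth_curve_iff using J c by (intro exI[of _ J] exI[of _ "\<lambda>t. f (\<beta> t)"]) auto
qed

lemma geodesic_image: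
  assumes "geodesic X I \<gamma>" "no_isolated I"
  shows "geodesic Y I (\<lambda>t. f (\<gamma> t))"
proof (rule Y.weak_imp_geodesic[OF _ assms(2)])
  have sm: "smooth_curve (atlas X) I \<gamma>" using assms(1) unfolding geodesic_def by blast
  show "smooth_curve (atlas Y) I (\<lambda>t. f (\<gamma> t))" by (rule smooth_curve_image[OF sm])
  show "weak_geodesic Y I (\<lambda>t. f (\<gamma> t))"
    by (rule iso_curves_weak_geodesic[OF X.riem_axioms Y.riem_axioms assms(2)
          iso_curves_image[OF X.smooth_curve_continuous[OF sm]] X.geodesic_imp_weak[OF assms]])
qed

end

text \<open>The derivative is pushed to a chart of \<open>Y\<close> along one curve and pulled back
  along the other; both steps preserve the norm.\<close>

lemma (in local_iso) same_projection_derivative: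
  assumes "continuous_on I \<gamma>" "continuous_on I \<delta>" "\<And>t. t \<in> I \<Longrightarrow> f (\<gamma> t) = f (\<delta> t)"
    and t: "t \<in> I" "c \<in> atlas X" "\<gamma> t \<in> chart_dom c" "c' \<in> atlas X" "\<delta> t \<in> chart_dom c'"
    and der: "((\<lambda>s. chart_map c (\<gamma> s)) has_vector_derivative b) (at t within I)"
  obtains b' where "((\<lambda>s. chart_map c' (\<delta> s)) has_vector_derivative b') (at t within I)"
    "X.nrm c' (\<delta> t) b' = X.nrm c (\<gamma> t) b"
proof -
  obtain d where d: "d \<in> atlas Y" "f (\<gamma> t) \<in> chart_dom d" by (rule Y.ex_chart)
  have d': "f (\<delta> t) \<in> chart_dom d" using d(2) assms(3)[OF t(1)] by simp
  obtain v where v: "((\<lambda>s. chart_map d (f (\<gamma> s))) has_vector_derivative v) (at t within I)"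
    "coord_metric Y d (chart_map d (f (\<gamma> t))) v v = coord_metric X c (chart_map c (\<gamma> t)) b b"
    by (rule iso_curves_derivative[OF iso_curves_image[OF assms(1)] t(1,2) d(1) t(3) d(2) der])
  have v': "((\<lambda>s. chart_map d (f (\<delta> s))) has_vector_derivative v) (at t within I)"
    by (rule has_vector_derivative_cong_local[OF v(1) open_UNIV _ t(1)]) (use assms(3) in auto)
  obtain b' where "((\<lambda>s. chart_map c' (\<delta> s)) has_vector_derivative b') (at t within I)"
    "coord_metric X c' (chart_map c' (\<delta> t)) b' b' = coord_metric Y d (chart_map d (f (\<delta> t))) v v"
    by (rule iso_curves_derivative[OF iso_curves_sym[OF iso_curves_image[OF assms(2)]] t(1) d(1) t(4) d' t(5) v'])
  then show thesis using that v(2) assms(3)[OF t(1)] unfolding X.nrm_def by simp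
qed

text \<open>Uniqueness of geodesics makes the description by \<open>THE\<close> determinate.\<close>

lemma (in riem) riemannian_exp_eq:
  assumes geo: "geodesic X {0..1} \<gamma>" and x: "\<gamma> 0 = x" and \<xi>: "velocity (atlas X) {0..1} \<gamma> 0 = \<xi>"
  shows "riemannian_exp X x \<xi> = \<gamma> 1"
  unfolding riemannian_exp_def
proof (rule the_equality)
  show "\<exists>\<gamma>'. geodesic X {0..1} \<gamma>' \<and> \<gamma>' 0 = x \<and> velocity (atlas X) {0..1} \<gamma>' 0 = \<xi> \<and> \<gamma>' 1 = \<gamma> 1" using assms by blast
  fix y assume "\<exists>\<gamma>. geodesic X {0..1} \<gamma> \<and> \<gamma> 0 = x \<and> velocity (atlas X) {0..1} \<gamma> 0 = \<xi> \<and> \<gamma> 1 = y"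
  then obtain \<delta> where \<delta>: "geodesic X {0..1} \<delta>" "\<delta> 0 = x" "velocity (atlas X) {0..1} \<delta> 0 = \<xi>" "\<delta> 1 = y" by blast
  obtain c where c: "c \<in> atlas X" "x \<in> chart_dom c" by (rule ex_chart)
  have vel: "chart_velocity {0..1} \<eta> c 0 = velocity (atlas X) {0..1} \<eta> 0 c" if "\<eta> 0 = x" for \<eta>
    using c that unfolding chart_velocity_def velocity_def o_def by simp
  note ni = no_isolated_atLeastAtMost[OF zero_less_one]
  have "\<delta> 1 = \<gamma> 1"
    by (rule weak_geodesic_unique[OF zero_less_one geodesic_imp_weak[OF \<delta>(1) ni] geodesic_imp_weak[OF geo ni] _ c(1)])
      (use \<delta> x \<xi> c vel in auto)
  then show "y = \<gamma> 1" using \<delta>(4) by simp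
qed

section \<open>Lengths and geodesics under the covering projection\<close>

locale covering_isometry = local_iso X Y \<pi> + X: hadamard_space X
  for X :: "('a::{t2_space, second_countable_topology}, 'e::euclidean_space) riemannian"
    and Y :: "('b::{t2_space, second_countable_topology}, 'e) riemannian"
    and \<pi> :: "'a \<Rightarrow> 'b"
begin

text \<open>By symmetry of \<open>iso_curves\<close> the lift \<open>\<tau>\<close> inherits
  coordinate derivatives and speed from \<open>\<beta>\<close>.\<close>

lemma dist_le_length_of_projection:
  assumes "smooth_curve (atlas Y) {0..1} \<beta>" "continuous_on {0..1} \<tau>" "\<And>t. t \<in> {0..1} \<Longrightarrow> \<pi> (\<tau> t) = \<beta> t"
  shows "riemannian_dist X (\<tau> 0) (\<tau> 1) \<le> curve_length Y 0 1 \<beta>"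
proof -
  have "riemannian_dist X (\<tau> 0) (\<tau> 1) \<le> 1 * curve_length Y 0 1 \<beta>"
  proof (rule X.dist_le_length_mult[OF Y.riem_axioms Y.smooth_imp_piecewise_smooth[OF assms(1)] assms(2) zero_less_one])
    fix s c v
    assume s: "0 < s" "s < 1" and c: "c \<in> atlas Y" "\<beta> s \<in> chart_dom c"
      and v: "((\<lambda>t. chart_map c (\<beta> t)) has_vector_derivative v) (at s)"
    have s': "s \<in> {0..1}" using s by simp
    have at: "at s within {0..1} = at s" by (rule at_within_interior_Icc[OF s])
    obtain d where d: "d \<in> atlas X" "\<tau> s \<in> chart_dom d" by (rule X.ex_chart)
    have c': "\<pi> (\<tau> s) \<in> chart_dom c" using c(2) assms(3)[OF s'] by simp
    have "((\<lambda>t. chart_map c (\<pi> (\<tau> t))) has_vector_derivative v) (at s within {0..1})"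
      by (rule has_vector_derivative_cong_local[OF has_vector_derivative_at_within[OF v] open_UNIV _ s']) (use assms(3) in auto)
    then obtain b where "((\<lambda>t. chart_map d (\<tau> t)) has_vector_derivative b) (at s within {0..1})"
      "coord_metric X d (chart_map d (\<tau> s)) b b = coord_metric Y c (chart_map c (\<pi> (\<tau> s))) v v"
      by (rule iso_curves_derivative[OF iso_curves_sym[OF iso_curves_image[OF assms(2)]] s' c(1) d(1) c' d(2)])
    then show "\<exists>d\<in>atlas X. \<tau> s \<in> chart_dom d \<and> (\<exists>b. ((\<lambda>t. chart_map d (\<tau> t)) has_vector_derivative b) (at s)
        \<and> X.nrm d (\<tau> s) b \<le> 1 * Y.nrm c (\<beta> s) v)"
      using d assms(3)[OF s'] unfolding at X.nrm_def Y.nrm_def by (intro bexI[of _ d]) auto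
  qed
  then show ?thesis by simp
qed

text \<open>The curves \<open>T (\<sigma> s)\<close> and \<open>\<sigma> s\<close> have the same
  projection, hence the same speed. The isometry property of the continuous map \<open>T\<close> is
  thus obtained along curves.\<close>

lemma dist_deck_le:
  assumes T: "continuous_on UNIV T" "\<And>z. \<pi> (T z) = \<pi> z"
  shows "riemannian_dist X (T y) (T z) \<le> riemannian_dist X y z"
proof -
  obtain \<gamma>0 where "X.joining y z \<gamma>0" by (rule X.ex_joining)
  then show ?thesis
  proof (rule X.dist_greatest)
    fix \<sigma> assume J: "X.joining y z \<sigma>"
    then have pw: "piecewise_smooth_curve (atlas X) 0 1 \<sigma>" unfolding X.joining_def by simp
    then have \<sigma>: "continuous_on {0..1} \<sigma>" unfolding piecewise_smooth_curve_def by simp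
    have T\<sigma>: "continuous_on {0..1} (\<lambda>s. T (\<sigma> s))" by (rule continuous_on_compose2[OF T(1) \<sigma>]) simp
    have "riemannian_dist X (T (\<sigma> 0)) (T (\<sigma> 1)) \<le> 1 * curve_length X 0 1 \<sigma>"
    proof (rule X.dist_le_length_mult[OF X.riem_axioms pw T\<sigma> zero_less_one])
      fix s c v
      assume s: "0 < s" "s < 1" and c: "c \<in> atlas X" "\<sigma> s \<in> chart_dom c"
        and v: "((\<lambda>t. chart_map c (\<sigma> t)) has_vector_derivative v) (at s)"
      have s': "s \<in> {0..1}" using s by simp
      have at: "at s within {0..1} = at s" by (rule at_within_interior_Icc[OF s])
      obtain d where d: "d \<in> atlas X" "T (\<sigma> s) \<in> chart_dom d" by (rule X.ex_chart)
      obtain b where "((\<lambda>t. chart_map d (T (\<sigma> t))) has_vector_derivative b) (at s within {0..1})"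
        "X.nrm d (T (\<sigma> s)) b = X.nrm c (\<sigma> s) v"
        by (rule same_projection_derivative[OF \<sigma> T\<sigma> _ s' c d has_vector_derivative_at_within[OF v]])
          (use T(2) in auto)
      then show "\<exists>d\<in>atlas X. T (\<sigma> s) \<in> chart_dom d \<and> (\<exists>b. ((\<lambda>t. chart_map d (T (\<sigma> t))) has_vector_derivative b) (at s)
          \<and> X.nrm d (T (\<sigma> s)) b \<le> 1 * X.nrm c (\<sigma> s) v)"
        using d unfolding at by (intro bexI[of _ d]) auto
    qed
    then show "riemannian_dist X (T y) (T z) \<le> curve_length X 0 1 \<sigma>" using J unfolding X.joining_def by simp
  qed
qed

text \<open>Being a geodesic is tested on the projection, which \<open>T\<close> does not
  change.\<close>

lemma weak_geodesic_deck:
  assumes T: "continuous_on UNIV T" "\<And>z. \<pi> (T z) = \<pi> z" and geo: "weak_geodesic X I \<gamma>" "no_isolated I"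
  shows "weak_geodesic X I (\<lambda>t. T (\<gamma> t))"
proof -
  have \<gamma>: "continuous_on I \<gamma>" using geo(1) unfolding weak_geodesic_def by blast
  have T\<gamma>: "continuous_on I (\<lambda>t. T (\<gamma> t))" by (rule continuous_on_compose2[OF T(1) \<gamma>]) simp
  have "weak_geodesic Y I (\<lambda>t. \<pi> (\<gamma> t))"
    by (rule iso_curves_weak_geodesic[OF X.riem_axioms Y.riem_axioms geo(2) iso_curves_image[OF \<gamma>] geo(1)])
  moreover have "iso_curves Y X I (\<lambda>t. \<pi> (\<gamma> t)) (\<lambda>t. T (\<gamma> t))"
    using iso_curves_sym[OF iso_curves_image[OF T\<gamma>]] T(2) by simp
  ultimately show ?thesis using iso_curves_weak_geodesic[OF Y.riem_axioms X.riem_axioms geo(2)] by blast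
qed

end

section \<open>Deck transformations\<close>

lemma (in hadamard_point) weak_geodesic_eq_geod:
  assumes geo: "weak_geodesic X UNIV \<delta>" "\<delta> 0 = p"
  obtains w where "\<And>t. t \<ge> 0 \<Longrightarrow> \<delta> t = geod w t"
proof -
  define w where "w = chart_velocity UNIV \<delta> c0 0"
  have "\<delta> t = geod w t" if "t \<ge> 0" for t
  proof (cases "t = 0")
    case True then show ?thesis using geo(2) geod(2) by simp
  next
    case False
    with that have t: "0 < t" by simp
    note ni = no_isolated_atLeastAtMost[OF t]
    note A = weak_geodesic_subset[OF weak_geod[of w] subset_UNIV ni]
    note B = weak_geodesic_subset[OF geo(1) subset_UNIV ni]
    show ?thesis
    proof (rule weak_geodesic_unique[OF t B(1) A(1) _ c0(1)])
      show "chart_velocity {0..t} \<delta> c0 0 = chart_velocity {0..t} (geod w) c0 0"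
        using A(2)[of 0 c0] B(2)[of 0 c0] t c0 geo(2) by (simp add: geod(2) geod_velocity w_def)
    qed (use t geod(2) geo(2) c0 in auto)
  qed
  then show thesis using that by blast
qed

context covering_isometry
begin

text \<open>The lifts of \<open>\<pi>\<close> through itself; no inverse is recorded.\<close>

definition deck :: "('a \<Rightarrow> 'a) \<Rightarrow> bool" where
  "deck T \<longleftrightarrow> continuous_on UNIV T \<and> (\<forall>z. \<pi> (T z) = \<pi> z)"

lemma deck_comp: "deck S \<Longrightarrow> deck T \<Longrightarrow> deck (S \<circ> T)"
  unfolding deck_def using continuous_on_compose[of UNIV T S] continuous_on_subset by fastforce

lemma deck_funpow: "deck T \<Longrightarrow> deck (T ^^ k)"
proof (induction k)
  case 0 then show ?case by (simp add: deck_def)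
next
  case (Suc k) then show ?case using deck_comp[of T "T ^^ k"] by (simp add: o_def)
qed

lemma deck_dist_le: "deck T \<Longrightarrow> riemannian_dist X (T y) (T z) \<le> riemannian_dist X y z"
  using dist_deck_le unfolding deck_def by blast

text \<open>
  The midpoint \<open>m\<close> of the segment from \<open>y\<close> to \<open>T y\<close> is moved to the midpoint of the segment from
  \<open>T y\<close> to \<open>T (T y)\<close>; both are reached from \<open>T y\<close> at half the distance.
\<close>

lemma deck_midpoint:
  assumes T: "deck T"
  obtains m where "riemannian_dist X m (T m) \<le> riemannian_dist X y (T (T y)) / 2"
proof -
  obtain c where c: "c \<in> atlas X" "T y \<in> chart_dom c" by (rule X.ex_chart)
  interpret H: hadamard_point X "T y" c by (rule X.hadamard_point[OF c])
  define u where "u = H.Log y"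
  define \<gamma> where "\<gamma> t = H.geod u (-1 * t + 1)" for t
  have "weak_geodesic X UNIV \<gamma>" unfolding \<gamma>_def
    by (rule X.weak_geodesic_affine(1)[OF H.weak_geod no_isolated_UNIV]) simp
  then have "weak_geodesic X UNIV (\<lambda>t. T (\<gamma> t))"
    using weak_geodesic_deck[of T] T no_isolated_UNIV unfolding deck_def by blast
  moreover have \<gamma>0: "\<gamma> 0 = y" unfolding \<gamma>_def u_def by (simp add: H.geod_eq_Exp H.Exp_Log)
  ultimately obtain w where w: "\<And>t. t \<ge> 0 \<Longrightarrow> T (\<gamma> t) = H.geod w t"
    using H.weak_geodesic_eq_geod[of "\<lambda>t. T (\<gamma> t)"] by metis
  have "\<gamma> 1 = T y" unfolding \<gamma>_def using H.geod(2) by simp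
  then have w1: "H.Exp w = T (T y)" using w[of 1] by (simp add: H.Exp_def)
  have "\<gamma> (1/2) = H.Exp ((1/2) *\<^sub>R u)" unfolding \<gamma>_def by (simp add: H.geod_eq_Exp)
  moreover have "T (\<gamma> (1/2)) = H.Exp ((1/2) *\<^sub>R w)" using w[of "1/2"] by (simp add: H.geod_eq_Exp)
  ultimately have "riemannian_dist X (\<gamma> (1/2)) (T (\<gamma> (1/2))) \<le> 1/2 * riemannian_dist X (H.Exp u) (H.Exp w)"
    using H.dist_Exp_contract[of "1/2" u w] by simp
  then show thesis using that w1 by (simp add: u_def H.Exp_Log)
qed

text \<open>Induction over all \<open>T\<close> and \<open>r\<close> at once: the midpoint
  inequality makes \<open>2 * r\<close> a lower bound for the displacement of \<open>T ^^ 2\<close>,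
  to which the hypothesis for \<open>n\<close> applies.\<close>

lemma deck_displacement_lower:
  assumes "deck T" "\<And>z. r \<le> riemannian_dist X z (T z)"
  shows "2 ^ n * r \<le> riemannian_dist X y ((T ^^ (2 ^ n)) y)"
  using assms
proof (induction n arbitrary: T r)
  case 0
  then show ?case by simp
next
  case (Suc n)
  have "2 * r \<le> riemannian_dist X z ((T ^^ 2) z)" for z
  proof -
    obtain m where "riemannian_dist X m (T m) \<le> riemannian_dist X z (T (T z)) / 2"
      by (rule deck_midpoint[OF Suc.prems(1)])
    then show ?thesis using Suc.prems(2)[of m] by (simp add: numeral_2_eq_2)
  qed
  from Suc.IH[OF deck_funpow[OF Suc.prems(1)] this] show ?case
    by (simp add: funpow_mult mult.commute)
qed

lemma deck_displacement_upper:
  assumes "deck T"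
  shows "riemannian_dist X y ((T ^^ k) y) \<le> real k * riemannian_dist X y (T y)"
proof (induction k)
  case 0 then show ?case by (simp add: X.dist_refl)
next
  case (Suc k)
  have "riemannian_dist X ((T ^^ k) y) ((T ^^ k) (T y)) \<le> riemannian_dist X y (T y)"
    by (rule deck_dist_le[OF deck_funpow[OF assms]])
  then show ?case
    using Suc X.dist_triangle[of y "(T ^^ k) (T y)" "(T ^^ k) y"]
    by (simp add: funpow_swap1 algebra_simps)
qed

lemma deck_displacement_upper_at:
  assumes "deck T"
  shows "riemannian_dist X x ((T ^^ k) x) \<le> 2 * riemannian_dist X x y + real k * riemannian_dist X y (T y)"
  using X.dist_triangle[of x "(T ^^ k) x" y] X.dist_triangle[of y "(T ^^ k) x" "(T ^^ k) y"]
    deck_displacement_upper[OF assms, of y k] deck_dist_le[OF deck_funpow[OF assms], of k y x] X.dist_commute[of y x]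
  by linarith

text \<open>The first claim divides \<open>deck_displacement_upper_at\<close> by \<open>k\<close>,
  where the cost of moving the base point disappears. For the second, the limit is evaluated along
  \<open>k = 2 ^ n\<close>.\<close>

lemma deck_translation_length:
  assumes T: "deck T" and lim: "(\<lambda>k. riemannian_dist X x ((T ^^ k) x) / real k) \<longlonglongrightarrow> \<rho>"
  shows "\<rho> \<le> riemannian_dist X y (T y)"
    and "(\<And>z. r \<le> riemannian_dist X z (T z)) \<Longrightarrow> r \<le> \<rho>"
proof -
  have "(\<lambda>k. 2 * riemannian_dist X x y / real k + riemannian_dist X y (T y)) \<longlonglongrightarrow> 0 + riemannian_dist X y (T y)"
    by (intro tendsto_intros lim_const_over_n)
  moreover have "eventually (\<lambda>k. riemannian_dist X x ((T ^^ k) x) / real k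
      \<le> 2 * riemannian_dist X x y / real k + riemannian_dist X y (T y)) sequentially"
    using eventually_gt_at_top[of 0]
  proof eventually_elim
    case (elim k)
    then show ?case using deck_displacement_upper_at[OF T, of x k y] by (simp add: field_simps)
  qed
  ultimately show "\<rho> \<le> riemannian_dist X y (T y)"
    using tendsto_le[OF sequentially_bot _ lim] by force
  assume r: "\<And>z. r \<le> riemannian_dist X z (T z)"
  have "strict_mono (\<lambda>n. 2 ^ n :: nat)" by (simp add: strict_mono_def)
  from LIMSEQ_subseq_LIMSEQ[OF lim this]
  have "(\<lambda>n. riemannian_dist X x ((T ^^ (2 ^ n)) x) / 2 ^ n) \<longlonglongrightarrow> \<rho>" by (simp add: o_def)
  moreover have "r \<le> riemannian_dist X x ((T ^^ (2 ^ n)) x) / 2 ^ n" for n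
    using deck_displacement_lower[OF T r, of n x] by (simp add: field_simps)
  ultimately show "r \<le> \<rho>" using LIMSEQ_le_const by blast
qed

lemma curve_length_projected_geodesic:
  assumes c: "c \<in> atlas X" "y \<in> chart_dom c"
  shows "curve_length Y 0 1 (\<lambda>t. \<pi> (hadamard_point.geod X y c w t)) = X.nrm c y w"
proof -
  interpret H: hadamard_point X y c by (rule X.hadamard_point[OF c])
  have \<gamma>: "continuous_on {0..1} (H.geod w)"
    using X.smooth_curve_continuous[OF H.smooth_geod] continuous_on_subset by blast
  show ?thesis
  proof (rule Y.length_of[of "{}" _ _ _ "\<lambda>_. X.nrm c y w"])
    show "continuous_on {0..1} (\<lambda>t. \<pi> (H.geod w t))"
      by (rule continuous_on_compose2[OF continuous_local_iso[of UNIV] \<gamma>]) simp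
    show "((\<lambda>_. X.nrm c y w) has_integral X.nrm c y w) {0..1::real}"
      using has_integral_const_real[of "X.nrm c y w" 0 1] by simp
    fix t :: real assume t: "0 < t" "t < 1"
    then have t': "t \<in> {0..1}" by simp
    obtain e where e: "e \<in> atlas X" "H.geod w t \<in> chart_dom e" by (rule X.ex_chart)
    obtain d where d: "d \<in> atlas Y" "\<pi> (H.geod w t) \<in> chart_dom d" by (rule Y.ex_chart)
    have "((\<lambda>s. chart_map e (H.geod w s)) has_vector_derivative chart_velocity UNIV (H.geod w) e t) (at t)"
      using H.weak_geod e unfolding weak_geodesic_def by blast
    then have D: "((\<lambda>s. chart_map e (H.geod w s)) has_vector_derivative chart_velocity UNIV (H.geod w) e t) (at t within {0..1})"
      by (rule has_vector_derivative_at_within)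
    obtain b where "((\<lambda>s. chart_map d (\<pi> (H.geod w s))) has_vector_derivative b) (at t within {0..1})"
      "coord_metric Y d (chart_map d (\<pi> (H.geod w t))) b b = coord_metric X e (chart_map e (H.geod w t))
        (chart_velocity UNIV (H.geod w) e t) (chart_velocity UNIV (H.geod w) e t)"
      by (rule iso_curves_derivative[OF iso_curves_image[OF \<gamma>] t' e(1) d(1) e(2) d(2) D])
    then show "\<exists>c'\<in>atlas Y. \<pi> (H.geod w t) \<in> chart_dom c' \<and> (\<exists>v. ((\<lambda>s. chart_map c' (\<pi> (H.geod w s))) has_vector_derivative v) (at t)
        \<and> X.nrm c y w = Y.nrm c' (\<pi> (H.geod w t)) v)"
      using d H.geod_speed[OF e] unfolding X.nrm_def Y.nrm_def at_within_interior_Icc[OF t] by (intro bexI[of _ d]) auto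
  qed auto
qed

text \<open>The derivative of \<open>\<pi>\<close> is onto, so \<open>v\<close> is the image of some
  \<open>w\<close>, and the geodesics from \<open>\<pi> x'\<close> are projections of the complete
  geodesics from \<open>x'\<close>. In this way the exponential map of \<open>Y\<close> is evaluated
  by completeness of the cover.\<close>

lemma exp_projection:
  assumes c: "c \<in> atlas X" "x' \<in> chart_dom c" and v: "v \<in> tangent_space (atlas Y) (\<pi> x')"
  obtains w where "tnorm Y (\<pi> x') v = X.nrm c x' w"
    "\<And>t. t \<ge> 0 \<Longrightarrow> riemannian_exp Y (\<pi> x') (\<lambda>c. t *\<^sub>R v c) = \<pi> (hadamard_point.geod X x' c w t)"
proof -
  interpret H: hadamard_point X x' c by (rule X.hadamard_point[OF c])
  obtain d where d: "d \<in> atlas Y" "\<pi> x' \<in> chart_dom d" by (rule Y.ex_chart)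
  obtain h k W W' N where iso: "chart_iso X c Y d h k W W'" "open N" "x' \<in> N"
    "\<forall>z\<in>N. z \<in> chart_dom c \<and> \<pi> z \<in> chart_dom d \<and> chart_map c z \<in> W \<and> chart_map d (\<pi> z) = h (chart_map c z)"
    by (rule local_chart_iso[OF c d])
  define y where "y = chart_map c x'"
  have y: "y \<in> W" "h y = chart_map d (\<pi> x')" using iso(3,4) unfolding y_def by auto
  obtain w where w: "frechet_derivative h (at y) w = v d"
    using chart_iso_surj[OF iso(1) y(1)] by (metis surjD)
  have veq: "v = tangent_vec (atlas Y) d (\<pi> x') (v d)" by (rule Y.tangent_space_eq[OF v d])
  have "coord_metric Y d (chart_map d (\<pi> x')) (v d) (v d) = coord_metric X c (chart_map c x') w w"
    using iso(1) y w unfolding chart_iso_def y_def by auto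
  then have "tnorm Y (\<pi> x') v = X.nrm c x' w"
    using Y.tnorm_tangent_vec[OF d, of "v d"] veq unfolding X.nrm_def Y.nrm_def by simp
  moreover have "riemannian_exp Y (\<pi> x') (\<lambda>c. t *\<^sub>R v c) = \<pi> (H.geod w t)" if "t \<ge> 0" for t
  proof -
    \<comment> \<open>The geodesic with initial velocity \<open>t *\<^sub>R w\<close> on
      \<open>{0..1}\<close>, the interval over which \<open>riemannian_exp\<close> is defined;
      \<open>+ 0\<close> matches the form of \<open>geodesic_affine\<close>.\<close>
    define \<gamma> where "\<gamma> s = H.geod w (t * s + 0)" for s
    note ni = no_isolated_atLeastAtMost[OF zero_less_one]
    have geo: "geodesic X {0..1} \<gamma>" unfolding \<gamma>_def by (rule X.geodesic_affine[OF H.geod(1) ni])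
    have \<gamma>0: "\<gamma> 0 = x'" unfolding \<gamma>_def using H.geod(2) by simp
    have \<gamma>c: "continuous_on {0..1} \<gamma>" using X.geodesic_imp_weak[OF geo ni] unfolding weak_geodesic_def by blast
    have z: "0 \<in> {0..1::real}" by simp
    have "((\<lambda>s. chart_map c (H.geod w s)) has_vector_derivative chart_velocity UNIV (H.geod w) c 0) (at 0)"
      using H.weak_geod[of w] c H.geod(2)[of w] unfolding weak_geodesic_def by simp
    then have W0: "((\<lambda>s. chart_map c (H.geod w s)) has_vector_derivative w) (at 0)"
      unfolding H.geod_velocity .
    have "((\<lambda>s. t * s + 0) has_vector_derivative t) (at 0)"
      by (auto intro!: derivative_eq_intros simp: has_real_derivative_iff_has_vector_derivative[symmetric])
    from vector_diff_chain_at[OF this, of "\<lambda>s. chart_map c (H.geod w s)" w] W0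
    have "((\<lambda>s. chart_map c (\<gamma> s)) has_vector_derivative t *\<^sub>R w) (at 0)" unfolding \<gamma>_def by (simp add: o_def)
    then have D: "((\<lambda>s. chart_map c (\<gamma> s)) has_vector_derivative t *\<^sub>R w) (at 0 within {0..1})"
      by (rule has_vector_derivative_at_within)
    have "((\<lambda>s. h (chart_map c (\<gamma> s))) has_vector_derivative frechet_derivative h (at y) (t *\<^sub>R w)) (at 0 within {0..1})"
      using chart_iso_has_vector_derivative(1)[OF iso(1) _ D] \<gamma>0 y unfolding y_def by simp
    moreover have "frechet_derivative h (at y) (t *\<^sub>R w) = t *\<^sub>R v d"
    proof -
      have "(h has_derivative frechet_derivative h (at y)) (at y)"
        using iso(1) y(1) smooth_on_has_derivative unfolding chart_iso_def by blast
      then show ?thesis using w has_derivative_linear linear_scale by metis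
    qed
    moreover obtain T where T: "open T" "T \<inter> {0..1} = \<gamma> -` N \<inter> {0..1}"
      using \<gamma>c iso(2) unfolding continuous_on_open_invariant by metis
    moreover have "0 \<in> T" using T(2) iso(3) \<gamma>0 z by blast
    ultimately have "((\<lambda>s. chart_map d (\<pi> (\<gamma> s))) has_vector_derivative t *\<^sub>R v d) (at 0 within {0..1})"
      using has_vector_derivative_cong_local[of "\<lambda>s. h (chart_map c (\<gamma> s))" "t *\<^sub>R v d" 0 "{0..1}" T "\<lambda>s. chart_map d (\<pi> (\<gamma> s))"]
        iso(3,4) \<gamma>0 by auto
    then have "velocity (atlas Y) {0..1} (\<lambda>s. \<pi> (\<gamma> s)) 0 = tangent_vec (atlas Y) d (\<pi> x') (t *\<^sub>R v d)"
      using Y.velocity_eq[of d "\<lambda>s. \<pi> (\<gamma> s)" 0 "{0..1}" "t *\<^sub>R v d"] d \<gamma>0 ni \<gamma>c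
        continuous_on_compose2[OF continuous_local_iso[of UNIV] \<gamma>c] by simp
    also have "\<dots> = (\<lambda>c. t *\<^sub>R v c)"
    proof
      fix e
      show "tangent_vec (atlas Y) d (\<pi> x') (t *\<^sub>R v d) e = t *\<^sub>R v e"
      proof (cases "e \<in> atlas Y \<and> \<pi> x' \<in> chart_dom e")
        case True
        then have "linear (frechet_derivative (transition d e) (at (chart_map d (\<pi> x'))))"
          using Y.transition_has_derivative[OF d(1) _ d(2)] has_derivative_linear by blast
        then show ?thesis by (subst (2) veq) (simp add: tangent_vec_def linear_scale)
      qed (subst (2) veq, auto simp: tangent_vec_def)
    qed
    finally have "riemannian_exp Y (\<pi> x') (\<lambda>c. t *\<^sub>R v c) = \<pi> (\<gamma> 1)"
      using Y.riemannian_exp_eq[OF geodesic_image[OF geo ni]] \<gamma>0 by simp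
    then show ?thesis unfolding \<gamma>_def by simp
  qed
  ultimately show thesis using that by blast
qed

end

section \<open>The free homotopy class of a periodic point\<close>

locale lifted_isotopy = covering_isometry X Y \<pi>
  for X :: "('a::{t2_space, second_countable_topology}, 'e::euclidean_space) riemannian"
    and Y :: "('b::{t2_space, second_countable_topology}, 'e) riemannian"
    and \<pi> :: "'a \<Rightarrow> 'b" +
  fixes g :: "real \<Rightarrow> 'b \<Rightarrow> 'b" and G :: "real \<Rightarrow> 'a \<Rightarrow> 'a"
  assumes cover: "section_covering \<pi>" and lift: "isotopy_lift \<pi> g G"
begin

lemma G_cont: "continuous_on ({0..1} \<times> UNIV) (\<lambda>(t, y). G t y)"
  and G_proj: "t \<in> {0..1} \<Longrightarrow> \<pi> (G t y) = g t (\<pi> y)"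
  and G_0: "G 0 = id"
  using lift unfolding isotopy_lift_def by auto

lemma continuous_G:
  assumes "continuous_on S a" "continuous_on S b" "\<And>s. s \<in> S \<Longrightarrow> a s \<in> {0..1}"
  shows "continuous_on S (\<lambda>s. G (a s) (b s))"
proof -
  have "continuous_on S (\<lambda>s. (\<lambda>(t, y). G t y) (a s, b s))"
    by (rule continuous_on_compose2[OF G_cont continuous_on_Pair[OF assms(1,2)]]) (use assms(3) in auto)
  then show ?thesis by simp
qed

lemma lift_eq:
  assumes "connected S" "a \<in> S" "x \<in> S" "continuous_on S \<alpha>" "continuous_on S \<beta>"
    "\<And>s. s \<in> S \<Longrightarrow> \<pi> (\<alpha> s) = \<pi> (\<beta> s)" "\<alpha> a = \<beta> a"
  shows "\<alpha> x = \<beta> x"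
  by (rule continuous_lift_unique[OF section_covering_locally_injective[OF cover] assms])

text \<open>The cover is contracted to \<open>x\<close> along geodesics. Projecting this homotopy
  and lifting it from the constant map \<open>y\<close> gives at time \<open>1\<close> a continuous
  self-lift of \<open>\<pi>\<close>; the contraction keeps \<open>x\<close> fixed, so
  \<open>x\<close> goes to \<open>y\<close>.\<close>

lemma ex_deck:
  assumes "\<pi> y = \<pi> x"
  obtains T where "deck T" "T x = y"
proof -
  obtain c where c: "c \<in> atlas X" "x \<in> chart_dom c" by (rule X.ex_chart)
  interpret H: hadamard_point X x c by (rule X.hadamard_point[OF c])
  define h where "h = (\<lambda>(t, z). \<pi> (H.Exp (t *\<^sub>R H.Log z)))"
  have L: "continuous_on S (\<lambda>q. H.Log (snd q))" for S :: "(real \<times> 'a) set"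
    by (rule continuous_on_compose2[OF H.continuous_Log[of UNIV] continuous_on_snd[OF continuous_on_id]]) simp
  have "continuous_on ({0..1} \<times> UNIV) (\<lambda>q. \<pi> (H.Exp (fst q *\<^sub>R H.Log (snd q))))"
    by (rule continuous_on_compose2[OF continuous_local_iso[of UNIV] continuous_on_compose2[OF H.continuous_Exp[of UNIV]]])
      (auto intro!: continuous_intros L)
  then have h: "continuous_on ({0..1} \<times> UNIV) h" unfolding h_def by (simp add: split_beta)
  obtain k where k: "continuous_on ({0..1} \<times> UNIV) k" "\<forall>z\<in>UNIV. k (0, z) = y"
    "\<forall>t\<in>{0..1}. \<forall>z\<in>UNIV. \<pi> (k (t, z)) = h (t, z)"
  proof (rule homotopy_lift[OF cover h, of "\<lambda>_. y"])
    show "\<pi> y = h (0, z)" for z using assms unfolding h_def by (simp add: H.Exp_0)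
  qed auto
  have Lx: "H.Log x = 0" using H.Log_Exp[of 0] by (simp add: H.Exp_0)
  have "deck (\<lambda>z. k (1, z))"
    unfolding deck_def
  proof
    show "continuous_on UNIV (\<lambda>z. k (1, z))"
      by (rule continuous_on_compose2[OF k(1)]) (auto intro!: continuous_intros)
    show "\<forall>z. \<pi> (k (1, z)) = \<pi> z" using k(3) unfolding h_def by (simp add: H.Exp_Log)
  qed
  moreover have "k (1, x) = y"
  proof (rule lift_eq[of "{0..1}" 0 1 "\<lambda>t. k (t, x)" "\<lambda>_. y"])
    show "continuous_on {0..1} (\<lambda>t. k (t, x))"
      by (rule continuous_on_compose2[OF k(1)]) (auto intro!: continuous_intros)
    show "\<pi> (k (t, x)) = \<pi> y" if "t \<in> {0..1}" for t
      using k(3) that assms Lx unfolding h_def by (simp add: H.Exp_0)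
  qed (use k(2) in auto)
  ultimately show thesis by (rule that)
qed

text \<open>Both sides lift the path \<open>t \<mapsto> g t (\<pi> y)\<close> and start at
  \<open>T y\<close>.\<close>

lemma deck_commute:
  assumes T: "deck T" and t: "t \<in> {0..1}"
  shows "T (G t y) = G t (T y)"
proof (rule lift_eq[of "{0..1}" 0 t "\<lambda>t. T (G t y)" "\<lambda>t. G t (T y)"])
  have "continuous_on {0..1} (\<lambda>t. G t y)" by (intro continuous_G continuous_intros) auto
  then show "continuous_on {0..1} (\<lambda>t. T (G t y))"
    using T continuous_on_compose2[of UNIV T "{0..1}" "\<lambda>t. G t y"] unfolding deck_def by simp
  show "continuous_on {0..1} (\<lambda>t. G t (T y))" by (intro continuous_G continuous_intros) auto
qed (use T t in \<open>auto simp: deck_def G_proj G_0\<close>)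

lemma deck_funpow_commute: "deck T \<Longrightarrow> T ((G 1 ^^ k) y) = (G 1 ^^ k) (T y)"
  by (induction k) (simp_all add: deck_commute)

lemma deck_orbit:
  assumes T: "deck T" "T x = (G 1 ^^ p) x"
  shows "(G 1 ^^ (k * p)) x = (T ^^ k) x"
proof (induction k)
  case (Suc k)
  have "(G 1 ^^ (Suc k * p)) x = (G 1 ^^ p) ((T ^^ k) x)" using Suc by (simp add: funpow_add)
  also have "\<dots> = (T ^^ k) (T x)" using deck_funpow_commute[OF deck_funpow[OF T(1)]] T(2) by simp
  finally show ?case by (simp add: funpow_swap1)
qed simp

lemma funpow_proj: "\<pi> ((G 1 ^^ k) y) = (g 1 ^^ k) (\<pi> y)"
  by (induction k) (simp_all add: G_proj)

text \<open>The lift of \<open>periodic_curve\<close> starting at \<open>y\<close>; over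
  \<open>{0..p}\<close> it runs from \<open>y\<close> to \<open>(G 1 ^^ p) y\<close>.\<close>

definition orbit_curve :: "'a \<Rightarrow> real \<Rightarrow> 'a" where
  "orbit_curve y t = G (frac t) ((G 1 ^^ nat \<lfloor>t\<rfloor>) y)"

lemma orbit_curve_proj: "\<pi> (orbit_curve y t) = periodic_curve g (\<pi> y) t"
  unfolding orbit_curve_def periodic_curve_def
  using G_proj[of "frac t"] frac_ge_0[of t] frac_lt_1[of t] by (simp add: funpow_proj less_imp_le)

lemma orbit_curve_of_nat: "orbit_curve y (real n) = (G 1 ^^ n) y"
  unfolding orbit_curve_def by (simp add: G_0 frac_def)

lemma continuous_orbit_curve: "continuous_on {0..real n} (orbit_curve y)"
proof (induction n)
  case (Suc n)
  have "continuous_on {real n..real (Suc n)} (\<lambda>t. G (t - real n) ((G 1 ^^ n) y))"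
    by (intro continuous_G continuous_intros) auto
  moreover have "G (t - real n) ((G 1 ^^ n) y) = orbit_curve y t" if t: "t \<in> {real n..real (Suc n)}" for t
  \<comment> \<open>At the right end \<open>frac\<close> drops to \<open>0\<close> and the floor
    jumps to \<open>Suc n\<close>; the two formulas agree because \<open>G 0 = id\<close>.\<close>
  proof (cases "t = real (Suc n)")
    case True
    then show ?thesis unfolding True orbit_curve_of_nat by simp
  next
    case False
    with t have "\<lfloor>t\<rfloor> = int n" by (intro floor_unique) auto
    then show ?thesis unfolding orbit_curve_def frac_def by simp
  qed
  ultimately have "continuous_on {real n..real (Suc n)} (orbit_curve y)" by (rule continuous_on_eq)
  from continuous_on_closed_Un[OF _ _ Suc this]
  have "continuous_on ({0..real n} \<union> {real n..real (Suc n)}) (orbit_curve y)" by simp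
  moreover have "{0..real n} \<union> {real n..real (Suc n)} = {0..real (Suc n)}" by auto
  ultimately show ?case by simp
qed simp

text \<open>A free homotopy lifts to a homotopy of paths which join each point \<open>z\<close> to \<open>T z\<close>.\<close>

lemma class_length_lower:
  assumes T: "deck T" "T x = (G 1 ^^ p) x"
    and \<beta>: "\<beta> \<in> periodic_point_class g (\<pi> x) p" "smooth_curve (atlas Y) {0..1} \<beta>"
  obtains y where "riemannian_dist X y (T y) \<le> curve_length Y 0 1 \<beta>"
proof -
  obtain h :: "real \<times> real \<Rightarrow> 'b" where h: "continuous_on ({0..1} \<times> {0..1}) h"
    "\<forall>s\<in>{0..1}. h (0, s) = periodic_curve g (\<pi> x) (s * real p)" "\<forall>s\<in>{0..1}. h (1, s) = \<beta> s"
    "\<forall>t\<in>{0..1}. h (t, 1) = h (t, 0)"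
    using \<beta>(1) unfolding periodic_point_class_def free_homotopy_class_def
    by (auto simp: homotopic_loops pathfinish_def pathstart_def)
  define k0 where "k0 s = orbit_curve x (s * real p)" for s
  have k0: "continuous_on {0..1} k0" unfolding k0_def
    by (rule continuous_on_compose2[OF continuous_orbit_curve[of p]])
      (auto intro!: continuous_intros mult_left_le_one_le)
  obtain k where k: "continuous_on ({0..1} \<times> {0..1}) k" "\<forall>s\<in>{0..1}. k (0, s) = k0 s"
    "\<forall>t\<in>{0..1}. \<forall>s\<in>{0..1}. \<pi> (k (t, s)) = h (t, s)"
    by (rule homotopy_lift[OF cover h(1) k0]) (use h(2) in \<open>auto simp: k0_def orbit_curve_proj\<close>)
  have cont: "continuous_on {0..1} (\<lambda>t. k (t, s))" if "s \<in> {0..1}" for s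
    by (rule continuous_on_compose2[OF k(1)]) (use that in \<open>auto intro!: continuous_intros\<close>)
  \<comment> \<open>Both edges have the same projection, as the intermediate curves are closed, and
    they are related by \<open>T\<close> at time \<open>0\<close> because the orbit curve ends at
    \<open>T x\<close>.\<close>
  have "k (1, 1) = T (k (1, 0))"
  proof (rule lift_eq[of "{0..1}" 0 1 "\<lambda>t. k (t, 1)" "\<lambda>t. T (k (t, 0))"])
    show "continuous_on {0..1} (\<lambda>t. T (k (t, 0)))"
      using T(1) cont[of 0] unfolding deck_def by (auto intro: continuous_on_compose2)
    show "\<pi> (k (t, 1)) = \<pi> (T (k (t, 0)))" if "t \<in> {0..1}" for t
      using k(3) h(4) that T(1) unfolding deck_def by simp
    show "k (0, 1) = T (k (0, 0))"
      using k(2) T(2) orbit_curve_of_nat[of x p] orbit_curve_of_nat[of x 0] unfolding k0_def by simp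
  qed (use cont[of 1] in auto)
  moreover have "riemannian_dist X (k (1, 0)) (k (1, 1)) \<le> curve_length Y 0 1 \<beta>"
  proof (rule dist_le_length_of_projection[OF \<beta>(2), of "\<lambda>s. k (1, s)"])
    show "continuous_on {0..1} (\<lambda>s. k (1, s))"
      by (rule continuous_on_compose2[OF k(1)]) (auto intro!: continuous_intros)
  qed (use k(3) h(3) in auto)
  ultimately show thesis using that by simp
qed

text \<open>In the coordinates \<open>Log\<close> the straight homotopy between two paths is corrected linearly so
  that every intermediate path joins some point \<open>z\<close> to \<open>T z\<close>.\<close>

lemma class_length_upper:
  assumes T: "deck T" "T x = (G 1 ^^ p) x"
  obtains \<beta> where "\<beta> \<in> periodic_point_class g (\<pi> x) p" "smooth_curve (atlas Y) {0..1} \<beta>"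
    "curve_length Y 0 1 \<beta> = riemannian_dist X y (T y)"
proof -
  obtain c where c: "c \<in> atlas X" "y \<in> chart_dom c" by (rule X.ex_chart)
  interpret H: hadamard_point X y c by (rule X.hadamard_point[OF c])
  define w where "w = H.Log (T y)"
  define \<beta> where "\<beta> t = \<pi> (H.geod w t)" for t
  have len: "curve_length Y 0 1 \<beta> = riemannian_dist X y (T y)"
    unfolding \<beta>_def curve_length_projected_geodesic[OF c] using H.dist_Exp[of w] by (simp add: w_def H.Exp_Log)
  have sm: "smooth_curve (atlas Y) {0..1} \<beta>"
    unfolding \<beta>_def by (rule smooth_curve_image[OF X.smooth_curve_subset[OF H.smooth_geod]]) simp
  define A where "A t = H.Log (orbit_curve x (t * real p))" for t
  \<comment> \<open>Stage \<open>s\<close> of the homotopy starts at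
    \<open>H.Exp ((1 - s) *\<^sub>R A 0)\<close>, so it has to end at the image of this point under
    \<open>T\<close>, whose coordinates are \<open>\<tau> s\<close>. The last summand of
    \<open>h\<close> moves the end point there and leaves the start fixed; it vanishes for
    \<open>s = 0\<close> and \<open>s = 1\<close> since \<open>\<tau> 0 = A 1\<close> and
    \<open>\<tau> 1 = w\<close>.\<close>
  define \<tau> where "\<tau> s = H.Log (T (H.Exp ((1 - s) *\<^sub>R A 0)))" for s :: real
  define h where "h q = \<pi> (H.Exp ((1 - fst q) *\<^sub>R A (snd q) + (fst q * snd q) *\<^sub>R w
    + snd q *\<^sub>R (\<tau> (fst q) - (1 - fst q) *\<^sub>R A 1 - fst q *\<^sub>R w)))" for q
  have A: "continuous_on {0..1} A" unfolding A_def
    by (intro continuous_on_compose2[OF H.continuous_Log[of UNIV]] continuous_on_compose2[OF continuous_orbit_curve[of p]])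
      (auto intro!: continuous_intros mult_left_le_one_le)
  have cT: "continuous_on UNIV T" using T(1) unfolding deck_def by blast
  have \<tau>: "continuous_on {0..1} \<tau>" unfolding \<tau>_def
    by (rule continuous_on_compose2[OF H.continuous_Log[of UNIV]],
        rule continuous_on_compose2[OF cT], rule continuous_on_compose2[OF H.continuous_Exp[of UNIV]])
      (auto intro!: continuous_intros)
  have A01: "T (H.Exp (A 0)) = H.Exp (A 1)"
    using T(2) orbit_curve_of_nat[of x p] orbit_curve_of_nat[of x 0] unfolding A_def by (simp add: H.Exp_Log)
  have \<tau>0: "\<tau> 0 = A 1" unfolding \<tau>_def by (simp add: A01 H.Log_Exp)
  have \<tau>1: "\<tau> 1 = w" unfolding \<tau>_def w_def by (simp add: H.Exp_0)
  have "homotopic_loops UNIV (\<lambda>s. periodic_curve g (\<pi> x) (0 + s * (real p - 0))) \<beta>"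
    unfolding homotopic_loops
  proof (intro exI[of _ h] conjI ballI)
    have As: "continuous_on ({0..1} \<times> {0..1}) (\<lambda>q :: real \<times> real. A (snd q))"
      by (rule continuous_on_compose2[OF A]) (auto intro!: continuous_intros)
    have \<tau>s: "continuous_on ({0..1} \<times> {0..1}) (\<lambda>q :: real \<times> real. \<tau> (fst q))"
      by (rule continuous_on_compose2[OF \<tau>]) (auto intro!: continuous_intros)
    show "continuous_on ({0..1} \<times> {0..1}) h" unfolding h_def
      by (rule continuous_on_compose2[OF continuous_local_iso[of UNIV]],
          rule continuous_on_compose2[OF H.continuous_Exp[of UNIV]])
        (auto intro!: continuous_intros As \<tau>s)
    fix s :: real assume s: "s \<in> {0..1}"
    show "h (0, s) = periodic_curve g (\<pi> x) (0 + s * (real p - 0))"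
      unfolding h_def by (simp add: \<tau>0 A_def H.Exp_Log orbit_curve_proj)
    show "h (1, s) = \<beta> s" unfolding h_def \<beta>_def by (simp add: \<tau>1 H.geod_eq_Exp)
    have "h (s, 1) = \<pi> (H.Exp (\<tau> s))" unfolding h_def by simp
    also have "\<dots> = h (s, 0)" using T(1) unfolding h_def \<tau>_def deck_def by (simp add: H.Exp_Log)
    finally show "pathfinish (h \<circ> Pair s) = pathstart (h \<circ> Pair s)" by (simp add: pathfinish_def pathstart_def)
  qed simp
  then show thesis using that[OF _ sm len] unfolding periodic_point_class_def free_homotopy_class_def by simp
qed

text \<open>The lengths of smooth curves in the class include all displacements
  \<open>d(y, T y)\<close>, and each of them dominates one such displacement, so their infimum is
  the translation length.\<close>

lemma class_length_eq:
  assumes T: "deck T" "T x = (G 1 ^^ p) x"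
    and lim: "(\<lambda>k. riemannian_dist X x ((T ^^ k) x) / real k) \<longlonglongrightarrow> \<rho>"
  shows "class_length Y (periodic_point_class g (\<pi> x) p) = \<rho>"
  unfolding class_length_def
proof (rule cInf_eq_non_empty)
  note tr = deck_translation_length[OF T(1) lim]
  let ?S = "{curve_length Y 0 1 \<beta> |\<beta>. \<beta> \<in> periodic_point_class g (\<pi> x) p \<and> smooth_curve (atlas Y) {0..1} \<beta>}"
  have upper: "riemannian_dist X y (T y) \<in> ?S" for y
  proof -
    obtain \<beta> where "\<beta> \<in> periodic_point_class g (\<pi> x) p" "smooth_curve (atlas Y) {0..1} \<beta>"
      "curve_length Y 0 1 \<beta> = riemannian_dist X y (T y)"
      by (rule class_length_upper[OF T])
    then show ?thesis by force
  qed
  then show "?S \<noteq> {}" by blast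
  show "\<rho> \<le> l" if l: "l \<in> ?S" for l
  proof -
    obtain \<beta> where \<beta>: "\<beta> \<in> periodic_point_class g (\<pi> x) p" "smooth_curve (atlas Y) {0..1} \<beta>" "l = curve_length Y 0 1 \<beta>"
      using l by blast
    obtain y where "riemannian_dist X y (T y) \<le> curve_length Y 0 1 \<beta>" by (rule class_length_lower[OF T \<beta>(1,2)])
    then show ?thesis using tr(1)[of y] \<beta>(3) by simp
  qed
  show "r \<le> \<rho>" if "\<And>l. l \<in> ?S \<Longrightarrow> r \<le> l" for r
    by (rule tr(2)) (rule that[OF upper])
qed

text \<open>At the times \<open>n = k * p\<close> the orbit is at \<open>(T ^^ k) x\<close>, while
  the lifted ray is at distance \<open>n\<close> times the norm of \<open>v\<close> from
  \<open>x\<close>. The triangle inequality transfers the \<open>o(n)\<close> bound to the distance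
  from \<open>x\<close> to \<open>(T ^^ k) x\<close>.\<close>

lemma rotation_vector_norm:
  assumes v: "is_rotation_vector X Y \<pi> (G 1) (\<pi> x) v" and per: "(g 1 ^^ p) (\<pi> x) = \<pi> x" "0 < p"
  shows "tnorm Y (\<pi> x) v = class_length Y (periodic_point_class g (\<pi> x) p) / real p"
proof -
  have vt: "v \<in> tangent_space (atlas Y) (\<pi> x)" using v unfolding is_rotation_vector_def by blast
  obtain \<alpha> where \<alpha>: "continuous_on {0..} \<alpha>" "\<alpha> 0 = x"
    "\<forall>t\<ge>0. \<pi> (\<alpha> t) = riemannian_exp Y (\<pi> x) (\<lambda>c. t *\<^sub>R v c)"
    "(\<lambda>n. riemannian_dist X (\<alpha> (real n)) ((G 1 ^^ n) x)) \<in> o(\<lambda>n. real n)"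
    using v unfolding is_rotation_vector_def by blast
  obtain c where c: "c \<in> atlas X" "x \<in> chart_dom c" by (rule X.ex_chart)
  interpret H: hadamard_point X x c by (rule X.hadamard_point[OF c])
  obtain w where w: "tnorm Y (\<pi> x) v = H.pnorm w"
    "\<And>t. t \<ge> 0 \<Longrightarrow> riemannian_exp Y (\<pi> x) (\<lambda>c. t *\<^sub>R v c) = \<pi> (H.geod w t)"
    using exp_projection[OF c vt] by metis
  \<comment> \<open>The lift in the definition of a rotation vector is only known to be continuous;
    unique lifting identifies it with a geodesic, which minimises.\<close>
  have \<alpha>_eq: "\<alpha> t = H.geod w t" if "t \<ge> 0" for t
  proof (rule lift_eq[of "{0..}" 0 t \<alpha> "H.geod w"])
    show "continuous_on {0..} (H.geod w)"
      using X.smooth_curve_continuous[OF H.smooth_geod] continuous_on_subset by blast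
  qed (use \<alpha> w(2) that H.geod(2) in auto)
  have "\<pi> ((G 1 ^^ p) x) = \<pi> x" using funpow_proj per(1) by simp
  then obtain T where T: "deck T" "T x = (G 1 ^^ p) x" by (rule ex_deck)
  define e where "e n = riemannian_dist X (\<alpha> (real n)) ((G 1 ^^ n) x)" for n
  have dist_\<alpha>: "riemannian_dist X x (\<alpha> (real n)) = real n * H.pnorm w" for n
    using H.dist_Exp[of "real n *\<^sub>R w"] X.nrm_scale[OF c, of "real n" w] by (simp add: \<alpha>_eq H.geod_eq_Exp)
  have "(\<lambda>n. e n / real n) \<longlonglongrightarrow> 0" unfolding e_def by (rule smalloD_tendsto[OF \<alpha>(4)])
  moreover have "strict_mono (\<lambda>k. k * p)" using per(2) by (simp add: strict_mono_def)
  ultimately have "(\<lambda>k. e (k * p) / real (k * p)) \<longlonglongrightarrow> 0"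
    using LIMSEQ_subseq_LIMSEQ[of "\<lambda>n. e n / real n" 0 "\<lambda>k. k * p"] by (simp add: o_def)
  \<comment> \<open>The factor \<open>p\<close> replaces the divisor \<open>k * p\<close> by
    \<open>k\<close>; it is the origin of the denominator in the result.\<close>
  then have "(\<lambda>k. real p * (e (k * p) / real (k * p))) \<longlonglongrightarrow> real p * 0" by (rule tendsto_mult_left)
  then have e0: "(\<lambda>k. e (k * p) / real k) \<longlonglongrightarrow> 0" using per(2) by simp
  have "(\<lambda>k. riemannian_dist X x ((T ^^ k) x) / real k - real p * H.pnorm w) \<longlonglongrightarrow> 0"
  proof (rule Lim_null_comparison[OF _ e0])
    show "eventually (\<lambda>k. norm (riemannian_dist X x ((T ^^ k) x) / real k - real p * H.pnorm w) \<le> e (k * p) / real k) sequentially"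
      using eventually_gt_at_top[of 0]
    proof eventually_elim
      case (elim k)
      have "\<bar>riemannian_dist X x ((T ^^ k) x) - real (k * p) * H.pnorm w\<bar> \<le> e (k * p)"
        using X.dist_triangle[of x "(T ^^ k) x" "\<alpha> (real (k * p))"]
          X.dist_triangle[of x "\<alpha> (real (k * p))" "(T ^^ k) x"] X.dist_commute[of "(T ^^ k) x"]
        unfolding e_def deck_orbit[OF T] dist_\<alpha> abs_le_iff by (auto simp: algebra_simps)
      then have "\<bar>riemannian_dist X x ((T ^^ k) x) - real (k * p) * H.pnorm w\<bar> / real k \<le> e (k * p) / real k"
        by (rule divide_right_mono) simp
      moreover have "riemannian_dist X x ((T ^^ k) x) / real k - real p * H.pnorm w
          = (riemannian_dist X x ((T ^^ k) x) - real (k * p) * H.pnorm w) / real k"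
        using elim by (simp add: field_simps)
      ultimately show ?case by (simp only: real_norm_def abs_divide abs_of_nat)
    qed
  qed
  then have "(\<lambda>k. riemannian_dist X x ((T ^^ k) x) / real k) \<longlonglongrightarrow> real p * H.pnorm w"
    by (simp add: LIM_zero_iff)
  from class_length_eq[OF T this] show ?thesis using w(1) per(2) by simp
qed

end

theorem theorem17:
  fixes \<M>' :: "('a::{t2_space, second_countable_topology}, 'e::euclidean_space) riemannian"
    and \<M> :: "('b::{t2_space, second_countable_topology}, 'e) riemannian"
    and \<pi> :: "'a \<Rightarrow> 'b" and f :: "'b \<Rightarrow> 'b" and g :: "real \<Rightarrow> 'b \<Rightarrow> 'b"
    and G :: "real \<Rightarrow> 'a \<Rightarrow> 'a" and F :: "'a \<Rightarrow> 'a"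
    and x :: 'b and p :: nat and v :: "('b, 'e) tvec"
  assumes "hadamard_manifold \<M>'"
    and "riemannian_covering \<M>' \<M> \<pi>"
    and "isotopy g id f"
    and "minimal_period f x p"
    and "isotopy_lift \<pi> g G"
    and "F = G 1"
    and "is_rotation_vector \<M>' \<M> \<pi> F x v"
  shows "tnorm \<M> x v = class_length \<M> (periodic_point_class g x p) / real p"
proof -
  have cov: "riemannian_manifold \<M>'" "riemannian_manifold \<M>" "covering_space UNIV \<pi> UNIV" "local_isometry \<M>' \<M> \<pi>"
    using assms(2) unfolding riemannian_covering_def by auto
  interpret lifted_isotopy \<M>' \<M> \<pi> g G
    by unfold_locales (use cov assms(1,5) covering_space_imp_section_covering in auto)
  obtain x' where "\<pi> x' = x" using covering_space_imp_surjective[OF cov(3)] by (metis UNIV_I imageE)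
  moreover have "g 1 = f" using assms(3) unfolding isotopy_def by blast
  ultimately show ?thesis
    using rotation_vector_norm[of x' v p] assms(4,6,7) unfolding minimal_period_def by auto
qed

end
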